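(* Let $U=\mathbb R^n$, $W=U\oplus U^*[-1]$, and let $V=S(W)$ be the Schouten algebra, i.e. the Gerstenhaber algebra with its free graded commutative product and the degree $-1$ bracket extending the canonical pairing between $U$ and $U^*$. Consider the bicomplex $\big(\mathrm{Hom}(P(V[1]),V[1])^{\mathrm{gr}_2,\mathrm{gr}_3},[d_m,\cdot],[d_{br},\cdot]\big)$ of coderivations of $P(V[1])$. In the spectral sequence obtained by first taking cohomology with respect to $[d_m,\cdot]$ and then with respect to the differential induced by $[d_{br},\cdot]$, the second term is concentrated in bidegree $(\mathrm{gr}_2,\mathrm{gr}_3)=(0,0)$. In particular the cohomology of the total complex vanishes in all degrees $\mathrm{gr}_2+\mathrm{gr}_3<0$ (so there are no obstructions to formality of a homotopy $e_2$-algebra with cohomology algebra $V$).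
   Context: $X[m]^i=X^{m+i}$. $e_2$ is the operad of Gerstenhaber algebras; $e_2\{-1\}$ is its operadic shift ($\mathcal O\{m\}$-structures on $X$ are $\mathcal O$-structures on $X[m]$). $P(X)$ is the cofree coalgebra over the linear dual cooperad $e_2\{-1\}^*$ cogenerated by the graded space $X$; it has two cooperations $P(X)\to P(X)\otimes P(X)$: a cocommutative comultiplication of degree $+1$ and a Lie cobracket of degree $0$. As a graded space $P(V[1])\cong S\big((T(V[1])/\mathrm{shuffles})[1]\big)[-1]$ (with $T$ and $S$ here without the zeroth powers). A homotopy $e_2$-algebra structure on $V$ is the same as a differential on $P(V[1])$. Gradings on $P(V[1])$: $\mathrm{gr}_2$ equals $k-1$ on $(T^k(V[1])/\mathrm{shuffles})[1]$ and is extended additively; $\mathrm{gr}_3=k-1$ on $S^k\big((T(V[1])/\mathrm{shuffles})[1]\big)[-1]$; $\mathrm{gr}_1$ is the ordinary degree. On $V[1]$ one has $\mathrm{gr}_2=\mathrm{gr}_3=0$. A coderivation of $P(V[1])$ is determined by its corestriction to $V[1]$, so the Lie superalgebra of coderivations is identified with $\mathrm{Hom}(P(V[1]),V[1])$, which is thereby graded: a map supported on the part of $P(V[1])$ of gradings $(\mathrm{gr}_2,\mathrm{gr}_3)=(a,b)$ has $(\mathrm{gr}_2,\mathrm{gr}_3)=(-a,-b)$. The $e_2$-algebra structure on $V$ is a differential $d_m+d_{br}$ on $P(V[1])$, with $d_m$ of tridegree $(1,-1,0)$ (coming from the product) and $d_{br}$ of tridegree $(1,0,-1)$ (coming from the bracket);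 $d_m$ and $d_{br}$ are anticommuting differentials. Brackets denote the supercommutator of coderivations. *)

theory Defs
  imports "HOL-Analysis.Finite_Function_Topology" "HOL-Library.Function_Algebras"
begin

text \<open>
  A vector space with a chosen basis indexed by a type \<open>'b\<close> is \<open>'b \<Rightarrow>\<^sub>0 real\<close>. The grading of such a
  space is given by the degrees of the basis elements. Signs follow the Koszul rule throughout.
\<close>

definition lin_ext :: "('k \<Rightarrow> 'v::real_vector) \<Rightarrow> ('k \<Rightarrow>\<^sub>0 real) \<Rightarrow> 'v" where
  "lin_ext f x = (\<Sum>k\<in>Poly_Mapping.keys x. Poly_Mapping.lookup x k *\<^sub>R f k)"

definition ksgn :: "int \<Rightarrow> real" where
  "ksgn k = (if even k then 1 else -1)"


section \<open>Tensor product of vector spaces\<close>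

definition tensor_relations :: "(('a::real_vector \<times> 'b::real_vector) \<Rightarrow>\<^sub>0 real) set" where
  "tensor_relations = span (
     {Poly_Mapping.single (a + a', b) 1 - Poly_Mapping.single (a, b) 1
        - Poly_Mapping.single (a', b) 1 |a a' b. True} \<union>
     {Poly_Mapping.single (a, b + b') 1 - Poly_Mapping.single (a, b) 1
        - Poly_Mapping.single (a, b') 1 |a b b'. True} \<union>
     {Poly_Mapping.single (r *\<^sub>R a, b) 1 - Poly_Mapping.single (a, b) r |r a b. True} \<union>
     {Poly_Mapping.single (a, r *\<^sub>R b) 1 - Poly_Mapping.single (a, b) r |r a b. True})"

lemma equivp_mod_span: "equivp (\<lambda>x y. x - y \<in> span S)"
proof (rule equivpI)
  show "symp (\<lambda>x y. x - y \<in> span S)"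
    by (rule sympI) (metis span_neg minus_diff_eq)
  show "transp (\<lambda>x y. x - y \<in> span S)"
    by (rule transpI) (metis span_add diff_add_cancel add_diff_eq)
qed (simp add: reflp_def span_zero)

lemma mod_span_add: "x - x' \<in> span S \<Longrightarrow> y - y' \<in> span S \<Longrightarrow> (x + y) - (x' + y') \<in> span S"
  by (metis add_diff_add span_add)

lemma mod_span_diff: "x - x' \<in> span S \<Longrightarrow> y - y' \<in> span S \<Longrightarrow> (x - y) - (x' - y') \<in> span S"
  by (metis diff_diff_eq2 diff_add_eq span_diff add_diff_eq diff_diff_add)

lemma mod_span_uminus: "x - x' \<in> span S \<Longrightarrow> - x - - x' \<in> span S"
  by (metis minus_diff_minus span_neg)

lemma mod_span_scaleR: "x - x' \<in> span S \<Longrightarrow> r *\<^sub>R x - r *\<^sub>R x' \<in> span S"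
  by (metis scaleR_diff_right span_scale)

lemmas mod_span = mod_span_add mod_span_diff mod_span_uminus mod_span_scaleR

quotient_type (overloaded) ('a, 'b) tensor = "('a::real_vector \<times> 'b::real_vector) \<Rightarrow>\<^sub>0 real" /
    "\<lambda>x y. x - y \<in> tensor_relations"
  unfolding tensor_relations_def by (rule equivp_mod_span)

instantiation tensor :: (real_vector, real_vector) real_vector
begin

lift_definition zero_tensor :: "('a, 'b) tensor" is 0 .
lift_definition plus_tensor :: "('a, 'b) tensor \<Rightarrow> ('a, 'b) tensor \<Rightarrow> ('a, 'b) tensor" is "(+)"
  unfolding tensor_relations_def by (rule mod_span)
lift_definition minus_tensor :: "('a, 'b) tensor \<Rightarrow> ('a, 'b) tensor \<Rightarrow> ('a, 'b) tensor" is "(-)"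
  unfolding tensor_relations_def by (rule mod_span)
lift_definition uminus_tensor :: "('a, 'b) tensor \<Rightarrow> ('a, 'b) tensor" is uminus
  unfolding tensor_relations_def by (rule mod_span)
lift_definition scaleR_tensor :: "real \<Rightarrow> ('a, 'b) tensor \<Rightarrow> ('a, 'b) tensor" is scaleR
  unfolding tensor_relations_def by (rule mod_span)

instance
  by standard
    (transfer; simp add: tensor_relations_def span_zero algebra_simps scaleR_add_left
      scaleR_add_right)+

end

lift_definition tens :: "'a::real_vector \<Rightarrow> 'b::real_vector \<Rightarrow> ('a, 'b) tensor"  (infixr "\<otimes>" 75)
  is "\<lambda>a b. Poly_Mapping.single (a, b) 1" .

text \<open>Meaningful for linear \<open>f\<close> and \<open>g\<close>; the result then does not depend on the representative.\<close>

definition tensor_map ::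
    "('a::real_vector \<Rightarrow> 'c::real_vector) \<Rightarrow> ('b::real_vector \<Rightarrow> 'd::real_vector) \<Rightarrow>
     ('a, 'b) tensor \<Rightarrow> ('c, 'd) tensor" where
  "tensor_map f g t = lin_ext (\<lambda>(a, b). f a \<otimes> g b) (rep_tensor t)"


section \<open>Graded spaces, shift and the words spanning the cofree coalgebra\<close>

class graded_basis =
  fixes bdeg :: "'a \<Rightarrow> int"

datatype 'b shifted = Shift 'b

instantiation shifted :: (graded_basis) graded_basis
begin
primrec bdeg_shifted :: "'a shifted \<Rightarrow> int" where
  "bdeg (Shift b) = bdeg b - 1"
instance ..
end

text \<open>
  A word \<open>w = [b\<^sub>1, \<dots>, b\<^sub>m]\<close> stands for \<open>b\<^sub>1 \<otimes> \<dots> \<otimes> b\<^sub>m\<close> in \<open>T\<^sup>m X\<close>, and a list of words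
  \<open>[w\<^sub>1, \<dots>, w\<^sub>k]\<close> for the product \<open>w\<^sub>1 \<dots> w\<^sub>k\<close> in \<open>S\<^sup>k ((T X / shuffles)[1])[-1]\<close>. The functions \<open>wdeg\<close>,
  \<open>tdeg\<close>, \<open>sdeg\<close>, \<open>gr1\<close> are the degrees in \<open>T X\<close>, \<open>(T X)[1]\<close>, \<open>S ((T X)[1])\<close>, \<open>S ((T X)[1])[-1]\<close>.
\<close>

definition wdeg :: "'b::graded_basis list \<Rightarrow> int" where
  "wdeg w = sum_list (map bdeg w)"

definition tdeg :: "'b::graded_basis list \<Rightarrow> int" where
  "tdeg w = wdeg w - 1"

definition sdeg :: "'b::graded_basis list list \<Rightarrow> int" where
  "sdeg ws = sum_list (map tdeg ws)"

definition gr1 :: "'b::graded_basis list list \<Rightarrow> int" where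
  "gr1 ws = sdeg ws + 1"

definition gr2 :: "'b list list \<Rightarrow> int" where
  "gr2 ws = sum_list (map (\<lambda>w. int (length w) - 1) ws)"

definition gr3 :: "'b list list \<Rightarrow> int" where
  "gr3 ws = int (length ws) - 1"

fun shuffle_prod :: "'b::graded_basis list \<Rightarrow> 'b list \<Rightarrow> 'b list \<Rightarrow>\<^sub>0 real" where
  "shuffle_prod [] v = Poly_Mapping.single v 1"
| "shuffle_prod u [] = Poly_Mapping.single u 1"
| "shuffle_prod (a # u) (b # v) =
     lin_ext (\<lambda>w. Poly_Mapping.single (a # w) 1) (shuffle_prod u (b # v)) +
     ksgn (bdeg b * wdeg (a # u)) *\<^sub>R
       lin_ext (\<lambda>w. Poly_Mapping.single (b # w) 1) (shuffle_prod (a # u) v)"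

text \<open>
  The last set of generators removes the zeroth powers of \<open>T\<close> and \<open>S\<close>.
\<close>

definition cofree_relations :: "('b::graded_basis list list \<Rightarrow>\<^sub>0 real) set" where
  "cofree_relations = span (
     {lin_ext (\<lambda>w. Poly_Mapping.single (us @ w # vs) 1) (shuffle_prod u v) |us u v vs.
        u \<noteq> [] \<and> v \<noteq> []} \<union>
     {Poly_Mapping.single (us @ u # v # vs) 1
        - Poly_Mapping.single (us @ v # u # vs) (ksgn (tdeg u * tdeg v)) |us u v vs. True} \<union>
     {Poly_Mapping.single ws 1 |ws. ws = [] \<or> [] \<in> set ws})"


section \<open>The cofree coalgebra\<close>

text \<open>
  \<open>'b cofree\<close> is \<open>P(X) = S((T X / shuffles)[1])[-1]\<close> for the graded space \<open>X\<close> with basis \<open>'b\<close>.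
\<close>

quotient_type (overloaded) 'b cofree = "'b::graded_basis list list \<Rightarrow>\<^sub>0 real" /
    "\<lambda>x y. x - y \<in> cofree_relations"
  unfolding cofree_relations_def by (rule equivp_mod_span)

instantiation cofree :: (graded_basis) real_vector
begin

lift_definition zero_cofree :: "'a cofree" is 0 .
lift_definition plus_cofree :: "'a cofree \<Rightarrow> 'a cofree \<Rightarrow> 'a cofree" is "(+)"
  unfolding cofree_relations_def by (rule mod_span)
lift_definition minus_cofree :: "'a cofree \<Rightarrow> 'a cofree \<Rightarrow> 'a cofree" is "(-)"
  unfolding cofree_relations_def by (rule mod_span)
lift_definition uminus_cofree :: "'a cofree \<Rightarrow> 'a cofree" is uminus
  unfolding cofree_relations_def by (rule mod_span)
lift_definition scaleR_cofree :: "real \<Rightarrow> 'a cofree \<Rightarrow> 'a cofree" is scaleR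
  unfolding cofree_relations_def by (rule mod_span)

instance
  by standard
    (transfer; simp add: cofree_relations_def span_zero algebra_simps scaleR_add_left
      scaleR_add_right)+

end

lift_definition word_class :: "'b::graded_basis list list \<Rightarrow> 'b cofree"
  is "\<lambda>ws. Poly_Mapping.single ws 1" .

definition deg_part :: "int \<Rightarrow> 'b::graded_basis cofree set" where
  "deg_part d = span (word_class ` {ws. gr1 ws = d})"

definition gr23_part :: "int \<Rightarrow> int \<Rightarrow> 'b::graded_basis cofree set" where
  "gr23_part i j = span (word_class ` {ws. gr2 ws = i \<and> gr3 ws = j})"

text \<open>
  All maps out of \<open>'b cofree\<close> below are given by formulas on words which are compatible with
  \<open>cofree_relations\<close>, so that the representative chosen by \<open>rep_cofree\<close> is irrelevant.

  \<open>cogen\<close> is the projection to the cogenerators.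
\<close>

definition cogen :: "'b::graded_basis cofree \<Rightarrow> 'b \<Rightarrow>\<^sub>0 real" where
  "cogen x = lin_ext (\<lambda>ws. case ws of [[b]] \<Rightarrow> Poly_Mapping.single b 1 | _ \<Rightarrow> 0) (rep_cofree x)"

text \<open>The unshuffle coproduct of \<open>S ((T X)[1])\<close>, including the terms with a unit.\<close>

primrec unshuffle ::
    "'b::graded_basis list list \<Rightarrow> ('b list list \<times> 'b list list) \<Rightarrow>\<^sub>0 real" where
  "unshuffle [] = Poly_Mapping.single ([], []) 1"
| "unshuffle (w # ws) =
     lin_ext (\<lambda>(x, y). Poly_Mapping.single (w # x, y) 1
                + Poly_Mapping.single (x, w # y) (ksgn (tdeg w * sdeg x)))
       (unshuffle ws)"

definition pair_mult ::
    "(('b::graded_basis list list \<times> 'b list list) \<Rightarrow>\<^sub>0 real) \<Rightarrow>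
     (('b list list \<times> 'b list list) \<Rightarrow>\<^sub>0 real) \<Rightarrow> ('b list list \<times> 'b list list) \<Rightarrow>\<^sub>0 real" where
  "pair_mult A B = lin_ext (\<lambda>(x, y). lin_ext (\<lambda>(x', y').
     Poly_Mapping.single (x @ x', y @ y') (ksgn (sdeg y * sdeg x'))) B) A"

text \<open>
  The Lie cobracket of \<open>T X / shuffles\<close> is \<open>w \<mapsto> \<Sum> (u \<otimes> v - (-1)\<^bsup>|u||v|\<^esup> v \<otimes> u)\<close>, the sum being over the
  deconcatenations \<open>w = u v\<close>. Conjugating it with the shift gives the following map of degree \<open>-1\<close>
  on \<open>(T X / shuffles)[1]\<close>.
\<close>

definition word_cobracket ::
    "'b::graded_basis list \<Rightarrow> ('b list list \<times> 'b list list) \<Rightarrow>\<^sub>0 real" where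
  "word_cobracket w = (\<Sum>j\<in>{1..<length w}. let u = take j w; v = drop j w in
     Poly_Mapping.single ([u], [v]) (ksgn (wdeg u))
     + Poly_Mapping.single ([v], [u]) (ksgn (wdeg u + tdeg u * tdeg v)))"

text \<open>
  The extension to \<open>S ((T X / shuffles)[1])\<close>, determined by the co-Leibniz rule: it is dual to the
  extension of a Lie bracket to the symmetric algebra as a biderivation.
\<close>

primrec sym_cobracket ::
    "'b::graded_basis list list \<Rightarrow> ('b list list \<times> 'b list list) \<Rightarrow>\<^sub>0 real" where
  "sym_cobracket [] = 0"
| "sym_cobracket (w # ws) =
     pair_mult (word_cobracket w) (unshuffle ws)
     + ksgn (tdeg w) *\<^sub>R
         pair_mult (Poly_Mapping.single ([w], []) 1 + Poly_Mapping.single ([], [w]) 1)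
           (sym_cobracket ws)"

text \<open>
  With \<open>\<sigma>\<close> the shift \<open>[-1]\<close> (of degree \<open>1\<close>), the cooperations on \<open>S((T X / shuffles)[1])[-1]\<close> are
  \<open>(\<sigma> \<otimes> \<sigma>) \<circ> f \<circ> \<sigma>\<^sup>-\<^sup>1\<close> with \<open>f\<close> one of the two maps above; \<open>\<sigma> \<otimes> \<sigma>\<close> produces the sign \<open>(-1)\<^bsup>|x|\<^esup>\<close>.
  Terms with a unit vanish in \<open>'b cofree\<close>.
\<close>

definition shift_pair ::
    "(('b::graded_basis list list \<times> 'b list list) \<Rightarrow>\<^sub>0 real) \<Rightarrow> ('b cofree, 'b cofree) tensor" where
  "shift_pair = lin_ext (\<lambda>(x, y). ksgn (sdeg x) *\<^sub>R (word_class x \<otimes> word_class y))"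

definition comult :: "'b::graded_basis cofree \<Rightarrow> ('b cofree, 'b cofree) tensor" where
  "comult x = shift_pair (lin_ext unshuffle (rep_cofree x))"

definition cobracket :: "'b::graded_basis cofree \<Rightarrow> ('b cofree, 'b cofree) tensor" where
  "cobracket x = shift_pair (lin_ext sym_cobracket (rep_cofree x))"


section \<open>Coderivations\<close>

text \<open>\<open>koszul_sign p\<close> multiplies elements of degree \<open>d\<close> by \<open>(-1)\<^bsup>p d\<^esup>\<close>.\<close>

definition koszul_sign :: "int \<Rightarrow> 'b::graded_basis cofree \<Rightarrow> 'b cofree" where
  "koszul_sign p x = lin_ext (\<lambda>ws. ksgn (p * gr1 ws) *\<^sub>R word_class ws) (rep_cofree x)"

text \<open>\<open>D \<otimes> 1 + 1 \<otimes> D\<close> for \<open>D\<close> of degree \<open>p\<close>\<close>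

definition tensor_der ::
    "int \<Rightarrow> ('b::graded_basis cofree \<Rightarrow> 'b cofree) \<Rightarrow>
     ('b cofree, 'b cofree) tensor \<Rightarrow> ('b cofree, 'b cofree) tensor" where
  "tensor_der p D t = tensor_map D id t + tensor_map (koszul_sign p) D t"

text \<open>The sign in the first identity is due to the degree \<open>1\<close> of \<^const>\<open>comult\<close>.\<close>

definition coderivation :: "int \<Rightarrow> ('b::graded_basis cofree \<Rightarrow> 'b cofree) \<Rightarrow> bool" where
  "coderivation p D \<longleftrightarrow>
     linear D \<and>
     (\<forall>d. D ` deg_part d \<subseteq> deg_part (d + p)) \<and>
     (\<forall>x. comult (D x) = ksgn p *\<^sub>R tensor_der p D (comult x)) \<and>
     (\<forall>x. cobracket (D x) = tensor_der p D (cobracket x))"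

definition supercommutator ::
    "int \<Rightarrow> int \<Rightarrow> ('v::real_vector \<Rightarrow> 'v) \<Rightarrow> ('v \<Rightarrow> 'v) \<Rightarrow> 'v \<Rightarrow> 'v" where
  "supercommutator p q D E = (\<lambda>x. D (E x) - ksgn (p * q) *\<^sub>R E (D x))"

text \<open>
  \<open>coder_hom p a b\<close> is the part of tridegree \<open>(p, a, b)\<close> of \<open>Hom(P(X), X)\<close>, and \<open>coder_tot p k\<close> the part
  of degree \<open>p\<close> and of total degree \<open>gr2 + gr3 = k\<close>. In both cases a map \<open>P(X) \<rightarrow> X\<close> is represented by
  the coderivation with this corestriction.
\<close>

definition coder_hom ::
    "int \<Rightarrow> int \<Rightarrow> int \<Rightarrow> ('b::graded_basis cofree \<Rightarrow> 'b cofree) set" where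
  "coder_hom p a b = {D. coderivation p D \<and>
     (\<forall>i j. (i, j) \<noteq> (- a, - b) \<longrightarrow> (\<forall>x\<in>gr23_part i j. cogen (D x) = 0))}"

definition coder_tot :: "int \<Rightarrow> int \<Rightarrow> ('b::graded_basis cofree \<Rightarrow> 'b cofree) set" where
  "coder_tot p k = {D. coderivation p D \<and>
     (\<forall>i j. i + j \<noteq> - k \<longrightarrow> (\<forall>x\<in>gr23_part i j. cogen (D x) = 0))}"

definition coder_of ::
    "int \<Rightarrow> ('b::graded_basis cofree \<Rightarrow> 'b \<Rightarrow>\<^sub>0 real) \<Rightarrow> 'b cofree \<Rightarrow> 'b cofree" where
  "coder_of p f = (THE D. coderivation p D \<and> (\<forall>x. cogen (D x) = f x))"


section \<open>Cohomology and the second term of a spectral sequence\<close>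

definition coset :: "'a::ab_group_add \<Rightarrow> 'a set \<Rightarrow> 'a set" where
  "coset x B = {y. x - y \<in> B}"

definition subquotient :: "'a::ab_group_add set \<Rightarrow> 'a set \<Rightarrow> 'a set set" where
  "subquotient Z B = (\<lambda>x. coset x B) ` Z"

text \<open>
  A bicomplex \<open>C p a b\<close> carries an internal degree \<open>p\<close> and two differentials, of tridegrees
  \<open>(1, -1, 0)\<close> and \<open>(1, 0, -1)\<close>; the differentials may depend on \<open>p\<close>.
\<close>

definition E1_zero ::
    "(int \<Rightarrow> int \<Rightarrow> int \<Rightarrow> 'a::ab_group_add set) \<Rightarrow> (int \<Rightarrow> 'a \<Rightarrow> 'a) \<Rightarrow>
     int \<Rightarrow> int \<Rightarrow> int \<Rightarrow> 'a set" where
  "E1_zero C d p a b = d (p - 1) ` C (p - 1) (a + 1) b"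

definition E1 ::
    "(int \<Rightarrow> int \<Rightarrow> int \<Rightarrow> 'a::ab_group_add set) \<Rightarrow> (int \<Rightarrow> 'a \<Rightarrow> 'a) \<Rightarrow>
     int \<Rightarrow> int \<Rightarrow> int \<Rightarrow> 'a set set" where
  "E1 C d p a b = subquotient {x \<in> C p a b. d p x = 0} (E1_zero C d p a b)"

text \<open>The map \<open>E1 C d p a b \<rightarrow> E1 C d (p + 1) a (b - 1)\<close> induced by the second differential \<open>d'\<close>\<close>

definition E1_diff ::
    "(int \<Rightarrow> int \<Rightarrow> int \<Rightarrow> 'a::ab_group_add set) \<Rightarrow> (int \<Rightarrow> 'a \<Rightarrow> 'a) \<Rightarrow> (int \<Rightarrow> 'a \<Rightarrow> 'a) \<Rightarrow>
     int \<Rightarrow> int \<Rightarrow> int \<Rightarrow> 'a set \<Rightarrow> 'a set" where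
  "E1_diff C d d' p a b c = (\<Union>x\<in>c. coset (d' p x) (E1_zero C d (p + 1) a (b - 1)))"

definition E2 ::
    "(int \<Rightarrow> int \<Rightarrow> int \<Rightarrow> 'a::ab_group_add set) \<Rightarrow> (int \<Rightarrow> 'a \<Rightarrow> 'a) \<Rightarrow> (int \<Rightarrow> 'a \<Rightarrow> 'a) \<Rightarrow>
     int \<Rightarrow> int \<Rightarrow> int \<Rightarrow> 'a set set set" where
  "E2 C d d' p a b =
     (let Z = {c \<in> E1 C d p a b. E1_diff C d d' p a b c = E1_zero C d (p + 1) a (b - 1)};
          B = E1_diff C d d' (p - 1) a (b + 1) ` E1 C d (p - 1) a (b + 1)
      in (\<lambda>c. {c' \<in> E1 C d p a b. {x - y |x y. x \<in> c \<and> y \<in> c'} \<in> B}) ` Z)"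

definition total_cohomology ::
    "(int \<Rightarrow> int \<Rightarrow> 'a::ab_group_add set) \<Rightarrow> (int \<Rightarrow> 'a \<Rightarrow> 'a) \<Rightarrow> int \<Rightarrow> int \<Rightarrow> 'a set set" where
  "total_cohomology C d p k =
     subquotient {x \<in> C p k. d p x = 0} (d (p - 1) ` C (p - 1) (k + 1))"


section \<open>The Schouten algebra\<close>

text \<open>
  For \<open>U = \<real>\<^sup>n\<close>, with standard basis \<open>x\<^sub>i\<close> and dual basis \<open>\<xi>\<^sub>i\<close> (placed in degree \<open>1\<close> of \<open>U\<^sup>*[-1]\<close>) indexed by
  the type \<open>'n\<close>, the algebra \<open>V = S(U \<oplus> U\<^sup>*[-1])\<close> has as basis the monomials
  \<open>Mono \<alpha> A = x\<^sup>\<alpha> \<xi>\<^bsub>i\<^sub>1\<^esub> \<dots> \<xi>\<^bsub>i\<^sub>r\<^esub>\<close> with \<open>A = {i\<^sub>1 < \<dots> < i\<^sub>r}\<close>.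
\<close>

datatype 'n mono = Mono "'n \<Rightarrow> nat" "'n set"

type_synonym 'n schouten = "'n mono \<Rightarrow>\<^sub>0 real"

instantiation mono :: (type) graded_basis
begin
primrec bdeg_mono :: "'a mono \<Rightarrow> int" where
  "bdeg (Mono \<alpha> A) = int (card A)"
instance ..
end

fun mono_mult :: "'n::{finite,linorder} mono \<Rightarrow> 'n mono \<Rightarrow> 'n schouten" where
  "mono_mult (Mono \<alpha> A) (Mono \<beta> B) =
     (if A \<inter> B = {}
      then Poly_Mapping.single (Mono (\<lambda>i. \<alpha> i + \<beta> i) (A \<union> B))
             (ksgn (int (card {(i, j). i \<in> A \<and> j \<in> B \<and> j < i})))
      else 0)"

definition schouten_mult ::
    "'n::{finite,linorder} schouten \<Rightarrow> 'n schouten \<Rightarrow> 'n schouten" where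
  "schouten_mult f g = lin_ext (\<lambda>a. lin_ext (\<lambda>b. mono_mult a b) g) f"

text \<open>\<open>\<partial>/\<partial>x\<^sub>i\<close>, and the left and right derivatives with respect to \<open>\<xi>\<^sub>i\<close>\<close>

fun dx :: "'n \<Rightarrow> 'n mono \<Rightarrow> 'n schouten" where
  "dx i (Mono \<alpha> A) = Poly_Mapping.single (Mono (\<alpha>(i := \<alpha> i - 1)) A) (real (\<alpha> i))"

fun dxi_left :: "'n::{finite,linorder} \<Rightarrow> 'n mono \<Rightarrow> 'n schouten" where
  "dxi_left i (Mono \<alpha> A) =
     (if i \<in> A then Poly_Mapping.single (Mono \<alpha> (A - {i})) (ksgn (int (card {j\<in>A. j < i}))) else 0)"

fun dxi_right :: "'n::{finite,linorder} \<Rightarrow> 'n mono \<Rightarrow> 'n schouten" where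
  "dxi_right i (Mono \<alpha> A) =
     (if i \<in> A then Poly_Mapping.single (Mono \<alpha> (A - {i})) (ksgn (int (card {j\<in>A. i < j}))) else 0)"

text \<open>
  The biderivation of degree \<open>-1\<close> with \<open>{\<xi>\<^sub>i, x\<^sub>j} = \<delta>\<^sub>i\<^sub>j = - {x\<^sub>j, \<xi>\<^sub>i}\<close> and \<open>{x\<^sub>i, x\<^sub>j} = 0 = {\<xi>\<^sub>i, \<xi>\<^sub>j}\<close>
\<close>

definition mono_bracket :: "'n::{finite,linorder} mono \<Rightarrow> 'n mono \<Rightarrow> 'n schouten" where
  "mono_bracket a b =
     (\<Sum>i\<in>UNIV. schouten_mult (dxi_right i a) (dx i b) - schouten_mult (dx i a) (dxi_left i b))"

definition to_shift :: "('b \<Rightarrow>\<^sub>0 real) \<Rightarrow> 'b shifted \<Rightarrow>\<^sub>0 real" where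
  "to_shift = lin_ext (\<lambda>b. Poly_Mapping.single (Shift b) 1)"

text \<open>
  The corestrictions of \<open>d_m\<close> and \<open>d_br\<close>. The sign \<open>(-1)\<^bsup>|a|\<^esup>\<close> arises from the shift \<open>V \<rightarrow> V[1]\<close>. It turns
  the graded commutative product into a map vanishing on shuffles, and the bracket into a map which
  is graded symmetric on \<open>V[1][1]\<close>.
\<close>

definition mult_corestr ::
    "'n::{finite,linorder} mono shifted cofree \<Rightarrow> 'n mono shifted \<Rightarrow>\<^sub>0 real" where
  "mult_corestr x = lin_ext
     (\<lambda>ws. case ws of [[Shift a, Shift b]] \<Rightarrow> ksgn (bdeg a) *\<^sub>R to_shift (mono_mult a b) | _ \<Rightarrow> 0)
     (rep_cofree x)"

definition bracket_corestr ::
    "'n::{finite,linorder} mono shifted cofree \<Rightarrow> 'n mono shifted \<Rightarrow>\<^sub>0 real" where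
  "bracket_corestr x = lin_ext
     (\<lambda>ws. case ws of [[Shift a], [Shift b]] \<Rightarrow> ksgn (bdeg a) *\<^sub>R to_shift (mono_bracket a b)
            | _ \<Rightarrow> 0)
     (rep_cofree x)"

definition d_m ::
    "'n::{finite,linorder} mono shifted cofree \<Rightarrow> 'n mono shifted cofree" where
  "d_m = coder_of 1 mult_corestr"

definition d_br ::
    "'n::{finite,linorder} mono shifted cofree \<Rightarrow> 'n mono shifted cofree" where
  "d_br = coder_of 1 bracket_corestr"

end

theory Submission
  imports Defs "HOL-Library.Multiset"
begin

text \<open>
  A coderivation \<open>D\<close> of the cofree coalgebra corresponds to its corestriction \<open>f\<close>, a map on lists of words
  vanishing on shuffles and graded symmetric in the words: \<open>D\<close> applies \<open>f\<close> to middle pieces of some of the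
  words and shuffles the remaining pieces around the result; conversely a coderivation with \<open>f = 0\<close>
  vanishes because the cooperations detect everything but the cogenerators.

  For \<open>gr2 < 0\<close> the complex of \<open>[d\<^sub>m, \<cdot>]\<close> is acyclic, as Harrison cohomology of a free commutative algebra
  is concentrated in derivations. Indeed \<open>u v \<mapsto> \<Sum> u x\<^sub>j \<partial>\<^sub>j(v)\<close> is a derivation of the shuffle product, so it
  acts on corestrictions, and its anticommutator with \<open>[d\<^sub>m, \<cdot>]\<close> is triangular for the polynomial degree
  of the arguments. After a correction at the unit the diagonal entries are non-zero, so the
  anticommutator is invertible, although it is not a multiple of the identity.

  For \<open>gr2 = 0\<close> what remains are the symmetric multiderivations, that is functions on a cotangent bundle,
  with \<open>[d\<^sub>b\<^sub>r, \<cdot>]\<close> acting on the values at the generators as the de Rham differential, for which the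
  Poincare lemma holds. The total complex is then handled by a zigzag through the values of \<open>gr2\<close>.
\<close>

section \<open>Linear extensions, signs and tensors\<close>

text \<open>Operations on words are evaluated on test functions with values in any vector space, so
  that compositions become nested calls and relations become conditions on test functions. A
  coderivation moves words into its corestriction one at a time; its compatibility with the
  cobracket can be proved by induction only with correction terms for the words already moved. The
  obstacle for \<open>[d_m, f]\<close> is that it also multiplies values of \<open>f\<close> by
  outer letters of the arguments, which the bar homotopy does not see. Such a term evaluates
  \<open>f\<close> on arguments of smaller polynomial degree unless the letter is the unit: hence
  the triangularity. The diagonal entry of a word is its polynomial degree, less 1 for a single
  variable and plus 1 for \<open>[e]\<close> and \<open>[e, e]\<close>. Polynomial degrees of
  arguments are unbounded, so the inverse is a limit that stabilises at each argument. The Poincare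
  homotopy divides by number of arguments plus polynomial degree. It has to yield a multiderivation
  on all arguments, so this weight is extended from variables in a way that respects the Leibniz
  rule.\<close>

lemma lookup_scaleR_poly [simp]: "Poly_Mapping.lookup (r *\<^sub>R x) k = r *\<^sub>R Poly_Mapping.lookup x k"
proof -
  have "finite {i. r *\<^sub>R Poly_Mapping.lookup x i \<noteq> 0}"
    by (rule finite_subset[OF _ finite_lookup[of x]]) auto
  then show ?thesis by (simp add: scaleR_poly_mapping_def)
qed

lemma single_scaleR: "r *\<^sub>R Poly_Mapping.single k (s::real) = Poly_Mapping.single k (r * s)"
  by (rule poly_mapping_eqI) (simp add: lookup_single when_def)

lemma lin_ext_superset:
  assumes "finite A" "Poly_Mapping.keys x \<subseteq> A"
  shows "lin_ext f x = (\<Sum>k\<in>A. Poly_Mapping.lookup x k *\<^sub>R f k)"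
  unfolding lin_ext_def using assms
  by (intro sum.mono_neutral_left) (auto simp: in_keys_iff)

lemma lin_ext_add: "lin_ext f (x + y) = lin_ext f x + lin_ext f y"
proof -
  let ?A = "Poly_Mapping.keys x \<union> Poly_Mapping.keys y"
  have s: "Poly_Mapping.keys (x + y) \<subseteq> ?A"
    by (simp add: Poly_Mapping.keys_add)
  show ?thesis
    using lin_ext_superset[of ?A "x + y" f] lin_ext_superset[of ?A x f]
      lin_ext_superset[of ?A y f] s
    by (simp add: lookup_add scaleR_left_distrib sum.distrib)
qed

lemma lin_ext_scale: "lin_ext f (r *\<^sub>R x) = r *\<^sub>R lin_ext f x"
proof -
  have "Poly_Mapping.keys (r *\<^sub>R x) \<subseteq> Poly_Mapping.keys x"
    by (auto simp: in_keys_iff)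
  then show ?thesis
    using lin_ext_superset[of "Poly_Mapping.keys x" "r *\<^sub>R x" f]
      lin_ext_superset[of "Poly_Mapping.keys x" x f]
    by (simp add: scaleR_sum_right)
qed

lemma linear_lin_ext [simp]: "linear (lin_ext f)"
  by (rule linearI) (auto simp: lin_ext_add lin_ext_scale)

lemma lin_ext_zero [simp]: "lin_ext f 0 = 0"
  by (simp add: lin_ext_def)

lemma lin_ext_minus: "lin_ext f (- x) = - lin_ext f x"
  using linear_neg[OF linear_lin_ext] .

lemma lin_ext_diff: "lin_ext f (x - y) = lin_ext f x - lin_ext f y"
  using linear_diff[OF linear_lin_ext] .

lemma lin_ext_sum: "lin_ext f (sum g A) = (\<Sum>a\<in>A. lin_ext f (g a))"
  using linear_sum[OF linear_lin_ext] .

lemma lin_ext_single [simp]: "lin_ext f (Poly_Mapping.single k c) = c *\<^sub>R f k"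
  by (cases "c = 0") (simp_all add: lin_ext_def)

lemma lin_ext_linear: "linear L \<Longrightarrow> L (lin_ext f x) = lin_ext (\<lambda>k. L (f k)) x"
  by (simp add: lin_ext_def linear_sum linear_cmul)

lemma lin_ext_lin_ext: "lin_ext f (lin_ext g x) = lin_ext (\<lambda>k. lin_ext f (g k)) x"
  by (rule lin_ext_linear) simp

lemma lin_ext_cong: "(\<And>k. k \<in> Poly_Mapping.keys x \<Longrightarrow> f k = g k) \<Longrightarrow> lin_ext f x = lin_ext g x"
  by (simp add: lin_ext_def cong: sum.cong)

lemma lin_ext_fun_add: "lin_ext (\<lambda>k. f k + g k) x = lin_ext f x + lin_ext g x"
  by (simp add: lin_ext_def scaleR_right_distrib sum.distrib)

lemma lin_ext_fun_scale: "lin_ext (\<lambda>k. r *\<^sub>R f k) x = r *\<^sub>R lin_ext f x"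
  by (simp add: lin_ext_def scaleR_sum_right mult.commute)

lemma lin_ext_fun_minus: "lin_ext (\<lambda>k. - f k) x = - lin_ext f x"
  by (simp add: lin_ext_def sum_negf)

lemma lin_ext_fun_diff: "lin_ext (\<lambda>k. f k - g k) x = lin_ext f x - lin_ext g x"
  by (simp add: lin_ext_def scaleR_right_diff_distrib sum_subtractf)

lemma lin_ext_fun_zero [simp]: "lin_ext (\<lambda>k. 0) x = 0"
  by (simp add: lin_ext_def)

lemma lin_ext_fun_sum: "lin_ext (\<lambda>k. \<Sum>a\<in>A. f a k) x = (\<Sum>a\<in>A. lin_ext (f a) x)"
  unfolding lin_ext_def by (subst sum.swap) (simp add: scaleR_sum_right)

lemma lin_ext_eq_0: "(\<And>k. k \<in> Poly_Mapping.keys x \<Longrightarrow> f k = 0) \<Longrightarrow> lin_ext f x = 0"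
  by (simp add: lin_ext_def)

lemma lin_ext_id [simp]: "lin_ext (\<lambda>k. Poly_Mapping.single k 1) x = x"
proof (rule poly_mapping_eqI)
  fix k
  have "Poly_Mapping.lookup (lin_ext (\<lambda>k. Poly_Mapping.single k 1) x) k
      = (\<Sum>j\<in>Poly_Mapping.keys x. Poly_Mapping.lookup x j *\<^sub>R Poly_Mapping.lookup (Poly_Mapping.single j 1) k)"
    by (simp add: lin_ext_def lookup_sum)
  also have "\<dots> = (\<Sum>j\<in>Poly_Mapping.keys x. if j = k then Poly_Mapping.lookup x j else 0)"
    by (intro sum.cong) (auto simp: lookup_single when_def)
  also have "\<dots> = Poly_Mapping.lookup x k"
    by (simp add: in_keys_iff)
  finally show "Poly_Mapping.lookup (lin_ext (\<lambda>k. Poly_Mapping.single k 1) x) k = Poly_Mapping.lookup x k" .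
qed

lemma lin_ext_swap:
  "lin_ext (\<lambda>k. lin_ext (\<lambda>l. f k l) y) x = lin_ext (\<lambda>l. lin_ext (\<lambda>k. f k l) x) y"
  unfolding lin_ext_def by (simp add: scaleR_sum_right mult.commute) (rule sum.swap)

lemma keys_lin_ext:
  assumes "k \<in> Poly_Mapping.keys (lin_ext f x)"
  obtains j where "j \<in> Poly_Mapping.keys x" "k \<in> Poly_Mapping.keys (f j)"
proof -
  have "(\<Sum>j\<in>Poly_Mapping.keys x. Poly_Mapping.lookup x j *\<^sub>R Poly_Mapping.lookup (f j) k) \<noteq> 0"
    using assms by (simp add: in_keys_iff lin_ext_def lookup_sum)
  then obtain j where "j \<in> Poly_Mapping.keys x" "Poly_Mapping.lookup x j *\<^sub>R Poly_Mapping.lookup (f j) k \<noteq> 0"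
    by (rule sum.not_neutral_contains_not_neutral)
  then show thesis using that[of j] by (simp add: in_keys_iff)
qed

lemmas le_simps = lin_ext_add lin_ext_scale lin_ext_minus lin_ext_diff lin_ext_sum
  lin_ext_lin_ext lin_ext_fun_add lin_ext_fun_scale lin_ext_fun_minus lin_ext_fun_diff
  lin_ext_fun_sum

lemma ksgn_add: "ksgn (a + b) = ksgn a * ksgn b" by (simp add: ksgn_def)
lemma ksgn_diff: "ksgn (a - b) = ksgn a * ksgn b" by (simp add: ksgn_def)
lemma ksgn_minus [simp]: "ksgn (- a) = ksgn a" by (simp add: ksgn_def)
lemma ksgn_0 [simp]: "ksgn 0 = 1" by (simp add: ksgn_def)
lemma ksgn_1 [simp]: "ksgn 1 = -1" by (simp add: ksgn_def)
lemma ksgn_sq [simp]: "ksgn a * ksgn a = 1" by (simp add: ksgn_def)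
lemma ksgn_sq' [simp]: "ksgn a * (ksgn a * x) = x" by (simp add: ksgn_def)
lemma ksgn_mult_self [simp]: "ksgn (a * a) = ksgn a" by (simp add: ksgn_def)
lemma ksgn_2 [simp]: "ksgn (2 * a) = 1" "ksgn 2 = 1" by (simp_all add: ksgn_def)
lemma ksgn_nz [simp]: "ksgn a \<noteq> 0" by (simp add: ksgn_def)

lemmas ks = ksgn_add ksgn_diff distrib_left distrib_right left_diff_distrib right_diff_distrib

lemma wdeg_simps [simp]:
  "wdeg [] = 0" "wdeg (a # w) = bdeg a + wdeg w" "wdeg (u @ v) = wdeg u + wdeg v"
  by (simp_all add: wdeg_def)

lemma sdeg_simps [simp]:
  "sdeg [] = 0" "sdeg (w # ws) = tdeg w + sdeg ws" "sdeg (us @ vs) = sdeg us + sdeg vs"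
  by (simp_all add: sdeg_def)

lemma wdeg_perm: "mset u = mset v \<Longrightarrow> wdeg u = wdeg v"
  unfolding wdeg_def by (metis mset_map sum_mset_sum_list)

subsection \<open>Tensors\<close>

lemma abs_tensor_eq: "abs_tensor x = abs_tensor y \<longleftrightarrow> x - y \<in> tensor_relations"
  by (rule tensor.abs_eq_iff)

lemma abs_tensor_linear: "linear abs_tensor"
  by (rule linearI) (simp_all add: plus_tensor.abs_eq scaleR_tensor.abs_eq)

lemma abs_tensor_expand: "abs_tensor x = lin_ext (\<lambda>(a, b). a \<otimes> b) x"
proof -
  have "abs_tensor x = abs_tensor (lin_ext (\<lambda>k. Poly_Mapping.single k 1) x)" by simp
  also have "\<dots> = lin_ext (\<lambda>k. abs_tensor (Poly_Mapping.single k 1)) x"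
    by (rule lin_ext_linear[OF abs_tensor_linear])
  also have "\<dots> = lin_ext (\<lambda>(a, b). a \<otimes> b) x"
    by (intro lin_ext_cong) (auto simp: tens.abs_eq)
  finally show ?thesis .
qed

lemma tens_bilinear:
  "(a + a') \<otimes> b = a \<otimes> b + a' \<otimes> b" "a \<otimes> (b + b') = a \<otimes> b + a \<otimes> b'"
  "(r *\<^sub>R a) \<otimes> b = r *\<^sub>R (a \<otimes> b)" "a \<otimes> (r *\<^sub>R b) = r *\<^sub>R (a \<otimes> b)"
proof -
  have "Poly_Mapping.single (a + a', b) 1 - Poly_Mapping.single (a, b) 1 - Poly_Mapping.single (a', b) 1 \<in> tensor_relations"
    unfolding tensor_relations_def by (rule span_base, rule UnI1, rule UnI1, rule UnI1, rule CollectI) blast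
  then show "(a + a') \<otimes> b = a \<otimes> b + a' \<otimes> b"
    by (simp add: tens.abs_eq plus_tensor.abs_eq abs_tensor_eq diff_diff_eq)
  have "Poly_Mapping.single (a, b + b') 1 - Poly_Mapping.single (a, b) 1 - Poly_Mapping.single (a, b') 1 \<in> tensor_relations"
    unfolding tensor_relations_def by (rule span_base, rule UnI1, rule UnI1, rule UnI2, rule CollectI) blast
  then show "a \<otimes> (b + b') = a \<otimes> b + a \<otimes> b'"
    by (simp add: tens.abs_eq plus_tensor.abs_eq abs_tensor_eq diff_diff_eq)
  have "Poly_Mapping.single (r *\<^sub>R a, b) 1 - Poly_Mapping.single (a, b) r \<in> tensor_relations"
    unfolding tensor_relations_def by (rule span_base, rule UnI1, rule UnI2, rule CollectI) blast
  then show "(r *\<^sub>R a) \<otimes> b = r *\<^sub>R (a \<otimes> b)"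
    by (simp add: tens.abs_eq scaleR_tensor.abs_eq abs_tensor_eq single_scaleR)
  have "Poly_Mapping.single (a, r *\<^sub>R b) 1 - Poly_Mapping.single (a, b) r \<in> tensor_relations"
    unfolding tensor_relations_def by (rule span_base, rule UnI2, rule CollectI) blast
  then show "a \<otimes> (r *\<^sub>R b) = r *\<^sub>R (a \<otimes> b)"
    by (simp add: tens.abs_eq scaleR_tensor.abs_eq abs_tensor_eq single_scaleR)
qed

lemma linear_tens_left: "linear (\<lambda>a. a \<otimes> b)" and linear_tens_right: "linear (\<lambda>b. a \<otimes> b)"
  by (rule linearI; simp add: tens_bilinear)+

lemma tens_zero [simp]: "0 \<otimes> b = 0" "a \<otimes> 0 = 0"
  using linear_0[OF linear_tens_left] linear_0[OF linear_tens_right] by auto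

definition tensor_lift :: "('a::real_vector \<Rightarrow> 'b::real_vector \<Rightarrow> 'c::real_vector) \<Rightarrow> ('a, 'b) tensor \<Rightarrow> 'c" where
  "tensor_lift \<beta> t = lin_ext (\<lambda>(a, b). \<beta> a b) (rep_tensor t)"

text \<open>Universal property of the tensor product: a bilinear map kills the four families of
  generators of \<open>tensor_relations\<close>, so the chosen representative does not
  matter.\<close>

lemma tensor_lift_abs:
  assumes "\<And>b. linear (\<lambda>a. \<beta> a b)" "\<And>a. linear (\<beta> a)"
  shows "tensor_lift \<beta> (abs_tensor x) = lin_ext (\<lambda>(a, b). \<beta> a b) x"
proof -
  let ?L = "lin_ext (\<lambda>(a, b). \<beta> a b)"
  have "?L z = 0" if "z \<in> tensor_relations" for z
    using that unfolding tensor_relations_def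
  proof (induction rule: span_induct)
    case base show ?case by (rule linear_subspace_kernel) simp
  next
    case (step z)
    then show ?case
      by (auto simp: lin_ext_diff linear_add[OF assms(1)] linear_add[OF assms(2)]
          linear_cmul[OF assms(1)] linear_cmul[OF assms(2)])
  qed
  moreover have "rep_tensor (abs_tensor x) - x \<in> tensor_relations"
    using abs_tensor_eq[of "rep_tensor (abs_tensor x)" x] Quotient_abs_rep[OF Quotient_tensor] by metis
  ultimately show ?thesis
    unfolding tensor_lift_def by (metis lin_ext_diff eq_iff_diff_eq_0)
qed

lemma tensor_lift_tens:
  assumes "\<And>b. linear (\<lambda>a. \<beta> a b)" "\<And>a. linear (\<beta> a)"
  shows "tensor_lift \<beta> (a \<otimes> b) = \<beta> a b"
  using tensor_lift_abs[OF assms, of "Poly_Mapping.single (a, b) 1"] by (simp add: tens.abs_eq)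

lemma linear_tensor_lift:
  fixes \<beta> :: "'a::real_vector \<Rightarrow> 'b::real_vector \<Rightarrow> 'c::real_vector"
  assumes "\<And>b. linear (\<lambda>a. \<beta> a b)" "\<And>a. linear (\<beta> a)"
  shows "linear (tensor_lift \<beta>)"
proof (rule linearI)
  have rep: "abs_tensor (rep_tensor t) = t" for t :: "('a, 'b) tensor"
    by (rule Quotient_abs_rep[OF Quotient_tensor])
  fix s t and r :: real
  show "tensor_lift \<beta> (s + t) = tensor_lift \<beta> s + tensor_lift \<beta> t"
    using tensor_lift_abs[OF assms, of "rep_tensor s + rep_tensor t"]
    by (simp add: lin_ext_add tensor_lift_def plus_tensor.abs_eq[symmetric] rep)
  show "tensor_lift \<beta> (r *\<^sub>R s) = r *\<^sub>R tensor_lift \<beta> s"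
    using tensor_lift_abs[OF assms, of "r *\<^sub>R rep_tensor s"]
    by (simp add: lin_ext_scale tensor_lift_def scaleR_tensor.abs_eq[symmetric] rep)
qed

lemma tensor_induct [case_names zero add tens]:
  assumes "P 0" "\<And>s t. P s \<Longrightarrow> P t \<Longrightarrow> P (s + t)" "\<And>r a b. P (r *\<^sub>R (a \<otimes> b))"
  shows "P t"
proof -
  have "P (\<Sum>k\<in>A. Poly_Mapping.lookup (rep_tensor t) k *\<^sub>R (case k of (a, b) \<Rightarrow> a \<otimes> b))" if "finite A" for A
    using that
  proof (induction A rule: finite_induct)
    case empty show ?case using assms(1) by simp
  next
    case (insert k F)
    then show ?case using assms(2)[OF assms(3) insert.IH] by (cases k) simp
  qed
  then have p: "P (lin_ext (\<lambda>(a, b). a \<otimes> b) (rep_tensor t))"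
    by (simp add: lin_ext_def)
  have e: "lin_ext (\<lambda>(a, b). a \<otimes> b) (rep_tensor t) = t"
    unfolding abs_tensor_expand[symmetric] by (rule Quotient_abs_rep[OF Quotient_tensor])
  show ?thesis using p unfolding e .
qed

lemma linear_eq_tensor:
  assumes "linear F" "linear G" "\<And>a b. F (a \<otimes> b) = G (a \<otimes> b)"
  shows "F t = G t"
  by (induction t rule: tensor_induct)
    (simp_all add: linear_0[OF assms(1)] linear_0[OF assms(2)] linear_add[OF assms(1)]
      linear_add[OF assms(2)] linear_cmul[OF assms(1)] linear_cmul[OF assms(2)] assms(3))

lemma tensor_map_eq_lift: "tensor_map f g = tensor_lift (\<lambda>a b. f a \<otimes> g b)"
  by (simp add: tensor_map_def tensor_lift_def fun_eq_iff)

lemma linear_tens_comp_left: "linear f \<Longrightarrow> linear (\<lambda>a. f a \<otimes> c)"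
  using linear_compose[OF _ linear_tens_left, of f c] by (simp add: o_def)

lemma linear_tens_comp_right: "linear g \<Longrightarrow> linear (\<lambda>b. c \<otimes> g b)"
  using linear_compose[OF _ linear_tens_right, of g c] by (simp add: o_def)

lemma tensor_map_tens: "linear f \<Longrightarrow> linear g \<Longrightarrow> tensor_map f g (a \<otimes> b) = f a \<otimes> g b"
  unfolding tensor_map_eq_lift
  by (rule tensor_lift_tens) (erule linear_tens_comp_left linear_tens_comp_right)+

lemma linear_tensor_map: "linear f \<Longrightarrow> linear g \<Longrightarrow> linear (tensor_map f g)"
  unfolding tensor_map_eq_lift
  by (rule linear_tensor_lift) (erule linear_tens_comp_left linear_tens_comp_right)+

section \<open>The shuffle algebra\<close>

text \<open>The shuffle product evaluated on a test function. Iterated products become nested calls,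
  and a statement modulo shuffles becomes a statement about test functions annihilated by
  \<open>sh\<close>.\<close>

definition sh :: "'b::graded_basis list \<Rightarrow> 'b list \<Rightarrow> ('b list \<Rightarrow> 'v) \<Rightarrow> 'v::real_vector" where
  "sh u v \<Phi> = lin_ext \<Phi> (shuffle_prod u v)"

lemma sh_Nil [simp]: "sh [] v \<Phi> = \<Phi> v" "sh u [] \<Phi> = \<Phi> u"
  by (simp_all add: sh_def, cases u, simp_all)

lemma sh_Cons: "sh (a # u) (b # v) \<Phi> = sh u (b # v) (\<lambda>w. \<Phi> (a # w))
    + ksgn (bdeg b * wdeg (a # u)) *\<^sub>R sh (a # u) v (\<lambda>w. \<Phi> (b # w))"
  by (simp add: sh_def le_simps)

lemma sh_add: "sh u v (\<lambda>w. \<Phi> w + \<Psi> w) = sh u v \<Phi> + sh u v \<Psi>"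
  and sh_scale: "sh u v (\<lambda>w. r *\<^sub>R \<Phi> w) = r *\<^sub>R sh u v \<Phi>"
  and sh_minus: "sh u v (\<lambda>w. - \<Phi> w) = - sh u v \<Phi>"
  and sh_zero [simp]: "sh u v (\<lambda>w. 0) = 0"
  by (simp_all add: sh_def le_simps)

lemma sh_lin: "linear L \<Longrightarrow> L (sh u v \<Phi>) = sh u v (\<lambda>w. L (\<Phi> w))"
  by (simp add: sh_def lin_ext_linear)

lemma sh_lin_ext: "lin_ext f (sh u v \<Phi>) = sh u v (\<lambda>w. lin_ext f (\<Phi> w))"
  "sh u v (\<lambda>w. lin_ext (\<lambda>k. \<Theta> w k) x) = lin_ext (\<lambda>k. sh u v (\<lambda>w. \<Theta> w k)) x"
  unfolding sh_def by (rule lin_ext_lin_ext, rule lin_ext_swap)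

lemma sh_swap: "sh u v (\<lambda>w. sh s t (\<lambda>z. \<Theta> w z)) = sh s t (\<lambda>z. sh u v (\<lambda>w. \<Theta> w z))"
  unfolding sh_def by (rule lin_ext_swap)

lemma shuffle_prod_mset: "w \<in> Poly_Mapping.keys (shuffle_prod u v) \<Longrightarrow> mset w = mset u + mset v"
proof (induction u v arbitrary: w rule: shuffle_prod.induct)
  case (3 a u b v)
  have "w \<in> Poly_Mapping.keys (lin_ext (\<lambda>w. Poly_Mapping.single (a # w) (1::real)) (shuffle_prod u (b # v))) \<union>
     Poly_Mapping.keys (lin_ext (\<lambda>w. Poly_Mapping.single (b # w) (1::real)) (shuffle_prod (a # u) v))"
    using 3(3) Poly_Mapping.keys_add by (fastforce simp: in_keys_iff lookup_add)
  then show ?case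
    by (auto elim!: keys_lin_ext simp: 3 split: if_splits)
qed (auto split: if_splits)

text \<open>Every term of a shuffle is a rearrangement of the letters of \<open>u\<close> and
  \<open>v\<close>. This is how signs depending only on degrees are later pulled out of
  \<open>sh\<close>.\<close>

lemma sh_cong:
  assumes "\<And>w. mset w = mset u + mset v \<Longrightarrow> \<Phi> w = \<Psi> w"
  shows "sh u v \<Phi> = sh u v \<Psi>"
  unfolding sh_def by (intro lin_ext_cong assms shuffle_prod_mset)

lemma sh_cong_deg:
  assumes "\<And>w. wdeg w = wdeg u + wdeg v \<Longrightarrow> length w = length u + length v \<Longrightarrow> \<Phi> w = \<Psi> w"
  shows "sh u v \<Phi> = sh u v \<Psi>"
proof (rule sh_cong, rule assms)
  fix w assume "mset w = mset u + mset v"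
  then have "mset w = mset (u @ v)" by simp
  then show "wdeg w = wdeg u + wdeg v" "length w = length u + length v"
    using wdeg_perm[of w "u @ v"] mset_eq_length[of w "u @ v"] by auto
qed

lemma sh_scale_deg:
  "(\<And>w. wdeg w = wdeg u + wdeg v \<Longrightarrow> f w = r) \<Longrightarrow> sh u v (\<lambda>w. f w *\<^sub>R \<Phi> w) = r *\<^sub>R sh u v \<Phi>"
  by (subst sh_scale[symmetric]) (rule sh_cong_deg, simp)

lemma sh_comm: "sh u v \<Phi> = ksgn (wdeg u * wdeg v) *\<^sub>R sh v u \<Phi>"
proof (induction u v arbitrary: \<Phi> rule: shuffle_prod.induct)
  case (3 a u b v)
  show ?case
    by (simp add: sh_Cons 3(1)[of "\<lambda>w. \<Phi> (a # w)"] 3(2)[of "\<lambda>w. \<Phi> (b # w)"] ks algebra_simps)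
qed simp_all

text \<open>On both sides the terms are sorted by the word that supplies the first letter; removing
  this letter leaves triple shuffles of smaller total length.\<close>

lemma sh_assoc:
  fixes u v t :: "'b::graded_basis list" and \<Phi> :: "'b list \<Rightarrow> 'v::real_vector"
  shows "sh u v (\<lambda>w. sh w t \<Phi>) = sh v t (\<lambda>w. sh u w \<Phi>)"
proof (induction "length u + length v + length t" arbitrary: u v t \<Phi> rule: less_induct)
  case less
  show ?case
  proof (cases "u = [] \<or> v = [] \<or> t = []")
    case True then show ?thesis by auto
  next
    case False
    then obtain a u' b v' c t' where e: "u = a # u'" "v = b # v'" "t = c # t'"
      by (metis neq_Nil_conv)
    let ?u = "a # u'" and ?v = "b # v'" and ?t = "c # t'"
    let ?s = "ksgn (bdeg b * wdeg ?u)" and ?r = "ksgn (bdeg c * (wdeg ?u + wdeg ?v))"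
    have i1: "sh u' ?v (\<lambda>w. sh w ?t \<Psi>) = sh ?v ?t (\<lambda>w. sh u' w \<Psi>)" for \<Psi> :: "'b list \<Rightarrow> 'v"
      by (rule less) (simp add: e)
    have i2: "sh ?u v' (\<lambda>w. sh w ?t \<Psi>) = sh v' ?t (\<lambda>w. sh ?u w \<Psi>)" for \<Psi> :: "'b list \<Rightarrow> 'v"
      by (rule less) (simp add: e)
    have i3: "sh ?u ?v (\<lambda>w. sh w t' \<Psi>) = sh ?v t' (\<lambda>w. sh ?u w \<Psi>)" for \<Psi> :: "'b list \<Rightarrow> 'v"
      by (rule less) (simp add: e)
    have l1: "sh u' ?v (\<lambda>w. sh (a # w) ?t \<Phi>) = sh u' ?v (\<lambda>w. sh w ?t (\<lambda>x. \<Phi> (a # x)))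
        + ?r *\<^sub>R sh u' ?v (\<lambda>w. sh (a # w) t' (\<lambda>x. \<Phi> (c # x)))"
      unfolding sh_Cons sh_add by (subst sh_scale_deg[where r = ?r]) (auto simp: algebra_simps)
    have l2: "sh ?u v' (\<lambda>w. sh (b # w) ?t \<Phi>) = sh ?u v' (\<lambda>w. sh w ?t (\<lambda>x. \<Phi> (b # x)))
        + ?r *\<^sub>R sh ?u v' (\<lambda>w. sh (b # w) t' (\<lambda>x. \<Phi> (c # x)))"
      unfolding sh_Cons sh_add by (subst sh_scale_deg[where r = ?r]) (auto simp: algebra_simps)
    \<comment> \<open>The terms beginning with \<open>c\<close>, one group from \<open>l1\<close>
      and one from \<open>l2\<close>, recombine by \<open>sh_Cons\<close> into a full shuffle of
      \<open>?u\<close> and \<open>?v\<close>.\<close>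
    have "sh ?u ?v (\<lambda>w. sh w ?t \<Phi>) = sh u' ?v (\<lambda>w. sh w ?t (\<lambda>x. \<Phi> (a # x)))
        + ?s *\<^sub>R sh ?u v' (\<lambda>w. sh w ?t (\<lambda>x. \<Phi> (b # x)))
        + ?r *\<^sub>R sh ?u ?v (\<lambda>w. sh w t' (\<lambda>x. \<Phi> (c # x)))"
      by (subst sh_Cons) (simp only: l1 l2 scaleR_right_distrib sh_Cons[of a u' b v' "\<lambda>w. sh w t' _"] scaleR_scaleR mult.commute add.assoc add.left_commute add.commute)
    also have "\<dots> = sh ?v ?t (\<lambda>w. sh u' w (\<lambda>x. \<Phi> (a # x)))
        + ?s *\<^sub>R sh v' ?t (\<lambda>w. sh ?u w (\<lambda>x. \<Phi> (b # x)))
        + ?r *\<^sub>R sh ?v t' (\<lambda>w. sh ?u w (\<lambda>x. \<Phi> (c # x)))"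
      by (simp only: i1 i2 i3)
    also have "\<dots> = sh ?v ?t (\<lambda>w. sh ?u w \<Phi>)"
    proof -
      have r1: "sh v' ?t (\<lambda>w. sh ?u (b # w) \<Phi>) = sh v' ?t (\<lambda>w. sh u' (b # w) (\<lambda>x. \<Phi> (a # x)))
          + ?s *\<^sub>R sh v' ?t (\<lambda>w. sh ?u w (\<lambda>x. \<Phi> (b # x)))"
        by (simp add: sh_Cons[of a u' b] sh_add sh_scale)
      have r2: "sh ?v t' (\<lambda>w. sh ?u (c # w) \<Phi>) = sh ?v t' (\<lambda>w. sh u' (c # w) (\<lambda>x. \<Phi> (a # x)))
          + ksgn (bdeg c * wdeg ?u) *\<^sub>R sh ?v t' (\<lambda>w. sh ?u w (\<lambda>x. \<Phi> (c # x)))"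
        by (simp add: sh_Cons[of a u' c] sh_add sh_scale)
      show ?thesis
        unfolding sh_Cons[of b v' c t' "\<lambda>w. sh ?u w \<Phi>"] r1 r2
          sh_Cons[of b v' c t' "\<lambda>w. sh u' w (\<lambda>x. \<Phi> (a # x))"]
        by (simp add: ks scaleR_right_distrib mult.commute mult.left_commute add.assoc add.left_commute)
    qed
    finally show ?thesis by (simp only: e)
  qed
qed

lemma sh_left_comm:
  "sh u v (\<lambda>w. sh s w \<Phi>) = ksgn (wdeg u * wdeg s) *\<^sub>R sh s v (\<lambda>w. sh u w \<Phi>)"
proof -
  have "sh u v (\<lambda>w. sh s w \<Phi>) = sh s u (\<lambda>w. sh w v \<Phi>)" by (rule sh_assoc[symmetric])
  also have "\<dots> = ksgn (wdeg s * wdeg u) *\<^sub>R sh u s (\<lambda>w. sh w v \<Phi>)" by (rule sh_comm)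
  also have "\<dots> = ksgn (wdeg u * wdeg s) *\<^sub>R sh s v (\<lambda>w. sh u w \<Phi>)" by (simp add: sh_assoc mult.commute)
  finally show ?thesis .
qed

text \<open>The recursion by last letters. The auxiliary facts \<open>n1\<close> and
  \<open>n2\<close> treat the cases in which one of the words has a single letter.\<close>

lemma sh_snoc:
  fixes u v :: "'b::graded_basis list" and \<Phi> :: "'b list \<Rightarrow> 'v::real_vector"
  shows "sh (u @ [a]) (v @ [b]) \<Phi> =
    ksgn (bdeg a * wdeg (v @ [b])) *\<^sub>R sh u (v @ [b]) (\<lambda>w. \<Phi> (w @ [a])) + sh (u @ [a]) v (\<lambda>w. \<Phi> (w @ [b]))"
proof -
  have n1: "sh [a] (v @ [b]) \<Phi> = ksgn (bdeg a * wdeg (v @ [b])) *\<^sub>R \<Phi> (v @ [b] @ [a]) + sh [a] v (\<lambda>w. \<Phi> (w @ [b]))"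
    for v a b and \<Phi> :: "'b list \<Rightarrow> 'v"
    by (induction v arbitrary: \<Phi>) (simp_all add: sh_Cons ks algebra_simps)
  have n2: "sh (u @ [a]) [b] \<Phi> = ksgn (bdeg a * bdeg b) *\<^sub>R sh u [b] (\<lambda>w. \<Phi> (w @ [a])) + \<Phi> (u @ [a] @ [b])"
    for u a b and \<Phi> :: "'b list \<Rightarrow> 'v"
    by (subst (1 2) sh_comm) (simp add: n1 ks algebra_simps)
  show ?thesis
  proof (induction u v arbitrary: \<Phi> rule: shuffle_prod.induct)
    case (1 v)
    show ?case using n1[of a v b \<Phi>] by simp
  next
    case (2 c u)
    show ?case using n2[of "c # u" a b \<Phi>] by simp
  next
    case (3 c u d v)
    show ?case
      by (simp add: sh_Cons 3(1)[of "\<lambda>w. \<Phi> (c # w)", simplified] 3(2)[of "\<lambda>w. \<Phi> (d # w)", simplified] ks algebra_simps)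
  qed
qed

subsection \<open>Deconcatenation\<close>

text \<open>Deconcatenation with the two improper cuts included; they make the bialgebra
  compatibility \<open>dec_sh\<close> hold without exceptions.\<close>

primrec dec :: "'b list \<Rightarrow> ('b list \<Rightarrow> 'b list \<Rightarrow> 'v) \<Rightarrow> 'v::real_vector" where
  "dec [] \<Psi> = \<Psi> [] []"
| "dec (a # w) \<Psi> = \<Psi> [] (a # w) + dec w (\<lambda>u v. \<Psi> (a # u) v)"

lemma dec_add: "dec w (\<lambda>u v. \<Phi> u v + \<Psi> u v) = dec w \<Phi> + dec w \<Psi>"
  by (induction w arbitrary: \<Phi> \<Psi>) (simp_all add: algebra_simps)

lemma dec_scale: "dec w (\<lambda>u v. r *\<^sub>R \<Phi> u v) = r *\<^sub>R dec w \<Phi>"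
  by (induction w arbitrary: \<Phi>) (simp_all add: algebra_simps)

lemma dec_zero [simp]: "dec w (\<lambda>u v. 0) = 0"
  by (induction w) simp_all

lemma dec_lin: "linear L \<Longrightarrow> L (dec w \<Phi>) = dec w (\<lambda>u v. L (\<Phi> u v))"
  by (induction w arbitrary: \<Phi>) (simp_all add: linear_add)

lemma dec_cong: "(\<And>u v. w = u @ v \<Longrightarrow> \<Phi> u v = \<Psi> u v) \<Longrightarrow> dec w \<Phi> = dec w \<Psi>"
proof (induction w arbitrary: \<Phi> \<Psi>)
  case (Cons a w)
  have "dec w (\<lambda>u v. \<Phi> (a # u) v) = dec w (\<lambda>u v. \<Psi> (a # u) v)"
    by (rule Cons.IH) (simp add: Cons.prems)
  with Cons.prems[of "[]" "a # w"] show ?case by simp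
qed simp

lemma dec_snoc: "dec (w @ [a]) \<Psi> = dec w (\<lambda>u v. \<Psi> u (v @ [a])) + \<Psi> (w @ [a]) []"
  by (induction w arbitrary: \<Psi>) (simp_all add: algebra_simps)

lemma dec_dec: "dec w (\<lambda>u v. dec u (\<lambda>s t. \<Theta> s t v)) = dec w (\<lambda>s v. dec v (\<lambda>t u. \<Theta> s t u))"
  by (induction w arbitrary: \<Theta>) (simp_all add: dec_add algebra_simps)

lemma dec_swap: "dec w (\<lambda>u v. dec z (\<lambda>s t. \<Theta> u v s t)) = dec z (\<lambda>s t. dec w (\<lambda>u v. \<Theta> u v s t))"
  by (induction w arbitrary: \<Theta>) (simp_all add: dec_add)

lemma sh_dec_swap: "sh u v (\<lambda>w. dec z (\<lambda>s t. \<Theta> w s t)) = dec z (\<lambda>s t. sh u v (\<lambda>w. \<Theta> w s t))"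
  by (induction z arbitrary: \<Theta>) (simp_all add: sh_add)

lemma lin_ext_dec: "lin_ext (\<lambda>k. dec z (\<lambda>s t. \<Theta> k s t)) x = dec z (\<lambda>s t. lin_ext (\<lambda>k. \<Theta> k s t) x)"
  by (induction z arbitrary: \<Theta>) (simp_all add: le_simps)

text \<open>Deconcatenation is multiplicative for the shuffle product: a cut of a shuffle cuts both
  words, and the sign comes from moving \<open>v1\<close> past \<open>u2\<close>.\<close>

lemma dec_sh:
  fixes u v :: "'b::graded_basis list" and \<Psi> :: "'b list \<Rightarrow> 'b list \<Rightarrow> 'v::real_vector"
  shows "sh u v (\<lambda>w. dec w \<Psi>) =
    dec u (\<lambda>u1 u2. dec v (\<lambda>v1 v2. ksgn (wdeg u2 * wdeg v1) *\<^sub>R sh u1 v1 (\<lambda>a. sh u2 v2 (\<lambda>b. \<Psi> a b))))"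
proof (induction u v arbitrary: \<Psi> rule: shuffle_prod.induct)
  case (3 a u b v)
  have w: "dec u (\<lambda>u1 u2. f (wdeg (u1 @ u2)) u1 u2) = dec u (\<lambda>u1 u2. f (wdeg u) u1 u2)"
    for f :: "int \<Rightarrow> 'b list \<Rightarrow> 'b list \<Rightarrow> 'v" by (rule dec_cong) simp
  have c: "dec u (\<lambda>u1 u2. dec v (\<lambda>v1 v2. ksgn (bdeg b * (bdeg a + wdeg u)) *\<^sub>R f u1 u2 v1 v2))
      = dec u (\<lambda>u1 u2. dec v (\<lambda>v1 v2. ksgn (bdeg b * (bdeg a + wdeg u1 + wdeg u2)) *\<^sub>R f u1 u2 v1 v2))"
    for f :: "'b list \<Rightarrow> 'b list \<Rightarrow> 'b list \<Rightarrow> 'b list \<Rightarrow> 'v"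
    by (rule dec_cong) (simp add: algebra_simps)
  have c1: "dec u (\<lambda>u1 u2. ksgn (bdeg b * (bdeg a + wdeg u)) *\<^sub>R f u1 u2)
      = dec u (\<lambda>u1 u2. ksgn (bdeg b * (bdeg a + wdeg u1 + wdeg u2)) *\<^sub>R f u1 u2)"
    for f :: "'b list \<Rightarrow> 'b list \<Rightarrow> 'v"
    by (rule dec_cong) (simp add: algebra_simps)
  have r: "ksgn (bdeg b * (bdeg a + wdeg u)) *\<^sub>R dec u (\<lambda>u1 u2. f u1 u2)
      = dec u (\<lambda>u1 u2. ksgn (bdeg b * (bdeg a + wdeg u1 + wdeg u2)) *\<^sub>R f u1 u2)"
    for f :: "'b list \<Rightarrow> 'b list \<Rightarrow> 'v"
    by (subst dec_scale[symmetric]) (rule c1)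
  show ?case
    apply (subst sh_Cons)
    apply (simp add: sh_add 3(1) 3(2) dec_add sh_Cons scaleR_right_distrib)
    apply (simp add: r dec_scale[symmetric] dec_add[symmetric] ks algebra_simps)
    apply (rule dec_cong, simp add: ks algebra_simps)
    done
qed (simp_all)

text \<open>The marked letter \<open>x\<close> divides every shuffle into a left and a right part,
  and thereby cuts \<open>v\<close> as well.\<close>

lemma dec_sh_insert:
  fixes v A B :: "'b::graded_basis list" and \<Phi> :: "'b list \<Rightarrow> 'v::real_vector"
  shows "sh v (A @ x # B) \<Phi> = dec v (\<lambda>v1 v2. ksgn (wdeg v2 * (wdeg A + bdeg x)) *\<^sub>R
    sh v1 A (\<lambda>p. sh v2 B (\<lambda>q. \<Phi> (p @ x # q))))"
proof (induction v A arbitrary: \<Phi> rule: shuffle_prod.induct)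
  case (1 A)
  then show ?case by simp
next
  case (2 c v)
  have "sh w (x # B) \<Phi> = dec w (\<lambda>v1 v2. ksgn (wdeg v2 * bdeg x) *\<^sub>R sh v2 B (\<lambda>q. \<Phi> (v1 @ x # q)))" for w
  proof (induction w arbitrary: \<Phi>)
    case (Cons c w)
    show ?case by (simp add: sh_Cons Cons ks algebra_simps)
  qed simp
  from this[of "c # v"] show ?case by simp
next
  case (3 c v a A)
  have r: "ksgn (bdeg a * (bdeg c + wdeg v)) *\<^sub>R dec v (\<lambda>u1 u2. f u1 u2)
      = dec v (\<lambda>u1 u2. ksgn (bdeg a * (bdeg c + wdeg u1 + wdeg u2)) *\<^sub>R f u1 u2)"
    for f :: "'b list \<Rightarrow> 'b list \<Rightarrow> 'v"
    by (subst dec_scale[symmetric]) (rule dec_cong, simp add: algebra_simps)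
  show ?case
    apply (simp add: sh_Cons 3(1)[of "\<lambda>w. \<Phi> (c # w)", simplified] 3(2)[of "\<lambda>w. \<Phi> (a # w)", simplified] scaleR_right_distrib)
    apply (simp add: r dec_add[symmetric] ks algebra_simps)
    apply (subst dec_scale[symmetric])
    apply (subst dec_add[symmetric])
    apply (rule dec_cong)
    apply (simp add: ks algebra_simps)
    done
qed

section \<open>Maps out of the cofree coalgebra\<close>

lemma ksgn_mult_2 [simp]: "ksgn (a * 2) = 1" by (simp add: ksgn_def)

text \<open>The conditions for descending to \<open>'b cofree\<close>, except the one at the empty
  list. They are inherited when some of the words are fixed, where the empty rest is no longer
  special; inductions over the list of words rely on this.\<close>

definition good0 :: "('b::graded_basis list list \<Rightarrow> 'v::real_vector) \<Rightarrow> bool" where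
  "good0 \<phi> \<longleftrightarrow>
     (\<forall>us vs u v. u \<noteq> [] \<longrightarrow> v \<noteq> [] \<longrightarrow> sh u v (\<lambda>w. \<phi> (us @ w # vs)) = 0) \<and>
     (\<forall>us vs u v. \<phi> (us @ u # v # vs) = ksgn (tdeg u * tdeg v) *\<^sub>R \<phi> (us @ v # u # vs)) \<and>
     (\<forall>ws. [] \<in> set ws \<longrightarrow> \<phi> ws = 0)"

definition good :: "('b::graded_basis list list \<Rightarrow> 'v::real_vector) \<Rightarrow> bool" where
  "good \<phi> \<longleftrightarrow> good0 \<phi> \<and> \<phi> [] = 0"

lemma good0D:
  assumes "good0 \<phi>"
  shows "u \<noteq> [] \<Longrightarrow> v \<noteq> [] \<Longrightarrow> sh u v (\<lambda>w. \<phi> (us @ w # vs)) = 0"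
    "\<phi> (us @ u # v # vs) = ksgn (tdeg u * tdeg v) *\<^sub>R \<phi> (us @ v # u # vs)"
    "[] \<in> set ws \<Longrightarrow> \<phi> ws = 0"
  using assms unfolding good0_def by blast+

lemma good0D_hd:
  assumes "good0 \<phi>"
  shows "u \<noteq> [] \<Longrightarrow> v \<noteq> [] \<Longrightarrow> sh u v (\<lambda>w. \<phi> (w # vs)) = 0"
    "\<phi> (u # v # vs) = ksgn (tdeg u * tdeg v) *\<^sub>R \<phi> (v # u # vs)"
proof -
  show "u \<noteq> [] \<Longrightarrow> v \<noteq> [] \<Longrightarrow> sh u v (\<lambda>w. \<phi> (w # vs)) = 0"
    using good0D(1)[OF assms, where us = "[]"] by simp
  show "\<phi> (u # v # vs) = ksgn (tdeg u * tdeg v) *\<^sub>R \<phi> (v # u # vs)"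
    using good0D(2)[OF assms, of "[]" u v vs] unfolding append_Nil .
qed

lemma good0I:
  assumes "\<And>us vs u v. u \<noteq> [] \<Longrightarrow> v \<noteq> [] \<Longrightarrow> sh u v (\<lambda>w. \<phi> (us @ w # vs)) = 0"
    "\<And>us vs u v. \<phi> (us @ u # v # vs) = ksgn (tdeg u * tdeg v) *\<^sub>R \<phi> (us @ v # u # vs)"
    "\<And>ws. [] \<in> set ws \<Longrightarrow> \<phi> ws = 0"
  shows "good0 \<phi>"
  using assms unfolding good0_def by blast

lemma goodD: "good \<phi> \<Longrightarrow> good0 \<phi>" "good \<phi> \<Longrightarrow> \<phi> [] = 0"
  by (simp_all add: good_def)

lemma good0_prefix: "good0 \<phi> \<Longrightarrow> good0 (\<lambda>ws. \<phi> (p @ ws))"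
proof (rule good0I)
  fix us vs and u v :: "'a list"
  assume g: "good0 \<phi>"
  show "u \<noteq> [] \<Longrightarrow> v \<noteq> [] \<Longrightarrow> sh u v (\<lambda>w. \<phi> (p @ us @ w # vs)) = 0"
    using good0D(1)[OF g, where us = "p @ us"] by simp
  show "\<phi> (p @ us @ u # v # vs) = ksgn (tdeg u * tdeg v) *\<^sub>R \<phi> (p @ us @ v # u # vs)"
    using good0D(2)[OF g, of "p @ us" u v vs] unfolding append_assoc .
  show "[] \<in> set ws \<Longrightarrow> \<phi> (p @ ws) = 0" for ws
    using good0D(3)[OF g] by simp
qed

lemma good0_Cons: "good0 \<phi> \<Longrightarrow> good0 (\<lambda>ws. \<phi> (w # ws))"
  using good0_prefix[of \<phi> "[w]"] by simp

lemma good0_add: "good0 \<phi> \<Longrightarrow> good0 \<psi> \<Longrightarrow> good0 (\<lambda>ws. \<phi> ws + \<psi> ws)"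
proof (rule good0I)
  fix us vs and u v :: "'a list"
  assume g: "good0 \<phi>" "good0 \<psi>"
  show "sh u v (\<lambda>w. \<phi> (us @ w # vs) + \<psi> (us @ w # vs)) = 0" if "u \<noteq> []" "v \<noteq> []"
    using good0D(1)[OF g(1) that] good0D(1)[OF g(2) that] by (simp add: sh_add)
  show "\<phi> (us @ u # v # vs) + \<psi> (us @ u # v # vs)
      = ksgn (tdeg u * tdeg v) *\<^sub>R (\<phi> (us @ v # u # vs) + \<psi> (us @ v # u # vs))"
    by (subst good0D(2)[OF g(1)], subst good0D(2)[OF g(2)]) (rule scaleR_right_distrib[symmetric])
  show "\<phi> ws + \<psi> ws = 0" if "[] \<in> set ws" for ws
    using good0D(3)[OF g(1) that] good0D(3)[OF g(2) that] by simp
qed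

lemma good0_zero [simp]: "good0 (\<lambda>ws. 0)"
  by (rule good0I) simp_all

lemma good0_linear: "good0 \<phi> \<Longrightarrow> linear L \<Longrightarrow> good0 (\<lambda>ws. L (\<phi> ws))"
proof (rule good0I)
  fix us vs and u v :: "'a list"
  assume g: "good0 \<phi>" "linear L"
  show "sh u v (\<lambda>w. L (\<phi> (us @ w # vs))) = 0" if "u \<noteq> []" "v \<noteq> []"
    using sh_lin[OF g(2), of u v "\<lambda>w. \<phi> (us @ w # vs)"] good0D(1)[OF g(1) that] linear_0[OF g(2)] by simp
  show "L (\<phi> (us @ u # v # vs)) = ksgn (tdeg u * tdeg v) *\<^sub>R L (\<phi> (us @ v # u # vs))"
    by (subst good0D(2)[OF g(1)]) (rule linear_cmul[OF g(2)])
  show "L (\<phi> ws) = 0" if "[] \<in> set ws" for ws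
    using good0D(3)[OF g(1) that] linear_0[OF g(2)] by simp
qed

lemma good0_scaleR: "good0 \<phi> \<Longrightarrow> good0 (\<lambda>ws. r *\<^sub>R \<phi> ws)"
  by (erule good0_linear[where L = "\<lambda>x. r *\<^sub>R x"]) (simp add: linearI scaleR_right_distrib)

lemma good0_sum: "(\<And>i. i \<in> I \<Longrightarrow> good0 (\<phi> i)) \<Longrightarrow> good0 (\<lambda>ws. \<Sum>i\<in>I. \<phi> i ws)"
  by (induction I rule: infinite_finite_induct) (simp_all add: good0_add)

lemma good0_lin_ext: "(\<And>k. good0 (\<phi> k)) \<Longrightarrow> good0 (\<lambda>ws. lin_ext (\<lambda>k. \<phi> k ws) x)"
  unfolding lin_ext_def by (intro good0_sum good0_scaleR)

text \<open>The coefficients that may be multiplied onto a function without destroying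
  \<open>good0\<close>: they ignore the order of the words and of the letters in each word, as
  degrees and lengths do.\<close>

definition word_inv :: "('b list list \<Rightarrow> 'r) \<Rightarrow> bool" where
  "word_inv r \<longleftrightarrow> (\<forall>us vs w w'. mset w = mset w' \<longrightarrow> r (us @ w # vs) = r (us @ w' # vs)) \<and>
     (\<forall>us vs u v. r (us @ u # v # vs) = r (us @ v # u # vs))"

lemma word_inv_comp: "word_inv r \<Longrightarrow> word_inv (\<lambda>ws. f (r ws))"
  unfolding word_inv_def by metis

lemma word_inv_comp2: "word_inv r \<Longrightarrow> word_inv r' \<Longrightarrow> word_inv (\<lambda>ws. f (r ws) (r' ws))"
  unfolding word_inv_def by metis

lemma word_inv_sum_list:
  assumes "\<And>w w'. mset w = mset w' \<Longrightarrow> f w = f w'"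
  shows "word_inv (\<lambda>ws. sum_list (map f ws) :: 'r::comm_monoid_add)"
  unfolding word_inv_def by (auto simp: add.left_commute dest: assms)

lemma tdeg_perm: "mset u = mset v \<Longrightarrow> tdeg u = tdeg v"
  by (metis tdeg_def wdeg_perm)

lemma word_inv_gr [simp]: "word_inv sdeg" "word_inv gr1" "word_inv gr2" "word_inv gr3" "word_inv (\<lambda>ws. length ws)"
proof -
  show "word_inv sdeg" unfolding sdeg_def by (rule word_inv_sum_list) (rule tdeg_perm)
  then show "word_inv gr1" unfolding gr1_def by (rule word_inv_comp)
  show "word_inv gr2" unfolding gr2_def by (rule word_inv_sum_list) (metis mset_eq_length)
  show "word_inv (\<lambda>ws. length ws)" by (simp add: word_inv_def)
  then show "word_inv gr3" unfolding gr3_def by (rule word_inv_comp)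
qed

lemma good0_scale_inv:
  assumes "good0 \<phi>" "word_inv r"
  shows "good0 (\<lambda>ws. r ws *\<^sub>R \<phi> ws)"
proof (rule good0I)
  fix us vs and u v :: "'a list"
  show "sh u v (\<lambda>w. r (us @ w # vs) *\<^sub>R \<phi> (us @ w # vs)) = 0" if "u \<noteq> []" "v \<noteq> []"
  proof -
    have "sh u v (\<lambda>w. r (us @ w # vs) *\<^sub>R \<phi> (us @ w # vs))
        = sh u v (\<lambda>w. r (us @ (u @ v) # vs) *\<^sub>R \<phi> (us @ w # vs))"
      using assms(2) by (intro sh_cong) (metis mset_append word_inv_def)
    with that good0D(1)[OF assms(1)] show ?thesis by (simp add: sh_scale)
  qed
  show "r (us @ u # v # vs) *\<^sub>R \<phi> (us @ u # v # vs)
      = ksgn (tdeg u * tdeg v) *\<^sub>R r (us @ v # u # vs) *\<^sub>R \<phi> (us @ v # u # vs)"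
  proof -
    have "r (us @ u # v # vs) = r (us @ v # u # vs)"
      using assms(2) unfolding word_inv_def by blast
    then show ?thesis
      by (subst good0D(2)[OF assms(1)]) (simp only: scaleR_left_commute)
  qed
  show "r ws *\<^sub>R \<phi> ws = 0" if "[] \<in> set ws" for ws
    using good0D(3)[OF assms(1) that] by simp
qed

lemma good0_if_inv: "good0 \<phi> \<Longrightarrow> word_inv P \<Longrightarrow> good0 (\<lambda>ws. if P ws then \<phi> ws else 0)"
  using good0_scale_inv[of \<phi> "\<lambda>ws. if P ws then 1 else 0"] word_inv_comp[of P "\<lambda>b. if b then 1 else 0"]
  by (simp add: if_distrib[of "\<lambda>r. r *\<^sub>R _"] cong: if_cong)

text \<open>The map induced on the quotient, meaningful when \<open>good \<phi>\<close>.\<close>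

definition pl :: "('b::graded_basis list list \<Rightarrow> 'v) \<Rightarrow> 'b cofree \<Rightarrow> 'v::real_vector" where
  "pl \<phi> x = lin_ext \<phi> (rep_cofree x)"

lemma abs_cofree_rep: "abs_cofree (rep_cofree x) = x"
  by (rule Quotient_abs_rep[OF Quotient_cofree])

lemma abs_cofree_linear: "linear abs_cofree"
  by (rule linearI) (simp_all add: plus_cofree.abs_eq scaleR_cofree.abs_eq)

lemma abs_cofree_expand: "abs_cofree x = lin_ext word_class x"
proof -
  have e: "word_class = (\<lambda>ws. abs_cofree (Poly_Mapping.single ws 1))"
    by (rule ext) (rule word_class.abs_eq)
  show ?thesis
    unfolding e using lin_ext_linear[OF abs_cofree_linear, of "\<lambda>k. Poly_Mapping.single k 1" x] by simp
qed

lemma good_kills: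
  assumes "good \<phi>" "z \<in> cofree_relations"
  shows "lin_ext \<phi> z = 0"
  using assms(2) unfolding cofree_relations_def
proof (induction rule: span_induct)
  case base show ?case by (rule linear_subspace_kernel) simp
next
  case (step z)
  note g = good0D[OF goodD(1)[OF assms(1)]]
  consider (a) us u v vs where "u \<noteq> []" "v \<noteq> []" "z = lin_ext (\<lambda>w. Poly_Mapping.single (us @ w # vs) 1) (shuffle_prod u v)"
    | (b) us u v vs where "z = Poly_Mapping.single (us @ u # v # vs) 1 - Poly_Mapping.single (us @ v # u # vs) (ksgn (tdeg u * tdeg v))"
    | (c) ws where "z = Poly_Mapping.single ws 1" "ws = [] \<or> [] \<in> set ws"
    using step by blast
  then show ?case
  proof cases
    case a
    with g(1)[of u v us vs] show ?thesis by (simp add: le_simps sh_def)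
  next
    case b
    then show ?thesis using g(2)[of us u v vs] by (simp add: lin_ext_diff)
  next
    case c
    then show ?thesis using g(3) goodD(2)[OF assms(1)] by auto
  qed
qed

lemma pl_abs: "good \<phi> \<Longrightarrow> pl \<phi> (abs_cofree z) = lin_ext \<phi> z"
proof -
  assume g: "good \<phi>"
  have "rep_cofree (abs_cofree z) - z \<in> cofree_relations"
    using abs_cofree_rep cofree.abs_eq_iff by metis
  from good_kills[OF g this] show ?thesis by (simp add: pl_def lin_ext_diff)
qed

lemma pl_wc [simp]: "good \<phi> \<Longrightarrow> pl \<phi> (word_class ws) = \<phi> ws"
  by (simp add: word_class.abs_eq pl_abs)

lemma linear_pl: "good \<phi> \<Longrightarrow> linear (pl \<phi>)"
proof (rule linearI)
  fix x y :: "'a cofree" and r :: real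
  assume g: "good \<phi>"
  have "x + y = abs_cofree (rep_cofree x + rep_cofree y)" "r *\<^sub>R x = abs_cofree (r *\<^sub>R rep_cofree x)"
    by (simp_all add: plus_cofree.abs_eq[symmetric] scaleR_cofree.abs_eq[symmetric] abs_cofree_rep)
  then show "pl \<phi> (x + y) = pl \<phi> x + pl \<phi> y" "pl \<phi> (r *\<^sub>R x) = r *\<^sub>R pl \<phi> x"
    by (simp_all add: pl_abs[OF g] lin_ext_add lin_ext_scale) (simp_all add: pl_def)
qed

lemma cofree_expand: "x = lin_ext word_class (rep_cofree x)"
  using abs_cofree_expand abs_cofree_rep by metis

lemma linear_eq_cofree:
  assumes "linear F" "linear G" "\<And>ws. F (word_class ws) = G (word_class ws)"
  shows "F x = G x"
  by (subst (1 2) cofree_expand) (simp add: lin_ext_linear assms)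

lemma wc_rel: "z \<in> cofree_relations \<Longrightarrow> lin_ext word_class z = 0"
  unfolding abs_cofree_expand[symmetric] zero_cofree.abs_eq
  by (simp add: cofree.abs_eq_iff)

lemma good_wc [simp]: "good word_class"
  unfolding good_def
proof (intro conjI good0I)
  fix us vs and u v :: "'a list"
  have sp: "x \<in> cofree_relations" if "x \<in> S" "S \<subseteq> cofree_relations" for x :: "'a list list \<Rightarrow>\<^sub>0 real" and S
    using that by auto
  show "sh u v (\<lambda>w. word_class (us @ w # vs)) = 0" if "u \<noteq> []" "v \<noteq> []"
  proof -
    have "lin_ext (\<lambda>w. Poly_Mapping.single (us @ w # vs) 1) (shuffle_prod u v) \<in> cofree_relations"
      unfolding cofree_relations_def by (rule span_base, rule UnI1, rule UnI1, rule CollectI) (use that in blast)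
    from wc_rel[OF this] show ?thesis by (simp add: le_simps sh_def)
  qed
  have "Poly_Mapping.single (us @ u # v # vs) 1 - Poly_Mapping.single (us @ v # u # vs) (ksgn (tdeg u * tdeg v)) \<in> cofree_relations"
    unfolding cofree_relations_def by (rule span_base, rule UnI1, rule UnI2, rule CollectI) blast
  from wc_rel[OF this] show "word_class (us @ u # v # vs) = ksgn (tdeg u * tdeg v) *\<^sub>R word_class (us @ v # u # vs)"
    by (simp add: lin_ext_diff)
next
  fix ws :: "'a list list" assume "[] \<in> set ws"
  then have "Poly_Mapping.single ws 1 \<in> cofree_relations"
    unfolding cofree_relations_def by (intro span_base UnI2) blast
  from wc_rel[OF this] show "word_class ws = 0" by simp
next
  have "Poly_Mapping.single [] 1 \<in> (cofree_relations :: ('a list list \<Rightarrow>\<^sub>0 real) set)"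
    unfolding cofree_relations_def by (intro span_base UnI2) blast
  from wc_rel[OF this] show "word_class ([] :: 'a list list) = 0" by simp
qed

lemmas good0_wc = goodD(1)[OF good_wc]
lemma wc_Nil [simp]: "word_class [] = 0" by (rule goodD(2)[OF good_wc])

lemma good_linear_wc: "linear F \<Longrightarrow> good (\<lambda>ws. F (word_class ws))"
  unfolding good_def using good0_linear[OF good0_wc] linear_0 by fastforce

subsection \<open>The cooperations\<close>

definition un :: "'b::graded_basis list list \<Rightarrow> ('b list list \<Rightarrow> 'b list list \<Rightarrow> 'v) \<Rightarrow> 'v::real_vector" where
  "un ws \<Psi> = lin_ext (\<lambda>(x, y). \<Psi> x y) (unshuffle ws)"

text \<open>Transpose of one step of the unshuffle: the new word joins either of the two
  factors.\<close>

definition pfx :: "'b::graded_basis list \<Rightarrow> ('b list list \<Rightarrow> 'b list list \<Rightarrow> 'v) \<Rightarrow>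
    'b list list \<Rightarrow> 'b list list \<Rightarrow> 'v::real_vector" where
  "pfx w \<Psi> x y = \<Psi> (w # x) y + ksgn (tdeg w * sdeg x) *\<^sub>R \<Psi> x (w # y)"

lemma un_Nil [simp]: "un [] \<Psi> = \<Psi> [] []"
  by (simp add: un_def)

lemma un_Cons: "un (w # ws) \<Psi> = un ws (pfx w \<Psi>)"
  unfolding un_def by (simp add: le_simps case_prod_beta' pfx_def)

lemma un_add: "un ws (\<lambda>x y. \<Phi> x y + \<Psi> x y) = un ws \<Phi> + un ws \<Psi>"
  and un_scale: "un ws (\<lambda>x y. r *\<^sub>R \<Phi> x y) = r *\<^sub>R un ws \<Phi>"
  and un_zero [simp]: "un ws (\<lambda>x y. 0) = 0"
  by (simp_all add: un_def case_prod_beta' le_simps)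

lemma un_lin: "linear L \<Longrightarrow> L (un ws \<Phi>) = un ws (\<lambda>x y. L (\<Phi> x y))"
  by (simp add: un_def lin_ext_linear case_prod_beta')

lemma un_sh: "sh u v (\<lambda>w. un ws (\<Theta> w)) = un ws (\<lambda>x y. sh u v (\<lambda>w. \<Theta> w x y))"
  unfolding un_def sh_def case_prod_beta' by (rule lin_ext_swap)

lemma un_cong:
  "(\<And>x y. mset x + mset y = mset ws \<Longrightarrow> \<Phi> x y = \<Psi> x y) \<Longrightarrow> un ws \<Phi> = un ws \<Psi>"
proof (induction ws arbitrary: \<Phi> \<Psi>)
  case (Cons w ws)
  have "un ws (pfx w \<Phi>) = un ws (pfx w \<Psi>)"
    by (rule Cons.IH) (simp add: pfx_def Cons.prems)
  then show ?case by (simp add: un_Cons)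
qed simp

lemma sdeg_perm: "mset x = mset y \<Longrightarrow> sdeg x = sdeg y"
  unfolding sdeg_def by (metis mset_map sum_mset_sum_list)

lemma un_cong_deg:
  assumes "\<And>x y. sdeg x + sdeg y = sdeg ws \<Longrightarrow> length x + length y = length ws \<Longrightarrow> \<Phi> x y = \<Psi> x y"
  shows "un ws \<Phi> = un ws \<Psi>"
proof (rule un_cong, rule assms)
  fix x y assume "mset x + mset y = mset ws"
  then have "mset (x @ y) = mset ws" by simp
  then show "sdeg x + sdeg y = sdeg ws" "length x + length y = length ws"
    using sdeg_perm mset_eq_length by fastforce+
qed

definition gp :: "('b::graded_basis list list \<Rightarrow> 'b list list \<Rightarrow> 'v::real_vector) \<Rightarrow> bool" where
  "gp \<Psi> \<longleftrightarrow> (\<forall>y. good0 (\<lambda>x. \<Psi> x y)) \<and> (\<forall>x. good0 (\<Psi> x))"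

lemma gpD: "gp \<Psi> \<Longrightarrow> good0 (\<lambda>x. \<Psi> x y)" "gp \<Psi> \<Longrightarrow> good0 (\<Psi> x)"
  by (simp_all add: gp_def)

lemma gp_pfx: "gp \<Psi> \<Longrightarrow> gp (pfx w \<Psi>)"
  unfolding gp_def pfx_def
  by (auto intro!: good0_add good0_Cons good0_scaleR good0_scale_inv word_inv_comp[of sdeg "\<lambda>d. ksgn (_ * d)"])

text \<open>The terms with both words in the same factor are exchanged by the symmetry of
  \<open>\<Psi>\<close>; the two mixed terms are exchanged with each other.\<close>

lemma gp_swap:
  assumes "gp \<Psi>"
  shows "pfx v (pfx u \<Psi>) x y = ksgn (tdeg u * tdeg v) *\<^sub>R pfx u (pfx v \<Psi>) x y"
  unfolding pfx_def
  using good0D_hd(2)[OF gpD(1)[OF assms], where u = u and v = v and vs = x]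
    good0D_hd(2)[OF gpD(2)[OF assms], where u = u and v = v and vs = y]
  by (simp add: ks algebra_simps)

lemma un_good0: "gp \<Psi> \<Longrightarrow> good0 (\<lambda>ws. un ws \<Psi>)"
proof (rule good0I)
  fix us vs and u v :: "'a list"
  assume gp: "gp \<Psi>"
  show "sh u v (\<lambda>w. un (us @ w # vs) \<Psi>) = 0" if n: "u \<noteq> []" "v \<noteq> []"
    using gp
  proof (induction us arbitrary: \<Psi>)
    case Nil
    have "sh u v (\<lambda>w. pfx w \<Psi> x y) = 0" for x y
    proof -
      have "sh u v (\<lambda>w. pfx w \<Psi> x y) = sh u v (\<lambda>w. \<Psi> (w # x) y) +
          ksgn ((wdeg u + wdeg v - 1) * sdeg x) *\<^sub>R sh u v (\<lambda>w. \<Psi> x (w # y))"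
        unfolding pfx_def sh_add by (subst sh_scale_deg) (auto simp: tdeg_def)
      then show ?thesis
        using good0D_hd(1)[OF gpD(1)[OF Nil] n] good0D_hd(1)[OF gpD(2)[OF Nil] n] by simp
    qed
    then show ?case by (simp add: un_Cons un_sh)
  next
    case (Cons a us)
    then show ?case by (simp add: un_Cons gp_pfx)
  qed
  show "un (us @ u # v # vs) \<Psi> = ksgn (tdeg u * tdeg v) *\<^sub>R un (us @ v # u # vs) \<Psi>"
    using gp
  proof (induction us arbitrary: \<Psi>)
    case Nil
    show ?case
      by (simp add: un_Cons un_scale[symmetric] gp_swap[OF Nil, of v u, abs_def])
  next
    case (Cons a us)
    then show ?case by (simp add: un_Cons gp_pfx)
  qed
next
  fix ws :: "'a list list"
  assume "gp \<Psi>" "[] \<in> set ws"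
  then show "un ws \<Psi> = 0"
  proof (induction ws arbitrary: \<Psi>)
    case (Cons w ws)
    show ?case
    proof (cases "w = []")
      case True
      have "pfx [] \<Psi> = (\<lambda>x y. 0)"
        using good0D(3)[OF gpD(1)[OF Cons.prems(1)]] good0D(3)[OF gpD(2)[OF Cons.prems(1)]]
        by (intro ext) (simp add: pfx_def)
      then show ?thesis by (simp add: un_Cons True)
    next
      case False
      then show ?thesis using Cons by (simp add: un_Cons gp_pfx)
    qed
  qed simp
qed

subsection \<open>The cobracket\<close>

lemma dec_sum: "dec w \<Theta> = (\<Sum>j\<le>length w. \<Theta> (take j w) (drop j w))"
  by (induction w arbitrary: \<Theta>) (simp_all del: sum.atMost_Suc add: sum.atMost_Suc_shift)

lemma dec_proper:
  assumes "\<And>v. \<Theta> [] v = 0" "\<And>u. \<Theta> u [] = 0"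
  shows "(\<Sum>j\<in>{1..<length w}. \<Theta> (take j w) (drop j w)) = dec w \<Theta>"
  unfolding dec_sum by (rule sum.mono_neutral_left) (auto simp: assms not_less Suc_le_eq)

text \<open>The part of the cobracket of \<open>w # ws\<close> in which \<open>w\<close> is the word
  that is cut. The improper cuts of \<open>dec\<close> are included; they contribute nothing for
  test functions vanishing on empty words (\<open>nilz\<close>).\<close>

definition ctw :: "'b::graded_basis list \<Rightarrow> 'b list list \<Rightarrow> ('b list list \<Rightarrow> 'b list list \<Rightarrow> 'v) \<Rightarrow> 'v::real_vector" where
  "ctw w ws \<Psi> = dec w (\<lambda>u v. un ws (\<lambda>x y. ksgn (wdeg u) *\<^sub>R (ksgn (tdeg v * sdeg x) *\<^sub>R \<Psi> (u # x) (v # y)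
      + ksgn (tdeg u * tdeg v + tdeg u * sdeg x) *\<^sub>R \<Psi> (v # x) (u # y))))"

definition be :: "'b::graded_basis list list \<Rightarrow> ('b list list \<Rightarrow> 'b list list \<Rightarrow> 'v) \<Rightarrow> 'v::real_vector" where
  "be ws \<Psi> = lin_ext (\<lambda>(x, y). \<Psi> x y) (sym_cobracket ws)"

lemma be_Nil [simp]: "be [] \<Psi> = 0" by (simp add: be_def)

lemma be_zero [simp]: "be ws (\<lambda>x y. 0) = 0"
  and be_add: "be ws (\<lambda>x y. \<Phi> x y + \<Psi> x y) = be ws \<Phi> + be ws \<Psi>"
  and be_scale: "be ws (\<lambda>x y. r *\<^sub>R \<Phi> x y) = r *\<^sub>R be ws \<Phi>"
  by (simp_all add: be_def case_prod_beta' le_simps)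

lemma be_lin: "linear L \<Longrightarrow> L (be ws \<Phi>) = be ws (\<lambda>x y. L (\<Phi> x y))"
  by (simp add: be_def lin_ext_linear case_prod_beta')

lemma be_sh: "sh u v (\<lambda>w. be ws (\<Theta> w)) = be ws (\<lambda>x y. sh u v (\<lambda>w. \<Theta> w x y))"
  unfolding be_def sh_def case_prod_beta' by (rule lin_ext_swap)

definition nilz :: "('b list list \<Rightarrow> 'b list list \<Rightarrow> 'v::real_vector) \<Rightarrow> bool" where
  "nilz \<Psi> \<longleftrightarrow> (\<forall>x y. [] \<in> set x \<or> [] \<in> set y \<longrightarrow> \<Psi> x y = 0)"

lemma nilz_pfx: "nilz \<Psi> \<Longrightarrow> nilz (pfx w \<Psi>)"
  by (auto simp: nilz_def pfx_def)

lemma gp_nilz: "gp \<Psi> \<Longrightarrow> nilz \<Psi>"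
  unfolding nilz_def using good0D(3)[OF gpD(1)] good0D(3)[OF gpD(2)] by blast

lemma be_Cons:
  assumes "nilz \<Psi>"
  shows "be (w # ws) \<Psi> = ctw w ws \<Psi> + ksgn (tdeg w) *\<^sub>R be ws (pfx w \<Psi>)"
proof -
  let ?\<Theta> = "\<lambda>u v. un ws (\<lambda>x y. ksgn (wdeg u) *\<^sub>R (ksgn (tdeg v * sdeg x) *\<^sub>R \<Psi> (u # x) (v # y)
      + ksgn (tdeg u * tdeg v + tdeg u * sdeg x) *\<^sub>R \<Psi> (v # x) (u # y)))"
  have z: "\<Psi> x y = 0" if "[] \<in> set x \<or> [] \<in> set y" for x y using assms that by (auto simp: nilz_def)
  have "lin_ext (\<lambda>(x, y). \<Psi> x y) (pair_mult (word_cobracket w) (unshuffle ws))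
      = (\<Sum>j\<in>{1..<length w}. ?\<Theta> (take j w) (drop j w))"
    unfolding pair_mult_def word_cobracket_def un_def Let_def
    by (simp add: le_simps case_prod_beta' ksgn_add scaleR_right_distrib scaleR_scaleR[symmetric]
        del: scaleR_scaleR)
  also have "\<dots> = ctw w ws \<Psi>"
    unfolding ctw_def by (rule dec_proper) (simp_all add: z)
  finally have 1: "lin_ext (\<lambda>(x, y). \<Psi> x y) (pair_mult (word_cobracket w) (unshuffle ws)) = ctw w ws \<Psi>" .
  have 2: "lin_ext (\<lambda>(x, y). \<Psi> x y) (pair_mult (Poly_Mapping.single ([w], []) 1 + Poly_Mapping.single ([], [w]) 1)
      (sym_cobracket ws)) = be ws (pfx w \<Psi>)"
    unfolding pair_mult_def be_def pfx_def
    by (simp add: le_simps case_prod_beta')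
  show ?thesis
    by (simp add: be_def[of "w # ws"] lin_ext_add lin_ext_scale 1 2)
qed

text \<open>A cut with letters of both words on the same side is killed in that slot. What remains
  are the cuts separating \<open>u\<close> from \<open>v\<close>, in both orders.\<close>

lemma dec_sh_kill:
  assumes n: "u \<noteq> []" "v \<noteq> []"
    and k1: "\<And>p q b. p \<noteq> [] \<Longrightarrow> q \<noteq> [] \<Longrightarrow> sh p q (\<lambda>a. \<Theta> a b) = 0"
    and k2: "\<And>p q a. p \<noteq> [] \<Longrightarrow> q \<noteq> [] \<Longrightarrow> sh p q (\<Theta> a) = 0"
    and z: "\<And>b. \<Theta> [] b = 0" "\<And>a. \<Theta> a [] = 0"
  shows "sh u v (\<lambda>w. dec w \<Theta>) = \<Theta> u v + ksgn (wdeg u * wdeg v) *\<^sub>R \<Theta> v u"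
proof -
  have d: "dec w (\<lambda>u v. if v = [] then c else 0) = c" "dec w (\<lambda>u v. if u = [] then c else 0) = c"
    for w :: "'a list" and c :: 'b
    by (induction w) simp_all
  let ?T = "\<lambda>u1 u2 v1 v2. ksgn (wdeg u2 * wdeg v1) *\<^sub>R sh u1 v1 (\<lambda>a. sh u2 v2 (\<lambda>b. \<Theta> a b))"
  have "?T u1 u2 v1 v2 = (if u2 = [] then if v1 = [] then \<Theta> u v else 0 else 0) +
      (if u1 = [] then if v2 = [] then ksgn (wdeg u * wdeg v) *\<^sub>R \<Theta> v u else 0 else 0)"
    if e: "u = u1 @ u2" "v = v1 @ v2" for u1 u2 v1 v2
  proof (cases "u2 = [] \<or> v2 = []")
    case False
    then have "sh u2 v2 (\<lambda>b. \<Theta> a b) = 0" for a using k2 by blast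
    with False show ?thesis by simp
  next
    case t: True
    show ?thesis
    proof (cases "u1 = [] \<or> v1 = []")
      case False
      then have "sh u1 v1 (\<lambda>a. \<Theta> a b) = 0" for b using k1 by blast
      with False t show ?thesis by auto
    next
      case True
      with t e n show ?thesis by (auto simp: z)
    qed
  qed
  then have "sh u v (\<lambda>w. dec w \<Theta>) = dec u (\<lambda>u1 u2. dec v (\<lambda>v1 v2.
      (if u2 = [] then if v1 = [] then \<Theta> u v else 0 else 0) +
      (if u1 = [] then if v2 = [] then ksgn (wdeg u * wdeg v) *\<^sub>R \<Theta> v u else 0 else 0)))"
    unfolding dec_sh by (intro dec_cong) blast
  also have "\<dots> = dec u (\<lambda>u1 u2. if u2 = [] then \<Theta> u v else 0) +
      dec u (\<lambda>u1 u2. if u1 = [] then ksgn (wdeg u * wdeg v) *\<^sub>R \<Theta> v u else 0)"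
    unfolding dec_add[symmetric] by (intro dec_cong) (simp add: dec_add d)
  finally show ?thesis by (simp add: d)
qed

text \<open>The cobracket descends modulo shuffles: of all cuts only \<open>u | v\<close> and
  \<open>v | u\<close> survive, and these cancel because the cobracket is skew symmetric.\<close>

lemma ctw_kill:
  assumes "gp \<Psi>" "u \<noteq> []" "v \<noteq> []"
  shows "sh u v (\<lambda>w. ctw w ws \<Psi>) = 0"
proof -
  let ?\<Theta> = "\<lambda>u v. un ws (\<lambda>x y. ksgn (wdeg u) *\<^sub>R (ksgn (tdeg v * sdeg x) *\<^sub>R \<Psi> (u # x) (v # y)
      + ksgn (tdeg u * tdeg v + tdeg u * sdeg x) *\<^sub>R \<Psi> (v # x) (u # y)))"
  note g = gpD[OF assms(1)]
  have k1: "sh p q (\<lambda>a. ?\<Theta> a b) = 0" if pq: "p \<noteq> []" "q \<noteq> []" for p q b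
  proof -
    have "sh p q (\<lambda>u. ksgn (wdeg u) *\<^sub>R (ksgn (tdeg b * sdeg x) *\<^sub>R \<Psi> (u # x) (b # y)
      + ksgn (tdeg u * tdeg b + tdeg u * sdeg x) *\<^sub>R \<Psi> (b # x) (u # y))) = 0" for x y
    proof -
      let ?d = "wdeg p + wdeg q"
      have "sh p q (\<lambda>u. ksgn (wdeg u) *\<^sub>R (ksgn (tdeg b * sdeg x) *\<^sub>R \<Psi> (u # x) (b # y)
          + ksgn (tdeg u * tdeg b + tdeg u * sdeg x) *\<^sub>R \<Psi> (b # x) (u # y)))
        = sh p q (\<lambda>u. ksgn ?d *\<^sub>R (ksgn (tdeg b * sdeg x) *\<^sub>R \<Psi> (u # x) (b # y)
          + ksgn ((?d - 1) * tdeg b + (?d - 1) * sdeg x) *\<^sub>R \<Psi> (b # x) (u # y)))"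
        by (rule sh_cong_deg) (simp add: tdeg_def[of _])
      then show ?thesis using good0D_hd(1)[OF g(1) pq] good0D_hd(1)[OF g(2) pq]
        by (simp add: sh_scale sh_add)
    qed
    then show ?thesis by (simp add: un_sh)
  qed
  have k2: "sh p q (?\<Theta> a) = 0" if pq: "p \<noteq> []" "q \<noteq> []" for p q a
  proof -
    have "sh p q (\<lambda>v. ksgn (wdeg a) *\<^sub>R (ksgn (tdeg v * sdeg x) *\<^sub>R \<Psi> (a # x) (v # y)
      + ksgn (tdeg a * tdeg v + tdeg a * sdeg x) *\<^sub>R \<Psi> (v # x) (a # y))) = 0" for x y
    proof -
      let ?d = "wdeg p + wdeg q"
      have "sh p q (\<lambda>v. ksgn (wdeg a) *\<^sub>R (ksgn (tdeg v * sdeg x) *\<^sub>R \<Psi> (a # x) (v # y)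
          + ksgn (tdeg a * tdeg v + tdeg a * sdeg x) *\<^sub>R \<Psi> (v # x) (a # y)))
        = sh p q (\<lambda>v. ksgn (wdeg a) *\<^sub>R (ksgn ((?d - 1) * sdeg x) *\<^sub>R \<Psi> (a # x) (v # y)
          + ksgn (tdeg a * (?d - 1) + tdeg a * sdeg x) *\<^sub>R \<Psi> (v # x) (a # y)))"
        by (rule sh_cong_deg) (simp add: tdeg_def[of _])
      then show ?thesis using good0D_hd(1)[OF g(1) pq] good0D_hd(1)[OF g(2) pq]
        by (simp add: sh_scale sh_add)
    qed
    then show ?thesis by (simp add: un_sh)
  qed
  have z: "?\<Theta> [] b = 0" "?\<Theta> a [] = 0" for a b
    using gp_nilz[OF assms(1)] by (simp_all add: nilz_def)
  have "?\<Theta> u v + ksgn (wdeg u * wdeg v) *\<^sub>R ?\<Theta> v u = 0"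
    unfolding un_scale[symmetric] un_add[symmetric]
    by (simp add: tdeg_def ks algebra_simps)
  with dec_sh_kill[of u v ?\<Theta>, OF assms(2,3) k1 k2 z] show ?thesis unfolding ctw_def by simp
qed

text \<open>The word \<open>v\<close> has to pass the cut \<open>u\<close>, and the cobracket has
  degree -1; this explains \<open>tdeg u - 1\<close> in the sign.\<close>

lemma ctw_swap:
  assumes "gp \<Psi>"
  shows "ctw u (v # vs) \<Psi> = ksgn (tdeg v * (tdeg u - 1)) *\<^sub>R ctw u vs (pfx v \<Psi>)"
  unfolding ctw_def un_Cons dec_scale[symmetric] un_scale[symmetric]
proof (rule dec_cong, rule arg_cong[where f = "un vs"], intro ext)
  fix a b x y assume e: "u = a @ b"
  note s1 = good0D_hd(2)[OF gpD(1)[OF assms], where v = v and vs = x]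
  note s2 = good0D_hd(2)[OF gpD(2)[OF assms], where v = v and vs = y]
  show "pfx v (\<lambda>x y. ksgn (wdeg a) *\<^sub>R (ksgn (tdeg b * sdeg x) *\<^sub>R \<Psi> (a # x) (b # y)
      + ksgn (tdeg a * tdeg b + tdeg a * sdeg x) *\<^sub>R \<Psi> (b # x) (a # y))) x y =
    ksgn (tdeg v * (tdeg u - 1)) *\<^sub>R ksgn (wdeg a) *\<^sub>R (ksgn (tdeg b * sdeg x) *\<^sub>R pfx v \<Psi> (a # x) (b # y)
      + ksgn (tdeg a * tdeg b + tdeg a * sdeg x) *\<^sub>R pfx v \<Psi> (b # x) (a # y))"
    unfolding pfx_def s1[where u = a] s1[where u = b] s2[where u = a] s2[where u = b]
    by (simp add: e tdeg_def ks algebra_simps)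
qed

lemma good0_dec: "(\<And>u v. good0 (\<phi> u v)) \<Longrightarrow> good0 (\<lambda>ws. dec w (\<lambda>u v. \<phi> u v ws))"
  by (induction w arbitrary: \<phi>) (simp_all add: good0_add)

lemma gp_ctw_arg:
  assumes "gp \<Psi>"
  shows "gp (\<lambda>x y. ksgn (wdeg u) *\<^sub>R (ksgn (tdeg v * sdeg x) *\<^sub>R \<Psi> (u # x) (v # y)
      + ksgn (tdeg u * tdeg v + tdeg u * sdeg x) *\<^sub>R \<Psi> (v # x) (u # y)))"
  unfolding gp_def
proof (intro conjI allI good0_scaleR good0_add)
  fix x y
  have i: "word_inv (\<lambda>x. ksgn (tdeg v * sdeg x))" "word_inv (\<lambda>x. ksgn (tdeg u * tdeg v + tdeg u * sdeg x))"
    by (rule word_inv_comp[OF word_inv_gr(1)])+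
  show "good0 (\<lambda>x. ksgn (tdeg v * sdeg x) *\<^sub>R \<Psi> (u # x) (v # y))"
    "good0 (\<lambda>x. ksgn (tdeg u * tdeg v + tdeg u * sdeg x) *\<^sub>R \<Psi> (v # x) (u # y))"
    by (intro good0_scale_inv i good0_Cons[where \<phi> = "\<lambda>x. \<Psi> x _"] gpD(1)[OF assms])+
  show "good0 (\<lambda>y. \<Psi> (u # x) (v # y))" "good0 (\<lambda>y. \<Psi> (v # x) (u # y))"
    by (intro good0_Cons[where \<phi> = "\<lambda>y. \<Psi> _ y"] gpD(2)[OF assms])+
qed

lemma ctw_good0: "gp \<Psi> \<Longrightarrow> good0 (\<lambda>ws. ctw w ws \<Psi>)"
  unfolding ctw_def by (intro good0_dec un_good0 gp_ctw_arg)

lemma be_good0: "gp \<Psi> \<Longrightarrow> good0 (\<lambda>ws. be ws \<Psi>)"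
proof (rule good0I)
  fix us vs and u v :: "'a list"
  assume gp: "gp \<Psi>"
  show "sh u v (\<lambda>w. be (us @ w # vs) \<Psi>) = 0" if n: "u \<noteq> []" "v \<noteq> []"
    using gp
  proof (induction us arbitrary: \<Psi>)
    case Nil
    have "sh u v (\<lambda>w. pfx w \<Psi> x y) = 0" for x y
    proof -
      have "sh u v (\<lambda>w. pfx w \<Psi> x y) = sh u v (\<lambda>w. \<Psi> (w # x) y) +
          ksgn ((wdeg u + wdeg v - 1) * sdeg x) *\<^sub>R sh u v (\<lambda>w. \<Psi> x (w # y))"
        unfolding pfx_def sh_add by (subst sh_scale_deg) (auto simp: tdeg_def)
      then show ?thesis
        using good0D_hd(1)[OF gpD(1)[OF Nil] n] good0D_hd(1)[OF gpD(2)[OF Nil] n] by simp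
    qed
    then have "sh u v (\<lambda>w. be vs (pfx w \<Psi>)) = 0" by (simp add: be_sh)
    then show ?case
      using ctw_kill[OF Nil n, of vs]
      by (simp add: be_Cons[OF gp_nilz[OF Nil]] sh_add)
        (subst sh_scale_deg[where r = "ksgn (wdeg u + wdeg v - 1)"], simp_all add: tdeg_def)
  next
    case (Cons a us)
    then show ?case
      using good0D(1)[OF ctw_good0[OF Cons.prems] n]
      by (simp add: be_Cons[OF gp_nilz[OF Cons.prems]] gp_pfx sh_add sh_scale)
  qed
  show "be (us @ u # v # vs) \<Psi> = ksgn (tdeg u * tdeg v) *\<^sub>R be (us @ v # u # vs) \<Psi>"
    using gp
  proof (induction us arbitrary: \<Psi>)
    case Nil
    note z = gp_nilz[OF Nil] gp_nilz[OF gp_pfx[OF Nil]]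
    have "be vs (pfx v (pfx u \<Psi>)) = ksgn (tdeg u * tdeg v) *\<^sub>R be vs (pfx u (pfx v \<Psi>))"
      unfolding be_scale[symmetric] by (rule arg_cong[where f = "be vs"]) (intro ext gp_swap[OF Nil])
    then show ?case
      by (simp add: be_Cons[OF z(1)] be_Cons[OF z(2)] ctw_swap[OF Nil] ks algebra_simps)
  next
    case (Cons a us)
    have "ctw a (us @ u # v # vs) \<Psi> = ksgn (tdeg u * tdeg v) *\<^sub>R ctw a (us @ v # u # vs) \<Psi>"
      by (rule good0D(2)[OF ctw_good0[OF Cons.prems]])
    with Cons.IH[OF gp_pfx[OF Cons.prems]] show ?case
      by (simp add: be_Cons[OF gp_nilz[OF Cons.prems]] scaleR_right_distrib mult.commute)
  qed
next
  fix ws :: "'a list list"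
  assume "gp \<Psi>" "[] \<in> set ws"
  then show "be ws \<Psi> = 0"
  proof (induction ws arbitrary: \<Psi>)
    case (Cons w ws)
    note z = gp_nilz[OF Cons.prems(1)]
    show ?case
    proof (cases "w = []")
      case True
      have p: "pfx [] \<Psi> = (\<lambda>x y. 0)" using z by (intro ext) (simp add: pfx_def nilz_def)
      have c: "ctw [] ws \<Psi> = 0" using z by (simp add: ctw_def nilz_def)
      show ?thesis by (simp add: be_Cons[OF z] True p c)
    next
      case False
      then show ?thesis
        using Cons good0D(3)[OF ctw_good0[OF Cons.prems(1)]] by (simp add: be_Cons[OF z] gp_pfx)
    qed
  qed simp
qed

text \<open>The test function for which \<open>un\<close> and \<open>be\<close> become
  \<open>comult\<close> and \<open>cobracket\<close>; its sign is that of
  \<open>shift_pair\<close>.\<close>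

definition sp :: "'b::graded_basis list list \<Rightarrow> 'b list list \<Rightarrow> ('b cofree, 'b cofree) tensor" where
  "sp x y = ksgn (sdeg x) *\<^sub>R (word_class x \<otimes> word_class y)"

lemma gp_sp: "gp sp"
  unfolding gp_def sp_def
  by (auto intro!: good0_scale_inv word_inv_comp[of sdeg ksgn] good0_scaleR
      good0_linear[OF good0_wc linear_tens_left] good0_linear[OF good0_wc linear_tens_right])

lemma good_un_sp: "good (\<lambda>ws. un ws sp)" and good_be_sp: "good (\<lambda>ws. be ws sp)"
  using un_good0[OF gp_sp] be_good0[OF gp_sp] by (simp_all add: good_def sp_def)

lemma comult_pl: "comult = pl (\<lambda>ws. un ws sp)"
  by (simp add: comult_def shift_pair_def pl_def un_def sp_def[abs_def] lin_ext_lin_ext fun_eq_iff)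

lemma cobracket_pl: "cobracket = pl (\<lambda>ws. be ws sp)"
  by (simp add: cobracket_def shift_pair_def pl_def be_def sp_def[abs_def] lin_ext_lin_ext fun_eq_iff)

lemma comult_wc: "comult (word_class ws) = un ws sp"
  and cobracket_wc: "cobracket (word_class ws) = be ws sp"
  and linear_comult: "linear comult" and linear_cobracket: "linear cobracket"
  by (simp_all add: comult_pl cobracket_pl good_un_sp good_be_sp linear_pl)

definition cg :: "'b::graded_basis list list \<Rightarrow> 'b \<Rightarrow>\<^sub>0 real" where
  "cg ws = (case ws of [[b]] \<Rightarrow> Poly_Mapping.single b 1 | _ \<Rightarrow> 0)"

lemma cg_simps [simp]: "cg [] = 0" "cg [[b]] = Poly_Mapping.single b 1" "cg (u # v # ws) = 0"
  "cg [[]] = 0" "cg [a # b # w] = 0" "cg ([] # ws) = 0"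
  by (simp_all add: cg_def split: list.splits)

lemma cg_zero: "length ws \<noteq> 1 \<Longrightarrow> cg ws = 0" "length w \<noteq> 1 \<Longrightarrow> cg [w] = 0"
  by (auto simp: cg_def split: list.splits)

lemma good_cg: "good cg"
  unfolding good_def
proof (intro conjI good0I)
  fix us vs and u v :: "'a list"
  show "sh u v (\<lambda>w. cg (us @ w # vs)) = 0" if "u \<noteq> []" "v \<noteq> []"
  proof (cases "us = [] \<and> vs = []")
    case True
    have "sh u v (\<lambda>w. cg [w]) = sh u v (\<lambda>w. 0)"
      using that by (intro sh_cong_deg cg_zero(2)) (cases u; cases v; simp)
    then show ?thesis using True by simp
  next
    case False
    then have "cg (us @ w # vs) = 0" for w by (intro cg_zero(1)) auto
    then show ?thesis by simp
  qed
  show "cg (us @ u # v # vs) = ksgn (tdeg u * tdeg v) *\<^sub>R cg (us @ v # u # vs)"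
    by (simp add: cg_zero(1))
  show "cg ws = 0" if "[] \<in> set ws" for ws :: "'a list list"
    using that by (cases "length ws = 1") (auto simp: cg_zero(1) length_Suc_conv)
qed simp

lemma cogen_pl: "cogen = pl cg"
  by (simp add: cogen_def pl_def cg_def[abs_def] fun_eq_iff)

lemma cogen_wc: "cogen (word_class ws) = cg ws" and linear_cogen: "linear cogen"
  by (simp_all add: cogen_pl good_cg linear_pl)

section \<open>The coderivation with a given corestriction\<close>

definition dec3 :: "'b list \<Rightarrow> ('b list \<Rightarrow> 'b list \<Rightarrow> 'b list \<Rightarrow> 'v) \<Rightarrow> 'v::real_vector" where
  "dec3 w \<Theta> = dec w (\<lambda>u r. dec r (\<lambda>v t. \<Theta> u v t))"

lemma dec3_add: "dec3 w (\<lambda>u v t. \<Phi> u v t + \<Psi> u v t) = dec3 w \<Phi> + dec3 w \<Psi>"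
  and dec3_scale: "dec3 w (\<lambda>u v t. r *\<^sub>R \<Phi> u v t) = r *\<^sub>R dec3 w \<Phi>"
  and dec3_zero [simp]: "dec3 w (\<lambda>u v t. 0) = 0"
  by (simp_all add: dec3_def dec_add dec_scale)

lemma dec3_cong: "(\<And>u v t. w = u @ v @ t \<Longrightarrow> \<Phi> u v t = \<Psi> u v t) \<Longrightarrow> dec3 w \<Phi> = dec3 w \<Psi>"
  unfolding dec3_def by (intro dec_cong) simp

lemma dec3_mid:
  fixes \<Phi> :: "'b list \<Rightarrow> 'b list \<Rightarrow> 'v::real_vector"
  shows "dec3 w (\<lambda>u v t. if v = [] then \<Phi> u t else 0) = dec w \<Phi>"
proof -
  have "dec r (\<lambda>v t. if v = [] then F t else 0) = F r" for r :: "'b list" and F :: "'b list \<Rightarrow> 'v"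
    by (cases r) simp_all
  then show ?thesis by (simp add: dec3_def)
qed

lemma dec_dec3_swap: "dec w (\<lambda>u v. dec3 z (\<Theta> u v)) = dec3 z (\<lambda>a b c. dec w (\<lambda>u v. \<Theta> u v a b c))"
  by (simp only: dec3_def dec_swap[of w])

lemma dec3_swap: "dec3 w (\<lambda>u v t. dec3 z (\<Theta> u v t)) = dec3 z (\<lambda>a b c. dec3 w (\<lambda>u v t. \<Theta> u v t a b c))"
  by (simp only: dec3_def[of w] dec_dec3_swap)

lemma dec3_sh: "sh u v (\<lambda>w. dec3 w \<Xi>) = dec3 u (\<lambda>u1 u2 u3. dec3 v (\<lambda>v1 v2 v3.
    ksgn (wdeg u2 * wdeg v1 + wdeg u3 * (wdeg v1 + wdeg v2)) *\<^sub>R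
      sh u1 v1 (\<lambda>a. sh u2 v2 (\<lambda>b. sh u3 v3 (\<lambda>c. \<Xi> a b c)))))"
  unfolding dec3_def
proof (subst dec_sh, rule dec_cong, subst dec_swap, rule dec_cong)
  fix u1 u' v1 v'
  show "ksgn (wdeg u' * wdeg v1) *\<^sub>R sh u1 v1 (\<lambda>a. sh u' v' (\<lambda>r. dec r (\<Xi> a))) =
    dec u' (\<lambda>u2 u3. dec v' (\<lambda>v2 v3. ksgn (wdeg u2 * wdeg v1 + wdeg u3 * (wdeg v1 + wdeg v2)) *\<^sub>R
      sh u1 v1 (\<lambda>a. sh u2 v2 (\<lambda>b. sh u3 v3 (\<lambda>c. \<Xi> a b c)))))"
    unfolding dec_sh sh_dec_swap dec_scale[symmetric]
    by (intro dec_cong) (simp add: sh_scale ks algebra_simps)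
qed

lemma good0_suffix: "good0 \<phi> \<Longrightarrow> good0 (\<lambda>ws. \<phi> (ws @ p))"
proof (rule good0I)
  fix us vs and u v :: "'a list"
  assume g: "good0 \<phi>"
  show "u \<noteq> [] \<Longrightarrow> v \<noteq> [] \<Longrightarrow> sh u v (\<lambda>w. \<phi> ((us @ w # vs) @ p)) = 0"
    using good0D(1)[OF g, where us = us and vs = "vs @ p"] by simp
  show "\<phi> ((us @ u # v # vs) @ p) = ksgn (tdeg u * tdeg v) *\<^sub>R \<phi> ((us @ v # u # vs) @ p)"
    using good0D(2)[OF g, of us u v "vs @ p"] unfolding append_assoc append_Cons .
  show "[] \<in> set ws \<Longrightarrow> \<phi> (ws @ p) = 0" for ws
    using good0D(3)[OF g] by simp
qed

lemma good0_sh: "(\<And>w. good0 (\<phi> w)) \<Longrightarrow> good0 (\<lambda>ws. sh u v (\<lambda>w. \<phi> w ws))"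
  unfolding sh_def by (rule good0_lin_ext)

lemma good0_dec3: "(\<And>u v t. good0 (\<phi> u v t)) \<Longrightarrow> good0 (\<lambda>ws. dec3 w (\<lambda>u v t. \<phi> u v t ws))"
  unfolding dec3_def by (intro good0_dec)

lemma sym_move:
  fixes \<phi> :: "'b::graded_basis list list \<Rightarrow> 'v::real_vector"
  assumes "\<And>us vs u v. \<phi> (us @ u # v # vs) = ksgn (tdeg u * tdeg v) *\<^sub>R \<phi> (us @ v # u # vs)"
  shows "\<phi> (us @ w # vs) = ksgn (tdeg w * sdeg us) *\<^sub>R \<phi> (w # us @ vs)"
proof (induction us arbitrary: vs rule: rev_induct)
  case (snoc u us)
  have a: "\<phi> ((us @ [u]) @ w # vs) = ksgn (tdeg u * tdeg w) *\<^sub>R \<phi> (us @ w # u # vs)"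
    using assms[of us u w vs] by simp
  show ?case
    using a unfolding snoc[of "u # vs"] by (simp add: ks mult.commute)
qed simp

text \<open>Symmetry moves any word to the front, so shuffles need only be tested there.\<close>

lemma good0I_front:
  assumes front: "\<And>vs u v. u \<noteq> [] \<Longrightarrow> v \<noteq> [] \<Longrightarrow> sh u v (\<lambda>w. \<phi> (w # vs)) = 0"
    and sym: "\<And>us vs u v. \<phi> (us @ u # v # vs) = ksgn (tdeg u * tdeg v) *\<^sub>R \<phi> (us @ v # u # vs)"
    and nil: "\<And>ws. [] \<in> set ws \<Longrightarrow> \<phi> ws = 0"
  shows "good0 \<phi>"
proof (rule good0I[OF _ sym nil])
  fix us vs and u v :: "'a list"
  assume n: "u \<noteq> []" "v \<noteq> []"
  have "sh u v (\<lambda>w. \<phi> (us @ w # vs)) = sh u v (\<lambda>w. ksgn (tdeg w * sdeg us) *\<^sub>R \<phi> (w # us @ vs))"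
    by (rule sh_cong) (rule sym_move[OF sym])
  also have "\<dots> = ksgn ((wdeg u + wdeg v - 1) * sdeg us) *\<^sub>R sh u v (\<lambda>w. \<phi> (w # us @ vs))"
    by (rule sh_scale_deg) (simp add: tdeg_def)
  finally show "sh u v (\<lambda>w. \<phi> (us @ w # vs)) = 0" by (simp add: front[OF n])
qed

subsection \<open>Cutting every word into three parts\<close>

text \<open>Each word is cut as \<open>w\<^sub>i = u\<^sub>i v\<^sub>i u'\<^sub>i\<close>; the summation runs over the triples of a term \<open>A\<close> of the
  shuffle product of the \<open>u\<^sub>i\<close>, the list of the \<open>v\<^sub>i\<close>, and a term \<open>B\<close> of the shuffle product of the \<open>u'\<^sub>i\<close>.\<close>

primrec nn :: "'b::graded_basis list list \<Rightarrow>
    ('b list \<Rightarrow> 'b list list \<Rightarrow> 'b list \<Rightarrow> 'v) \<Rightarrow> 'v::real_vector" where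
  "nn [] \<Theta> = \<Theta> [] [] []"
| "nn (w # ws) \<Theta> = dec3 w (\<lambda>u v t. nn ws (\<lambda>A vs B.
     ksgn (wdeg A * (tdeg v + wdeg t) + sdeg vs * wdeg t) *\<^sub>R
       sh u A (\<lambda>A'. sh t B (\<lambda>B'. \<Theta> A' (v # vs) B'))))"

lemma nn_add: "nn ws (\<lambda>A vs B. \<Phi> A vs B + \<Psi> A vs B) = nn ws \<Phi> + nn ws \<Psi>"
  by (induction ws arbitrary: \<Phi> \<Psi>) (simp_all add: sh_add dec3_add scaleR_right_distrib)

lemma nn_scale: "nn ws (\<lambda>A vs B. r *\<^sub>R \<Phi> A vs B) = r *\<^sub>R nn ws \<Phi>"
  by (induction ws arbitrary: \<Phi>) (simp_all add: sh_scale dec3_scale scaleR_left_commute[of _ r] del: scaleR_scaleR)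

lemma nn_zero [simp]: "nn ws (\<lambda>A vs B. 0) = 0"
  by (induction ws) simp_all

lemma nn_sum: "nn ws (\<lambda>A vs B. \<Sum>i\<in>I. \<Phi> i A vs B) = (\<Sum>i\<in>I. nn ws (\<Phi> i))"
  by (induction I rule: infinite_finite_induct) (simp_all add: nn_add)

lemma nn_lin_ext: "nn ws (\<lambda>A vs B. lin_ext (\<lambda>k. \<Phi> k A vs B) x) = lin_ext (\<lambda>k. nn ws (\<Phi> k)) x"
  unfolding lin_ext_def by (simp add: nn_sum nn_scale)

lemma nn_sh: "sh u v (\<lambda>w. nn ws (\<Theta> w)) = nn ws (\<lambda>A vs B. sh u v (\<lambda>w. \<Theta> w A vs B))"
  unfolding sh_def by (rule nn_lin_ext[symmetric])

lemma nn_dec: "dec w (\<lambda>u v. nn ws (\<Theta> u v)) = nn ws (\<lambda>A vs B. dec w (\<lambda>u v. \<Theta> u v A vs B))"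
  by (induction w arbitrary: \<Theta>) (simp_all add: nn_add)

lemma sh_mem:
  assumes "subspace S" "\<And>w. length w = length u + length v \<Longrightarrow> wdeg w = wdeg u + wdeg v \<Longrightarrow> \<Phi> w \<in> S"
  shows "sh u v \<Phi> \<in> S"
proof -
  have "\<Phi> w \<in> S" if "w \<in> Poly_Mapping.keys (shuffle_prod u v)" for w
  proof (rule assms(2))
    have "mset w = mset (u @ v)" using shuffle_prod_mset[OF that] by simp
    then show "length w = length u + length v" "wdeg w = wdeg u + wdeg v"
      using wdeg_perm[of w "u @ v"] mset_eq_length[of w "u @ v"] by auto
  qed
  then show ?thesis unfolding sh_def lin_ext_def
    by (intro subspace_sum subspace_scale assms(1))
qed

lemma dec_mem: "subspace S \<Longrightarrow> (\<And>u v. w = u @ v \<Longrightarrow> \<Phi> u v \<in> S) \<Longrightarrow> dec w \<Phi> \<in> S"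
proof (induction w arbitrary: \<Phi>)
  case (Cons a w)
  have "dec w (\<lambda>u v. \<Phi> (a # u) v) \<in> S" by (rule Cons.IH[OF Cons.prems(1)]) (simp add: Cons.prems(2))
  then show ?case using Cons.prems(2)[of "[]" "a # w"] by (simp add: subspace_add[OF Cons.prems(1)])
qed simp

lemma dec3_mem: "subspace S \<Longrightarrow> (\<And>u v t. w = u @ v @ t \<Longrightarrow> \<Phi> u v t \<in> S) \<Longrightarrow> dec3 w \<Phi> \<in> S"
  unfolding dec3_def by (intro dec_mem) simp_all

definition nl :: "'b list list \<Rightarrow> nat" where "nl ws = length (concat ws)"

lemma nl_simps [simp]: "nl [] = 0" "nl (w # ws) = length w + nl ws" "nl (us @ vs) = nl us + nl vs"
  by (simp_all add: nl_def)

text \<open>All sums involved stay in a subspace. With \<open>S = {0}\<close> and a difference of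
  test functions this yields \<open>nn_cong\<close>; the same scheme later gives statements on
  degrees and supports. The three invariants say that no words, degree or letters are lost.\<close>

lemma nn_mem:
  assumes "subspace S"
    "\<And>A vs B. length vs = length ws \<Longrightarrow> wdeg A + sdeg vs + wdeg B = sdeg ws \<Longrightarrow>
      length A + nl vs + length B = nl ws \<Longrightarrow> \<Theta> A vs B \<in> S"
  shows "nn ws \<Theta> \<in> S"
  using assms(2)
proof (induction ws arbitrary: \<Theta>)
  case (Cons w ws)
  show ?case
    unfolding nn.simps
    by (intro dec3_mem Cons.IH subspace_scale sh_mem assms(1) Cons.prems) (auto simp: tdeg_def)
qed simp

lemma nn_cong:
  assumes "\<And>A vs B. length vs = length ws \<Longrightarrow> wdeg A + sdeg vs + wdeg B = sdeg ws \<Longrightarrow>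
      length A + nl vs + length B = nl ws \<Longrightarrow> \<Theta> A vs B = \<Xi> A vs B"
  shows "nn ws \<Theta> = nn ws \<Xi>"
proof -
  have "nn ws (\<lambda>A vs B. \<Theta> A vs B + (-1) *\<^sub>R \<Xi> A vs B) \<in> {0}"
    by (rule nn_mem) (auto simp: assms subspace_def)
  then show ?thesis unfolding nn_add nn_scale by simp
qed

definition good3 :: "('b::graded_basis list \<Rightarrow> 'b list list \<Rightarrow> 'b list \<Rightarrow> 'v::real_vector) \<Rightarrow> bool" where
  "good3 \<Theta> \<longleftrightarrow> (\<forall>A B. good0 (\<lambda>vs. \<Theta> A vs B))"

lemma good3D: "good3 \<Theta> \<Longrightarrow> good0 (\<lambda>vs. \<Theta> A vs B)"
  by (simp add: good3_def)

lemma good3_step: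
  assumes "good3 \<Theta>"
  shows "good3 (\<lambda>A vs B. ksgn (wdeg A * d + sdeg vs * e) *\<^sub>R sh u A (\<lambda>A'. sh t B (\<lambda>B'. \<Theta> A' (v # vs) B')))"
  unfolding good3_def
  by (intro allI good0_scale_inv good0_sh good0_Cons[where \<phi> = "\<lambda>vs. \<Theta> _ vs _"] good3D[OF assms])
    (rule word_inv_comp[OF word_inv_gr(1)])

lemma nn_nil: "good3 \<Theta> \<Longrightarrow> [] \<in> set ws \<Longrightarrow> nn ws \<Theta> = 0"
proof (induction ws arbitrary: \<Theta>)
  case (Cons w ws)
  show ?case
  proof (cases "w = []")
    case True
    have "\<Theta> A ([] # vs) B = 0" for A vs B using good0D(3)[OF good3D[OF Cons.prems(1)]] by simp
    then show ?thesis by (simp add: True dec3_def)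
  next
    case False
    then have "[] \<in> set ws" using Cons.prems by simp
    then have "nn ws (\<lambda>A vs B. ksgn (wdeg A * d + sdeg vs * e) *\<^sub>R sh u A (\<lambda>A'. sh t B (\<lambda>B'. \<Theta> A' (v # vs) B'))) = 0"
      for d e u t v by (intro Cons.IH good3_step Cons.prems)
    then show ?thesis by simp
  qed
qed simp

lemma sh_double_comm:
  "sh v1 A (\<lambda>A'. sh v3 B (\<lambda>B'. sh u1 A' (\<lambda>A''. sh u3 B' (\<lambda>B''. K A'' B'')))) =
   ksgn (wdeg u1 * wdeg v1 + wdeg u3 * wdeg v3) *\<^sub>R
   sh u1 A (\<lambda>A'. sh u3 B (\<lambda>B'. sh v1 A' (\<lambda>A''. sh v3 B' (\<lambda>B''. K A'' B''))))"
proof -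
  have "sh v1 A (\<lambda>A'. sh v3 B (\<lambda>B'. sh u1 A' (\<lambda>A''. sh u3 B' (\<lambda>B''. K A'' B''))))
    = sh v1 A (\<lambda>A'. sh u1 A' (\<lambda>A''. sh v3 B (\<lambda>B'. sh u3 B' (\<lambda>B''. K A'' B''))))"
    by (rule sh_cong) (rule sh_swap)
  also have "\<dots> = ksgn (wdeg v1 * wdeg u1) *\<^sub>R sh u1 A (\<lambda>A'. sh v1 A' (\<lambda>A''. sh v3 B (\<lambda>B'. sh u3 B' (\<lambda>B''. K A'' B''))))"
    by (rule sh_left_comm)
  also have "\<dots> = ksgn (wdeg v1 * wdeg u1) *\<^sub>R sh u1 A (\<lambda>A'. sh v1 A' (\<lambda>A''.
      ksgn (wdeg v3 * wdeg u3) *\<^sub>R sh u3 B (\<lambda>B'. sh v3 B' (\<lambda>B''. K A'' B''))))"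
    by (simp only: sh_left_comm[of v3 B u3])
  also have "\<dots> = ksgn (wdeg v1 * wdeg u1) *\<^sub>R ksgn (wdeg v3 * wdeg u3) *\<^sub>R sh u1 A (\<lambda>A'. sh u3 B (\<lambda>B'. sh v1 A' (\<lambda>A''. sh v3 B' (\<lambda>B''. K A'' B''))))"
    by (simp only: sh_scale sh_swap[of v1 _ u3 B])
  finally show ?thesis by (simp add: ksgn_add mult.commute)
qed

lemma nn_two:
  fixes \<Theta> :: "'b::graded_basis list \<Rightarrow> 'b list list \<Rightarrow> 'b list \<Rightarrow> 'v::real_vector"
  shows "nn (u # v # vs) \<Theta> = dec3 u (\<lambda>u1 u2 u3. dec3 v (\<lambda>v1 v2 v3. nn vs (\<lambda>A ws B.
    ksgn (wdeg A * (tdeg v2 + wdeg v3) + sdeg ws * wdeg v3 + (wdeg v1 + wdeg A) * (tdeg u2 + wdeg u3)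
        + (tdeg v2 + sdeg ws) * wdeg u3) *\<^sub>R
    sh v1 A (\<lambda>A'. sh v3 B (\<lambda>B'. sh u1 A' (\<lambda>A''. sh u3 B' (\<lambda>B''. \<Theta> A'' (u2 # v2 # ws) B'')))))))"
proof -
  have "sh v1 A (\<lambda>A'. sh v3 B (\<lambda>B'. ksgn (wdeg A' * d + e) *\<^sub>R K A' B'))
     = ksgn ((wdeg v1 + wdeg A) * d + e) *\<^sub>R sh v1 A (\<lambda>A'. sh v3 B (\<lambda>B'. K A' B'))"
    for v1 A v3 B d e and K :: "'b list \<Rightarrow> 'b list \<Rightarrow> 'v"
    unfolding sh_scale by (rule sh_scale_deg) simp
  then show ?thesis by (simp add: ksgn_add mult.assoc)
qed

text \<open>Both sides run over the same cuts of \<open>u\<close> and \<open>v\<close>. The middle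
  pieces are exchanged by the symmetry of \<open>\<Theta>\<close>, the outer pieces by commutativity
  of the shuffle product.\<close>

lemma nn_sym:
  assumes "good3 \<Theta>"
  shows "nn (us @ u # v # vs) \<Theta> = ksgn (tdeg u * tdeg v) *\<^sub>R nn (us @ v # u # vs) \<Theta>"
  using assms
proof (induction us arbitrary: \<Theta>)
  case Nil
  have "nn (u # v # vs) \<Theta> = dec3 u (\<lambda>u1 u2 u3. dec3 v (\<lambda>v1 v2 v3. nn vs (\<lambda>A ws B.
    ksgn (tdeg u * tdeg v) *\<^sub>R
    ksgn (wdeg A * (tdeg u2 + wdeg u3) + sdeg ws * wdeg u3 + (wdeg u1 + wdeg A) * (tdeg v2 + wdeg v3)
        + (tdeg u2 + sdeg ws) * wdeg v3) *\<^sub>R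
    sh u1 A (\<lambda>A'. sh u3 B (\<lambda>B'. sh v1 A' (\<lambda>A''. sh v3 B' (\<lambda>B''. \<Theta> A'' (v2 # u2 # ws) B'')))))))"
    unfolding nn_two
  proof (intro dec3_cong nn_cong, goal_cases)
    case (1 u1 u2 u3 v1 v2 v3 A ws B)
    have s: "\<Theta> A'' (u2 # v2 # ws) B'' = ksgn (tdeg u2 * tdeg v2) *\<^sub>R \<Theta> A'' (v2 # u2 # ws) B''" for A'' B''
      using good0D_hd(2)[OF good3D[OF Nil]] .
    show ?case
      unfolding s sh_scale sh_double_comm[of v1 A v3 B u1 u3] using 1
      by (simp add: tdeg_def ks algebra_simps)
  qed
  also have "\<dots> = ksgn (tdeg u * tdeg v) *\<^sub>R nn (v # u # vs) \<Theta>"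
    unfolding nn_two nn_scale dec3_scale
    by (rule arg_cong[OF dec3_swap])
  finally show ?case by simp
next
  case (Cons a us)
  have "nn (us @ u # v # vs) (\<lambda>A vs B. ksgn (wdeg A * d + sdeg vs * e) *\<^sub>R sh s A (\<lambda>A'. sh t B (\<lambda>B'. \<Theta> A' (b # vs) B')))
    = ksgn (tdeg u * tdeg v) *\<^sub>R nn (us @ v # u # vs) (\<lambda>A vs B. ksgn (wdeg A * d + sdeg vs * e) *\<^sub>R sh s A (\<lambda>A'. sh t B (\<lambda>B'. \<Theta> A' (b # vs) B')))"
    for d e s t b
    by (rule Cons.IH) (rule good3_step[OF Cons.prems])
  then show ?case by (simp add: dec3_scale)
qed

definition homog :: "int \<Rightarrow> ('b::graded_basis list list \<Rightarrow> 'c::graded_basis \<Rightarrow>\<^sub>0 real) \<Rightarrow> bool" where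
  "homog p f \<longleftrightarrow> (\<forall>vs. \<forall>x\<in>Poly_Mapping.keys (f vs). bdeg x = gr1 vs + p)"

text \<open>The terms of a coderivation in which every word takes part: the middle pieces enter
  \<open>f\<close>, and the letter returned by \<open>f\<close> is placed between the shuffled left
  and right remainders.\<close>

definition GG :: "int \<Rightarrow> ('b::graded_basis list list \<Rightarrow> 'b \<Rightarrow>\<^sub>0 real) \<Rightarrow> 'b list list \<Rightarrow>
    ('b list \<Rightarrow> 'v) \<Rightarrow> 'v::real_vector" where
  "GG p f ws \<Phi> = nn ws (\<lambda>A vs B. ksgn (p * wdeg A) *\<^sub>R lin_ext (\<lambda>x. \<Phi> (A @ x # B)) (f vs))"

definition shk :: "('b::graded_basis list \<Rightarrow> 'v::real_vector) \<Rightarrow> bool" where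
  "shk \<Phi> \<longleftrightarrow> (\<forall>u v. u \<noteq> [] \<longrightarrow> v \<noteq> [] \<longrightarrow> sh u v \<Phi> = 0)"

lemma shkD: "shk \<Phi> \<Longrightarrow> u \<noteq> [] \<Longrightarrow> v \<noteq> [] \<Longrightarrow> sh u v \<Phi> = 0"
  by (simp add: shk_def)

lemma good3_GG: "good0 f \<Longrightarrow> good3 (\<lambda>A vs B. ksgn (p * wdeg A) *\<^sub>R lin_ext (\<lambda>x. \<Phi> (A @ x # B)) (f vs))"
  unfolding good3_def by (intro allI good0_scaleR good0_linear[OF _ linear_lin_ext])

text \<open>The summand of \<open>GG\<close> for a first word cut as \<open>a b c\<close>, the data
  \<open>A\<close>, \<open>vs\<close>, \<open>B\<close> of the other words being fixed.\<close>

definition TT :: "int \<Rightarrow> ('b::graded_basis list list \<Rightarrow> 'b \<Rightarrow>\<^sub>0 real) \<Rightarrow> ('b list \<Rightarrow> 'v) \<Rightarrow> 'b list \<Rightarrow>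
    'b list list \<Rightarrow> 'b list \<Rightarrow> 'b list \<Rightarrow> 'b list \<Rightarrow> 'b list \<Rightarrow> 'v::real_vector" where
  "TT p f \<Phi> A vs B a b c = ksgn (wdeg A * (tdeg b + wdeg c) + sdeg vs * wdeg c) *\<^sub>R
     sh a A (\<lambda>A'. sh c B (\<lambda>B'. ksgn (p * wdeg A') *\<^sub>R lin_ext (\<lambda>x. \<Phi> (A' @ x # B')) (f (b # vs))))"

lemma GG_Cons: "GG p f (w # vs) \<Phi> = dec3 w (\<lambda>a b c. nn vs (\<lambda>A vs B. TT p f \<Phi> A vs B a b c))"
  by (simp add: GG_def TT_def)

text \<open>If the middle piece of \<open>v\<close> is empty, the cuts of \<open>v\<close>
  distribute it to both sides of the letter \<open>x\<close>. By \<open>dec_sh_insert\<close> their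
  sum is the shuffle of \<open>v\<close> with \<open>A' @ x # B'\<close>, which
  \<open>\<Phi>\<close> kills.\<close>

lemma TT_kill1:
  assumes h: "homog p f" and k: "shk \<Phi>" and n: "v \<noteq> []"
  shows "dec v (\<lambda>v1 v3. ksgn ((wdeg u2 + wdeg u3) * wdeg v1) *\<^sub>R
    sh u1 v1 (\<lambda>a. sh u3 v3 (\<lambda>c. TT p f \<Phi> A vs B a u2 c))) = 0"
proof -
  let ?L = "\<lambda>A' B'. lin_ext (\<lambda>x. \<Phi> (A' @ x # B')) (f (u2 # vs))"
  let ?c = "ksgn ((wdeg u1 + wdeg u2 + wdeg u3 + p) * wdeg v + wdeg A * (tdeg u2 + wdeg u3) + sdeg vs * wdeg u3 + p * (wdeg u1 + wdeg A))"
  have 1: "sh u1 v1 (\<lambda>a. sh u3 v3 (\<lambda>c. sh a A (\<lambda>A'. sh c B (\<lambda>B'. ?L A' B')))) =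
      ksgn (wdeg v1 * wdeg u1) *\<^sub>R ksgn (wdeg v3 * wdeg u3) *\<^sub>R
        sh u1 A (\<lambda>A'. sh u3 B (\<lambda>B'. lin_ext (\<lambda>x. sh v1 A' (\<lambda>A''. sh v3 B' (\<lambda>B''. \<Phi> (A'' @ x # B'')))) (f (u2 # vs))))" for v1 v3
  proof -
    have "sh u1 v1 (\<lambda>a. sh u3 v3 (\<lambda>c. sh a A (\<lambda>A'. sh c B (\<lambda>B'. ?L A' B'))))
      = sh u1 v1 (\<lambda>a. sh a A (\<lambda>A'. sh u3 v3 (\<lambda>c. sh c B (\<lambda>B'. ?L A' B'))))"
      by (rule sh_cong) (rule sh_swap)
    also have "\<dots> = sh v1 A (\<lambda>w. sh u1 w (\<lambda>A'. sh v3 B (\<lambda>w. sh u3 w (\<lambda>B'. ?L A' B'))))"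
      by (simp only: sh_assoc)
    also have "\<dots> = ksgn (wdeg v1 * wdeg u1) *\<^sub>R ksgn (wdeg v3 * wdeg u3) *\<^sub>R
        sh u1 A (\<lambda>A'. sh v1 A' (\<lambda>A''. sh u3 B (\<lambda>B'. sh v3 B' (\<lambda>B''. ?L A'' B''))))"
      by (simp only: sh_left_comm[of v3 B] sh_left_comm[of v1 A] sh_scale) (rule scaleR_left_commute)
    also have "\<dots> = ksgn (wdeg v1 * wdeg u1) *\<^sub>R ksgn (wdeg v3 * wdeg u3) *\<^sub>R
        sh u1 A (\<lambda>A'. sh u3 B (\<lambda>B'. lin_ext (\<lambda>x. sh v1 A' (\<lambda>A''. sh v3 B' (\<lambda>B''. \<Phi> (A'' @ x # B'')))) (f (u2 # vs))))"
      by (simp only: sh_swap[of v1 _ u3] sh_lin_ext(2))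
    finally show ?thesis .
  qed
  have "dec v (\<lambda>v1 v3. ksgn ((wdeg u2 + wdeg u3) * wdeg v1) *\<^sub>R
      sh u1 v1 (\<lambda>a. sh u3 v3 (\<lambda>c. TT p f \<Phi> A vs B a u2 c)))
    = dec v (\<lambda>v1 v3. ?c *\<^sub>R sh u1 A (\<lambda>A'. sh u3 B (\<lambda>B'. lin_ext (\<lambda>x.
        ksgn (wdeg v3 * (wdeg A' + bdeg x)) *\<^sub>R
        sh v1 A' (\<lambda>p. sh v3 B' (\<lambda>q. \<Phi> (p @ x # q)))) (f (u2 # vs)))))"
  proof (rule dec_cong)
    fix v1 v3 assume v: "v = v1 @ v3"
    have "sh u1 v1 (\<lambda>a. sh u3 v3 (\<lambda>c. TT p f \<Phi> A vs B a u2 c)) =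
      sh u1 v1 (\<lambda>a. sh u3 v3 (\<lambda>c. ksgn (wdeg A * (tdeg u2 + wdeg u3 + wdeg v3) + sdeg vs * (wdeg u3 + wdeg v3) + p * (wdeg u1 + wdeg v1 + wdeg A)) *\<^sub>R
        sh a A (\<lambda>A'. sh c B (\<lambda>B'. ?L A' B'))))"
      unfolding TT_def sh_scale[symmetric] by (intro sh_cong_deg) (simp add: ks algebra_simps)
    also have "\<dots> = ksgn (wdeg A * (tdeg u2 + wdeg u3 + wdeg v3) + sdeg vs * (wdeg u3 + wdeg v3) + p * (wdeg u1 + wdeg v1 + wdeg A)) *\<^sub>R
        ksgn (wdeg v1 * wdeg u1) *\<^sub>R ksgn (wdeg v3 * wdeg u3) *\<^sub>R
        sh u1 A (\<lambda>A'. sh u3 B (\<lambda>B'. lin_ext (\<lambda>x. sh v1 A' (\<lambda>A''. sh v3 B' (\<lambda>B''. \<Phi> (A'' @ x # B'')))) (f (u2 # vs))))"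
      by (simp only: sh_scale 1)
    finally have 2: "sh u1 v1 (\<lambda>a. sh u3 v3 (\<lambda>c. TT p f \<Phi> A vs B a u2 c)) = \<dots>" .
    show "ksgn ((wdeg u2 + wdeg u3) * wdeg v1) *\<^sub>R sh u1 v1 (\<lambda>a. sh u3 v3 (\<lambda>c. TT p f \<Phi> A vs B a u2 c))
      = ?c *\<^sub>R sh u1 A (\<lambda>A'. sh u3 B (\<lambda>B'. lin_ext (\<lambda>x.
        ksgn (wdeg v3 * (wdeg A' + bdeg x)) *\<^sub>R
        sh v1 A' (\<lambda>p. sh v3 B' (\<lambda>q. \<Phi> (p @ x # q)))) (f (u2 # vs))))"
      unfolding 2 sh_scale[symmetric] lin_ext_fun_scale[symmetric]
    proof (intro sh_cong_deg lin_ext_cong, goal_cases)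
      case (1 A' B' x)
      then have "bdeg x = wdeg u2 + sdeg vs + p" using h by (simp add: homog_def gr1_def tdeg_def)
      then show ?case using 1 by (simp add: v ks algebra_simps)
    qed
  qed
  also have "\<dots> = ?c *\<^sub>R sh u1 A (\<lambda>A'. sh u3 B (\<lambda>B'. lin_ext (\<lambda>x. sh v (A' @ x # B') \<Phi>) (f (u2 # vs))))"
    unfolding dec_sh_insert lin_ext_dec sh_dec_swap dec_scale ..
  finally show ?thesis by (simp add: shkD[OF k n])
qed

lemma TT_kill2:
  assumes h: "homog p f" and k: "shk \<Phi>" and n: "v \<noteq> []"
  shows "dec v (\<lambda>v1 v3. ksgn (wdeg v3 * (wdeg u1 + wdeg u2)) *\<^sub>R
    sh v1 u1 (\<lambda>a. sh v3 u3 (\<lambda>c. TT p f \<Phi> A vs B a u2 c))) = 0"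
proof -
  have "dec v (\<lambda>v1 v3. ksgn (wdeg v3 * (wdeg u1 + wdeg u2)) *\<^sub>R
      sh v1 u1 (\<lambda>a. sh v3 u3 (\<lambda>c. TT p f \<Phi> A vs B a u2 c)))
    = dec v (\<lambda>v1 v3. ksgn ((wdeg u1 + wdeg u2 + wdeg u3) * wdeg v) *\<^sub>R ksgn ((wdeg u2 + wdeg u3) * wdeg v1) *\<^sub>R
      sh u1 v1 (\<lambda>a. sh u3 v3 (\<lambda>c. TT p f \<Phi> A vs B a u2 c)))"
  proof (rule dec_cong)
    fix v1 v3 assume v: "v = v1 @ v3"
    show "ksgn (wdeg v3 * (wdeg u1 + wdeg u2)) *\<^sub>R
      sh v1 u1 (\<lambda>a. sh v3 u3 (\<lambda>c. TT p f \<Phi> A vs B a u2 c)) =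
      ksgn ((wdeg u1 + wdeg u2 + wdeg u3) * wdeg v) *\<^sub>R ksgn ((wdeg u2 + wdeg u3) * wdeg v1) *\<^sub>R
      sh u1 v1 (\<lambda>a. sh u3 v3 (\<lambda>c. TT p f \<Phi> A vs B a u2 c))"
      unfolding sh_comm[of v1 u1] sh_comm[of v3 u3] sh_scale by (simp add: v ks algebra_simps)
  qed
  then show ?thesis unfolding dec_scale TT_kill1[OF assms] by simp
qed

lemma good0_GG:
  assumes f: "good0 f" and h: "homog p f" and k: "shk \<Phi>"
  shows "good0 (\<lambda>ws. GG p f ws \<Phi>)"
proof (rule good0I_front)
  show "GG p f (us @ u # v # vs) \<Phi> = ksgn (tdeg u * tdeg v) *\<^sub>R GG p f (us @ v # u # vs) \<Phi>" for us u v vs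
    unfolding GG_def by (rule nn_sym[OF good3_GG[OF f]])
  show "GG p f ws \<Phi> = 0" if "[] \<in> set ws" for ws
    unfolding GG_def by (rule nn_nil[OF good3_GG[OF f] that])
  fix vs and u v :: "'a list"
  assume n: "u \<noteq> []" "v \<noteq> []"
  let ?X = "\<lambda>a b c. nn vs (\<lambda>A vs B. TT p f \<Phi> A vs B a b c)"
  have nil: "TT p f \<Phi> A vs B a [] c = 0" for A vs B a c
    using good0D(3)[OF f] by (simp add: TT_def)
  have mid: "sh p' q (\<lambda>b. ?X a b c) = 0" if "p' \<noteq> []" "q \<noteq> []" for p' q a c
  proof -
    have "sh p' q (\<lambda>b. TT p f \<Phi> A vs B a b c) = 0" for A vs B
    proof -
      have "sh p' q (\<lambda>b. TT p f \<Phi> A vs B a b c) = ksgn (wdeg A * (wdeg p' + wdeg q - 1 + wdeg c) + sdeg vs * wdeg c) *\<^sub>R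
        sh p' q (\<lambda>b. sh a A (\<lambda>A'. sh c B (\<lambda>B'. ksgn (p * wdeg A') *\<^sub>R lin_ext (\<lambda>x. \<Phi> (A' @ x # B')) (f (b # vs)))))"
        unfolding TT_def by (rule sh_scale_deg) (simp add: tdeg_def)
      also have "sh p' q (\<lambda>b. sh a A (\<lambda>A'. sh c B (\<lambda>B'. ksgn (p * wdeg A') *\<^sub>R lin_ext (\<lambda>x. \<Phi> (A' @ x # B')) (f (b # vs)))))
        = sh a A (\<lambda>A'. sh c B (\<lambda>B'. ksgn (p * wdeg A') *\<^sub>R lin_ext (\<lambda>x. \<Phi> (A' @ x # B')) (sh p' q (\<lambda>b. f (b # vs)))))"
        by (simp only: sh_swap[of p' q] sh_scale sh_lin_ext(1))
      finally show ?thesis by (simp add: good0D_hd(1)[OF f that])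
    qed
    then show ?thesis by (simp add: nn_sh)
  qed
  \<comment> \<open>For two non-empty middle pieces \<open>f\<close> kills their shuffle. If both
    are empty, each conditional term is zero by \<open>nil\<close>, so nothing is counted
    twice.\<close>
  have "sh u v (\<lambda>w. GG p f (w # vs) \<Phi>) = dec3 u (\<lambda>u1 u2 u3. dec3 v (\<lambda>v1 v2 v3.
      (if v2 = [] then ksgn ((wdeg u2 + wdeg u3) * wdeg v1) *\<^sub>R sh u1 v1 (\<lambda>a. sh u3 v3 (\<lambda>c. ?X a u2 c)) else 0)
      + (if u2 = [] then ksgn (wdeg u3 * (wdeg v1 + wdeg v2)) *\<^sub>R sh u1 v1 (\<lambda>a. sh u3 v3 (\<lambda>c. ?X a v2 c)) else 0)))"
    unfolding GG_Cons dec3_sh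
  proof (intro dec3_cong, goal_cases)
    case (1 u1 u2 u3 v1 v2 v3)
    have "sh u1 v1 (\<lambda>a. sh u2 v2 (\<lambda>b. sh u3 v3 (\<lambda>c. ?X a b c))) = 0" if "u2 \<noteq> []" "v2 \<noteq> []"
      by (subst sh_swap[of u2]) (simp add: mid[OF that])
    then show ?case
      by (cases "u2 = []"; cases "v2 = []") (simp_all add: nil ks)
  qed
  also have "\<dots> = dec3 u (\<lambda>u1 u2 u3. dec3 v (\<lambda>v1 v2 v3.
      if v2 = [] then ksgn ((wdeg u2 + wdeg u3) * wdeg v1) *\<^sub>R sh u1 v1 (\<lambda>a. sh u3 v3 (\<lambda>c. ?X a u2 c)) else 0))
     + dec3 u (\<lambda>u1 u2 u3. if u2 = [] then dec3 v (\<lambda>v1 v2 v3. ksgn (wdeg u3 * (wdeg v1 + wdeg v2)) *\<^sub>R sh u1 v1 (\<lambda>a. sh u3 v3 (\<lambda>c. ?X a v2 c))) else 0)"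
    by (subst dec3_add[symmetric]) (intro dec3_cong, simp add: dec3_add)
  also have "\<dots> = dec3 u (\<lambda>u1 u2 u3. dec v (\<lambda>v1 v3. ksgn ((wdeg u2 + wdeg u3) * wdeg v1) *\<^sub>R sh u1 v1 (\<lambda>a. sh u3 v3 (\<lambda>c. ?X a u2 c))))
     + dec3 v (\<lambda>v1 v2 v3. dec u (\<lambda>u1 u3. ksgn (wdeg u3 * (wdeg v1 + wdeg v2)) *\<^sub>R sh u1 v1 (\<lambda>a. sh u3 v3 (\<lambda>c. ?X a v2 c))))"
    unfolding dec3_mid dec_dec3_swap ..
  also have "\<dots> = 0"
    unfolding nn_sh nn_scale[symmetric] nn_dec TT_kill1[OF h k n(2)] TT_kill2[OF h k n(1)] by simp
  finally show "sh u v (\<lambda>w. GG p f (w # vs) \<Phi>) = 0" .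
qed

lemma GG_nil_list [simp]: "GG p f [] \<Phi> = lin_ext (\<lambda>x. \<Phi> [x]) (f [])"
  by (simp add: GG_def)

lemma GG_mem:
  fixes f :: "'b::graded_basis list list \<Rightarrow> 'b \<Rightarrow>\<^sub>0 real"
  assumes S: "subspace S" and h: "homog p f"
    and m: "\<And>g vs. f vs \<noteq> 0 \<Longrightarrow> length vs = length ws \<Longrightarrow> nl vs + length g = nl ws + 1 \<Longrightarrow>
      tdeg g = p + sdeg ws \<Longrightarrow> g \<noteq> [] \<Longrightarrow> \<Phi> g \<in> S"
  shows "GG p f ws \<Phi> \<in> S"
  unfolding GG_def
proof (rule nn_mem[OF S], rule subspace_scale[OF S])
  fix A B :: "'b list" and vs :: "'b list list"
  assume a: "length vs = length ws" "wdeg A + sdeg vs + wdeg B = sdeg ws" "length A + nl vs + length B = nl ws"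
  show "lin_ext (\<lambda>x. \<Phi> (A @ x # B)) (f vs) \<in> S"
    unfolding lin_ext_def
  proof (intro subspace_sum subspace_scale S)
    fix x assume x: "x \<in> Poly_Mapping.keys (f vs)"
    have "bdeg x = gr1 vs + p" using h x by (simp add: homog_def)
    then show "\<Phi> (A @ x # B) \<in> S"
      using a x by (intro m[of vs]) (auto simp: tdeg_def gr1_def)
  qed
qed

lemma GG_add: "GG p f ws (\<lambda>g. \<Phi> g + \<Psi> g) = GG p f ws \<Phi> + GG p f ws \<Psi>"
  and GG_scale: "GG p f ws (\<lambda>g. r *\<^sub>R \<Phi> g) = r *\<^sub>R GG p f ws \<Phi>"
  and GG_zero [simp]: "GG p f ws (\<lambda>g. 0) = 0"
  by (simp_all add: GG_def le_simps nn_add[symmetric] nn_scale[symmetric] scaleR_right_distrib mult.commute)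

lemma GG_cong:
  assumes h: "homog p f" and "\<And>g. tdeg g = p + sdeg ws \<Longrightarrow> g \<noteq> [] \<Longrightarrow> \<Phi> g = \<Psi> g"
  shows "GG p f ws \<Phi> = GG p f ws \<Psi>"
proof -
  have "GG p f ws (\<lambda>g. \<Phi> g + (-1) *\<^sub>R \<Psi> g) \<in> {0}"
    by (rule GG_mem[OF _ h]) (auto simp: assms(2) subspace_def)
  then show ?thesis unfolding GG_add GG_scale by simp
qed

text \<open>A non-empty prefix of one word is split off and moved in front of all words;
  \<open>rc\<close> does the same with suffixes and the end of the list. They describe how a cut of
  the output word of \<open>GG\<close> is traced back to the input words.\<close>

primrec lc :: "'b::graded_basis list list \<Rightarrow> ('b list \<Rightarrow> 'b list list \<Rightarrow> 'v) \<Rightarrow> 'v::real_vector" where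
  "lc [] H = 0"
| "lc (w # ws) H = dec w (\<lambda>a b. if a = [] then 0 else H a (b # ws))
     + lc ws (\<lambda>a zs. ksgn (wdeg a * tdeg w) *\<^sub>R H a (w # zs))"

primrec rc :: "'b::graded_basis list list \<Rightarrow> ('b list list \<Rightarrow> 'b list \<Rightarrow> 'v) \<Rightarrow> 'v::real_vector" where
  "rc [] H = 0"
| "rc (w # ws) H = dec w (\<lambda>a b. if b = [] then 0 else ksgn (wdeg b * sdeg ws) *\<^sub>R H (a # ws) b)
     + rc ws (\<lambda>zs b. H (w # zs) b)"

lemma lc_add: "lc ws (\<lambda>a zs. H a zs + K a zs) = lc ws H + lc ws K"
proof (induction ws arbitrary: H K)
  case (Cons w ws)
  have "dec w (\<lambda>a b. if a = [] then 0 else H a (b # ws) + K a (b # ws))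
     = dec w (\<lambda>a b. (if a = [] then 0 else H a (b # ws)) + (if a = [] then 0 else K a (b # ws)))"
    by (rule dec_cong) simp
  with Cons show ?case by (simp add: dec_add scaleR_right_distrib)
qed simp

lemma lc_scale: "lc ws (\<lambda>a zs. r *\<^sub>R H a zs) = r *\<^sub>R lc ws H"
proof (induction ws arbitrary: H)
  case (Cons w ws)
  have "dec w (\<lambda>a b. if a = [] then 0 else r *\<^sub>R H a (b # ws)) = dec w (\<lambda>a b. r *\<^sub>R (if a = [] then 0 else H a (b # ws)))"
    by (rule dec_cong) simp
  with Cons show ?case
    by (simp add: dec_scale scaleR_right_distrib scaleR_left_commute[of _ r] del: scaleR_scaleR)
qed simp

lemma rc_add: "rc ws (\<lambda>zs b. H zs b + K zs b) = rc ws H + rc ws K"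
proof (induction ws arbitrary: H K)
  case (Cons w ws)
  have "dec w (\<lambda>a b. if b = [] then 0 else ksgn (wdeg b * sdeg ws) *\<^sub>R (H (a # ws) b + K (a # ws) b))
     = dec w (\<lambda>a b. (if b = [] then 0 else ksgn (wdeg b * sdeg ws) *\<^sub>R H (a # ws) b)
         + (if b = [] then 0 else ksgn (wdeg b * sdeg ws) *\<^sub>R K (a # ws) b))"
    by (rule dec_cong) (simp add: scaleR_right_distrib)
  with Cons show ?case by (simp add: dec_add)
qed simp

lemma rc_scale: "rc ws (\<lambda>zs b. r *\<^sub>R H zs b) = r *\<^sub>R rc ws H"
proof (induction ws arbitrary: H)
  case (Cons w ws)
  have "dec w (\<lambda>a b. if b = [] then 0 else ksgn (wdeg b * sdeg ws) *\<^sub>R r *\<^sub>R H (a # ws) b)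
     = dec w (\<lambda>a b. r *\<^sub>R (if b = [] then 0 else ksgn (wdeg b * sdeg ws) *\<^sub>R H (a # ws) b))"
    by (rule dec_cong) (simp add: mult.commute)
  with Cons show ?case
    by (simp add: dec_scale scaleR_right_distrib del: scaleR_scaleR)
qed simp

lemma lc_mem:
  assumes "subspace S"
    "\<And>a zs. a \<noteq> [] \<Longrightarrow> length zs = length ws \<Longrightarrow> wdeg a + sdeg zs = sdeg ws \<Longrightarrow> length a + nl zs = nl ws \<Longrightarrow> H a zs \<in> S"
  shows "lc ws H \<in> S"
  using assms(2)
proof (induction ws arbitrary: H)
  case (Cons w ws)
  have "dec w (\<lambda>a b. if a = [] then 0 else H a (b # ws)) \<in> S"
    by (rule dec_mem[OF assms(1)]) (auto simp: tdeg_def subspace_0[OF assms(1)] intro!: Cons.prems)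
  moreover have "lc ws (\<lambda>a zs. ksgn (wdeg a * tdeg w) *\<^sub>R H a (w # zs)) \<in> S"
    by (intro Cons.IH subspace_scale assms(1) Cons.prems) auto
  ultimately show ?case by (simp add: subspace_add assms(1))
qed (simp add: subspace_0[OF assms(1)])

lemma rc_mem:
  assumes "subspace S"
    "\<And>zs b. b \<noteq> [] \<Longrightarrow> length zs = length ws \<Longrightarrow> wdeg b + sdeg zs = sdeg ws \<Longrightarrow> length b + nl zs = nl ws \<Longrightarrow> H zs b \<in> S"
  shows "rc ws H \<in> S"
  using assms(2)
proof (induction ws arbitrary: H)
  case (Cons w ws)
  have "dec w (\<lambda>a b. if b = [] then 0 else ksgn (wdeg b * sdeg ws) *\<^sub>R H (a # ws) b) \<in> S"
    by (rule dec_mem[OF assms(1)]) (auto simp: tdeg_def subspace_0[OF assms(1)] intro!: Cons.prems subspace_scale assms(1))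
  moreover have "rc ws (\<lambda>zs b. H (w # zs) b) \<in> S"
    by (intro Cons.IH Cons.prems) auto
  ultimately show ?case by (simp add: subspace_add assms(1))
qed (simp add: subspace_0[OF assms(1)])

lemma lc_cong:
  assumes "\<And>a zs. a \<noteq> [] \<Longrightarrow> length zs = length ws \<Longrightarrow> wdeg a + sdeg zs = sdeg ws \<Longrightarrow> length a + nl zs = nl ws \<Longrightarrow> H a zs = K a zs"
  shows "lc ws H = lc ws K"
proof -
  have "lc ws (\<lambda>a zs. H a zs + (-1) *\<^sub>R K a zs) \<in> {0}"
    by (rule lc_mem) (auto simp: assms subspace_def)
  then show ?thesis unfolding lc_add lc_scale by simp
qed

lemma rc_cong:
  assumes "\<And>zs b. b \<noteq> [] \<Longrightarrow> length zs = length ws \<Longrightarrow> wdeg b + sdeg zs = sdeg ws \<Longrightarrow> length b + nl zs = nl ws \<Longrightarrow> H zs b = K zs b"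
  shows "rc ws H = rc ws K"
proof -
  have "rc ws (\<lambda>zs b. H zs b + (-1) *\<^sub>R K zs b) \<in> {0}"
    by (rule rc_mem) (auto simp: assms subspace_def)
  then show ?thesis unfolding rc_add rc_scale by simp
qed

lemma lc_snoc: "lc (ws @ [w]) H = lc ws (\<lambda>a zs. H a (zs @ [w]))
    + dec w (\<lambda>a b. if a = [] then 0 else ksgn (wdeg a * sdeg ws) *\<^sub>R H a (ws @ [b]))"
proof (induction ws arbitrary: H)
  case (Cons v ws)
  have "dec w (\<lambda>a b. if a = [] then 0 else ksgn (wdeg a * sdeg ws) *\<^sub>R ksgn (wdeg a * tdeg v) *\<^sub>R H a (v # ws @ [b]))
     = dec w (\<lambda>a b. if a = [] then 0 else ksgn (wdeg a * (tdeg v + sdeg ws)) *\<^sub>R H a (v # ws @ [b]))"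
    by (rule dec_cong) (simp add: ks mult.commute)
  with Cons show ?case by (simp del: scaleR_scaleR cong: if_cong)
qed (simp cong: if_cong)

lemma rc_snoc: "rc (ws @ [w]) H = rc ws (\<lambda>zs b. ksgn (wdeg b * tdeg w) *\<^sub>R H (zs @ [w]) b)
    + dec w (\<lambda>a b. if b = [] then 0 else H (ws @ [a]) b)"
proof (induction ws arbitrary: H)
  case (Cons v ws)
  have "dec v (\<lambda>a b. if b = [] then 0 else ksgn (wdeg b * sdeg (ws @ [w])) *\<^sub>R H (a # ws @ [w]) b)
     = dec v (\<lambda>a b. if b = [] then 0 else ksgn (wdeg b * sdeg ws) *\<^sub>R ksgn (wdeg b * tdeg w) *\<^sub>R H (a # ws @ [w]) b)"
    by (rule dec_cong) (simp add: ks mult.commute)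
  with Cons show ?case by (simp del: scaleR_scaleR cong: if_cong)
qed (simp cong: if_cong)

text \<open>A left piece with letters of both words arises as a proper shuffle and is killed in the
  left slot. So a non-empty left piece is a prefix of \<open>u\<close> or a prefix of
  \<open>A\<close>.\<close>

lemma dec_sh_left:
  assumes k: "\<And>b. shk (\<lambda>a. \<Theta> a b)"
  shows "sh u A (\<lambda>w. dec w (\<lambda>a b. if a = [] then 0 else \<Theta> a b)) =
    dec u (\<lambda>u1 u2. if u1 = [] then 0 else sh u2 A (\<lambda>b. \<Theta> u1 b))
    + dec A (\<lambda>A1 A2. if A1 = [] then 0 else ksgn (wdeg u * wdeg A1) *\<^sub>R sh u A2 (\<lambda>b. \<Theta> A1 b))"
proof -
  have d: "dec w (\<lambda>u v. if u = [] then F v else 0) = F w" for w :: "'a list" and F :: "'a list \<Rightarrow> 'b"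
    by (cases w) simp_all
  have T: "ksgn (wdeg u2 * wdeg A1) *\<^sub>R sh u1 A1 (\<lambda>a. sh u2 A2 (\<lambda>b. if a = [] then 0 else \<Theta> a b))
    = (if A1 = [] then (if u1 = [] then 0 else sh u2 A2 (\<lambda>b. \<Theta> u1 b)) else 0)
     + (if u1 = [] then (if A1 = [] then 0 else ksgn (wdeg u2 * wdeg A1) *\<^sub>R sh u2 A2 (\<lambda>b. \<Theta> A1 b)) else 0)" for u1 u2 A1 A2
  proof (cases "u1 = [] \<or> A1 = []")
    case False
    have "sh u1 A1 (\<lambda>a. sh u2 A2 (\<lambda>b. if a = [] then 0 else \<Theta> a b)) = sh u1 A1 (\<lambda>a. sh u2 A2 (\<lambda>b. \<Theta> a b))"
      by (rule sh_cong_deg, rename_tac w, case_tac w) (use False in auto)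
    also have "\<dots> = 0" by (subst sh_swap) (use False shkD[OF k] in simp)
    finally show ?thesis using False by auto
  qed auto
  have s: "dec u (\<lambda>u1 u2. dec A (\<lambda>A1 A2. if u1 = [] then if A1 = [] then 0 else ksgn (wdeg u2 * wdeg A1) *\<^sub>R sh u2 A2 (\<lambda>b. \<Theta> A1 b) else 0))
    = dec A (\<lambda>A1 A2. dec u (\<lambda>u1 u2. if u1 = [] then if A1 = [] then 0 else ksgn (wdeg u2 * wdeg A1) *\<^sub>R sh u2 A2 (\<lambda>b. \<Theta> A1 b) else 0))"
    by (rule dec_swap)
  show ?thesis unfolding dec_sh T dec_add s by (simp only: d)
qed

lemma dec_sh_right:
  assumes k: "\<And>a. shk (\<Theta> a)"
  shows "sh u B (\<lambda>w. dec w (\<lambda>a b. if b = [] then 0 else \<Theta> a b)) =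
    dec u (\<lambda>u1 u2. if u2 = [] then 0 else ksgn (wdeg u2 * wdeg B) *\<^sub>R sh u1 B (\<lambda>a. \<Theta> a u2))
    + dec B (\<lambda>B1 B2. if B2 = [] then 0 else sh u B1 (\<lambda>a. \<Theta> a B2))"
proof -
  have d: "dec w (\<lambda>u v. if v = [] then F u else 0) = F w" for w :: "'a list" and F :: "'a list \<Rightarrow> 'b"
    by (induction w arbitrary: F) simp_all
  have T: "ksgn (wdeg u2 * wdeg B1) *\<^sub>R sh u1 B1 (\<lambda>a. sh u2 B2 (\<lambda>b. if b = [] then 0 else \<Theta> a b))
    = (if B2 = [] then (if u2 = [] then 0 else ksgn (wdeg u2 * wdeg B1) *\<^sub>R sh u1 B1 (\<lambda>a. \<Theta> a u2)) else 0)
     + (if u2 = [] then (if B2 = [] then 0 else sh u1 B1 (\<lambda>a. \<Theta> a B2)) else 0)" for u1 u2 B1 B2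
  proof (cases "u2 = [] \<or> B2 = []")
    case False
    have "sh u2 B2 (\<lambda>b. if b = [] then 0 else \<Theta> a b) = 0" for a
    proof -
      have "sh u2 B2 (\<lambda>b. if b = [] then 0 else \<Theta> a b) = sh u2 B2 (\<Theta> a)"
        by (rule sh_cong_deg, rename_tac w, case_tac w) (use False in auto)
      then show ?thesis using shkD[OF k] False by simp
    qed
    then show ?thesis using False by auto
  qed auto
  have s: "dec u (\<lambda>u1 u2. dec B (\<lambda>B1 B2. if u2 = [] then if B2 = [] then 0 else sh u1 B1 (\<lambda>a. \<Theta> a B2) else 0))
    = dec B (\<lambda>B1 B2. dec u (\<lambda>u1 u2. if u2 = [] then if B2 = [] then 0 else sh u1 B1 (\<lambda>a. \<Theta> a B2) else 0))"
    by (rule dec_swap)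
  show ?thesis unfolding dec_sh T dec_add s by (simp only: d)
qed

lemma dec3_dec_left: "dec3 w (\<lambda>u v t. dec u (\<lambda>u1 u2. F u1 u2 v t)) = dec w (\<lambda>a b. dec3 b (\<lambda>u v t. F a u v t))"
proof -
  have "dec r (\<lambda>v t. dec u (\<lambda>u1 u2. F u1 u2 v t)) = dec u (\<lambda>u1 u2. dec r (\<lambda>v t. F u1 u2 v t))" for u r
    by (rule dec_swap)
  then show ?thesis by (simp only: dec3_def dec_dec)
qed

lemma dec3_dec_right: "dec3 w (\<lambda>u v t. dec t (\<lambda>t1 t2. F u v t1 t2)) = dec w (\<lambda>a b. dec3 a (\<lambda>u v t. F u v t b))"
  by (simp only: dec3_def dec_dec)

lemma shk_sh: "(\<And>b. shk (\<lambda>a. \<Theta> a b)) \<Longrightarrow> shk (\<lambda>a. sh u v (\<Theta> a))"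
  unfolding shk_def by (simp add: sh_swap[of _ _ u v])

lemma shk_deg_scale: "shk \<Phi> \<Longrightarrow> shk (\<lambda>a. f (wdeg a) *\<^sub>R \<Phi> a)"
  unfolding shk_def by (metis scaleR_zero_right sh_scale_deg)

text \<open>By \<open>dec_sh_left\<close>, applied word by word, a prefix of the collected left
  remainder stems from a single input word.\<close>

lemma nn_left:
  assumes "\<And>b vs B. shk (\<lambda>a. \<Theta> a b vs B)"
  shows "nn ws (\<lambda>A vs B. dec A (\<lambda>a b. if a = [] then 0 else \<Theta> a b vs B)) =
    lc ws (\<lambda>a zs. nn zs (\<lambda>A vs B. \<Theta> a A vs B))"
  using assms
proof (induction ws arbitrary: \<Theta>)
  case (Cons w ws)
  let ?c = "\<lambda>d A v t vs. ksgn ((d + wdeg A) * (tdeg v + wdeg t) + sdeg vs * wdeg t)"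
  have step: "ksgn (wdeg A * (tdeg v + wdeg t) + sdeg vs * wdeg t) *\<^sub>R
      sh u A (\<lambda>A'. sh t B (\<lambda>B'. dec A' (\<lambda>a b. if a = [] then 0 else \<Theta> a b (v # vs) B')))
    = dec u (\<lambda>u1 u2. if u1 = [] then 0 else ?c 0 A v t vs *\<^sub>R sh u2 A (\<lambda>b. sh t B (\<lambda>B'. \<Theta> u1 b (v # vs) B')))
     + dec A (\<lambda>A1 A2. if A1 = [] then 0 else ?c (wdeg A1) A2 v t vs *\<^sub>R ksgn (wdeg u * wdeg A1) *\<^sub>R
         sh u A2 (\<lambda>b. sh t B (\<lambda>B'. \<Theta> A1 b (v # vs) B')))" for A B u v t vs
  proof -
    have if_sh: "(if a = [] then 0 else sh t B (\<lambda>B'. K B')) = sh t B (\<lambda>B'. if a = [] then 0 else K B')" for a :: "'a list" and K :: "'a list \<Rightarrow> 'b"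
      by simp
    have "sh u A (\<lambda>A'. sh t B (\<lambda>B'. dec A' (\<lambda>a b. if a = [] then 0 else \<Theta> a b (v # vs) B')))
      = sh u A (\<lambda>A'. dec A' (\<lambda>a b. if a = [] then 0 else sh t B (\<lambda>B'. \<Theta> a b (v # vs) B')))"
      unfolding sh_dec_swap if_sh ..
    also have "\<dots> = dec u (\<lambda>u1 u2. if u1 = [] then 0 else sh u2 A (\<lambda>b. sh t B (\<lambda>B'. \<Theta> u1 b (v # vs) B')))
      + dec A (\<lambda>A1 A2. if A1 = [] then 0 else ksgn (wdeg u * wdeg A1) *\<^sub>R sh u A2 (\<lambda>b. sh t B (\<lambda>B'. \<Theta> A1 b (v # vs) B')))"
      by (rule dec_sh_left) (intro shk_sh Cons.prems)
    finally show ?thesis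
      by (simp only: scaleR_right_distrib dec_scale[symmetric])
        (intro arg_cong2[where f = "(+)"] dec_cong, simp_all)
  qed
  have 1: "dec3 w (\<lambda>u v t. nn ws (\<lambda>A vs B. dec u (\<lambda>u1 u2. if u1 = [] then 0 else ?c 0 A v t vs *\<^sub>R sh u2 A (\<lambda>b. sh t B (\<lambda>B'. \<Theta> u1 b (v # vs) B')))))
    = dec w (\<lambda>a b. if a = [] then 0 else nn (b # ws) (\<lambda>A vs B. \<Theta> a A vs B))"
  proof -
    have i: "nn ws (\<lambda>A vs B. if u1 = [] then 0 else K A vs B) = (if u1 = [] then 0 else nn ws K)" for u1 :: "'a list" and K :: "'a list \<Rightarrow> 'a list list \<Rightarrow> 'a list \<Rightarrow> 'b"
      by simp
    have j: "dec3 b (\<lambda>u v t. if u1 = [] then 0 else K u v t) = (if u1 = [] then 0 else dec3 b K)" for u1 b :: "'a list" and K :: "'a list \<Rightarrow> 'a list \<Rightarrow> 'a list \<Rightarrow> 'b"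
      by simp
    show ?thesis
      unfolding nn_dec[symmetric] i dec3_dec_left j nn.simps by (simp only: add_0)
  qed
  have 2: "nn ws (\<lambda>A vs B. dec A (\<lambda>A1 A2. if A1 = [] then 0 else ?c (wdeg A1) A2 v t vs *\<^sub>R ksgn (wdeg u * wdeg A1) *\<^sub>R
         sh u A2 (\<lambda>b. sh t B (\<lambda>B'. \<Theta> A1 b (v # vs) B'))))
    = lc ws (\<lambda>a zs. nn zs (\<lambda>A vs B. ?c (wdeg a) A v t vs *\<^sub>R ksgn (wdeg u * wdeg a) *\<^sub>R
         sh u A (\<lambda>b. sh t B (\<lambda>B'. \<Theta> a b (v # vs) B'))))" for u v t
    by (rule Cons.IH) (intro shk_sh Cons.prems shk_deg_scale[where f = "\<lambda>d. ksgn ((d + _) * _ + _)"] shk_deg_scale[where f = "\<lambda>d. ksgn (_ * d)"])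
  have 3: "dec3 w (\<lambda>u v t. lc ws (\<lambda>a zs. nn zs (\<lambda>A vs B. ?c (wdeg a) A v t vs *\<^sub>R ksgn (wdeg u * wdeg a) *\<^sub>R
         sh u A (\<lambda>b. sh t B (\<lambda>B'. \<Theta> a b (v # vs) B')))))
    = lc ws (\<lambda>a zs. ksgn (wdeg a * tdeg w) *\<^sub>R nn (w # zs) (\<lambda>A vs B. \<Theta> a A vs B))"
  proof -
    have sw: "dec z (\<lambda>s t. lc ws (\<Xi> s t)) = lc ws (\<lambda>a zs. dec z (\<lambda>s t. \<Xi> s t a zs))"
      for z :: "'a list" and \<Xi> :: "'a list \<Rightarrow> 'a list \<Rightarrow> 'a list \<Rightarrow> 'a list list \<Rightarrow> 'b"
      by (induction z arbitrary: \<Xi>) (simp_all add: lc_add)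
    have "dec3 w (\<lambda>u v t. lc ws (\<Xi> u v t)) = lc ws (\<lambda>a zs. dec3 w (\<lambda>u v t. \<Xi> u v t a zs))"
      for \<Xi> :: "'a list \<Rightarrow> 'a list \<Rightarrow> 'a list \<Rightarrow> 'a list \<Rightarrow> 'a list list \<Rightarrow> 'b"
      by (simp only: dec3_def sw)
    then show ?thesis
      unfolding nn.simps dec3_scale[symmetric] nn_scale[symmetric]
      by (simp only:) (intro lc_cong dec3_cong nn_cong, simp add: tdeg_def ks algebra_simps)
  qed
  show ?case
    unfolding nn.simps lc.simps step nn_add dec3_add 1 2 3 by simp
qed simp

lemma nn_right:
  assumes "\<And>A vs a. shk (\<lambda>b. \<Theta> A vs a b)"
  shows "nn ws (\<lambda>A vs B. dec B (\<lambda>a b. if b = [] then 0 else \<Theta> A vs a b)) =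
    rc ws (\<lambda>zs b. nn zs (\<lambda>A vs B. \<Theta> A vs B b))"
  using assms
proof (induction ws arbitrary: \<Theta>)
  case (Cons w ws)
  let ?c = "\<lambda>d A v t vs. ksgn (wdeg A * (tdeg v + wdeg t + d) + sdeg vs * (wdeg t + d))"
  have step: "ksgn (wdeg A * (tdeg v + wdeg t) + sdeg vs * wdeg t) *\<^sub>R
      sh u A (\<lambda>A'. sh t B (\<lambda>B'. dec B' (\<lambda>a b. if b = [] then 0 else \<Theta> A' (v # vs) a b)))
    = dec t (\<lambda>t1 t2. if t2 = [] then 0 else ?c (wdeg t2) A v t1 vs *\<^sub>R ksgn (wdeg t2 * wdeg B) *\<^sub>R
         sh u A (\<lambda>A'. sh t1 B (\<lambda>B'. \<Theta> A' (v # vs) B' t2)))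
     + dec B (\<lambda>B1 B2. if B2 = [] then 0 else ?c 0 A v t vs *\<^sub>R
         sh u A (\<lambda>A'. sh t B1 (\<lambda>B'. \<Theta> A' (v # vs) B' B2)))" for A B u v t vs
  proof -
    have if_sh: "(if b = [] then 0 else sh u A (\<lambda>B'. K B')) = sh u A (\<lambda>B'. if b = [] then 0 else K B')" for b :: "'a list" and K :: "'a list \<Rightarrow> 'b"
      by simp
    have "sh u A (\<lambda>A'. sh t B (\<lambda>B'. dec B' (\<lambda>a b. if b = [] then 0 else \<Theta> A' (v # vs) a b)))
      = sh t B (\<lambda>B'. dec B' (\<lambda>a b. if b = [] then 0 else sh u A (\<lambda>A'. \<Theta> A' (v # vs) a b)))"
      unfolding if_sh sh_dec_swap[symmetric] by (rule sh_swap)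
    also have "\<dots> = dec t (\<lambda>t1 t2. if t2 = [] then 0 else ksgn (wdeg t2 * wdeg B) *\<^sub>R sh t1 B (\<lambda>B'. sh u A (\<lambda>A'. \<Theta> A' (v # vs) B' t2)))
      + dec B (\<lambda>B1 B2. if B2 = [] then 0 else sh t B1 (\<lambda>B'. sh u A (\<lambda>A'. \<Theta> A' (v # vs) B' B2)))"
      by (rule dec_sh_right) (rule shk_sh[where \<Theta> = "\<lambda>b A'. \<Theta> A' _ _ b"], rule Cons.prems)
    also have "\<dots> = dec t (\<lambda>t1 t2. if t2 = [] then 0 else ksgn (wdeg t2 * wdeg B) *\<^sub>R sh u A (\<lambda>A'. sh t1 B (\<lambda>B'. \<Theta> A' (v # vs) B' t2)))
      + dec B (\<lambda>B1 B2. if B2 = [] then 0 else sh u A (\<lambda>A'. sh t B1 (\<lambda>B'. \<Theta> A' (v # vs) B' B2)))"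
      by (simp only: sh_swap[of _ _ u A])
    finally show ?thesis
      by (simp only: scaleR_right_distrib dec_scale[symmetric])
        (intro arg_cong2[where f = "(+)"] dec_cong, auto simp: algebra_simps)
  qed
  have 1: "dec3 w (\<lambda>u v t. nn ws (\<lambda>A vs B. dec t (\<lambda>t1 t2. if t2 = [] then 0 else ?c (wdeg t2) A v t1 vs *\<^sub>R ksgn (wdeg t2 * wdeg B) *\<^sub>R
         sh u A (\<lambda>A'. sh t1 B (\<lambda>B'. \<Theta> A' (v # vs) B' t2)))))
    = dec w (\<lambda>a b. if b = [] then 0 else ksgn (wdeg b * sdeg ws) *\<^sub>R nn (a # ws) (\<lambda>A vs B. \<Theta> A vs B b))"
  proof -
    have i: "nn ws (\<lambda>A vs B. if u1 = [] then 0 else K A vs B) = (if u1 = [] then 0 else nn ws K)" for u1 :: "'a list" and K :: "'a list \<Rightarrow> 'a list list \<Rightarrow> 'a list \<Rightarrow> 'b"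
      by simp
    have j: "dec3 b (\<lambda>u v t. if u1 = [] then 0 else K u v t) = (if u1 = [] then 0 else dec3 b K)" for u1 b :: "'a list" and K :: "'a list \<Rightarrow> 'a list \<Rightarrow> 'a list \<Rightarrow> 'b"
      by simp
    have "(if b = [] then 0 else dec3 a (\<lambda>u v t1. nn ws (\<lambda>A vs B. ?c (wdeg b) A v t1 vs *\<^sub>R ksgn (wdeg b * wdeg B) *\<^sub>R
         sh u A (\<lambda>A'. sh t1 B (\<lambda>B'. \<Theta> A' (v # vs) B' b)))))
      = (if b = [] then 0 else ksgn (wdeg b * sdeg ws) *\<^sub>R nn (a # ws) (\<lambda>A vs B. \<Theta> A vs B b))" for a b
    proof -
      have "dec3 a (\<lambda>u v t1. nn ws (\<lambda>A vs B. ?c (wdeg b) A v t1 vs *\<^sub>R ksgn (wdeg b * wdeg B) *\<^sub>R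
         sh u A (\<lambda>A'. sh t1 B (\<lambda>B'. \<Theta> A' (v # vs) B' b))))
        = dec3 a (\<lambda>u v t1. nn ws (\<lambda>A vs B. ksgn (wdeg b * sdeg ws) *\<^sub>R ksgn (wdeg A * (tdeg v + wdeg t1) + sdeg vs * wdeg t1) *\<^sub>R
         sh u A (\<lambda>A'. sh t1 B (\<lambda>B'. \<Theta> A' (v # vs) B' b))))"
      proof (intro dec3_cong nn_cong, goal_cases)
        case (1 u v t A vs B)
        \<comment> \<open>The total degree trades the sign involving \<open>B\<close> for one in
          \<open>sdeg ws\<close>, the form in which it occurs in \<open>rc\<close>.\<close>
        then have "sdeg ws = wdeg A + sdeg vs + wdeg B" by simp
        then show ?case by (simp add: ks algebra_simps)
      qed
      then show ?thesis by (simp only: nn.simps dec3_scale nn_scale)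
    qed
    then show ?thesis
      unfolding nn_dec[symmetric] i dec3_dec_right j by (simp only:)
  qed
  have 2: "nn ws (\<lambda>A vs B. dec B (\<lambda>B1 B2. if B2 = [] then 0 else ?c 0 A v t vs *\<^sub>R
         sh u A (\<lambda>A'. sh t B1 (\<lambda>B'. \<Theta> A' (v # vs) B' B2))))
    = rc ws (\<lambda>zs b. nn zs (\<lambda>A vs B. ?c 0 A v t vs *\<^sub>R
         sh u A (\<lambda>A'. sh t B (\<lambda>B'. \<Theta> A' (v # vs) B' b))))" for u v t
  proof (rule Cons.IH)
    fix A vs a
    have "shk (\<lambda>b. sh u A (\<lambda>A'. sh t a (\<lambda>B'. \<Theta> A' (v # vs) B' b)))"
      by (rule shk_sh[where \<Theta> = "\<lambda>b A'. sh t a (\<lambda>B'. \<Theta> A' (v # vs) B' b)"],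
          rule shk_sh[where \<Theta> = "\<lambda>b B'. \<Theta> _ (v # vs) B' b"], rule Cons.prems)
    then show "shk (\<lambda>b. ?c 0 A v t vs *\<^sub>R sh u A (\<lambda>A'. sh t a (\<lambda>B'. \<Theta> A' (v # vs) B' b)))"
      by (rule shk_deg_scale)
  qed
  have 3: "dec3 w (\<lambda>u v t. rc ws (\<lambda>zs b. nn zs (\<lambda>A vs B. ?c 0 A v t vs *\<^sub>R
         sh u A (\<lambda>A'. sh t B (\<lambda>B'. \<Theta> A' (v # vs) B' b)))))
    = rc ws (\<lambda>zs b. nn (w # zs) (\<lambda>A vs B. \<Theta> A vs B b))"
  proof -
    have sw: "dec z (\<lambda>s t. rc ws (\<Xi> s t)) = rc ws (\<lambda>zs b. dec z (\<lambda>s t. \<Xi> s t zs b))"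
      for z :: "'a list" and \<Xi> :: "'a list \<Rightarrow> 'a list \<Rightarrow> 'a list list \<Rightarrow> 'a list \<Rightarrow> 'b"
      by (induction z arbitrary: \<Xi>) (simp_all add: rc_add)
    have "dec3 w (\<lambda>u v t. rc ws (\<Xi> u v t)) = rc ws (\<lambda>zs b. dec3 w (\<lambda>u v t. \<Xi> u v t zs b))"
      for \<Xi> :: "'a list \<Rightarrow> 'a list \<Rightarrow> 'a list \<Rightarrow> 'a list list \<Rightarrow> 'a list \<Rightarrow> 'b"
      by (simp only: dec3_def sw)
    then show ?thesis by simp
  qed
  show ?case
    unfolding nn.simps rc.simps step nn_add dec3_add 1 2 3 by simp
qed simp

lemma nn_lin: "linear L \<Longrightarrow> L (nn ws \<Theta>) = nn ws (\<lambda>A vs B. L (\<Theta> A vs B))"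
proof (induction ws arbitrary: \<Theta>)
  case (Cons w ws)
  then show ?case
    by (simp add: dec3_def dec_lin[OF Cons.prems] sh_lin[OF Cons.prems] linear_cmul[OF Cons.prems])
qed simp

lemma GG_lin: "linear L \<Longrightarrow> L (GG p f ws \<Phi>) = GG p f ws (\<lambda>g. L (\<Phi> g))"
  by (simp add: GG_def nn_lin linear_cmul lin_ext_linear)

lemma dec_mid: "dec (A @ x # B) \<Gamma> = dec A (\<lambda>a b. \<Gamma> a (b @ x # B)) + dec B (\<lambda>a b. \<Gamma> (A @ x # a) b)"
  by (induction A arbitrary: \<Gamma>) (simp_all add: algebra_simps)

lemma shk_lin_ext: "(\<And>k. shk (\<lambda>a. \<Theta> a k)) \<Longrightarrow> shk (\<lambda>a. lin_ext (\<Theta> a) x)"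
  unfolding shk_def by (simp add: sh_lin_ext(2))

text \<open>A cut of \<open>A @ x # B\<close> lies on one side of the letter \<open>x\<close>: it is
  a cut of \<open>A\<close>, treated by \<open>nn_left\<close>, or of \<open>B\<close>, treated by
  \<open>nn_right\<close>.\<close>

lemma GG_dec_cut:
  assumes h: "homog p f" and k1: "\<And>b. shk (\<lambda>a. \<Gamma> a b)" and k2: "\<And>a. shk (\<Gamma> a)"
    and z: "\<And>b. \<Gamma> [] b = 0" "\<And>a. \<Gamma> a [] = 0"
  shows "GG p f ws (\<lambda>g. dec g \<Gamma>) = lc ws (\<lambda>a zs. ksgn (p * wdeg a) *\<^sub>R GG p f zs (\<Gamma> a))
    + rc ws (\<lambda>zs b. GG p f zs (\<lambda>g. \<Gamma> g b))"
proof -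
  have "ksgn (p * wdeg A) *\<^sub>R lin_ext (\<lambda>x. dec (A @ x # B) \<Gamma>) (f vs)
    = dec A (\<lambda>a b. if a = [] then 0 else ksgn (p * (wdeg a + wdeg b)) *\<^sub>R lin_ext (\<lambda>x. \<Gamma> a (b @ x # B)) (f vs))
    + dec B (\<lambda>a b. if b = [] then 0 else ksgn (p * wdeg A) *\<^sub>R lin_ext (\<lambda>x. \<Gamma> (A @ x # a) b) (f vs))" for A B vs
  proof -
    have "ksgn (p * wdeg A) *\<^sub>R lin_ext (\<lambda>x. dec (A @ x # B) \<Gamma>) (f vs)
      = dec A (\<lambda>a b. ksgn (p * wdeg A) *\<^sub>R lin_ext (\<lambda>x. \<Gamma> a (b @ x # B)) (f vs))
      + dec B (\<lambda>a b. ksgn (p * wdeg A) *\<^sub>R lin_ext (\<lambda>x. \<Gamma> (A @ x # a) b) (f vs))"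
      by (simp only: dec_mid lin_ext_fun_add lin_ext_dec dec_scale scaleR_right_distrib)
    also have "\<dots> = dec A (\<lambda>a b. if a = [] then 0 else ksgn (p * (wdeg a + wdeg b)) *\<^sub>R lin_ext (\<lambda>x. \<Gamma> a (b @ x # B)) (f vs))
      + dec B (\<lambda>a b. if b = [] then 0 else ksgn (p * wdeg A) *\<^sub>R lin_ext (\<lambda>x. \<Gamma> (A @ x # a) b) (f vs))"
      by (intro arg_cong2[where f = "(+)"] dec_cong) (auto simp: z)
    finally show ?thesis .
  qed
  then have "GG p f ws (\<lambda>g. dec g \<Gamma>) =
    nn ws (\<lambda>A vs B. dec A (\<lambda>a b. if a = [] then 0 else ksgn (p * (wdeg a + wdeg b)) *\<^sub>R lin_ext (\<lambda>x. \<Gamma> a (b @ x # B)) (f vs)))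
    + nn ws (\<lambda>A vs B. dec B (\<lambda>a b. if b = [] then 0 else ksgn (p * wdeg A) *\<^sub>R lin_ext (\<lambda>x. \<Gamma> (A @ x # a) b) (f vs)))"
    unfolding GG_def nn_add[symmetric] by (simp only:)
  also have "\<dots> = lc ws (\<lambda>a zs. nn zs (\<lambda>A vs B. ksgn (p * (wdeg a + wdeg A)) *\<^sub>R lin_ext (\<lambda>x. \<Gamma> a (A @ x # B)) (f vs)))
    + rc ws (\<lambda>zs b. nn zs (\<lambda>A vs B. ksgn (p * wdeg A) *\<^sub>R lin_ext (\<lambda>x. \<Gamma> (A @ x # B) b) (f vs)))"
  proof (intro arg_cong2[where f = "(+)"] nn_left nn_right)
    show "shk (\<lambda>a. ksgn (p * (wdeg a + wdeg b)) *\<^sub>R lin_ext (\<lambda>x. \<Gamma> a (b @ x # B)) (f vs))" for b vs B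
      by (rule shk_deg_scale[where f = "\<lambda>d. ksgn (p * (d + wdeg b))"]) (intro shk_lin_ext k1)
    show "shk (\<lambda>b. ksgn (p * wdeg A) *\<^sub>R lin_ext (\<lambda>x. \<Gamma> (A @ x # a) b) (f vs))" for A vs a
      by (rule shk_deg_scale[where f = "\<lambda>d. ksgn (p * wdeg A)"]) (intro shk_lin_ext k2)
  qed
  finally show ?thesis
    unfolding GG_def nn_scale[symmetric] by (simp add: ks)
qed

text \<open>
  \<open>DD p f ws [] word_class\<close> is the coderivation with corestriction \<open>f\<close>. The accumulator \<open>z\<close> collects the words
  which are chosen to enter \<open>f\<close>.
\<close>

primrec DD :: "int \<Rightarrow> ('b::graded_basis list list \<Rightarrow> 'b \<Rightarrow>\<^sub>0 real) \<Rightarrow> 'b list list \<Rightarrow> 'b list list \<Rightarrow>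
    ('b list list \<Rightarrow> 'v) \<Rightarrow> 'v::real_vector" where
  "DD p f [] z \<phi> = GG p f z (\<lambda>g. \<phi> [g])"
| "DD p f (w # ws) z \<phi> = DD p f ws (z @ [w]) \<phi> + ksgn ((p + sdeg z) * tdeg w) *\<^sub>R DD p f ws z (\<lambda>y. \<phi> (w # y))"

lemma DD_add: "DD p f ws z (\<lambda>y. \<phi> y + \<psi> y) = DD p f ws z \<phi> + DD p f ws z \<psi>"
  by (induction ws arbitrary: z \<phi> \<psi>) (simp_all add: GG_add scaleR_right_distrib)

lemma DD_scale: "DD p f ws z (\<lambda>y. r *\<^sub>R \<phi> y) = r *\<^sub>R DD p f ws z \<phi>"
  by (induction ws arbitrary: z \<phi>)
    (simp_all add: GG_scale scaleR_right_distrib scaleR_left_commute[of _ r] del: scaleR_scaleR)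

lemma DD_zero [simp]: "DD p f ws z (\<lambda>y. 0) = 0"
  by (induction ws arbitrary: z) simp_all

lemma DD_minus: "DD p f ws z (\<lambda>y. - \<phi> y) = - DD p f ws z \<phi>"
  using DD_scale[of p f ws z "-1" \<phi>] by simp

lemma DD_diff: "DD p f ws z (\<lambda>y. \<phi> y - \<psi> y) = DD p f ws z \<phi> - DD p f ws z \<psi>"
  using DD_add[of p f ws z \<phi> "\<lambda>y. - \<psi> y"] by (simp add: DD_minus)

lemma DD_lin: "linear L \<Longrightarrow> L (DD p f ws z \<phi>) = DD p f ws z (\<lambda>y. L (\<phi> y))"
proof (induction ws arbitrary: z \<phi>)
  case Nil then show ?case by (simp add: GG_lin)
next
  case (Cons w ws)
  then show ?case by (simp add: linear_add[OF Cons.prems] linear_cmul[OF Cons.prems])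
qed

lemma DD_dec: "DD p f ws z (\<lambda>y. dec w (\<lambda>u v. \<Theta> u v y)) = dec w (\<lambda>u v. DD p f ws z (\<Theta> u v))"
  by (induction w arbitrary: \<Theta>) (simp_all add: DD_add)

lemma DD_sum: "DD p f ws z (\<lambda>y. \<Sum>i\<in>I. \<phi> i y) = (\<Sum>i\<in>I. DD p f ws z (\<phi> i))"
  by (induction I rule: infinite_finite_induct) (simp_all add: DD_add)

lemma DD_lin_ext: "DD p f ws z (\<lambda>y. lin_ext (\<lambda>k. \<Theta> k y) x) = lin_ext (\<lambda>k. DD p f ws z (\<Theta> k)) x"
  unfolding lin_ext_def by (simp add: DD_sum DD_scale)

lemma DD_sh: "DD p f ws z (\<lambda>y. sh u v (\<lambda>w. \<Theta> w y)) = sh u v (\<lambda>w. DD p f ws z (\<Theta> w))"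
  unfolding sh_def by (rule DD_lin_ext)

lemma DD_mem:
  assumes S: "subspace S" and h: "homog p f"
    and m: "\<And>ws' vs. f vs \<noteq> 0 \<Longrightarrow> sdeg ws' = p + sdeg z + sdeg ws \<Longrightarrow>
      length ws' + length vs = length z + length ws + 1 \<Longrightarrow> nl ws' + nl vs = nl z + nl ws + 1 \<Longrightarrow>
      ws' \<noteq> [] \<Longrightarrow> \<phi> ws' \<in> S"
  shows "DD p f ws z \<phi> \<in> S"
  using m
proof (induction ws arbitrary: z \<phi>)
  case Nil
  then show ?case unfolding DD.simps by (intro GG_mem[OF S h]) auto
next
  case (Cons w ws)
  show ?case unfolding DD.simps
  proof (intro subspace_add subspace_scale S)
    show "DD p f ws (z @ [w]) \<phi> \<in> S"
      by (rule Cons.IH) (auto intro!: Cons.prems)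
    show "DD p f ws z (\<lambda>y. \<phi> (w # y)) \<in> S"
      by (rule Cons.IH) (auto intro!: Cons.prems)
  qed
qed

lemma DD_cong:
  assumes h: "homog p f" and "\<And>ws'. sdeg ws' = p + sdeg z + sdeg ws \<Longrightarrow> ws' \<noteq> [] \<Longrightarrow> \<phi> ws' = \<psi> ws'"
  shows "DD p f ws z \<phi> = DD p f ws z \<psi>"
proof -
  have "DD p f ws z (\<lambda>y. \<phi> y + (-1) *\<^sub>R \<psi> y) \<in> {0}"
    by (rule DD_mem[OF _ h]) (auto simp: assms(2) subspace_def)
  then show ?thesis unfolding DD_add DD_scale by simp
qed

lemma good0_shk: "good0 \<phi> \<Longrightarrow> shk (\<lambda>g. \<phi> (us @ g # vs))"
  unfolding shk_def by (simp add: good0D(1))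

lemma good0_shk1: "good0 \<phi> \<Longrightarrow> shk (\<lambda>g. \<phi> [g])"
  using good0_shk[of \<phi> "[]" "[]"] by simp

text \<open>Words migrate into the accumulator, so the relations have to be respected there as well
  before \<open>DD_good\<close> can be proved.\<close>

lemma DD_good_z:
  assumes f: "good0 f" "homog p f" and "good0 \<phi>"
  shows "good0 (\<lambda>z. DD p f ws z \<phi>)"
  using assms(3)
proof (induction ws arbitrary: \<phi>)
  case Nil
  then show ?case unfolding DD.simps by (intro good0_GG f good0_shk1)
next
  case (Cons w ws)
  show ?case unfolding DD.simps
  proof (intro good0_add good0_scale_inv)
    show "good0 (\<lambda>z. DD p f ws (z @ [w]) \<phi>)"
      by (rule good0_suffix[OF Cons.IH[OF Cons.prems]])
    show "good0 (\<lambda>z. DD p f ws z (\<lambda>y. \<phi> (w # y)))"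
      by (rule Cons.IH[OF good0_Cons[OF Cons.prems]])
    show "word_inv (\<lambda>z. ksgn ((p + sdeg z) * tdeg w))"
      by (rule word_inv_comp[OF word_inv_gr(1)])
  qed
qed

lemma DD_good:
  assumes f: "good0 f" "homog p f" and p: "good0 \<phi>"
  shows "good0 (\<lambda>ws. DD p f ws z \<phi>)"
proof (rule good0I)
  fix us vs and u v :: "'a list"
  show "sh u v (\<lambda>w. DD p f (us @ w # vs) z \<phi>) = 0" if n: "u \<noteq> []" "v \<noteq> []"
    using p
  proof (induction us arbitrary: z \<phi>)
    case Nil
    have 1: "sh u v (\<lambda>w. DD p f vs (z @ [w]) \<phi>) = 0"
      using good0D(1)[OF DD_good_z[OF f Nil] n] .
    have "sh u v (\<lambda>w. ksgn ((p + sdeg z) * tdeg w) *\<^sub>R DD p f vs z (\<lambda>y. \<phi> (w # y)))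
      = ksgn ((p + sdeg z) * (wdeg u + wdeg v - 1)) *\<^sub>R sh u v (\<lambda>w. DD p f vs z (\<lambda>y. \<phi> (w # y)))"
      by (rule sh_scale_deg) (simp add: tdeg_def)
    also have "sh u v (\<lambda>w. DD p f vs z (\<lambda>y. \<phi> (w # y))) = 0"
      unfolding DD_sh[symmetric] good0D_hd(1)[OF Nil n] by simp
    finally show ?case by (simp add: sh_add 1)
  next
    case (Cons a us)
    show ?case
      using Cons.IH[OF Cons.prems, of "z @ [a]"] Cons.IH[OF good0_Cons[OF Cons.prems], of z a]
      by (simp add: sh_add sh_scale)
  qed
  show "DD p f (us @ u # v # vs) z \<phi> = ksgn (tdeg u * tdeg v) *\<^sub>R DD p f (us @ v # u # vs) z \<phi>"
    using p
  proof (induction us arbitrary: z \<phi>)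
    case Nil
    have 1: "DD p f vs (z @ [u, v]) \<phi> = ksgn (tdeg u * tdeg v) *\<^sub>R DD p f vs (z @ [v, u]) \<phi>"
      using good0D(2)[OF DD_good_z[OF f Nil], of vs z u v "[]"] .
    have "DD p f vs z (\<lambda>y. \<phi> (u # v # y)) = ksgn (tdeg u * tdeg v) *\<^sub>R DD p f vs z (\<lambda>y. \<phi> (v # u # y))"
      unfolding DD_scale[symmetric]
      by (rule arg_cong[where f = "DD p f vs z"]) (rule ext, rule good0D_hd(2)[OF Nil])
    with 1 show ?case by (simp add: ks algebra_simps)
  next
    case (Cons a us)
    have "DD p f (us @ u # v # vs) (z @ [a]) \<phi> = ksgn (tdeg u * tdeg v) *\<^sub>R DD p f (us @ v # u # vs) (z @ [a]) \<phi>"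
      by (rule Cons.IH[OF Cons.prems])
    moreover have "DD p f (us @ u # v # vs) z (\<lambda>y. \<phi> (a # y)) = ksgn (tdeg u * tdeg v) *\<^sub>R DD p f (us @ v # u # vs) z (\<lambda>y. \<phi> (a # y))"
      by (rule Cons.IH[OF good0_Cons[OF Cons.prems]])
    ultimately show ?case by (simp add: scaleR_right_distrib mult.commute)
  qed
next
  fix ws :: "'a list list"
  assume "[] \<in> set ws"
  then show "DD p f ws z \<phi> = 0" using p
  proof (induction ws arbitrary: z \<phi>)
    case (Cons w ws)
    show ?case
    proof (cases "w = []")
      case True
      have 1: "DD p f ws (z @ [[]]) \<phi> = 0"
        by (rule good0D(3)[OF DD_good_z[OF f Cons.prems(2)]]) simp
      have "\<phi> ([] # y) = 0" for y using good0D(3)[OF Cons.prems(2)] by simp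
      with 1 True show ?thesis by simp
    next
      case False
      with Cons.prems have "[] \<in> set ws" by simp
      from Cons.IH[OF this Cons.prems(2)] Cons.IH[OF this good0_Cons[OF Cons.prems(2)]] show ?thesis by simp
    qed
  qed simp
qed

section \<open>Compatibility of the coderivation with the two cooperations\<close>

definition DP :: "int \<Rightarrow> ('b::graded_basis list list \<Rightarrow> 'b \<Rightarrow>\<^sub>0 real) \<Rightarrow> 'b list list \<Rightarrow>
    ('b list list \<Rightarrow> 'b list list \<Rightarrow> 'v) \<Rightarrow> 'b list list \<Rightarrow> 'b list list \<Rightarrow> 'v::real_vector" where
  "DP p f z \<Psi> x y = DD p f x z (\<lambda>x'. \<Psi> x' y) + ksgn ((p + sdeg z) * sdeg x) *\<^sub>R DD p f y z (\<Psi> x)"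

lemma DP_pfx:
  assumes h: "homog p f"
  shows "pfx w (DP p f z \<Psi>) x y = DP p f (z @ [w]) \<Psi> x y + ksgn ((p + sdeg z) * tdeg w) *\<^sub>R DP p f z (pfx w \<Psi>) x y"
proof -
  have "DD p f x z (\<lambda>x'. ksgn (tdeg w * sdeg x') *\<^sub>R \<Psi> x' (w # y))
      = ksgn (tdeg w * (p + sdeg z + sdeg x)) *\<^sub>R DD p f x z (\<lambda>x'. \<Psi> x' (w # y))"
    unfolding DD_scale[symmetric] by (rule DD_cong[OF h]) simp
  then show ?thesis
    by (simp add: DP_def pfx_def[abs_def] DD_add DD_scale ks algebra_simps)
qed

text \<open>A new word enters the accumulator or stays and joins one tensor factor
  (\<open>DP_pfx\<close>). There is no correction term, since the output of \<open>f\<close> lies in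
  one word and hence in one of the factors.\<close>

lemma DD_un:
  assumes h: "homog p f"
  shows "DD p f ws z (\<lambda>y. un y \<Psi>) = un ws (DP p f z \<Psi>)"
proof (induction ws arbitrary: z \<Psi>)
  case Nil
  show ?case by (simp add: DP_def un_Cons pfx_def GG_add)
next
  case (Cons w ws)
  show ?case
    by (simp add: un_Cons Cons DP_pfx[OF h, abs_def] un_add un_scale)
qed

lemma good0_nn_par: "(\<And>A vs B. good0 (\<lambda>x. \<Theta> x A vs B)) \<Longrightarrow> good0 (\<lambda>x. nn ws (\<Theta> x))"
proof (induction ws arbitrary: \<Theta>)
  case (Cons w ws)
  show ?case unfolding nn.simps
    by (intro good0_dec3 Cons.IH good0_scaleR good0_sh Cons.prems)
qed simp

lemma good0_GG_par: "(\<And>g. good0 (\<lambda>x. \<Phi> x g)) \<Longrightarrow> good0 (\<lambda>x. GG p f ws (\<Phi> x))"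
  unfolding GG_def by (intro good0_nn_par good0_scaleR good0_lin_ext)

lemma good0_DD_par: "(\<And>y. good0 (\<lambda>x. \<Phi> x y)) \<Longrightarrow> good0 (\<lambda>x. DD p f ws z (\<Phi> x))"
proof (induction ws arbitrary: z \<Phi>)
  case Nil
  then show ?case unfolding DD.simps by (intro good0_GG_par)
next
  case (Cons w ws)
  show ?case unfolding DD.simps
    by (intro good0_add good0_scaleR Cons.IH Cons.prems)
qed

lemma gp_DP:
  assumes f: "good0 f" "homog p f" and g: "gp \<Psi>"
  shows "gp (DP p f z \<Psi>)"
proof -
  have 1: "good0 (\<lambda>x. DD p f y z (\<Psi> x))" for y
    by (rule good0_DD_par) (rule gpD(1)[OF g])
  have 2: "good0 (\<lambda>y. DD p f x z (\<lambda>x'. \<Psi> x' y))" for x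
    by (rule good0_DD_par) (rule gpD(2)[OF g])
  have 3: "word_inv (\<lambda>x. ksgn ((p + sdeg z) * sdeg x))"
    by (rule word_inv_comp[OF word_inv_gr(1)])
  have 4: "good0 (\<lambda>x. DD p f x z (\<lambda>x'. \<Psi> x' y))" for y
    by (rule DD_good[OF f gpD(1)[OF g]])
  have 5: "good0 (\<lambda>y. DD p f y z (\<Psi> x))" for x
    by (rule DD_good[OF f gpD(2)[OF g]])
  show ?thesis
    unfolding gp_def DP_def
    using good0_add[OF 4 good0_scale_inv[OF 1 3]] good0_add[OF 2 good0_scaleR[OF 5]] by blast
qed

text \<open>The correction term after a piece \<open>a\<close> has been cut off: \<open>a\<close>
  forms a word of its own in one tensor factor, while the coderivation acts in the other
  one.\<close>

definition El :: "int \<Rightarrow> ('b::graded_basis list list \<Rightarrow> 'b \<Rightarrow>\<^sub>0 real) \<Rightarrow> 'b list \<Rightarrow> 'b list list \<Rightarrow> 'b list list \<Rightarrow>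
    ('b list list \<Rightarrow> 'b list list \<Rightarrow> 'v) \<Rightarrow> 'v::real_vector" where
  "El p f a z ws \<Psi> = ksgn (wdeg a) *\<^sub>R un ws (\<lambda>x y.
     ksgn ((p + sdeg z) * sdeg x) *\<^sub>R DD p f y z (\<Psi> (a # x)) +
     ksgn (tdeg a * (p + sdeg z + sdeg x)) *\<^sub>R DD p f x z (\<lambda>x'. \<Psi> x' (a # y)))"

lemma El_nil: "nilz \<Psi> \<Longrightarrow> El p f [] z ws \<Psi> = 0"
proof -
  assume "nilz \<Psi>"
  then have "\<Psi> ([] # x) = (\<lambda>y. 0)" "\<Psi> x' ([] # y) = 0" for x x' y
    by (auto simp: nilz_def fun_eq_iff)
  then show ?thesis by (simp add: El_def)
qed

lemma El_Cons:
  assumes h: "homog p f" and g: "gp \<Psi>"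
  shows "El p f a z (w # ws) \<Psi> = El p f a (z @ [w]) ws \<Psi> +
    ksgn (tdeg w * (p + sdeg z + wdeg a - 1)) *\<^sub>R El p f a z ws (pfx w \<Psi>)"
  unfolding El_def un_Cons un_scale[symmetric] un_add[symmetric]
proof (rule arg_cong[where f = "un ws"], intro ext)
  fix x y
  have s1: "\<Psi> (a # w # x) = (\<lambda>y'. ksgn (tdeg a * tdeg w) *\<^sub>R \<Psi> (w # a # x) y')"
    by (rule ext) (rule good0D_hd(2)[OF gpD(1)[OF g]])
  have s2: "\<Psi> x' (a # w # y) = ksgn (tdeg a * tdeg w) *\<^sub>R \<Psi> x' (w # a # y)" for x'
    by (rule good0D_hd(2)[OF gpD(2)[OF g]])
  have c: "DD p f x z (\<lambda>x'. ksgn (sdeg x' * tdeg w) *\<^sub>R \<Psi> x' (w # a # y))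
      = ksgn (tdeg w * (p + sdeg z + sdeg x)) *\<^sub>R DD p f x z (\<lambda>x'. \<Psi> x' (w # a # y))"
    unfolding DD_scale[symmetric] by (rule DD_cong[OF h]) (simp add: mult.commute)
  show "ksgn (wdeg a) *\<^sub>R pfx w (\<lambda>x y. ksgn ((p + sdeg z) * sdeg x) *\<^sub>R DD p f y z (\<Psi> (a # x)) +
     ksgn (tdeg a * (p + sdeg z + sdeg x)) *\<^sub>R DD p f x z (\<lambda>x'. \<Psi> x' (a # y))) x y =
    ksgn (wdeg a) *\<^sub>R (ksgn ((p + sdeg (z @ [w])) * sdeg x) *\<^sub>R DD p f y (z @ [w]) (\<Psi> (a # x)) +
     ksgn (tdeg a * (p + sdeg (z @ [w]) + sdeg x)) *\<^sub>R DD p f x (z @ [w]) (\<lambda>x'. \<Psi> x' (a # y))) +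
    ksgn (tdeg w * (p + sdeg z + wdeg a - 1)) *\<^sub>R ksgn (wdeg a) *\<^sub>R
     (ksgn ((p + sdeg z) * sdeg x) *\<^sub>R DD p f y z (pfx w \<Psi> (a # x)) +
     ksgn (tdeg a * (p + sdeg z + sdeg x)) *\<^sub>R DD p f x z (\<lambda>x'. pfx w \<Psi> x' (a # y)))"
    by (simp add: pfx_def[abs_def] s1 s2 DD_add DD_scale c tdeg_def[of a] ks algebra_simps)
qed

text \<open>Let \<open>w\<close> be cut as \<open>a b\<close>. If the coderivation acts on the
  factor containing \<open>a\<close>, then either \<open>a\<close> enters the accumulator and
  \<open>b\<close> is a spectator, or both are spectators; likewise for \<open>b\<close>. These are
  the three groups on the right.\<close>

lemma cut_identity:
  assumes h: "homog p f" and g: "gp \<Psi>"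
  shows "ksgn (p + sdeg z) *\<^sub>R ctw w ws (DP p f z \<Psi>) =
    dec w (\<lambda>a b. if a = [] then 0 else ksgn (wdeg a * sdeg z) *\<^sub>R ksgn (p * wdeg a) *\<^sub>R El p f a (z @ [b]) ws \<Psi>)
    + dec w (\<lambda>a b. if b = [] then 0 else - ksgn (wdeg b * (p + sdeg (z @ [a]) + 1)) *\<^sub>R El p f b (z @ [a]) ws \<Psi>)
    + ksgn ((p + sdeg z) * tdeg w) *\<^sub>R DD p f ws z (\<lambda>y. ctw w y \<Psi>)"
proof -
  let ?F = "\<lambda>a b x y. ksgn (wdeg a) *\<^sub>R (ksgn (tdeg b * sdeg x) *\<^sub>R \<Psi> (a # x) (b # y)
      + ksgn (tdeg a * tdeg b + tdeg a * sdeg x) *\<^sub>R \<Psi> (b # x) (a # y))"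
  note n = El_nil[OF gp_nilz[OF g]]
  have 1: "dec w (\<lambda>a b. if a = [] then 0 else ksgn (wdeg a * sdeg z) *\<^sub>R ksgn (p * wdeg a) *\<^sub>R El p f a (z @ [b]) ws \<Psi>)
    = dec w (\<lambda>a b. ksgn (wdeg a * sdeg z) *\<^sub>R ksgn (p * wdeg a) *\<^sub>R El p f a (z @ [b]) ws \<Psi>)"
    by (rule dec_cong) (simp add: n)
  have 2: "dec w (\<lambda>a b. if b = [] then 0 else - ksgn (wdeg b * (p + sdeg (z @ [a]) + 1)) *\<^sub>R El p f b (z @ [a]) ws \<Psi>)
    = dec w (\<lambda>a b. - ksgn (wdeg b * (p + sdeg (z @ [a]) + 1)) *\<^sub>R El p f b (z @ [a]) ws \<Psi>)"
    by (rule dec_cong) (simp add: n)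
  have 3: "DD p f ws z (\<lambda>y. ctw w y \<Psi>) = dec w (\<lambda>a b. un ws (DP p f z (?F a b)))"
    unfolding ctw_def DD_dec DD_un[OF h] ..
  show ?thesis
    unfolding 1 2 3 unfolding El_def ctw_def dec_scale[symmetric] dec_add[symmetric] un_scale[symmetric] un_add[symmetric]
  proof (rule dec_cong, rule arg_cong[where f = "un ws"], intro ext)
    fix a b x y assume w: "w = a @ b"
    have c1: "DD p f x z (\<lambda>x'. ksgn (tdeg b * sdeg x') *\<^sub>R \<Psi> (a # x') (b # y))
      = ksgn (tdeg b * (p + sdeg z + sdeg x)) *\<^sub>R DD p f x z (\<lambda>x'. \<Psi> (a # x') (b # y))"
      unfolding DD_scale[symmetric] by (rule DD_cong[OF h]) simp
    have c2: "DD p f x z (\<lambda>x'. ksgn (tdeg a * sdeg x') *\<^sub>R \<Psi> (b # x') (a # y))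
      = ksgn (tdeg a * (p + sdeg z + sdeg x)) *\<^sub>R DD p f x z (\<lambda>x'. \<Psi> (b # x') (a # y))"
      unfolding DD_scale[symmetric] by (rule DD_cong[OF h]) simp
    have c3: "DD p f x z (\<lambda>x'. ?F a b x' y) = ksgn (wdeg a) *\<^sub>R
        (ksgn (tdeg b * (p + sdeg z + sdeg x)) *\<^sub>R DD p f x z (\<lambda>x'. \<Psi> (a # x') (b # y))
        + ksgn (tdeg a * tdeg b) *\<^sub>R ksgn (tdeg a * (p + sdeg z + sdeg x)) *\<^sub>R DD p f x z (\<lambda>x'. \<Psi> (b # x') (a # y)))"
      by (simp only: ksgn_add[of "tdeg a * tdeg b"] scaleR_scaleR[symmetric, of "ksgn (tdeg a * tdeg b)"] DD_scale DD_add c1 c2)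
    have td: "tdeg w = tdeg a + tdeg b + 1" and wa: "wdeg a = tdeg a + 1" and wb: "wdeg b = tdeg b + 1"
      by (simp_all add: w tdeg_def)
    show "ksgn (p + sdeg z) *\<^sub>R ksgn (wdeg a) *\<^sub>R (ksgn (tdeg b * sdeg x) *\<^sub>R DP p f z \<Psi> (a # x) (b # y) +
         ksgn (tdeg a * tdeg b + tdeg a * sdeg x) *\<^sub>R DP p f z \<Psi> (b # x) (a # y)) =
      ksgn (wdeg a * sdeg z) *\<^sub>R ksgn (p * wdeg a) *\<^sub>R ksgn (wdeg a) *\<^sub>R
        (ksgn ((p + sdeg (z @ [b])) * sdeg x) *\<^sub>R DD p f y (z @ [b]) (\<Psi> (a # x)) +
         ksgn (tdeg a * (p + sdeg (z @ [b]) + sdeg x)) *\<^sub>R DD p f x (z @ [b]) (\<lambda>x'. \<Psi> x' (a # y))) +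
      - ksgn (wdeg b * (p + sdeg (z @ [a]) + 1)) *\<^sub>R ksgn (wdeg b) *\<^sub>R
        (ksgn ((p + sdeg (z @ [a])) * sdeg x) *\<^sub>R DD p f y (z @ [a]) (\<Psi> (b # x)) +
         ksgn (tdeg b * (p + sdeg (z @ [a]) + sdeg x)) *\<^sub>R DD p f x (z @ [a]) (\<lambda>x'. \<Psi> x' (b # y))) +
      ksgn ((p + sdeg z) * tdeg w) *\<^sub>R DP p f z (?F a b) x y"
      unfolding DP_def[of p f z "?F a b"] c3
      unfolding DP_def td wa wb
      by (simp add: DD_add DD_scale DD_minus DD_diff ks algebra_simps)
  qed
qed

text \<open>The cobracket may also cut the output word inside a piece that stems from the
  accumulator; \<open>lc\<close> and \<open>rc\<close> collect these cuts. The induction needs them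
  because words move into \<open>z\<close>. For \<open>z = []\<close> they vanish and the
  coderivation property remains.\<close>

lemma DD_be:
  assumes f: "good0 f" and h: "homog p f" and "gp \<Psi>"
  shows "DD p f ws z (\<lambda>y. be y \<Psi>) = ksgn (p + sdeg z) *\<^sub>R be ws (DP p f z \<Psi>)
    + lc z (\<lambda>a zs. ksgn (p * wdeg a) *\<^sub>R El p f a zs ws \<Psi>)
    + rc z (\<lambda>zs b. - ksgn (wdeg b * (p + sdeg zs + 1)) *\<^sub>R El p f b zs ws \<Psi>)"
  using assms(3)
proof (induction ws arbitrary: z \<Psi>)
  case Nil
  let ?\<Gamma> = "\<lambda>a b. ksgn (wdeg a) *\<^sub>R (\<Psi> [a] [b] + ksgn (tdeg a * tdeg b) *\<^sub>R \<Psi> [b] [a])"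
  note z = gp_nilz[OF Nil]
  have b: "be [g] \<Psi> = dec g ?\<Gamma>" for g :: "'a list" by (simp add: be_Cons[OF z] ctw_def)
  have k1: "shk (\<lambda>a. \<Psi> [a] [b])" and k2: "shk (\<lambda>a. \<Psi> [b] [a])" for b
    using good0_shk1[OF gpD(1)[OF Nil]] good0_shk1[OF gpD(2)[OF Nil]] by auto
  have shk_add: "shk (\<lambda>a. \<Phi> a + \<Xi> a)" if "shk \<Phi>" "shk \<Xi>" for \<Phi> \<Xi> :: "'a list \<Rightarrow> 'b"
    using that by (simp add: shk_def sh_add)
  have "GG p f z (\<lambda>g. dec g ?\<Gamma>) = lc z (\<lambda>a zs. ksgn (p * wdeg a) *\<^sub>R GG p f zs (?\<Gamma> a))
    + rc z (\<lambda>zs b. GG p f zs (\<lambda>g. ?\<Gamma> g b))"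
  proof (rule GG_dec_cut[OF h])
    have d: "tdeg a = wdeg a - 1" for a :: "'a list" by (simp add: tdeg_def)
    show "shk (\<lambda>a. ?\<Gamma> a b)" for b
      unfolding d[of _]
      by (intro shk_deg_scale[where f = ksgn] shk_add k1 shk_deg_scale[where f = "\<lambda>e. ksgn ((e - 1) * (wdeg b - 1))"] k2)
    show "shk (?\<Gamma> a)" for a
      unfolding d[of _]
      by (intro shk_deg_scale[where f = "\<lambda>e. ksgn (wdeg a)"] shk_add k2 shk_deg_scale[where f = "\<lambda>e. ksgn ((wdeg a - 1) * (e - 1))"] k1)
    show "?\<Gamma> [] b = 0" "?\<Gamma> a [] = 0" for a b using z by (simp_all add: nilz_def)
  qed
  also have "\<dots> = lc z (\<lambda>a zs. ksgn (p * wdeg a) *\<^sub>R El p f a zs [] \<Psi>)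
    + rc z (\<lambda>zs b. - ksgn (wdeg b * (p + sdeg zs + 1)) *\<^sub>R El p f b zs [] \<Psi>)"
  proof (intro arg_cong2[where f = "(+)"] lc_cong rc_cong)
    fix a zs
    have "GG p f zs (?\<Gamma> a) = GG p f zs (\<lambda>b. ksgn (wdeg a) *\<^sub>R (\<Psi> [a] [b] + ksgn (tdeg a * (p + sdeg zs)) *\<^sub>R \<Psi> [b] [a]))"
      by (rule GG_cong[OF h]) simp
    then show "ksgn (p * wdeg a) *\<^sub>R GG p f zs (?\<Gamma> a) = ksgn (p * wdeg a) *\<^sub>R El p f a zs [] \<Psi>"
      by (simp add: El_def GG_add GG_scale)
  next
    fix zs b
    have e: "GG p f zs (\<lambda>g. ?\<Gamma> g b) = ksgn (p + sdeg zs + 1) *\<^sub>R (GG p f zs (\<lambda>g. \<Psi> [g] [b])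
        + ksgn ((p + sdeg zs) * tdeg b) *\<^sub>R GG p f zs (\<lambda>g. \<Psi> [b] [g]))"
      unfolding GG_scale[symmetric] GG_add[symmetric]
    proof (rule GG_cong[OF h])
      fix g :: "'a list" assume t: "tdeg g = p + sdeg zs"
      then have "wdeg g = p + sdeg zs + 1" by (simp add: tdeg_def)
      with t show "?\<Gamma> g b = ksgn (p + sdeg zs + 1) *\<^sub>R (\<Psi> [g] [b] + ksgn ((p + sdeg zs) * tdeg b) *\<^sub>R \<Psi> [b] [g])" by simp
    qed
    show "GG p f zs (\<lambda>g. ?\<Gamma> g b) = - ksgn (wdeg b * (p + sdeg zs + 1)) *\<^sub>R El p f b zs [] \<Psi>"
      unfolding e by (simp add: El_def GG_add GG_scale tdeg_def[of b] ks algebra_simps)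
  qed
  finally show ?case by (simp add: b)
next
  case (Cons w ws)
  note z = gp_nilz[OF Cons.prems] gp_nilz[OF gp_DP[OF f h Cons.prems]]
  let ?q = "p + sdeg z"
  let ?Z1 = "lc z (\<lambda>a zs. ksgn (p * wdeg a) *\<^sub>R El p f a (zs @ [w]) ws \<Psi>)"
  let ?Z2 = "rc z (\<lambda>zs b. - ksgn (wdeg b * (p + sdeg zs + 1)) *\<^sub>R El p f b (zs @ [w]) ws \<Psi>)"
  let ?Y1 = "lc z (\<lambda>a zs. ksgn (p * wdeg a) *\<^sub>R El p f a zs ws (pfx w \<Psi>))"
  let ?Y2 = "rc z (\<lambda>zs b. - ksgn (wdeg b * (p + sdeg zs + 1)) *\<^sub>R El p f b zs ws (pfx w \<Psi>))"
  have l: "lc z (\<lambda>a zs. ksgn (p * wdeg a) *\<^sub>R El p f a zs (w # ws) \<Psi>) = ?Z1 + ksgn (tdeg w * (?q - 1)) *\<^sub>R ?Y1"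
    unfolding lc_scale[symmetric] lc_add[symmetric]
  proof (rule lc_cong)
    fix a :: "'a list" and zs :: "'a list list" assume "wdeg a + sdeg zs = sdeg z"
    then have "tdeg w * (p + sdeg zs + wdeg a - 1) = tdeg w * (?q - 1)" by simp
    then show "ksgn (p * wdeg a) *\<^sub>R El p f a zs (w # ws) \<Psi> = ksgn (p * wdeg a) *\<^sub>R El p f a (zs @ [w]) ws \<Psi> +
        ksgn (tdeg w * (?q - 1)) *\<^sub>R ksgn (p * wdeg a) *\<^sub>R El p f a zs ws (pfx w \<Psi>)"
      by (simp only: El_Cons[OF h Cons.prems] scaleR_right_distrib scaleR_left_commute)
  qed
  have r: "rc z (\<lambda>zs b. - ksgn (wdeg b * (p + sdeg zs + 1)) *\<^sub>R El p f b zs (w # ws) \<Psi>) = ?Z2 + ksgn (tdeg w * (?q - 1)) *\<^sub>R ?Y2"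
    unfolding rc_scale[symmetric] rc_add[symmetric]
  proof (rule rc_cong)
    fix b :: "'a list" and zs :: "'a list list" assume "wdeg b + sdeg zs = sdeg z"
    then have "tdeg w * (p + sdeg zs + wdeg b - 1) = tdeg w * (?q - 1)" by simp
    then show "- ksgn (wdeg b * (p + sdeg zs + 1)) *\<^sub>R El p f b zs (w # ws) \<Psi> =
        - ksgn (wdeg b * (p + sdeg zs + 1)) *\<^sub>R El p f b (zs @ [w]) ws \<Psi> +
        ksgn (tdeg w * (?q - 1)) *\<^sub>R - ksgn (wdeg b * (p + sdeg zs + 1)) *\<^sub>R El p f b zs ws (pfx w \<Psi>)"
      by (simp only: El_Cons[OF h Cons.prems] scaleR_right_distrib scaleR_left_commute)
  qed
  have rs: "rc z (\<lambda>zs b. ksgn (wdeg b * tdeg w) *\<^sub>R - ksgn (wdeg b * (p + sdeg (zs @ [w]) + 1)) *\<^sub>R El p f b (zs @ [w]) ws \<Psi>) = ?Z2"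
    by (rule rc_cong) (simp add: ks algebra_simps)
  have p: "pfx w (DP p f z \<Psi>) = (\<lambda>x y. DP p f (z @ [w]) \<Psi> x y + ksgn (?q * tdeg w) *\<^sub>R DP p f z (pfx w \<Psi>) x y)"
    by (intro ext) (rule DP_pfx[OF h])
  have q: "p + sdeg (z @ [w]) = ?q + tdeg w" by simp
  have L: "DD p f (w # ws) z (\<lambda>y. be y \<Psi>) = DD p f ws (z @ [w]) (\<lambda>y. be y \<Psi>)
     + ksgn (?q * tdeg w) *\<^sub>R DD p f ws z (\<lambda>y. ctw w y \<Psi>)
     + ksgn (?q * tdeg w) *\<^sub>R ksgn (tdeg w) *\<^sub>R DD p f ws z (\<lambda>y. be y (pfx w \<Psi>))"
    by (simp add: be_Cons[OF z(1)] DD_add DD_scale scaleR_right_distrib)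
  show ?case
    unfolding L l r Cons.IH[OF Cons.prems] Cons.IH[OF gp_pfx[OF Cons.prems]] lc_snoc rc_snoc rs
      be_Cons[OF z(2)] p be_add be_scale scaleR_right_distrib[of "ksgn ?q" "ctw w ws (DP p f z \<Psi>)"]
      cut_identity[OF h Cons.prems] q
    by (simp add: ks algebra_simps)
qed

subsection \<open>Existence\<close>

text \<open>Only the cuts with empty outer pieces contribute, that is, all words stay whole.\<close>

lemma nn_pure:
  fixes K :: "'b::graded_basis list list \<Rightarrow> 'v::real_vector"
  shows "nn ws (\<lambda>A vs B. if A = [] \<and> B = [] then K vs else 0) = K ws"
proof (induction ws arbitrary: K)
  case (Cons w ws)
  have s: "sh u A (\<lambda>A'. sh t B (\<lambda>B'. if A' = [] \<and> B' = [] then c else 0))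
      = (if u = [] \<and> A = [] \<and> t = [] \<and> B = [] then c else 0)" for u A t B :: "'b list" and c :: 'v
  proof (cases "(u = [] \<and> A = []) \<and> (t = [] \<and> B = [])")
    case False
    have "sh u A (\<lambda>A'. sh t B (\<lambda>B'. if A' = [] \<and> B' = [] then c else 0)) = sh u A (\<lambda>A'. sh t B (\<lambda>B'. 0))"
      by (intro sh_cong_deg) (use False in auto)
    with False show ?thesis by auto
  qed auto
  have e: "(if u = [] \<and> A = [] \<and> t = [] \<and> B = [] then c else 0) = (if A = [] \<and> B = [] then (if u = [] \<and> t = [] then c else 0) else 0)"
    for u A t B :: "'b list" and c :: 'v by simp
  have d: "dec3 w (\<lambda>u v t. if u = [] \<and> t = [] then F v else 0) = F w" for F :: "'b list \<Rightarrow> 'v"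
  proof -
    have "dec r (\<lambda>v t. if u = [] \<and> t = [] then F v else 0) = (if u = [] then F r else 0)" for u r :: "'b list" and F :: "'b list \<Rightarrow> 'v"
      by (induction r arbitrary: F) auto
    moreover have "dec w (\<lambda>u r. if u = [] then F r else 0) = F w" by (cases w) simp_all
    ultimately show ?thesis by (simp add: dec3_def)
  qed
  have "ksgn (wdeg A * (tdeg v + wdeg t) + sdeg vs * wdeg t) *\<^sub>R
      sh u A (\<lambda>A'. sh t B (\<lambda>B'. if A' = [] \<and> B' = [] then K (v # vs) else 0))
    = (if A = [] \<and> B = [] then (if u = [] \<and> t = [] then K (v # vs) else 0) else 0)" for u v t A B :: "'b list" and vs
    unfolding s e by simp
  then show ?case by (simp add: Cons d)
qed simp

text \<open>The projection to letters admits a single output word of one letter, so every word has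
  to enter \<open>f\<close> and to enter it whole.\<close>

lemma DD_cg:
  assumes "homog p f"
  shows "DD p f ws z cg = f (z @ ws)"
proof (induction ws arbitrary: z)
  case Nil
  have "lin_ext (\<lambda>x. cg [A @ x # B]) (f vs) = (if A = [] \<and> B = [] then f vs else 0)" for A vs B
  proof (cases "A = [] \<and> B = []")
    case False
    then have "cg [A @ x # B] = 0" for x by (intro cg_zero(2)) auto
    with False show ?thesis by auto
  qed simp
  then have "GG p f z (\<lambda>g. cg [g]) = nn z (\<lambda>A vs B. if A = [] \<and> B = [] then f vs else 0)"
    unfolding GG_def by (intro nn_cong) simp
  then show ?case by (simp add: nn_pure)
next
  case (Cons w ws)
  have "DD p f ws z (\<lambda>y. cg (w # y)) = DD p f ws z (\<lambda>y. 0)"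
    by (rule DD_cong[OF assms]) (auto simp: neq_Nil_conv)
  then show ?case by (simp add: Cons)
qed

definition cd :: "int \<Rightarrow> ('b::graded_basis list list \<Rightarrow> 'b \<Rightarrow>\<^sub>0 real) \<Rightarrow> 'b cofree \<Rightarrow> 'b cofree" where
  "cd p f = pl (\<lambda>ws. DD p f ws [] word_class)"

text \<open>The degree \<open>p\<close> part of Hom(P(X), X), written on lists of words. By
  \<open>coderivation_cd\<close> and \<open>cd_cor\<close> it is identified with the coderivations
  of degree \<open>p\<close>.\<close>

definition cochain :: "int \<Rightarrow> ('b::graded_basis list list \<Rightarrow> 'b \<Rightarrow>\<^sub>0 real) \<Rightarrow> bool" where
  "cochain p f \<longleftrightarrow> good f \<and> homog p f"

lemma cochainD: "cochain p f \<Longrightarrow> good f" "cochain p f \<Longrightarrow> good0 f" "cochain p f \<Longrightarrow> homog p f" "cochain p f \<Longrightarrow> f [] = 0"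
  by (simp_all add: cochain_def good_def)

lemma good_DD:
  assumes "cochain p f" "good0 \<phi>"
  shows "good (\<lambda>ws. DD p f ws [] \<phi>)"
  unfolding good_def using DD_good[OF cochainD(2,3)[OF assms(1)] assms(2)] cochainD(4)[OF assms(1)] by simp

lemma cd_wc: "cochain p f \<Longrightarrow> cd p f (word_class ws) = DD p f ws [] word_class"
  and linear_cd: "cochain p f \<Longrightarrow> linear (cd p f)"
  by (simp_all add: cd_def good_DD[OF _ good0_wc] linear_pl)

lemma good_koszul: "good (\<lambda>ws. ksgn (p * gr1 ws) *\<^sub>R word_class ws)"
  unfolding good_def
  by (auto intro!: good0_scale_inv good0_wc word_inv_comp[OF word_inv_gr(2)])

lemma koszul_sign_pl: "koszul_sign p = pl (\<lambda>ws. ksgn (p * gr1 ws) *\<^sub>R word_class ws)"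
  by (simp add: koszul_sign_def pl_def fun_eq_iff)

lemma koszul_sign_wc: "koszul_sign p (word_class ws) = ksgn (p * gr1 ws) *\<^sub>R word_class ws"
  by (simp add: koszul_sign_pl good_koszul)

lemma linear_koszul: "linear (koszul_sign p)"
  by (simp add: koszul_sign_pl good_koszul linear_pl)

lemma linear_tensor_der: "linear D \<Longrightarrow> linear (tensor_der p D)"
  unfolding tensor_der_def
  by (intro linear_compose_add linear_tensor_map linear_koszul) (simp_all add: linear_id)

lemma tensor_der_tens: "linear D \<Longrightarrow> tensor_der p D (a \<otimes> b) = D a \<otimes> b + koszul_sign p a \<otimes> D b"
  unfolding tensor_der_def by (simp add: tensor_map_tens linear_koszul linear_id)

lemma tensor_der_sp:
  assumes "linear D"
  shows "tensor_der p D (sp x y) = ksgn (sdeg x) *\<^sub>R (D (word_class x) \<otimes> word_class y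
    + ksgn (p * gr1 x) *\<^sub>R (word_class x \<otimes> D (word_class y)))"
  unfolding sp_def
  by (simp add: linear_cmul[OF linear_tensor_der[OF assms]] tensor_der_tens[OF assms] koszul_sign_wc tens_bilinear)

lemma DP_sp:
  assumes c: "cochain p f"
  shows "DP p f [] sp x y = ksgn p *\<^sub>R tensor_der p (cd p f) (sp x y)"
proof -
  have "DD p f x [] (\<lambda>x'. sp x' y) = DD p f x [] (\<lambda>x'. ksgn (p + sdeg x) *\<^sub>R (word_class x' \<otimes> word_class y))"
    by (rule DD_cong[OF cochainD(3)[OF c]]) (simp add: sp_def)
  also have "\<dots> = ksgn (p + sdeg x) *\<^sub>R (cd p f (word_class x) \<otimes> word_class y)"
    by (simp add: DD_scale cd_wc[OF c] DD_lin[OF linear_tens_left])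
  finally have 1: "DD p f x [] (\<lambda>x'. sp x' y) = \<dots>" .
  have 2: "DD p f y [] (sp x) = ksgn (sdeg x) *\<^sub>R (word_class x \<otimes> cd p f (word_class y))"
    unfolding sp_def[abs_def] by (simp add: DD_scale cd_wc[OF c] DD_lin[OF linear_tens_right])
  show ?thesis
    unfolding DP_def 1 2 tensor_der_sp[OF linear_cd[OF c]] by (simp add: gr1_def ks algebra_simps)
qed

lemma cogen_cd: "cochain p f \<Longrightarrow> cogen (cd p f (word_class ws)) = f ws"
  by (simp add: cd_wc DD_lin[OF linear_cogen] cogen_wc DD_cg[OF cochainD(3)])

lemma subspace_deg_part: "subspace (deg_part d)" and subspace_gr23_part: "subspace (gr23_part i j)"
  by (simp_all add: deg_part_def gr23_part_def)

lemma linear_span_mem: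
  assumes "linear F" "subspace S" "\<And>b. b \<in> B \<Longrightarrow> F b \<in> S" "x \<in> span B"
  shows "F x \<in> S"
proof -
  have "F ` span B = span (F ` B)" by (rule linear_span_image[OF assms(1), symmetric])
  moreover have "span (F ` B) \<subseteq> S" using assms(2,3) by (intro span_minimal) auto
  ultimately show ?thesis using assms(4) by blast
qed

lemma cd_deg: "cochain p f \<Longrightarrow> x \<in> deg_part d \<Longrightarrow> cd p f x \<in> deg_part (d + p)"
  unfolding deg_part_def[of d]
proof (rule linear_span_mem[OF linear_cd subspace_deg_part])
  fix b :: "'a cofree" assume c: "cochain p f" and "b \<in> word_class ` {ws. gr1 ws = d}"
  then obtain ws where ws: "b = word_class ws" "gr1 ws = d" by blast
  show "cd p f b \<in> deg_part (d + p)"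
    unfolding ws(1) cd_wc[OF c]
  proof (rule DD_mem[OF subspace_deg_part cochainD(3)[OF c]])
    fix ws' assume "sdeg ws' = p + sdeg [] + sdeg ws"
    then have "gr1 ws' = d + p" using ws(2) by (simp add: gr1_def)
    then show "word_class ws' \<in> deg_part (d + p)" unfolding deg_part_def by (intro span_base) blast
  qed
qed

text \<open>Both identities are the case \<open>z = []\<close> of \<open>DD_un\<close> and
  \<open>DD_be\<close> for the test function \<open>sp\<close>.\<close>

theorem coderivation_cd:
  assumes c: "cochain p f"
  shows "coderivation p (cd p f)"
  unfolding coderivation_def
proof (intro conjI allI linear_cd[OF c] image_subsetI cd_deg[OF c])
  note l = linear_tensor_der[OF linear_cd[OF c], of p]
  have ls: "linear (\<lambda>t. ksgn p *\<^sub>R tensor_der p (cd p f) t)"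
    using linear_compose_scale_right[OF l] .
  show "comult (cd p f x) = ksgn p *\<^sub>R tensor_der p (cd p f) (comult x)" for x
  proof (rule linear_eq_cofree[of "\<lambda>x. comult (cd p f x)" "\<lambda>x. ksgn p *\<^sub>R tensor_der p (cd p f) (comult x)"])
    show "linear (\<lambda>x. comult (cd p f x))" "linear (\<lambda>x. ksgn p *\<^sub>R tensor_der p (cd p f) (comult x))"
      using linear_compose[OF linear_cd[OF c] linear_comult] linear_compose[OF linear_comult ls] by (simp_all add: o_def)
    fix ws
    have "comult (cd p f (word_class ws)) = un ws (DP p f [] sp)"
      by (simp add: cd_wc[OF c] DD_lin[OF linear_comult] comult_wc DD_un[OF cochainD(3)[OF c]])
    also have "\<dots> = ksgn p *\<^sub>R tensor_der p (cd p f) (comult (word_class ws))"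
      by (simp add: comult_wc un_lin[OF l] un_scale[symmetric] DP_sp[OF c, abs_def])
    finally show "comult (cd p f (word_class ws)) = ksgn p *\<^sub>R tensor_der p (cd p f) (comult (word_class ws))" .
  qed
  show "cobracket (cd p f x) = tensor_der p (cd p f) (cobracket x)" for x
  proof (rule linear_eq_cofree[of "\<lambda>x. cobracket (cd p f x)" "\<lambda>x. tensor_der p (cd p f) (cobracket x)"])
    show "linear (\<lambda>x. cobracket (cd p f x))" "linear (\<lambda>x. tensor_der p (cd p f) (cobracket x))"
      using linear_compose[OF linear_cd[OF c] linear_cobracket] linear_compose[OF linear_cobracket l] by (simp_all add: o_def)
    fix ws
    have "cobracket (cd p f (word_class ws)) = ksgn p *\<^sub>R be ws (DP p f [] sp)"
      by (simp add: cd_wc[OF c] DD_lin[OF linear_cobracket] cobracket_wc DD_be[OF cochainD(2,3)[OF c] gp_sp])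
    also have "\<dots> = tensor_der p (cd p f) (cobracket (word_class ws))"
      by (simp add: cobracket_wc be_lin[OF l] be_scale DP_sp[OF c, abs_def])
    finally show "cobracket (cd p f (word_class ws)) = tensor_der p (cd p f) (cobracket (word_class ws))" .
  qed
qed

subsection \<open>The dual of the Dynkin operator\<close>

text \<open>The sign of the antipode when the prefix already passed is kept reversed, as in the
  argument \<open>r\<close> of \<open>dz\<close>: one sign per letter and the Koszul sign of the
  reversal.\<close>

primrec rsgn :: "'b::graded_basis list \<Rightarrow> real" where
  "rsgn [] = 1"
| "rsgn (x # u) = - ksgn (bdeg x * wdeg u) * rsgn u"

primrec dz :: "'b::graded_basis list \<Rightarrow> 'b list \<Rightarrow> ('b list \<Rightarrow> 'v) \<Rightarrow> 'v::real_vector" where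
  "dz r [] \<Phi> = 0"
| "dz r (x # v) \<Phi> = (ksgn (bdeg x * wdeg r) * rsgn r) *\<^sub>R sh r v (\<lambda>y. \<Phi> (x # y)) + dz (x # r) v \<Phi>"

text \<open>\<open>dynkin w = \<Sum> x \<cdot> (S(u) \<sqcup> v)\<close> over the factorizations \<open>w = u x v\<close> with a letter \<open>x\<close>, where \<open>S\<close> is the
  antipode and \<open>\<sqcup>\<close> the shuffle product. It is the transpose of the Dynkin operator, and it inverts,
  up to the factor \<open>length w\<close>, the iterated cobracket modulo shuffles.\<close>

definition dynkin :: "'b::graded_basis list \<Rightarrow> ('b list \<Rightarrow> 'v) \<Rightarrow> 'v::real_vector" where
  "dynkin w \<Phi> = dz [] w \<Phi>"

lemma rsgn_snoc: "rsgn (r @ [a]) = - ksgn (bdeg a * wdeg r) * rsgn r"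
  by (induction r) (simp_all add: ks algebra_simps)

text \<open>Modulo shuffles all choices of the letter \<open>x\<close> agree: moving the reversed
  prefix back in front of \<open>x\<close> undoes the antipode. So each remaining letter contributes
  one copy of the whole word.\<close>

lemma dz_shk:
  assumes k: "shk \<Phi>"
  shows "dz r v \<Phi> = real (length v) *\<^sub>R \<Phi> (rev r @ v)"
proof -
  have b: "(ksgn (bdeg x * wdeg r) * rsgn r) *\<^sub>R sh r v (\<lambda>y. \<Phi> (x # y)) = \<Phi> (rev r @ x # v)" for r x v
  proof (induction r arbitrary: x v)
    case (Cons y r)
    have "sh (y # r) (x # v) \<Phi> = 0" by (rule shkD[OF k]) simp_all
    then have "sh r (x # v) (\<lambda>w. \<Phi> (y # w)) = - ksgn (bdeg x * wdeg (y # r)) *\<^sub>R sh (y # r) v (\<lambda>w. \<Phi> (x # w))"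
      by (simp add: sh_Cons eq_neg_iff_add_eq_0)
    with Cons[of y "x # v"] show ?case by (simp add: ks algebra_simps)
  qed simp
  show ?thesis
  proof (induction v arbitrary: r)
    case (Cons x v)
    show ?case unfolding dz.simps b Cons by (simp add: algebra_simps)
  qed simp
qed

lemma dynkin_shk: "shk \<Phi> \<Longrightarrow> dynkin w \<Phi> = real (length w) *\<^sub>R \<Phi> w"
  by (simp add: dynkin_def dz_shk)

lemma dz_snoc: "dz (r @ [a]) (v @ [b]) \<Phi> = dz (r @ [a]) v (\<lambda>y. \<Phi> (y @ [b]))
    - ksgn (bdeg a * (wdeg r + wdeg v + bdeg b)) *\<^sub>R dz r (v @ [b]) (\<lambda>y. \<Phi> (y @ [a]))"
proof (induction v arbitrary: r)
  case Nil
  show ?case by (simp add: rsgn_snoc ks algebra_simps)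
next
  case (Cons x v)
  show ?case
    using Cons[of "x # r"] by (simp add: sh_snoc rsgn_snoc ks algebra_simps)
qed

text \<open>In this form the operator is recognised in \<open>R2_cobracket\<close>, where the cuts
  into a long word and a single outer letter survive.\<close>

lemma dynkin_rec: "dynkin (a # m @ [b]) \<Phi> = dynkin (a # m) (\<lambda>y. \<Phi> (y @ [b]))
    - ksgn (bdeg a * wdeg (m @ [b])) *\<^sub>R dynkin (m @ [b]) (\<lambda>y. \<Phi> (y @ [a]))"
  using dz_snoc[of "[]" a m b \<Phi>] by (simp add: dynkin_def)

lemma dynkin_rec': "length w \<ge> 2 \<Longrightarrow> dynkin w \<Phi> = dynkin (butlast w) (\<lambda>y. \<Phi> (y @ [last w]))
    - ksgn (bdeg (hd w) * wdeg (tl w)) *\<^sub>R dynkin (tl w) (\<lambda>y. \<Phi> (y @ [hd w]))"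
proof (cases w)
  case (Cons a m')
  assume "length w \<ge> 2"
  then have "m' \<noteq> []" using Cons by auto
  then obtain m b where "m' = m @ [b]" using rev_exhaust by blast
  then show ?thesis using dynkin_rec[of a m b \<Phi>] Cons by simp
qed simp

text \<open>By \<open>dynkin_rec'\<close> the operator is a difference of a part removing the last
  letter and a part removing the first. On a shuffle the induction hypothesis kills both, except
  when a one-letter word is used up; these boundary terms are \<open>?R\<close> in either
  part.\<close>

lemma shk_dynkin: "shk (\<lambda>w. dynkin w \<Phi>)"
proof -
  have "sh u v (\<lambda>w. dynkin w \<Phi>) = 0" if "u \<noteq> []" "v \<noteq> []" for u v
    using that
  proof (induction "length u + length v" arbitrary: u v \<Phi> rule: less_induct)
    case less
    let ?A = "\<lambda>w. dynkin (butlast w) (\<lambda>y. \<Phi> (y @ [last w]))"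
    let ?B = "\<lambda>w. ksgn (bdeg (hd w) * wdeg (tl w)) *\<^sub>R dynkin (tl w) (\<lambda>y. \<Phi> (y @ [hd w]))"
    let ?R = "(if length u = 1 then ksgn (bdeg (hd u) * wdeg v) *\<^sub>R dynkin v (\<lambda>y. \<Phi> (y @ [hd u])) else 0)
      + (if length v = 1 then dynkin u (\<lambda>y. \<Phi> (y @ [hd v])) else 0)"
    have len: "2 \<le> length u + length v" using less.prems by (cases u; cases v) auto
    have "sh u v (\<lambda>w. dynkin w \<Phi>) = sh u v (\<lambda>w. ?A w + (-1) *\<^sub>R ?B w)"
      by (rule sh_cong_deg) (use len in \<open>simp add: dynkin_rec'\<close>)
    also have "\<dots> = sh u v ?A - sh u v ?B" unfolding sh_add sh_scale by simp
    finally have 1: "sh u v (\<lambda>w. dynkin w \<Phi>) = sh u v ?A - sh u v ?B" .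
    have A: "sh u v ?A = ?R"
    proof -
      obtain u' a v' b where e: "u = u' @ [a]" "v = v' @ [b]" using less.prems rev_exhaust by metis
      have z1: "sh u' v (\<lambda>w. dynkin w \<Psi>) = 0" if "u' \<noteq> []" for \<Psi> :: "'a list \<Rightarrow> 'b"
        using less.hyps[of u' v \<Psi>] that less.prems by (simp add: e)
      have z2: "sh u v' (\<lambda>w. dynkin w \<Psi>) = 0" if "v' \<noteq> []" for \<Psi> :: "'a list \<Rightarrow> 'b"
        using less.hyps[of u v' \<Psi>] that less.prems by (simp add: e)
      have "sh u v ?A = ksgn (bdeg a * wdeg v) *\<^sub>R sh u' v (\<lambda>w. dynkin w (\<lambda>y. \<Phi> (y @ [a]))) + sh u v' (\<lambda>w. dynkin w (\<lambda>y. \<Phi> (y @ [b])))"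
        unfolding e sh_snoc by simp
      also have "\<dots> = ?R"
        using z1 z2 by (cases "u' = []"; cases "v' = []") (simp_all add: e)
      finally show ?thesis .
    qed
    have B: "sh u v ?B = ?R"
    proof -
      obtain u' a v' b where e: "u = a # u'" "v = b # v'" using less.prems by (metis neq_Nil_conv)
      have z1: "sh u' v (\<lambda>w. dynkin w \<Psi>) = 0" if "u' \<noteq> []" for \<Psi> :: "'a list \<Rightarrow> 'b"
        using less.hyps[of u' v \<Psi>] that less.prems by (simp add: e)
      have z2: "sh u v' (\<lambda>w. dynkin w \<Psi>) = 0" if "v' \<noteq> []" for \<Psi> :: "'a list \<Rightarrow> 'b"
        using less.hyps[of u v' \<Psi>] that less.prems by (simp add: e)
      have "sh u v ?B = sh u' v (\<lambda>w. ksgn (bdeg a * wdeg w) *\<^sub>R dynkin w (\<lambda>y. \<Phi> (y @ [a])))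
          + ksgn (bdeg b * wdeg u) *\<^sub>R sh u v' (\<lambda>w. ksgn (bdeg b * wdeg w) *\<^sub>R dynkin w (\<lambda>y. \<Phi> (y @ [b])))"
        unfolding e sh_Cons by simp
      also have "\<dots> = ksgn (bdeg a * (wdeg u' + wdeg v)) *\<^sub>R sh u' v (\<lambda>w. dynkin w (\<lambda>y. \<Phi> (y @ [a])))
          + ksgn (bdeg b * wdeg u) *\<^sub>R ksgn (bdeg b * (wdeg u + wdeg v')) *\<^sub>R sh u v' (\<lambda>w. dynkin w (\<lambda>y. \<Phi> (y @ [b])))"
        by (subst (1 2) sh_scale_deg) auto
      also have "\<dots> = ?R"
        using z1 z2 by (cases "u' = []"; cases "v' = []") (simp_all add: e ks mult_ac)
      finally show ?thesis .
    qed
    show ?case using 1 A B by simp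
  qed
  then show ?thesis by (simp add: shk_def)
qed

subsection \<open>Uniqueness\<close>

definition bil :: "('b::graded_basis list list \<Rightarrow> 'b list list \<Rightarrow> 'v) \<Rightarrow> 'b cofree \<Rightarrow> 'b cofree \<Rightarrow> 'v::real_vector" where
  "bil \<Psi> a b = pl (\<lambda>x. pl (\<Psi> x) b) a"

text \<open>A bilinear map on the quotient must in addition vanish on the empty list in each
  slot.\<close>

definition gpz :: "('b::graded_basis list list \<Rightarrow> 'b list list \<Rightarrow> 'v::real_vector) \<Rightarrow> bool" where
  "gpz \<Psi> \<longleftrightarrow> gp \<Psi> \<and> (\<forall>x. \<Psi> x [] = 0) \<and> (\<forall>y. \<Psi> [] y = 0)"

definition tl_lift :: "('b::graded_basis list list \<Rightarrow> 'b list list \<Rightarrow> 'v) \<Rightarrow> ('b cofree, 'b cofree) tensor \<Rightarrow> 'v::real_vector" where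
  "tl_lift \<Psi> = tensor_lift (bil \<Psi>)"

lemma gpz_good:
  assumes "gpz \<Psi>"
  shows "good (\<Psi> x)" "good (\<lambda>x. pl (\<Psi> x) b)"
proof -
  note g = assms[unfolded gpz_def]
  show "good (\<Psi> x)" using g gpD(2) by (auto simp: good_def)
  show "good (\<lambda>x. pl (\<Psi> x) b)"
  proof -
    have "\<Psi> [] = (\<lambda>y. 0)" using g by (intro ext) simp
    then show ?thesis
      unfolding good_def pl_def using good0_lin_ext[of "\<lambda>y x. \<Psi> x y" "rep_cofree b"] gpD(1)[of \<Psi>] g by auto
  qed
qed

lemma tl_lift_props:
  assumes "gpz \<Psi>"
  shows "linear (tl_lift \<Psi>)" "tl_lift \<Psi> (word_class x \<otimes> word_class y) = \<Psi> x y"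
proof -
  have 1: "linear (\<lambda>a. bil \<Psi> a b)" for b
    unfolding bil_def by (rule linear_pl[OF gpz_good(2)[OF assms]])
  have 2: "linear (bil \<Psi> a)" for a
  proof -
    have "bil \<Psi> a = (\<lambda>b. lin_ext (\<lambda>x. pl (\<Psi> x) b) (rep_cofree a))"
      by (simp add: bil_def pl_def[of _ a] fun_eq_iff)
    moreover have "linear \<dots>"
      by (rule linearI) (simp_all add: linear_add[OF linear_pl[OF gpz_good(1)[OF assms]]]
          linear_cmul[OF linear_pl[OF gpz_good(1)[OF assms]]] le_simps)
    ultimately show ?thesis by simp
  qed
  show "linear (tl_lift \<Psi>)"
    unfolding tl_lift_def by (rule linear_tensor_lift[OF 1 2])
  show "tl_lift \<Psi> (word_class x \<otimes> word_class y) = \<Psi> x y"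
    unfolding tl_lift_def tensor_lift_tens[OF 1 2] bil_def
    by (subst pl_wc[OF gpz_good(2)[OF assms]]) (rule pl_wc[OF gpz_good(1)[OF assms]])
qed

lemma tl_lift_sp: "gpz \<Psi> \<Longrightarrow> tl_lift \<Psi> (sp x y) = ksgn (sdeg x) *\<^sub>R \<Psi> x y"
  by (simp add: sp_def linear_cmul[OF tl_lift_props(1)] tl_lift_props(2))

text \<open>Each word goes to one of two factors, and by symmetry concatenation gives
  \<open>\<phi> ws\<close> back for each of the choices.\<close>

lemma un_concat:
  assumes "good0 \<phi>"
  shows "un ws (\<lambda>x y. \<phi> (x @ y)) = 2 ^ length ws *\<^sub>R \<phi> ws"
  using assms
proof (induction ws arbitrary: \<phi>)
  case (Cons w ws)
  have "pfx w (\<lambda>x y. \<phi> (x @ y)) = (\<lambda>x y. 2 *\<^sub>R \<phi> (w # (x @ y)))"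
  proof (intro ext)
    fix x y
    have "\<phi> (x @ w # y) = ksgn (tdeg w * sdeg x) *\<^sub>R \<phi> (w # x @ y)"
      by (rule sym_move) (rule good0D(2)[OF Cons.prems])
    then show "pfx w (\<lambda>x y. \<phi> (x @ y)) x y = 2 *\<^sub>R \<phi> (w # (x @ y))"
      by (simp add: pfx_def scaleR_2)
  qed
  with Cons.IH[OF good0_Cons[OF Cons.prems], of w] show ?case
    by (simp add: un_Cons un_scale)
qed simp

lemma un_unit: "un ws (\<lambda>x y. if x = [] then \<phi> y else 0) = \<phi> ws" "un ws (\<lambda>x y. if y = [] then \<phi> x else 0) = \<phi> ws"
proof (induction ws arbitrary: \<phi>)
  case (Cons w ws)
  have p1: "pfx w (\<lambda>x y. if x = [] then \<phi> y else 0) = (\<lambda>x y. if x = [] then \<phi> (w # y) else 0)" for \<phi> :: "'b list list \<Rightarrow> 'a"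
    by (auto simp: pfx_def fun_eq_iff)
  have p2: "pfx w (\<lambda>x y. if y = [] then \<phi> x else 0) = (\<lambda>x y. if y = [] then \<phi> (w # x) else 0)" for \<phi> :: "'b list list \<Rightarrow> 'a"
    by (auto simp: pfx_def fun_eq_iff)
  { case 1 show ?case using Cons(1)[of "\<lambda>y. \<phi> (w # y)"] unfolding un_Cons p1 . }
  { case 2 show ?case using Cons(2)[of "\<lambda>y. \<phi> (w # y)"] unfolding un_Cons p2 . }
qed simp_all

text \<open>A left inverse of the comultiplication on lists of several words: concatenation divided
  by \<open>2 ^ n - 2\<close>, the number of ways to distribute \<open>n\<close> words to two
  non-empty factors. The sign cancels that of \<open>sp\<close>.\<close>

definition R1 :: "'b::graded_basis list list \<Rightarrow> 'b list list \<Rightarrow> 'b cofree" where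
  "R1 x y = (if x = [] \<or> y = [] then 0 else
     (ksgn (sdeg x) / (2 ^ (length x + length y) - 2)) *\<^sub>R word_class (x @ y))"

lemma gpz_R1: "gpz R1"
proof -
  have l: "word_inv (\<lambda>x. x \<noteq> [])"
    using word_inv_comp[OF word_inv_gr(5), of "\<lambda>n. n \<noteq> 0"] by simp
  have 1: "good0 (R1 x)" for x :: "'a list list"
  proof -
    have "R1 x = (\<lambda>y. if y \<noteq> [] then (if x = [] then 0 else ksgn (sdeg x) / (2 ^ (length x + length y) - 2)) *\<^sub>R word_class (x @ y) else 0)"
      by (auto simp: R1_def fun_eq_iff)
    moreover have "good0 (\<lambda>y. if y \<noteq> [] then (if x = [] then 0 else ksgn (sdeg x) / (2 ^ (length x + length y) - 2)) *\<^sub>R word_class (x @ y) else 0)"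
      by (intro good0_if_inv good0_scale_inv good0_prefix[OF good0_wc] l word_inv_comp[OF word_inv_gr(5)])
    ultimately show ?thesis by simp
  qed
  have 2: "good0 (\<lambda>x. R1 x y)" for y :: "'a list list"
  proof -
    have "(\<lambda>x. R1 x y) = (\<lambda>x. if x \<noteq> [] then (if y = [] then 0 else ksgn (sdeg x) / (2 ^ (length x + length y) - 2)) *\<^sub>R word_class (x @ y) else 0)"
      by (auto simp: R1_def fun_eq_iff)
    moreover have "good0 (\<lambda>x. if x \<noteq> [] then (if y = [] then 0 else ksgn (sdeg x) / (2 ^ (length x + length y) - 2)) *\<^sub>R word_class (x @ y) else 0)"
      by (intro good0_if_inv good0_scale_inv good0_suffix[OF good0_wc] l
          word_inv_comp2[OF word_inv_gr(1) word_inv_gr(5), of "\<lambda>d n. if y = [] then 0 else ksgn d / (2 ^ (n + length y) - 2)"])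
    ultimately show ?thesis by simp
  qed
  show ?thesis using 1 2 by (simp add: gpz_def gp_def) (simp add: R1_def)
qed

lemma R1_comult: "tl_lift R1 (comult (word_class ws)) = (if length ws \<ge> 2 then word_class ws else 0)"
proof (cases "ws = []")
  case True
  then show ?thesis by (simp add: linear_0[OF linear_comult] linear_0[OF tl_lift_props(1)[OF gpz_R1]])
next
  case False
  let ?c = "2 ^ length ws - 2 :: real"
  have "tl_lift R1 (comult (word_class ws)) = un ws (\<lambda>x y. ksgn (sdeg x) *\<^sub>R R1 x y)"
    by (simp add: comult_wc un_lin[OF tl_lift_props(1)[OF gpz_R1]] tl_lift_sp[OF gpz_R1])
  \<comment> \<open>For a single word \<open>?c = 0\<close>; both sides are then zero, since one
    factor is empty and \<open>1 / 0 = 0\<close>.\<close>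
  also have "\<dots> = un ws (\<lambda>x y. (1 / ?c) *\<^sub>R (word_class (x @ y)
      + ((-1) *\<^sub>R (if x = [] then word_class y else 0) + (-1) *\<^sub>R (if y = [] then word_class x else 0))))"
    by (rule un_cong_deg) (use False in \<open>auto simp: R1_def\<close>)
  also have "\<dots> = (1 / ?c) *\<^sub>R (?c *\<^sub>R word_class ws)"
    unfolding un_scale un_add un_unit un_concat[OF good0_wc] by (simp add: scaleR_left_diff_distrib scaleR_2)
  also have "\<dots> = (if length ws \<ge> 2 then word_class ws else 0)"
  proof (cases "length ws \<ge> 2")
    case True
    then have "(2::real) ^ length ws \<ge> 2 ^ 2" by (intro power_increasing) auto
    then show ?thesis using True by simp
  next
    case f: False
    with False have "length ws = 1" by (cases ws) (auto simp: not_le less_Suc_eq)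
    then show ?thesis by simp
  qed
  finally show ?thesis .
qed

lemma nl_perm: "mset x = mset y \<Longrightarrow> nl x = nl y"
  unfolding nl_def length_concat by (metis mset_map sum_mset_sum_list)

lemma be_zero_supp:
  assumes "nilz \<Psi>" "\<And>x y. length x + length y = length ws + 1 \<Longrightarrow> nl x + nl y = nl ws \<Longrightarrow> \<Psi> x y = 0"
  shows "be ws \<Psi> = 0"
  using assms
proof (induction ws arbitrary: \<Psi>)
  case (Cons w ws)
  have 1: "ctw w ws \<Psi> = dec w (\<lambda>u v. 0)"
    unfolding ctw_def
  proof (rule dec_cong)
    fix u v assume w: "w = u @ v"
    have "un ws (\<lambda>x y. ksgn (wdeg u) *\<^sub>R (ksgn (tdeg v * sdeg x) *\<^sub>R \<Psi> (u # x) (v # y)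
      + ksgn (tdeg u * tdeg v + tdeg u * sdeg x) *\<^sub>R \<Psi> (v # x) (u # y))) = un ws (\<lambda>x y. 0)"
    proof (rule un_cong)
      fix x y assume m: "mset x + mset y = mset ws"
      then have "mset (x @ y) = mset ws" by simp
      then have "length x + length y = length ws" "nl x + nl y = nl ws"
        using mset_eq_length[of "x @ y" ws] nl_perm[of "x @ y" ws] by simp_all
      then have "\<Psi> (u # x) (v # y) = 0" "\<Psi> (v # x) (u # y) = 0"
        by (auto intro!: Cons.prems(2) simp: w)
      then show "ksgn (wdeg u) *\<^sub>R (ksgn (tdeg v * sdeg x) *\<^sub>R \<Psi> (u # x) (v # y)
        + ksgn (tdeg u * tdeg v + tdeg u * sdeg x) *\<^sub>R \<Psi> (v # x) (u # y)) = 0" by simp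
    qed
    then show "un ws (\<lambda>x y. ksgn (wdeg u) *\<^sub>R (ksgn (tdeg v * sdeg x) *\<^sub>R \<Psi> (u # x) (v # y)
      + ksgn (tdeg u * tdeg v + tdeg u * sdeg x) *\<^sub>R \<Psi> (v # x) (u # y))) = 0" by simp
  qed
  have "be ws (pfx w \<Psi>) = 0"
  proof (rule Cons.IH[OF nilz_pfx[OF Cons.prems(1)]])
    fix x y :: "'a list list" assume "length x + length y = length ws + 1" "nl x + nl y = nl ws"
    then have "\<Psi> (w # x) y = 0" "\<Psi> x (w # y) = 0" by (auto intro!: Cons.prems(2))
    then show "pfx w \<Psi> x y = 0" by (simp add: pfx_def)
  qed
  with 1 show ?case by (simp add: be_Cons[OF Cons.prems(1)])
qed simp

text \<open>A left inverse of the cobracket on single words with at least two letters. Only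
  components with a one-letter second factor are used; that letter is appended to the Dynkin
  operator of the first factor. The denominator is the number of letters, and the minus sign
  compensates the product of the signs in \<open>ctw\<close> and \<open>sp\<close>.\<close>

definition R2 :: "'b::graded_basis list list \<Rightarrow> 'b list list \<Rightarrow> 'b cofree" where
  "R2 x y = (case x of [u] \<Rightarrow> (- 1 / real (length u + 1)) *\<^sub>R
     lin_ext (\<lambda>a. dynkin u (\<lambda>g. word_class [g @ [a]])) (cg y) | _ \<Rightarrow> 0)"

lemma R2_simps [simp]: "R2 [] y = 0" "R2 (u # v # x) y = 0" "R2 x [] = 0" "R2 x (u # v # y) = 0" "R2 x [[]] = 0"
  "R2 x [a # b # w] = 0"
  "R2 [u] [[a]] = (- 1 / real (length u + 1)) *\<^sub>R dynkin u (\<lambda>g. word_class [g @ [a]])"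
  by (auto simp: R2_def split: list.splits)

lemma dynkin_Nil [simp]: "dynkin [] \<Phi> = 0"
  by (simp add: dynkin_def)

lemma gpz_R2: "gpz R2"
  unfolding gpz_def gp_def
proof (intro conjI allI)
  show "good0 (R2 x)" for x :: "'a list list"
  proof (cases "\<exists>u. x = [u]")
    case True
    then obtain u where x: "x = [u]" by blast
    have "R2 [u] = (\<lambda>y. (- 1 / real (length u + 1)) *\<^sub>R lin_ext (\<lambda>a. dynkin u (\<lambda>g. word_class [g @ [a]])) (cg y))"
      by (simp add: R2_def fun_eq_iff)
    then show ?thesis
      unfolding x by (simp only:) (intro good0_scaleR good0_linear[OF goodD(1)[OF good_cg] linear_lin_ext])
  next
    case False
    then have "R2 x = (\<lambda>y. 0)" by (auto simp: R2_def fun_eq_iff split: list.splits)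
    then show ?thesis by simp
  qed
  show "good0 (\<lambda>x. R2 x y)" for y :: "'a list list"
  proof (rule good0I)
    fix us vs and u v :: "'a list"
    show "sh u v (\<lambda>w. R2 (us @ w # vs) y) = 0" if n: "u \<noteq> []" "v \<noteq> []"
    proof (cases "us = [] \<and> vs = []")
      case True
      have "sh u v (\<lambda>w. R2 [w] y) = sh u v (\<lambda>w. (- 1 / real (length u + length v + 1)) *\<^sub>R
          lin_ext (\<lambda>a. dynkin w (\<lambda>g. word_class [g @ [a]])) (cg y))"
        by (rule sh_cong_deg) (simp add: R2_def)
      also have "\<dots> = 0"
        unfolding sh_scale sh_lin_ext(2) by (simp add: shkD[OF shk_dynkin n])
      finally show ?thesis using True by simp
    next
      case False
      then have "R2 (us @ w # vs) y = 0" for w by (auto simp: R2_def split: list.splits) (auto simp: append_eq_Cons_conv)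
      then show ?thesis by simp
    qed
    show "R2 (us @ u # v # vs) y = ksgn (tdeg u * tdeg v) *\<^sub>R R2 (us @ v # u # vs) y"
      by (auto simp: R2_def split: list.splits)
    show "R2 ws y = 0" if "[] \<in> set ws" for ws :: "'a list list"
      using that by (auto simp: R2_def split: list.splits)
  qed
qed simp_all

lemma R2_cobracket: "tl_lift R2 (cobracket (word_class ws)) =
    (if length ws = 1 \<and> nl ws \<ge> 2 then word_class ws else 0)"
proof -
  let ?R = "\<lambda>x y. ksgn (sdeg x) *\<^sub>R R2 x y"
  have R: "tl_lift R2 (cobracket (word_class ws)) = be ws ?R"
    by (simp add: cobracket_wc be_lin[OF tl_lift_props(1)[OF gpz_R2]] tl_lift_sp[OF gpz_R2])
  have n: "nilz ?R" using gp_nilz[of R2] gpz_R2 by (simp add: gpz_def nilz_def)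
  show ?thesis
  proof (cases "length ws = 1")
    case False
    have "be ws ?R = 0"
    proof (rule be_zero_supp[OF n])
      fix x y :: "'a list list" assume "length x + length y = length ws + 1"
      with False have "length x \<noteq> 1 \<or> length y \<noteq> 1" by auto
      then show "?R x y = 0" by (auto simp: R2_def cg_zero split: list.splits)
    qed
    with False R show ?thesis by simp
  next
    case True
    then obtain w where ws: "ws = [w]" by (auto simp: length_Suc_conv)
    have b: "be ws ?R = dec w (\<lambda>u v. - R2 [u] [v] + ksgn (wdeg u * wdeg v) *\<^sub>R R2 [v] [u])"
      unfolding ws be_Cons[OF n] ctw_def by (simp add: tdeg_def ks algebra_simps)
    show ?thesis
    proof (cases "length w \<ge> 2")
      case False
      then have "w = [] \<or> (\<exists>a. w = [a])" by (cases w) (auto simp: not_le less_Suc_eq)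
      then have "be ws ?R = 0" unfolding b by auto
      with False R ws show ?thesis by simp
    next
      case t: True
      then obtain a m' where "w = a # m'" "m' \<noteq> []" by (cases w; cases "tl w") auto
      then obtain m b' where w: "w = a # m @ [b']" by (metis rev_exhaust)
      \<comment> \<open>Apart from the improper cuts, only \<open>a m | b'\<close> and
        \<open>a | m b'\<close> have a one-letter piece in the slot where \<open>R2\<close> requires
        it.\<close>
      have z: "dec m (\<lambda>u v. - R2 [a # u] [v @ [b']] + ksgn (wdeg (a # u) * wdeg (v @ [b'])) *\<^sub>R R2 [v @ [b']] [a # u])
        = - R2 [a # m] [[b']] + ksgn (bdeg a * wdeg (m @ [b'])) *\<^sub>R R2 [m @ [b']] [[a]]"
      proof -
        have l: "dec m (\<lambda>u v. if v = [] then F u else 0) = F m" "dec m (\<lambda>u v. if u = [] then G v else 0) = G m"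
          for F G :: "'a list \<Rightarrow> 'a cofree" and m :: "'a list"
        proof -
          show "dec m (\<lambda>u v. if v = [] then F u else 0) = F m"
            by (induction m arbitrary: F) simp_all
          show "dec m (\<lambda>u v. if u = [] then G v else 0) = G m" by (cases m) simp_all
        qed
        have e1: "R2 [a # u] [v @ [b']] = (if v = [] then R2 [a # u] [[b']] else 0)" for u v by (cases v; cases "tl v") auto
        have e2: "ksgn k *\<^sub>R R2 [v @ [b']] [a # u] = (if u = [] then ksgn k *\<^sub>R R2 [v @ [b']] [[a]] else 0)" for u v k by (cases u) auto
        have "dec m (\<lambda>u v. - R2 [a # u] [v @ [b']] + ksgn (wdeg (a # u) * wdeg (v @ [b'])) *\<^sub>R R2 [v @ [b']] [a # u])
          = dec m (\<lambda>u v. (if v = [] then - R2 [a # u] [[b']] else 0) + (if u = [] then ksgn (bdeg a * wdeg (v @ [b'])) *\<^sub>R R2 [v @ [b']] [[a]] else 0))"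
          by (rule dec_cong) (subst e1, subst e2, simp)
        then show ?thesis unfolding dec_add l .
      qed
      have "be ws ?R = - R2 [a # m] [[b']] + ksgn (bdeg a * wdeg (m @ [b'])) *\<^sub>R R2 [m @ [b']] [[a]]"
        unfolding b w using z by (simp add: dec_snoc)
      also have "\<dots> = (1 / real (length w)) *\<^sub>R dynkin w (\<lambda>g. word_class [g])"
        unfolding w dynkin_rec by (simp add: algebra_simps)
      also have "\<dots> = word_class [w]"
        using t by (auto simp: dynkin_shk[OF good0_shk1[OF good0_wc]])
      finally show ?thesis using R ws t by simp
    qed
  qed
qed

text \<open>Lists of several words are recovered by \<open>R1\<close>, long single words by
  \<open>R2\<close>, and letters by the projection. In particular an element with zero projection
  and zero cooperations is zero.\<close>

lemma cofree_decomp: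
  "x = lin_ext (\<lambda>a. word_class [[a]]) (cogen x) + tl_lift R1 (comult x) + tl_lift R2 (cobracket x)"
proof (rule linear_eq_cofree[of "\<lambda>x. x" "\<lambda>x. lin_ext (\<lambda>a. word_class [[a]]) (cogen x) + tl_lift R1 (comult x) + tl_lift R2 (cobracket x)"])
  show "linear (\<lambda>x::'a cofree. x)" by (simp add: linearI)
  show "linear (\<lambda>x. lin_ext (\<lambda>a. word_class [[a]]) (cogen x) + tl_lift R1 (comult x) + tl_lift R2 (cobracket x :: ('a cofree, 'a cofree) tensor))"
    using linear_compose[OF linear_cogen linear_lin_ext] linear_compose[OF linear_comult tl_lift_props(1)[OF gpz_R1]]
      linear_compose[OF linear_cobracket tl_lift_props(1)[OF gpz_R2]]
    by (intro linear_compose_add) (simp_all add: o_def)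
  fix ws :: "'a list list"
  consider "ws = []" | "ws = [[]]" | a where "ws = [[a]]" | a b w where "ws = [a # b # w]" | u v us where "ws = u # v # us"
    by (metis neq_Nil_conv)
  then show "word_class ws = lin_ext (\<lambda>a. word_class [[a]]) (cogen (word_class ws)) + tl_lift R1 (comult (word_class ws))
      + tl_lift R2 (cobracket (word_class ws))"
  proof cases
    case 2
    then have "word_class ws = 0" using good0D(3)[OF good0_wc, of ws] by simp
    then show ?thesis
      by (simp add: linear_0[OF linear_cogen] linear_0[OF linear_comult] linear_0[OF linear_cobracket]
          linear_0[OF tl_lift_props(1)[OF gpz_R1]] linear_0[OF tl_lift_props(1)[OF gpz_R2]])
  next
    case 1
    then show ?thesis
      by (simp add: linear_0[OF linear_cogen] linear_0[OF linear_comult] linear_0[OF linear_cobracket]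
          linear_0[OF tl_lift_props(1)[OF gpz_R1]] linear_0[OF tl_lift_props(1)[OF gpz_R2]])
  qed (simp_all add: R1_comult R2_cobracket cogen_wc)
qed

lemma un_zero_supp: "(\<And>x y. nl x + nl y = nl ws \<Longrightarrow> \<Psi> x y = 0) \<Longrightarrow> un ws \<Psi> = 0"
proof (induction ws arbitrary: \<Psi>)
  case (Cons w ws)
  show ?case unfolding un_Cons by (rule Cons.IH) (simp add: pfx_def Cons.prems)
qed simp

text \<open>Induction on the number of letters. The cooperations of a list involve only lists with
  fewer letters, on which \<open>D\<close> vanishes; so both cooperations vanish on its image, and
  \<open>cofree_decomp\<close> finishes.\<close>

theorem coderivation_zero:
  assumes D: "coderivation p D" and c: "\<And>x. cogen (D x) = 0"
  shows "D x = 0"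
proof -
  have lin: "linear D" and cm: "\<And>x. comult (D x) = ksgn p *\<^sub>R tensor_der p D (comult x)"
    and cb: "\<And>x. cobracket (D x) = tensor_der p D (cobracket x)"
    using D by (auto simp: coderivation_def)
  note lt = linear_tensor_der[OF lin, of p]
  have zero: "D (word_class ws) = 0" for ws
  proof (induction "nl ws" arbitrary: ws rule: less_induct)
    case less
    have z: "tensor_der p D (sp x y) = 0" if "nl x + nl y = nl ws" for x y
    proof (cases "word_class x = 0 \<or> word_class y = 0")
      case True
      then show ?thesis by (auto simp: sp_def linear_0[OF lt])
    next
      case False
      have "nl z \<noteq> 0" if "word_class z \<noteq> 0" for z :: "'a list list"
      proof
        assume "nl z = 0"
        then have "z = [] \<or> [] \<in> set z" by (cases z) auto
        then show False using that good0D(3)[OF good0_wc] by auto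
      qed
      with False that have "nl x < nl ws" "nl y < nl ws" by force+
      from less[OF this(1)] less[OF this(2)] show ?thesis by (simp add: tensor_der_sp[OF lin])
    qed
    have "comult (D (word_class ws)) = 0"
      unfolding cm comult_wc un_lin[OF lt] using un_zero_supp[of ws "\<lambda>x y. tensor_der p D (sp x y)"] z by simp
    moreover have "cobracket (D (word_class ws)) = 0"
      unfolding cb cobracket_wc be_lin[OF lt]
    proof (rule be_zero_supp)
      show "nilz (\<lambda>x y. tensor_der p D (sp x y))"
        unfolding nilz_def by (metis gp_nilz[OF gp_sp, unfolded nilz_def] linear_0[OF lt])
    qed (rule z)
    ultimately show "D (word_class ws) = 0"
      using cofree_decomp[of "D (word_class ws)"]
      by (simp add: c linear_0[OF tl_lift_props(1)[OF gpz_R1]] linear_0[OF tl_lift_props(1)[OF gpz_R2]])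
  qed
  show ?thesis
    by (rule linear_eq_cofree[OF lin, of "\<lambda>x. 0"]) (simp_all add: zero linear_zero)
qed

section \<open>Coderivations and their corestrictions\<close>

definition cor :: "('b::graded_basis cofree \<Rightarrow> 'b cofree) \<Rightarrow> 'b list list \<Rightarrow> 'b \<Rightarrow>\<^sub>0 real" where
  "cor D ws = cogen (D (word_class ws))"

lemma coderivation_linear: "coderivation p D \<Longrightarrow> linear D"
  by (simp add: coderivation_def)

lemma coderivation_deg: "coderivation p D \<Longrightarrow> x \<in> deg_part d \<Longrightarrow> D x \<in> deg_part (d + p)"
  by (auto simp: coderivation_def)

lemma subspace_keys: "subspace {z :: 'b \<Rightarrow>\<^sub>0 real. \<forall>x\<in>Poly_Mapping.keys z. P x}"
  unfolding subspace_def by (auto simp: in_keys_iff lookup_add)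

lemma wc_deg_part: "word_class ws \<in> deg_part (gr1 ws)"
  unfolding deg_part_def by (intro span_base) blast

lemma cogen_deg: "z \<in> deg_part d \<Longrightarrow> x \<in> Poly_Mapping.keys (cogen z) \<Longrightarrow> bdeg x = d"
proof -
  assume "z \<in> deg_part d"
  then have "cogen z \<in> {z. \<forall>x\<in>Poly_Mapping.keys z. bdeg x = d}"
    unfolding deg_part_def
  proof (rule linear_span_mem[OF linear_cogen subspace_keys, rotated])
    fix b :: "'a cofree" assume "b \<in> word_class ` {ws. gr1 ws = d}"
    then obtain ws where "b = word_class ws" "gr1 ws = d" by blast
    then show "cogen b \<in> {z. \<forall>x\<in>Poly_Mapping.keys z. bdeg x = d}"
      by (auto simp: cogen_wc cg_def gr1_def tdeg_def split: list.splits if_splits)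
  qed
  then show "x \<in> Poly_Mapping.keys (cogen z) \<Longrightarrow> bdeg x = d" by blast
qed

lemma cochain_cor: "coderivation p D \<Longrightarrow> cochain p (cor D)"
  unfolding cochain_def
proof
  assume D: "coderivation p D"
  show "good (cor D)"
    unfolding cor_def using good_linear_wc[OF linear_compose[OF coderivation_linear[OF D] linear_cogen]] by (simp add: o_def)
  show "homog p (cor D)"
    unfolding homog_def cor_def using cogen_deg[OF coderivation_deg[OF D wc_deg_part]] by auto
qed

lemma coderivation_add: "coderivation p D \<Longrightarrow> coderivation p E \<Longrightarrow> coderivation p (\<lambda>x. D x + E x)"
  and coderivation_scale: "coderivation p D \<Longrightarrow> coderivation p (\<lambda>x. r *\<^sub>R D x)"
proof -
  have T: "tensor_der p (\<lambda>x. D x + E x) t = tensor_der p D t + tensor_der p E t" if "linear D" "linear E" for D E :: "'a cofree \<Rightarrow> 'a cofree" and t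
    by (rule linear_eq_tensor[OF linear_tensor_der[OF linear_compose_add[OF that]] linear_compose_add[OF linear_tensor_der[OF that(1)] linear_tensor_der[OF that(2)]]])
      (simp add: tensor_der_tens linear_compose_add that tens_bilinear)
  show "coderivation p D \<Longrightarrow> coderivation p E \<Longrightarrow> coderivation p (\<lambda>x. D x + E x)"
    using coderivation_deg[of p D] coderivation_deg[of p E] unfolding coderivation_def
    by (auto intro!: linear_compose_add subspace_add[OF subspace_deg_part]
        simp: T linear_add[OF linear_comult] linear_add[OF linear_cobracket] scaleR_right_distrib image_subset_iff)
  have S: "tensor_der p (\<lambda>x. r *\<^sub>R D x) t = r *\<^sub>R tensor_der p D t" if "linear D" for D :: "'a cofree \<Rightarrow> 'a cofree" and t
    by (rule linear_eq_tensor[OF linear_tensor_der[OF linear_compose_scale_right[OF that]] linear_compose_scale_right[OF linear_tensor_der[OF that]]])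
      (simp add: tensor_der_tens linear_compose_scale_right that tens_bilinear scaleR_right_distrib)
  show "coderivation p D \<Longrightarrow> coderivation p (\<lambda>x. r *\<^sub>R D x)"
    unfolding coderivation_def
    by (auto intro!: linear_compose_scale_right subspace_scale[OF subspace_deg_part]
        simp: image_subset_iff S linear_cmul[OF linear_comult] linear_cmul[OF linear_cobracket])
qed

lemma coderivation_diff: "coderivation p D \<Longrightarrow> coderivation p E \<Longrightarrow> coderivation p (\<lambda>x. D x - E x)"
  using coderivation_add[OF _ coderivation_scale[of p E "-1"], of D] by simp

lemma cogen_cor: "coderivation p D \<Longrightarrow> cogen (D x) = pl (cor D) x"
  using linear_eq_cofree[OF linear_compose[OF coderivation_linear linear_cogen] linear_pl[OF cochainD(1)[OF cochain_cor]], of p D p D x]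
  by (simp add: o_def cochainD(1)[OF cochain_cor]) (simp add: cor_def)

lemma coderivation_eqI:
  assumes "coderivation p D" "coderivation p E" "\<And>ws. cor D ws = cor E ws"
  shows "D = E"
proof
  fix x
  have "D x - E x = 0"
  proof (rule coderivation_zero[OF coderivation_diff[OF assms(1,2)]])
    fix x
    have "cor D = cor E" using assms(3) by (rule ext)
    then show "cogen (D x - E x) = 0"
      by (simp add: linear_diff[OF linear_cogen] cogen_cor[OF assms(1)] cogen_cor[OF assms(2)])
  qed
  then show "D x = E x" by simp
qed

lemma cor_cd: "cochain p f \<Longrightarrow> cor (cd p f) = f"
  by (rule ext) (simp add: cor_def cogen_cd)

lemma cd_cor: "coderivation p D \<Longrightarrow> cd p (cor D) = D"
  by (rule coderivation_eqI[OF coderivation_cd[OF cochain_cor]]) (simp_all add: cor_cd cochain_cor)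

text \<open>Existence is \<open>coderivation_cd\<close> and uniqueness is
  \<open>coderivation_eqI\<close>, so the definite description denotes.\<close>

lemma coder_of_cd:
  assumes c: "cochain p f" and F: "F = pl f"
  shows "coder_of p F = cd p f"
  unfolding coder_of_def
proof (rule the_equality)
  show "coderivation p (cd p f) \<and> (\<forall>x. cogen (cd p f x) = F x)"
    using coderivation_cd[OF c] cogen_cor[OF coderivation_cd[OF c]] by (simp add: cor_cd[OF c] F)
  fix D assume D: "coderivation p D \<and> (\<forall>x. cogen (D x) = F x)"
  show "D = cd p f"
    by (rule coderivation_eqI[of p])
      (use D coderivation_cd[OF c] cor_cd[OF c] in \<open>simp_all add: cor_def F cochainD(1)[OF c]\<close>)
qed

lemma koszul_koszul_comm:
  assumes "coderivation p D"
  shows "D (koszul_sign q x) = ksgn (p * q) *\<^sub>R koszul_sign q (D x)"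
proof (rule linear_eq_cofree[of "\<lambda>x. D (koszul_sign q x)" "\<lambda>x. ksgn (p * q) *\<^sub>R koszul_sign q (D x)"])
  note l = coderivation_linear[OF assms]
  show "linear (\<lambda>x. D (koszul_sign q x))" "linear (\<lambda>x. ksgn (p * q) *\<^sub>R koszul_sign q (D x))"
    using linear_compose[OF linear_koszul l] linear_compose_scale_right[OF linear_compose[OF l linear_koszul]]
    by (simp_all add: o_def)
  fix ws :: "'a list list"
  have k: "koszul_sign q z = ksgn (q * d) *\<^sub>R z" if "z \<in> deg_part d" for z :: "'a cofree" and d
  proof -
    have "koszul_sign q z - ksgn (q * d) *\<^sub>R z \<in> {0}"
      using that unfolding deg_part_def
      by (rule linear_span_mem[rotated -1])
        (auto intro!: linear_compose_sub linear_compose_scale_right linear_koszul simp: koszul_sign_wc linearI subspace_def)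
    then show ?thesis by simp
  qed
  show "D (koszul_sign q (word_class ws)) = ksgn (p * q) *\<^sub>R koszul_sign q (D (word_class ws))"
    using k[OF coderivation_deg[OF assms wc_deg_part]]
    by (simp add: koszul_sign_wc linear_cmul[OF l] ks mult_ac)
qed

lemma koszul_add: "koszul_sign p (koszul_sign q x) = koszul_sign (p + q) x"
  by (rule linear_eq_cofree[of "\<lambda>x. koszul_sign p (koszul_sign q x)"])
    (use linear_compose[OF linear_koszul linear_koszul] in \<open>simp_all add: o_def linear_koszul koszul_sign_wc linear_cmul[OF linear_koszul] ks mult_ac\<close>)

theorem coderivation_supercommutator:
  assumes D: "coderivation p D" and E: "coderivation q E"
  shows "coderivation (p + q) (supercommutator p q D E)"
proof -
  note lD = coderivation_linear[OF D] and lE = coderivation_linear[OF E]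
  let ?S = "supercommutator p q D E"
  have lDE: "linear (\<lambda>x. D (E x))" "linear (\<lambda>x. E (D x))"
    using linear_compose[OF lE lD] linear_compose[OF lD lE] by (simp_all add: o_def)
  have lS: "linear ?S"
    unfolding supercommutator_def by (intro linear_compose_sub linear_compose_scale_right lDE)
  note tD = linear_tensor_der[OF lD, of p] and tE = linear_tensor_der[OF lE, of q]
  have T: "tensor_der (p + q) ?S t = tensor_der p D (tensor_der q E t) - ksgn (p * q) *\<^sub>R tensor_der q E (tensor_der p D t)" for t
  proof (rule linear_eq_tensor[of "tensor_der (p + q) ?S" "\<lambda>t. tensor_der p D (tensor_der q E t) - ksgn (p * q) *\<^sub>R tensor_der q E (tensor_der p D t)"])
    show "linear (tensor_der (p + q) ?S)" by (rule linear_tensor_der[OF lS])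
    show "linear (\<lambda>t. tensor_der p D (tensor_der q E t) - ksgn (p * q) *\<^sub>R tensor_der q E (tensor_der p D t))"
      using linear_compose[OF tE tD] linear_compose[OF tD tE]
      by (intro linear_compose_sub linear_compose_scale_right) (simp_all add: o_def)
    fix a b
    have m: "(x - y) \<otimes> z = x \<otimes> z - y \<otimes> z" "z \<otimes> (x - y) = z \<otimes> x - z \<otimes> y" for x y z :: "'a cofree"
      using linear_diff[OF linear_tens_left] linear_diff[OF linear_tens_right] by auto
    show "tensor_der (p + q) ?S (a \<otimes> b) = tensor_der p D (tensor_der q E (a \<otimes> b)) - ksgn (p * q) *\<^sub>R tensor_der q E (tensor_der p D (a \<otimes> b))"
      unfolding tensor_der_tens[OF lS] unfolding supercommutator_def
      by (simp add: tensor_der_tens lD lE linear_add[OF tD] linear_add[OF tE] m tens_bilinear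
          koszul_koszul_comm[OF D] koszul_koszul_comm[OF E] koszul_add ks algebra_simps)
  qed
  show ?thesis
    unfolding coderivation_def
  proof (intro conjI allI lS image_subsetI)
    fix x :: "'a cofree" and d assume x: "x \<in> deg_part d"
    have "D (E x) \<in> deg_part (d + q + p)" "E (D x) \<in> deg_part (d + p + q)"
      using coderivation_deg[OF D coderivation_deg[OF E x]] coderivation_deg[OF E coderivation_deg[OF D x]] .
    then show "?S x \<in> deg_part (d + (p + q))"
      unfolding supercommutator_def
      by (intro subspace_diff[OF subspace_deg_part] subspace_scale[OF subspace_deg_part]) (simp_all add: algebra_simps)
  next
    fix x
    have cD: "comult (D x) = ksgn p *\<^sub>R tensor_der p D (comult x)" "cobracket (D x) = tensor_der p D (cobracket x)" for x
      using D by (simp_all add: coderivation_def)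
    have cE: "comult (E x) = ksgn q *\<^sub>R tensor_der q E (comult x)" "cobracket (E x) = tensor_der q E (cobracket x)" for x
      using E by (simp_all add: coderivation_def)
    show "comult (?S x) = ksgn (p + q) *\<^sub>R tensor_der (p + q) ?S (comult x)"
      unfolding T by (simp add: supercommutator_def linear_diff[OF linear_comult] linear_cmul[OF linear_comult] cD cE
          linear_cmul[OF tD] linear_cmul[OF tE] ks algebra_simps)
    show "cobracket (?S x) = tensor_der (p + q) ?S (cobracket x)"
      unfolding T by (simp add: supercommutator_def linear_diff[OF linear_cobracket] linear_cmul[OF linear_cobracket] cD cE)
  qed
qed

text \<open>From here on composites are computed on corestrictions: the inner coderivation enters
  through \<open>DD\<close>, the outer one only as a test function.\<close>

lemma cor_comp:
  assumes "coderivation p D" "coderivation q E"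
  shows "cogen (D (E (word_class ws))) = DD q (cor E) ws [] (cor D)"
proof -
  have "E (word_class ws) = DD q (cor E) ws [] word_class"
    using cd_cor[OF assms(2)] cd_wc[OF cochain_cor[OF assms(2)], of ws] by simp
  then show ?thesis
    using DD_lin[OF linear_compose[OF coderivation_linear[OF assms(1)] linear_cogen], of q "cor E" ws "[]" word_class]
    by (simp add: o_def cor_def[abs_def])
qed

lemma cor_supercommutator:
  assumes "coderivation p D" "coderivation q E"
  shows "cor (supercommutator p q D E) ws = DD q (cor E) ws [] (cor D) - ksgn (p * q) *\<^sub>R DD p (cor D) ws [] (cor E)"
  unfolding cor_def[of "supercommutator p q D E"] unfolding supercommutator_def
  by (simp add: linear_diff[OF linear_cogen] linear_cmul[OF linear_cogen]
      cor_comp[OF assms] cor_comp[OF assms(2,1)])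

lemma gr_nl: "gr2 ws = int (nl ws) - int (length ws)"
  by (induction ws) (simp_all add: gr2_def)

lemma cor_part:
  assumes "coderivation p D"
  shows "(\<forall>x\<in>gr23_part i j. cogen (D x) = 0) \<longleftrightarrow> (\<forall>ws. gr2 ws = i \<longrightarrow> gr3 ws = j \<longrightarrow> cor D ws = 0)"
proof
  assume "\<forall>x\<in>gr23_part i j. cogen (D x) = 0"
  moreover have "word_class ws \<in> gr23_part i j" if "gr2 ws = i" "gr3 ws = j" for ws :: "'a list list"
    using that unfolding gr23_part_def by (intro span_base) blast
  ultimately show "\<forall>ws. gr2 ws = i \<longrightarrow> gr3 ws = j \<longrightarrow> cor D ws = 0" by (simp add: cor_def)
next
  assume a: "\<forall>ws. gr2 ws = i \<longrightarrow> gr3 ws = j \<longrightarrow> cor D ws = 0"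
  show "\<forall>x\<in>gr23_part i j. cogen (D x) = 0"
  proof
    fix x :: "'a cofree" assume "x \<in> gr23_part i j"
    then have "(cogen \<circ> D) x \<in> {0}"
      unfolding gr23_part_def
      by (rule linear_span_mem[OF linear_compose[OF coderivation_linear[OF assms] linear_cogen], rotated -1])
        (use a in \<open>auto simp: cor_def subspace_def\<close>)
    then show "cogen (D x) = 0" by simp
  qed
qed

lemma coder_hom_iff: "D \<in> coder_hom p a b \<longleftrightarrow> coderivation p D \<and> (\<forall>ws. cor D ws \<noteq> 0 \<longrightarrow> gr2 ws = - a \<and> gr3 ws = - b)"
  unfolding coder_hom_def using cor_part[of p D] by (auto, metis+)

lemma coder_tot_iff: "D \<in> coder_tot p k \<longleftrightarrow> coderivation p D \<and> (\<forall>ws. cor D ws \<noteq> 0 \<longrightarrow> gr2 ws + gr3 ws = - k)"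
  unfolding coder_tot_def using cor_part[of p D] by (auto, metis)

text \<open>The map \<open>e\<close> replaces the letters of a list \<open>y\<close> by one letter
  in one word. So words and letters each balance up to 1, and both gradings are additive.\<close>

lemma DD_support:
  assumes h: "cochain q e" and nz: "DD q e ws [] d \<noteq> 0"
  obtains x y where "d x \<noteq> 0" "e y \<noteq> 0" "gr2 ws = gr2 x + gr2 y" "gr3 ws = gr3 x + gr3 y"
proof -
  have "\<exists>x y. d x \<noteq> 0 \<and> e y \<noteq> 0 \<and> length x + length y = length ws + 1 \<and> nl x + nl y = nl ws + 1"
  proof (rule ccontr)
    assume n: "\<not> ?thesis"
    have "DD q e ws [] d \<in> {0}"
      by (rule DD_mem[OF _ cochainD(3)[OF h]]) (use n in \<open>auto simp: subspace_def\<close>)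
    with nz show False by simp
  qed
  then show thesis using that by (fastforce simp: gr_nl gr3_def)
qed

lemma supercommutator_hom:
  assumes "D \<in> coder_hom p a b" "E \<in> coder_hom q a' b'"
  shows "supercommutator p q D E \<in> coder_hom (p + q) (a + a') (b + b')"
proof -
  have D: "coderivation p D" "\<And>ws. cor D ws \<noteq> 0 \<Longrightarrow> gr2 ws = - a \<and> gr3 ws = - b"
    and E: "coderivation q E" "\<And>ws. cor E ws \<noteq> 0 \<Longrightarrow> gr2 ws = - a' \<and> gr3 ws = - b'"
    using assms by (auto simp: coder_hom_iff)
  have "gr2 ws = - (a + a') \<and> gr3 ws = - (b + b')" if nz: "cor (supercommutator p q D E) ws \<noteq> 0" for ws
  proof -
    consider "DD q (cor E) ws [] (cor D) \<noteq> 0" | "DD p (cor D) ws [] (cor E) \<noteq> 0"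
      using nz unfolding cor_supercommutator[OF D(1) E(1)] by fastforce
    then show ?thesis
    proof cases
      case 1
      from DD_support[OF cochain_cor[OF E(1)] 1] show ?thesis using D(2) E(2) by (metis minus_add_distrib)
    next
      case 2
      from DD_support[OF cochain_cor[OF D(1)] 2] show ?thesis using D(2) E(2) by (metis minus_add_distrib add.commute)
    qed
  qed
  then show ?thesis by (simp add: coder_hom_iff coderivation_supercommutator[OF D(1) E(1)])
qed

lemma coder_hom_0: "(0 :: 'b::graded_basis cofree \<Rightarrow> _) \<in> coder_hom p a b"
proof -
  have "coderivation p (\<lambda>x. 0 :: 'b cofree)"
    using coderivation_scale[of p "cd p (\<lambda>ws. 0)" 0] coderivation_cd[of p "\<lambda>ws. 0"]
    by (simp add: cochain_def good_def homog_def)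
  then show ?thesis
    by (simp add: coder_hom_iff zero_fun_def cor_def linear_0[OF linear_cogen])
qed

lemma cor_diff: "cor (D - E) ws = cor D ws - cor E ws"
  by (simp add: cor_def linear_diff[OF linear_cogen])

lemma coder_hom_diff: "D \<in> coder_hom p a b \<Longrightarrow> E \<in> coder_hom p a b \<Longrightarrow> D - E \<in> coder_hom p a b"
  unfolding coder_hom_iff cor_diff
  using coderivation_diff[of p D E] by (auto simp: fun_diff_def) (metis diff_zero)+

section \<open>Free graded commutative algebras with derivations\<close>

text \<open>
  The letters are a basis of \<open>V[1]\<close>, for \<open>V\<close> a polynomial algebra on the variables \<open>xx j\<close> of degree
  \<open>jd j\<close>, with partial derivatives \<open>der j\<close> and polynomial degree \<open>pd\<close>. The product is \<open>mul\<close> conjugated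
  with the shift, which accounts for the unusual signs; \<open>dual\<close> is the pairing of the variables given by
  the symplectic form.
\<close>

locale poly_letters =
  fixes mul :: "'b::graded_basis \<Rightarrow> 'b \<Rightarrow> 'b \<Rightarrow>\<^sub>0 real"
    and der :: "'j::finite \<Rightarrow> 'b \<Rightarrow> 'b \<Rightarrow>\<^sub>0 real"
    and xx :: "'j \<Rightarrow> 'b" and jd :: "'j \<Rightarrow> int" and dual :: "'j \<Rightarrow> 'j"
    and e :: 'b and pd :: "'b \<Rightarrow> nat"
  assumes mul_keys: "x \<in> Poly_Mapping.keys (mul a b) \<Longrightarrow> bdeg x = bdeg a + bdeg b + 1 \<and> pd x = pd a + pd b"
    and mul_comm: "mul a b = - ksgn (bdeg a * bdeg b) *\<^sub>R mul b a"
    and mul_assoc: "lin_ext (\<lambda>x. mul x c) (mul a b) = - ksgn (bdeg a) *\<^sub>R lin_ext (mul a) (mul b c)"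
    and mul_e: "mul e a = Poly_Mapping.single a 1"
    and e_deg: "bdeg e = - 1" and pd_e: "pd e = 0" and pd_0: "pd a = 0 \<Longrightarrow> a = e"
    and xx_deg: "bdeg (xx j) = jd j - 1" and pd_xx: "pd (xx j) = 1" and pd_1: "pd a = 1 \<Longrightarrow> \<exists>j. a = xx j"
    and der_keys: "x \<in> Poly_Mapping.keys (der j a) \<Longrightarrow> bdeg x = bdeg a - jd j \<and> pd x + 1 = pd a"
    and der_mul: "lin_ext (der j) (mul a b) = ksgn (jd j) *\<^sub>R (lin_ext (\<lambda>x. mul x b) (der j a)
        + ksgn (jd j * bdeg a) *\<^sub>R lin_ext (mul a) (der j b))"
    and der_xx: "der j (xx k) = (if j = k then Poly_Mapping.single e 1 else 0)"
    and der_der: "lin_ext (der j) (der k a) = ksgn (jd j * jd k) *\<^sub>R lin_ext (der k) (der j a)"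
    and euler: "(\<Sum>j\<in>UNIV. ksgn (jd j) *\<^sub>R lin_ext (mul (xx j)) (der j a)) = real (pd a) *\<^sub>R Poly_Mapping.single a 1"
    and dual_dual: "dual (dual j) = j" and jd_dual: "jd (dual j) = 1 - jd j"

section \<open>Signs of products of odd variables, and the axioms for the Schouten algebra\<close>

definition inversions :: "'n::{finite,linorder} set \<Rightarrow> 'n set \<Rightarrow> int" where
  "inversions A B = int (card {(i, j). i \<in> A \<and> j \<in> B \<and> j < i})"

lemma inversions_Un_left: "A \<inter> B = {} \<Longrightarrow> inversions (A \<union> B) C = inversions A C + inversions B C"
proof -
  assume d: "A \<inter> B = {}"
  have "{(i, j). i \<in> A \<union> B \<and> j \<in> C \<and> j < i} = {(i, j). i \<in> A \<and> j \<in> C \<and> j < i} \<union> {(i, j). i \<in> B \<and> j \<in> C \<and> j < i}" by auto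
  moreover have "card \<dots> = card {(i, j). i \<in> A \<and> j \<in> C \<and> j < i} + card {(i, j). i \<in> B \<and> j \<in> C \<and> j < i}"
    by (rule card_Un_disjoint) (use d in auto)
  ultimately show ?thesis by (simp add: inversions_def)
qed

lemma inversions_Un_right: "A \<inter> B = {} \<Longrightarrow> inversions C (A \<union> B) = inversions C A + inversions C B"
proof -
  assume d: "A \<inter> B = {}"
  have "{(i, j). i \<in> C \<and> j \<in> A \<union> B \<and> j < i} = {(i, j). i \<in> C \<and> j \<in> A \<and> j < i} \<union> {(i, j). i \<in> C \<and> j \<in> B \<and> j < i}" by auto
  moreover have "card \<dots> = card {(i, j). i \<in> C \<and> j \<in> A \<and> j < i} + card {(i, j). i \<in> C \<and> j \<in> B \<and> j < i}"
    by (rule card_Un_disjoint) (use d in auto)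
  ultimately show ?thesis by (simp add: inversions_def)
qed

lemma inversions_swap: "A \<inter> B = {} \<Longrightarrow> inversions A B + inversions B A = int (card A) * int (card B)"
proof -
  assume d: "A \<inter> B = {}"
  have "A \<times> B = {(i, j). i \<in> A \<and> j \<in> B \<and> j < i} \<union> prod.swap ` {(i, j). i \<in> B \<and> j \<in> A \<and> j < i}"
    using d by (force simp: image_iff)
  moreover have "card \<dots> = card {(i, j). i \<in> A \<and> j \<in> B \<and> j < i} + card (prod.swap ` {(i, j). i \<in> B \<and> j \<in> A \<and> j < i})"
    by (rule card_Un_disjoint) auto
  ultimately have "card (A \<times> B) = card {(i, j). i \<in> A \<and> j \<in> B \<and> j < i} + card {(i, j). i \<in> B \<and> j \<in> A \<and> j < i}"
    by (simp add: card_image)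
  then show ?thesis by (simp add: inversions_def card_cartesian_product flip: of_nat_add of_nat_mult)
qed

lemma inversions_empty [simp]: "inversions {} B = 0" "inversions A {} = 0" "inversions {i} {i} = 0"
  by (auto simp: inversions_def)

lemma inversions_single: "int (card {j \<in> A. j < i}) = inversions {i} A" "int (card {j \<in> A. i < j}) = inversions A {i}"
proof -
  have "{(k, j). k \<in> {i} \<and> j \<in> A \<and> j < k} = Pair i ` {j \<in> A. j < i}" by auto
  then show "int (card {j \<in> A. j < i}) = inversions {i} A" by (simp add: inversions_def card_image inj_on_def)
  have "{(k, j). k \<in> A \<and> j \<in> {i} \<and> j < k} = (\<lambda>k. (k, i)) ` {j \<in> A. i < j}" by auto
  then show "int (card {j \<in> A. i < j}) = inversions A {i}" by (simp add: inversions_def card_image inj_on_def)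
qed

lemma mono_mult_simp: "mono_mult (Mono \<alpha> A) (Mono \<beta> B) = (if A \<inter> B = {} then
   Poly_Mapping.single (Mono (\<lambda>i. \<alpha> i + \<beta> i) (A \<union> B)) (ksgn (inversions A B)) else 0)"
  by (simp add: inversions_def)

lemma dxi_simp: "dxi_left i (Mono \<alpha> A) = (if i \<in> A then Poly_Mapping.single (Mono \<alpha> (A - {i})) (ksgn (inversions {i} A)) else 0)"
  "dxi_right i (Mono \<alpha> A) = (if i \<in> A then Poly_Mapping.single (Mono \<alpha> (A - {i})) (ksgn (inversions A {i})) else 0)"
  by (simp_all add: inversions_single)

declare mono_mult.simps [simp del] dxi_left.simps [simp del] dxi_right.simps [simp del]

lemma to_shift_single [simp]: "to_shift (Poly_Mapping.single b c) = Poly_Mapping.single (Shift b) c"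
  by (simp add: to_shift_def single_scaleR)

lemma to_shift_0 [simp]: "to_shift 0 = 0" by (simp add: to_shift_def)

lemma linear_to_shift: "linear to_shift"
  unfolding to_shift_def by (rule linear_lin_ext)

fun smul :: "'n::{finite,linorder} mono shifted \<Rightarrow> 'n mono shifted \<Rightarrow> 'n mono shifted \<Rightarrow>\<^sub>0 real" where
  "smul (Shift a) (Shift b) = ksgn (bdeg a) *\<^sub>R to_shift (mono_mult a b)"

fun sder :: "'n + 'n \<Rightarrow> 'n::{finite,linorder} mono shifted \<Rightarrow> 'n mono shifted \<Rightarrow>\<^sub>0 real" where
  "sder (Inl i) (Shift a) = to_shift (dx i a)"
| "sder (Inr i) (Shift a) = to_shift (dxi_left i a)"

fun svar :: "'n + 'n \<Rightarrow> 'n mono shifted" where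
  "svar (Inl i) = Shift (Mono (\<lambda>k. if k = i then 1 else 0) {})"
| "svar (Inr i) = Shift (Mono (\<lambda>k. 0) {i})"

fun sjd :: "'n + 'n \<Rightarrow> int" where "sjd (Inl i) = 0" | "sjd (Inr i) = 1"
fun sdual :: "'n + 'n \<Rightarrow> 'n + 'n" where "sdual (Inl i) = Inr i" | "sdual (Inr i) = Inl i"

definition sunit :: "'n mono shifted" where "sunit = Shift (Mono (\<lambda>k. 0) {})"

fun spd :: "'n::finite mono shifted \<Rightarrow> nat" where "spd (Shift (Mono \<alpha> A)) = (\<Sum>i\<in>UNIV. \<alpha> i) + card A"

lemma smul_simp: "smul (Shift (Mono \<alpha> A)) (Shift (Mono \<beta> B)) = (if A \<inter> B = {} then
   Poly_Mapping.single (Shift (Mono (\<lambda>i. \<alpha> i + \<beta> i) (A \<union> B))) (ksgn (int (card A) + inversions A B)) else 0)"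
  by (simp add: mono_mult_simp single_scaleR ksgn_add)

lemma sder_simp: "sder (Inl i) (Shift (Mono \<alpha> A)) = Poly_Mapping.single (Shift (Mono (\<alpha>(i := \<alpha> i - 1)) A)) (real (\<alpha> i))"
  "sder (Inr i) (Shift (Mono \<alpha> A)) = (if i \<in> A then Poly_Mapping.single (Shift (Mono \<alpha> (A - {i}))) (ksgn (inversions {i} A)) else 0)"
  by (simp_all add: dxi_simp)

declare smul.simps [simp del] sder.simps [simp del]

lemma single_eqI: "k = k' \<Longrightarrow> c = c' \<Longrightarrow> Poly_Mapping.single k c = Poly_Mapping.single k' c'" by simp

lemma smul_assoc: "lin_ext (\<lambda>x. smul x c) (smul a b) = - ksgn (bdeg a) *\<^sub>R lin_ext (smul a) (smul b c)"
proof -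
  obtain \<alpha> A where a: "a = Shift (Mono \<alpha> A)" by (metis shifted.exhaust mono.exhaust)
  obtain \<beta> B where b: "b = Shift (Mono \<beta> B)" by (metis shifted.exhaust mono.exhaust)
  obtain \<gamma> C where c: "c = Shift (Mono \<gamma> C)" by (metis shifted.exhaust mono.exhaust)
  show ?thesis
  proof (cases "A \<inter> B = {} \<and> A \<inter> C = {} \<and> B \<inter> C = {}")
    case True
    then have "card (A \<union> B) = card A + card B" by (simp add: card_Un_disjoint)
    with True show ?thesis
      by (simp add: a b c smul_simp Int_Un_distrib Int_Un_distrib2 single_scaleR inversions_Un_left inversions_Un_right Un_assoc add.assoc ks single_uminus mult_ac)
  next
    case False
    then show ?thesis by (auto simp: a b c smul_simp Int_Un_distrib Int_Un_distrib2)
  qed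
qed

lemma smul_comm: "smul a b = - ksgn (bdeg a * bdeg b) *\<^sub>R smul b a"
proof -
  obtain \<alpha> A where a: "a = Shift (Mono \<alpha> A)" by (metis shifted.exhaust mono.exhaust)
  obtain \<beta> B where b: "b = Shift (Mono \<beta> B)" by (metis shifted.exhaust mono.exhaust)
  show ?thesis
  proof (cases "A \<inter> B = {}")
    case True
    have k: "ksgn (inversions A B) = ksgn (int (card A) * int (card B)) * ksgn (inversions B A)"
      using arg_cong[OF inversions_swap[OF True], of "\<lambda>k. ksgn (k - inversions B A)"] by (simp add: ksgn_diff)
    have "B \<inter> A = {}" "B \<union> A = A \<union> B" "(\<lambda>i. \<beta> i + \<alpha> i) = (\<lambda>i. \<alpha> i + \<beta> i)" using True by (auto simp: add.commute)
    then show ?thesis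
      using True by (simp add: a b smul_simp single_scaleR ks k single_uminus mult_ac)
  qed (simp add: a b smul_simp Int_commute)
qed

lemma sder_mul_even: "lin_ext (sder (Inl i)) (smul a b) = lin_ext (\<lambda>x. smul x b) (sder (Inl i) a) + lin_ext (smul a) (sder (Inl i) b)"
proof -
  obtain \<alpha> A where a: "a = Shift (Mono \<alpha> A)" by (metis shifted.exhaust mono.exhaust)
  obtain \<beta> B where b: "b = Shift (Mono \<beta> B)" by (metis shifted.exhaust mono.exhaust)
  let ?M = "Poly_Mapping.single (Shift (Mono ((\<lambda>k. \<alpha> k + \<beta> k)(i := \<alpha> i + \<beta> i - 1)) (A \<union> B)))"
  show ?thesis
  proof (cases "A \<inter> B = {}")
    case True
    let ?s = "ksgn (int (card A) + inversions A B)"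
    have 1: "real (\<alpha> i) *\<^sub>R smul (Shift (Mono (\<alpha>(i := \<alpha> i - 1)) A)) b = ?M (real (\<alpha> i) * ?s)"
    proof (cases "\<alpha> i")
      case (Suc m)
      have "(\<lambda>k. (\<alpha>(i := \<alpha> i - 1)) k + \<beta> k) = (\<lambda>k. \<alpha> k + \<beta> k)(i := \<alpha> i + \<beta> i - 1)" by (auto simp: Suc)
      then show ?thesis using True by (simp add: b smul_simp single_scaleR)
    qed simp
    have 2: "real (\<beta> i) *\<^sub>R smul a (Shift (Mono (\<beta>(i := \<beta> i - 1)) B)) = ?M (real (\<beta> i) * ?s)"
    proof (cases "\<beta> i")
      case (Suc m)
      have "(\<lambda>k. \<alpha> k + (\<beta>(i := \<beta> i - 1)) k) = (\<lambda>k. \<alpha> k + \<beta> k)(i := \<alpha> i + \<beta> i - 1)" by (auto simp: Suc)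
      then show ?thesis using True by (simp add: a smul_simp single_scaleR)
    qed simp
    have 3: "lin_ext (sder (Inl i)) (smul a b) = ?M ((real (\<alpha> i) + real (\<beta> i)) * ?s)"
      using True by (simp add: a b smul_simp sder_simp single_scaleR mult.commute)
    have "lin_ext (\<lambda>x. smul x b) (sder (Inl i) a) = ?M (real (\<alpha> i) * ?s)" "lin_ext (smul a) (sder (Inl i) b) = ?M (real (\<beta> i) * ?s)"
      unfolding 1[symmetric] 2[symmetric] by (simp_all add: a b sder_simp)
    then show ?thesis
      unfolding 3 by (simp add: distrib_right single_add)
  qed (simp add: a b smul_simp sder_simp)
qed

lemma sder_mul_odd: "lin_ext (sder (Inr i)) (smul a b) = - (lin_ext (\<lambda>x. smul x b) (sder (Inr i) a)
    + ksgn (bdeg a) *\<^sub>R lin_ext (smul a) (sder (Inr i) b))"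
proof -
  obtain \<alpha> A where a: "a = Shift (Mono \<alpha> A)" by (metis shifted.exhaust mono.exhaust)
  obtain \<beta> B where b: "b = Shift (Mono \<beta> B)" by (metis shifted.exhaust mono.exhaust)
  have cA: "int (card A) = int (card (A - {i})) + 1" if "i \<in> A"
    using that by (simp add: card_Suc_Diff1[symmetric] del: card_Diff_insert)
  have sA: "inversions {i} C + inversions C {i} = int (card C)" if "i \<notin> C" for C :: "'a set"
    using inversions_swap[of "{i}" C] that by simp
  have dl: "inversions A C = inversions {i} C + inversions (A - {i}) C" if "i \<in> A" for A C :: "'a set"
    using inversions_Un_left[of "{i}" "A - {i}" C] that by (simp add: insert_absorb)
  have dr: "inversions C A = inversions C {i} + inversions C (A - {i})" if "i \<in> A" for A C :: "'a set"
    using inversions_Un_right[of "{i}" "A - {i}" C] that by (simp add: insert_absorb)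
  consider "A \<inter> B = {}" "i \<in> A" "i \<notin> B" | "A \<inter> B = {}" "i \<notin> A" "i \<in> B" | "A \<inter> B = {}" "i \<notin> A" "i \<notin> B"
    | "A \<inter> B = {i}" | "A \<inter> B \<noteq> {}" "A \<inter> B \<noteq> {i}" by blast
  then show ?thesis
  proof cases
    case 1
    then have s: "(A - {i}) \<inter> B = {}" "A \<union> B - {i} = A - {i} \<union> B" by auto
    have "inversions {i} (A \<union> B) = inversions {i} A + inversions {i} B" using 1 by (simp add: inversions_Un_right)
    then show ?thesis using 1 s
      by (simp add: a b smul_simp sder_simp single_scaleR cA dl[of A B] ks mult_ac single_uminus lin_ext_minus)
  next
    case 2
    then have s: "A \<inter> (B - {i}) = {}" "A \<union> B - {i} = A \<union> (B - {i})" by auto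
    have "inversions {i} (A \<union> B) = int (card A) - inversions A {i} + inversions {i} B"
      using 2 sA[of A] by (simp add: inversions_Un_right)
    then show ?thesis using 2 s
      by (simp add: a b smul_simp sder_simp single_scaleR dr[of B A] ks mult_ac single_uminus lin_ext_minus)
  next
    case 3 then show ?thesis by (simp add: a b smul_simp sder_simp)
  next
    case 4
    then have i: "i \<in> A" "i \<in> B" and s: "(A - {i}) \<inter> B = {}" "A \<inter> (B - {i}) = {}" "A - {i} \<union> B = A \<union> (B - {i})" by auto
    have e1: "inversions {i} A = inversions {i} (A - {i})" "inversions {i} B = inversions {i} (B - {i})"
      using dr[OF i(1), of "{i}"] dr[OF i(2), of "{i}"] by simp_all
    have e2: "inversions (A - {i}) B = inversions (A - {i}) {i} + inversions (A - {i}) (B - {i})" by (rule dr[OF i(2)])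
    have e3: "inversions A (B - {i}) = inversions {i} (B - {i}) + inversions (A - {i}) (B - {i})" by (rule dl[OF i(1)])
    have e4: "inversions {i} (A - {i}) = int (card (A - {i})) - inversions (A - {i}) {i}" using sA[of "A - {i}"] by simp
    \<comment> \<open>The product of \<open>a\<close> and \<open>b\<close> is zero here although
      neither term of the Leibniz rule is; both are multiples of the same monomial and
      cancel.\<close>
    have "lin_ext (\<lambda>x. smul x b) (sder (Inr i) a) + ksgn (bdeg a) *\<^sub>R lin_ext (smul a) (sder (Inr i) b) = 0"
      using i s by (simp add: a b smul_simp sder_simp single_scaleR single_add[symmetric] cA[OF i(1)] e1 e2 e3 e4 ks mult_ac single_uminus)
    then show ?thesis using 4 by (simp add: a b smul_simp)
  next
    case 5
    then have "i \<in> A \<Longrightarrow> (A - {i}) \<inter> B \<noteq> {}" "i \<in> B \<Longrightarrow> A \<inter> (B - {i}) \<noteq> {}" by blast+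
    with 5 show ?thesis by (auto simp: a b smul_simp sder_simp)
  qed
qed

lemma sder_comm: "lin_ext (sder j) (sder k a) = ksgn (sjd j * sjd k) *\<^sub>R lin_ext (sder k) (sder j a)"
proof -
  obtain \<alpha> A where a: "a = Shift (Mono \<alpha> A)" by (metis shifted.exhaust mono.exhaust)
  have odd: "lin_ext (sder (Inr i)) (sder (Inr m) a) = - lin_ext (sder (Inr m)) (sder (Inr i) a)" for i m
  proof (cases "i \<in> A \<and> m \<in> A \<and> i \<noteq> m")
    case True
    have d: "inversions {k} A = inversions {k} {l} + inversions {k} (A - {l})" if "l \<in> A" for k l
      using inversions_Un_right[of "{l}" "A - {l}" "{k}"] that by (simp add: insert_absorb)
    have sw: "inversions {m} {i} + inversions {i} {m} = 1" using inversions_swap[of "{m}" "{i}"] True by simp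
    then have "ksgn (inversions {m} {i}) = - ksgn (inversions {i} {m})"
      using ksgn_add[of "inversions {m} {i}" "inversions {i} {m}"] by (simp add: ksgn_def split: if_splits)
    moreover have "A - {m} - {i} = A - {i} - {m}" by auto
    ultimately show ?thesis
      using True True[THEN conjunct2, THEN conjunct2, symmetric] d[of i m] d[of m i] by (simp add: a sder_simp single_scaleR ks mult_ac single_uminus lin_ext_minus)
  next
    case False
    then show ?thesis by (cases "i = m"; cases "i \<in> A"; cases "m \<in> A") (auto simp: a sder_simp)
  qed
  have even: "lin_ext (sder (Inl i)) (sder (Inl m) a) = lin_ext (sder (Inl m)) (sder (Inl i) a)" for i m
    by (cases "i = m") (simp_all add: a sder_simp single_scaleR fun_upd_twist mult.commute)
  have mix: "lin_ext (sder (Inl i)) (sder (Inr m) a) = lin_ext (sder (Inr m)) (sder (Inl i) a)" for i m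
    by (simp add: a sder_simp single_scaleR mult.commute)
  show ?thesis
    by (cases j; cases k) (simp_all add: even mix, simp add: odd[symmetric])
qed

text \<open>Differentiating and multiplying back counts the exponent of each variable. For an odd
  variable \<open>ksgn (sjd j)\<close> compensates the sign that \<open>smul\<close> attaches to an
  odd first factor.\<close>

lemma seuler: "(\<Sum>j\<in>UNIV. ksgn (sjd j) *\<^sub>R lin_ext (smul (svar j)) (sder j a)) = real (spd a) *\<^sub>R Poly_Mapping.single a 1"
proof -
  obtain \<alpha> A where a: "a = Shift (Mono \<alpha> A)" by (metis shifted.exhaust mono.exhaust)
  have 1: "lin_ext (smul (svar (Inl i))) (sder (Inl i) a) = real (\<alpha> i) *\<^sub>R Poly_Mapping.single a 1" for i
  proof (cases "\<alpha> i")
    case (Suc m)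
    have "(\<lambda>k. (if k = i then 1 else 0) + (\<alpha>(i := \<alpha> i - 1)) k) = \<alpha>" by (auto simp: Suc)
    then show ?thesis by (simp add: a sder_simp smul_simp)
  qed (simp add: a sder_simp)
  have 2: "lin_ext (smul (svar (Inr i))) (sder (Inr i) a) = - (if i \<in> A then 1 else 0) *\<^sub>R Poly_Mapping.single a 1" for i
  proof (cases "i \<in> A")
    case True
    then have "inversions {i} A = inversions {i} (A - {i})"
      using inversions_Un_right[of "{i}" "A - {i}" "{i}"] by (simp add: insert_absorb)
    then show ?thesis using True by (simp add: a sder_simp smul_simp single_scaleR ks insert_absorb single_uminus)
  qed (simp add: a sder_simp)
  have "(\<Sum>j\<in>UNIV. ksgn (sjd j) *\<^sub>R lin_ext (smul (svar j)) (sder j a)) =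
    (\<Sum>i\<in>UNIV. real (\<alpha> i) *\<^sub>R Poly_Mapping.single a 1) + (\<Sum>i\<in>UNIV. (if i \<in> A then 1 else 0) *\<^sub>R Poly_Mapping.single a 1)"
    by (subst UNIV_Plus_UNIV[symmetric], subst sum.Plus) (simp_all add: 1 2 o_def del: svar.simps scaleR_minus_left)
  also have "\<dots> = real (spd a) *\<^sub>R Poly_Mapping.single a 1"
    using sum.If_cases[of UNIV "\<lambda>i. i \<in> A" "\<lambda>i. 1::real" "\<lambda>i. 0"]
    unfolding scaleR_sum_left[symmetric] scaleR_left_distrib[symmetric] by (simp add: a)
  finally show ?thesis .
qed

lemma schouten_letters: "poly_letters smul sder svar sjd sdual (sunit :: 'n::{finite,linorder} mono shifted) spd"
proof
  fix a b c x :: "'n::{finite,linorder} mono shifted" and j k :: "'n + 'n"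
  obtain \<alpha> A where a: "a = Shift (Mono \<alpha> A)" by (metis shifted.exhaust mono.exhaust)
  obtain \<beta> B where b: "b = Shift (Mono \<beta> B)" by (metis shifted.exhaust mono.exhaust)
  show "x \<in> Poly_Mapping.keys (smul a b) \<Longrightarrow> bdeg x = bdeg a + bdeg b + 1 \<and> spd x = spd a + spd b"
    by (auto simp: a b smul_simp card_Un_disjoint sum.distrib split: if_splits)
  show "smul a b = - ksgn (bdeg a * bdeg b) *\<^sub>R smul b a" by (rule smul_comm)
  show "lin_ext (\<lambda>x. smul x c) (smul a b) = - ksgn (bdeg a) *\<^sub>R lin_ext (smul a) (smul b c)" by (rule smul_assoc)
  show "smul sunit a = Poly_Mapping.single a 1" by (simp add: sunit_def a smul_simp)
  show "bdeg (sunit :: 'n mono shifted) = - 1" "spd (sunit :: 'n mono shifted) = 0" by (simp_all add: sunit_def)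
  show "a = sunit" if "spd a = 0" using that by (auto simp: a sunit_def)
  show "bdeg (svar j) = sjd j - 1" "spd (svar j) = 1" by (cases j; simp)+
  show "\<exists>j. a = svar j" if "spd a = 1"
  proof (cases "card A = 0")
    case True
    with that have s: "(\<Sum>i\<in>UNIV. \<alpha> i) = 1" by (simp add: a)
    then obtain i where i: "\<alpha> i = 1" "\<And>k. k \<noteq> i \<Longrightarrow> \<alpha> k = 0" using sum_eq_1_iff[of UNIV \<alpha>] by auto
    then have "\<alpha> = (\<lambda>k. if k = i then 1 else 0)" by auto
    then have "a = svar (Inl i)" using True by (simp add: a)
    then show ?thesis ..
  next
    case False
    with that have "card A = 1" "(\<Sum>i\<in>UNIV. \<alpha> i) = 0" unfolding a spd.simps by linarith+
    then have "card A = 1" "\<alpha> = (\<lambda>k. 0)" by auto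
    then obtain i where "A = {i}" by (auto simp: card_1_singleton_iff)
    then have "a = svar (Inr i)" using \<open>\<alpha> = (\<lambda>k. 0)\<close> by (simp add: a)
    then show ?thesis ..
  qed
  show "bdeg x = bdeg a - sjd j \<and> spd x + 1 = spd a" if "x \<in> Poly_Mapping.keys (sder j a)"
  proof (cases j)
    case (Inl i)
    have "(\<Sum>k\<in>UNIV. (\<alpha>(i := \<alpha> i - 1)) k) + 1 = (\<Sum>k\<in>UNIV. \<alpha> k)" if "\<alpha> i \<noteq> 0"
      using that by (simp add: sum.remove[of UNIV i])
    then show ?thesis using that by (auto simp: Inl a sder_simp split: if_splits)
  next
    case (Inr i)
    then have "i \<in> A" using that by (auto simp: a sder_simp split: if_splits)
    then have "card A = card (A - {i}) + 1" by (simp add: card_Suc_Diff1[symmetric] del: card_Diff_insert)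
    then show ?thesis using that by (auto simp: Inr a sder_simp split: if_splits)
  qed
  show "lin_ext (sder j) (smul a b) = ksgn (sjd j) *\<^sub>R (lin_ext (\<lambda>x. smul x b) (sder j a)
        + ksgn (sjd j * bdeg a) *\<^sub>R lin_ext (smul a) (sder j b))"
    by (cases j) (simp_all add: sder_mul_even sder_mul_odd)
  show "sder j (svar k) = (if j = k then Poly_Mapping.single sunit 1 else 0)"
    by (cases j; cases k) (auto simp: sder_simp sunit_def intro!: single_eqI)
  show "lin_ext (sder j) (sder k a) = ksgn (sjd j * sjd k) *\<^sub>R lin_ext (sder k) (sder j a)" by (rule sder_comm)
  show "(\<Sum>j\<in>UNIV. ksgn (sjd j) *\<^sub>R lin_ext (smul (svar j)) (sder j a)) = real (spd a) *\<^sub>R Poly_Mapping.single a 1" by (rule seuler)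
  show "sdual (sdual j) = j" "sjd (sdual j) = 1 - sjd j" by (cases j; simp)+
qed

definition hom :: "int \<Rightarrow> ('b::graded_basis \<Rightarrow>\<^sub>0 real) \<Rightarrow> bool" where
  "hom d x \<longleftrightarrow> (\<forall>k\<in>Poly_Mapping.keys x. bdeg k = d)"

lemma hom_single [intro]: "hom (bdeg a) (Poly_Mapping.single a c)"
  by (simp add: hom_def)

lemma lin_ext_scale_const: "(\<And>k. k \<in> Poly_Mapping.keys x \<Longrightarrow> f k = r) \<Longrightarrow> lin_ext (\<lambda>k. f k *\<^sub>R \<Phi> k) x = r *\<^sub>R lin_ext \<Phi> x"
  unfolding lin_ext_fun_scale[symmetric] by (rule lin_ext_cong) simp

lemma hom_lin_ext: "(\<And>k. k \<in> Poly_Mapping.keys x \<Longrightarrow> hom d (f k)) \<Longrightarrow> hom d (lin_ext f x)"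
  unfolding hom_def by (blast elim: keys_lin_ext)

text \<open>Test function form of the derivation of the symmetric algebra on words that extends a
  map \<open>g\<close> of degree \<open>q\<close> from single words.\<close>

primrec hat :: "int \<Rightarrow> ('b::graded_basis list \<Rightarrow> 'b list \<Rightarrow>\<^sub>0 real) \<Rightarrow> 'b list list \<Rightarrow>
    ('b list list \<Rightarrow> 'v) \<Rightarrow> 'v::real_vector" where
  "hat q g [] \<phi> = 0"
| "hat q g (w # ws) \<phi> = lin_ext (\<lambda>v. \<phi> (v # ws)) (g w) + ksgn (q * tdeg w) *\<^sub>R hat q g ws (\<lambda>y. \<phi> (w # y))"

lemma hat_mem:
  assumes "subspace S"
    and "\<And>us w vs v. ws = us @ w # vs \<Longrightarrow> v \<in> Poly_Mapping.keys (g w) \<Longrightarrow> \<phi> (us @ v # vs) \<in> S"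
  shows "hat q g ws \<phi> \<in> S"
  using assms(2)
proof (induction ws arbitrary: \<phi>)
  case (Cons w ws)
  have "lin_ext (\<lambda>v. \<phi> (v # ws)) (g w) \<in> S"
    unfolding lin_ext_def using Cons.prems[of "[]" w ws] assms(1) by (auto intro!: subspace_sum subspace_scale)
  moreover have "hat q g ws (\<lambda>y. \<phi> (w # y)) \<in> S"
    by (rule Cons.IH) (use Cons.prems[of "w # us" for us] in auto)
  ultimately show ?case using assms(1) by (auto intro!: subspace_add subspace_scale)
qed (use assms(1) in \<open>simp add: subspace_0\<close>)

lemma DD_single_step:
  fixes \<phi> :: "'b::graded_basis list list \<Rightarrow> 'v::real_vector"
  assumes h: "homog p f" and s: "\<And>vs. f vs \<noteq> 0 \<Longrightarrow> length vs = 1" and g: "good0 \<phi>"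
  shows "DD p f ws [w] \<phi> = GG p f [w] (\<lambda>g. \<phi> (g # ws))"
  using g
proof (induction ws arbitrary: \<phi>)
  case (Cons v ws)
  have z: "DD p f ws z \<psi> = 0" if "length z \<ge> 2" for ws z and \<psi> :: "'b list list \<Rightarrow> 'v"
    using that
  proof (induction ws arbitrary: z \<psi>)
    case Nil
    have "GG p f z (\<lambda>g. \<psi> [g]) \<in> {0}"
      by (rule GG_mem[OF _ h]) (use s Nil in \<open>auto simp: subspace_def\<close>)
    then show ?case by simp
  qed simp
  have "GG p f [w] (\<lambda>g. ksgn ((p + tdeg w) * tdeg v) *\<^sub>R \<phi> (v # g # ws)) = GG p f [w] (\<lambda>g. \<phi> (g # v # ws))"
  proof (rule GG_cong[OF h])
    fix g :: "'b list" assume "tdeg g = p + sdeg [w]"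
    then show "ksgn ((p + tdeg w) * tdeg v) *\<^sub>R \<phi> (v # g # ws) = \<phi> (g # v # ws)"
      by (subst good0D_hd(2)[OF Cons.prems, of g v ws]) simp
  qed
  then show ?case
    using z[of "[w, v]"] Cons.IH[OF good0_Cons[OF Cons.prems]] by (simp add: GG_scale)
qed simp

text \<open>If \<open>f\<close> accepts only one word, an accumulator with two words contributes
  nothing, and the coderivation is the derivation extending its action \<open>G\<close> on one
  word.\<close>

lemma DD_single:
  fixes \<phi> :: "'b::graded_basis list list \<Rightarrow> 'v::real_vector"
  assumes h: "homog p f" and s: "\<And>vs. f vs \<noteq> 0 \<Longrightarrow> length vs = 1" and g: "good0 \<phi>"
    and G: "\<And>w (\<Phi> :: 'b list \<Rightarrow> 'v). GG p f [w] \<Phi> = lin_ext \<Phi> (G w)"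
  shows "DD p f ws [] \<phi> = hat p G ws \<phi>"
  using g
proof (induction ws arbitrary: \<phi>)
  case Nil
  have "f [] = 0" using s[of "[]"] by auto
  then show ?case by simp
next
  case (Cons w ws)
  then show ?case by (simp add: DD_single_step[OF h s] G good0_Cons)
qed

text \<open>A one-letter word with an empty middle piece is killed by \<open>f\<close>, so all words
  enter \<open>f\<close> whole.\<close>

lemma GG_letters:
  fixes \<Phi> :: "'b::graded_basis list \<Rightarrow> 'v::real_vector"
  assumes f: "good0 f" and z: "\<forall>w\<in>set z. length w = 1"
  shows "GG p f z \<Phi> = lin_ext (\<lambda>x. \<Phi> [x]) (f z)"
proof -
  have "nn z \<Theta> = \<Theta> [] z []" if "\<And>A vs B. [] \<in> set vs \<Longrightarrow> \<Theta> A vs B = 0"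
    for \<Theta> :: "'b list \<Rightarrow> 'b list list \<Rightarrow> 'b list \<Rightarrow> 'v"
    using z that
  proof (induction z arbitrary: \<Theta>)
    case (Cons w z)
    then obtain a where w: "w = [a]" by (auto simp: length_Suc_conv)
    have "nn z (\<lambda>A vs B. ksgn (wdeg A * (tdeg v + wdeg t) + sdeg vs * wdeg t) *\<^sub>R sh u A (\<lambda>A'. sh t B (\<lambda>B'. \<Theta> A' (v # vs) B')))
        = ksgn (sdeg z * wdeg t) *\<^sub>R \<Theta> u (v # z) t" for u v t
    proof (subst Cons.IH)
      fix A B :: "'b list" and vs :: "'b list list" assume "[] \<in> set vs"
      then have "\<Theta> A' (v # vs) = (\<lambda>B'. 0)" for A' using Cons.prems(2) by auto
      then show "ksgn (wdeg A * (tdeg v + wdeg t) + sdeg vs * wdeg t) *\<^sub>R sh u A (\<lambda>A'. sh t B (\<lambda>B'. \<Theta> A' (v # vs) B')) = 0" by simp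
    qed (use Cons.prems in simp_all)
    then show ?case using Cons.prems(2) by (simp add: w dec3_def)
  qed simp
  from this[of "\<lambda>A vs B. ksgn (p * wdeg A) *\<^sub>R lin_ext (\<lambda>x. \<Phi> (A @ x # B)) (f vs)"] show ?thesis
    unfolding GG_def using good0D(3)[OF f] by simp
qed

section \<open>Graded product rules, the Poisson bracket and its Jacobi identity\<close>

context poly_letters
begin

definition M :: "('b \<Rightarrow>\<^sub>0 real) \<Rightarrow> ('b \<Rightarrow>\<^sub>0 real) \<Rightarrow> 'b \<Rightarrow>\<^sub>0 real" where
  "M x y = lin_ext (\<lambda>a. lin_ext (mul a) y) x"

definition dv :: "'j \<Rightarrow> ('b \<Rightarrow>\<^sub>0 real) \<Rightarrow> 'b \<Rightarrow>\<^sub>0 real" where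
  "dv j = lin_ext (der j)"

lemma M_simps: "M (x + x') y = M x y + M x' y" "M x (y + y') = M x y + M x y'"
  "M (r *\<^sub>R x) y = r *\<^sub>R M x y" "M x (r *\<^sub>R y) = r *\<^sub>R M x y"
  "M (- x) y = - M x y" "M x (- y) = - M x y" "M 0 y = 0" "M x 0 = 0"
  "M (x - x') y = M x y - M x' y" "M x (y - y') = M x y - M x y'"
  "M (sum f I) y = (\<Sum>i\<in>I. M (f i) y)" "M x (sum f I) = (\<Sum>i\<in>I. M x (f i))"
  by (simp_all add: M_def le_simps)

lemma M_single: "M (Poly_Mapping.single a 1) (Poly_Mapping.single b 1) = mul a b"
  "M (Poly_Mapping.single a 1) y = lin_ext (mul a) y" "M x (Poly_Mapping.single b 1) = lin_ext (\<lambda>x. mul x b) x"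
  by (simp_all add: M_def)

lemma dv_simps: "dv j (x + y) = dv j x + dv j y" "dv j (r *\<^sub>R x) = r *\<^sub>R dv j x" "dv j (- x) = - dv j x"
  "dv j 0 = 0" "dv j (x - y) = dv j x - dv j y" "dv j (sum f I) = (\<Sum>i\<in>I. dv j (f i))"
  "dv j (Poly_Mapping.single a c) = c *\<^sub>R der j a"
  by (simp_all add: dv_def le_simps)

lemma hom_mul: "hom (bdeg a + bdeg b + 1) (mul a b)"
  using mul_keys by (simp add: hom_def)

lemma hom_der: "hom (bdeg a - jd j) (der j a)"
  using der_keys by (simp add: hom_def)

lemma hom_M: "hom p x \<Longrightarrow> hom q y \<Longrightarrow> hom (p + q + 1) (M x y)"
  unfolding M_def using hom_mul by (intro hom_lin_ext) (auto simp: hom_def)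

lemma hom_dv: "hom p x \<Longrightarrow> hom (p - jd j) (dv j x)"
  unfolding dv_def using hom_der by (intro hom_lin_ext) (auto simp: hom_def)

lemma M_comm:
  assumes "hom p x" "hom q y"
  shows "M x y = - ksgn (p * q) *\<^sub>R M y x"
proof -
  have "M x y = lin_ext (\<lambda>a. lin_ext (\<lambda>b. (- ksgn (p * q)) *\<^sub>R mul b a) y) x"
    unfolding M_def by (intro lin_ext_cong, subst mul_comm) (use assms in \<open>simp add: hom_def\<close>)
  also have "\<dots> = - ksgn (p * q) *\<^sub>R M y x"
    unfolding M_def lin_ext_fun_scale lin_ext_swap[of _ y x] ..
  finally show ?thesis .
qed

lemma M_assoc:
  assumes "hom p x"
  shows "M (M x y) z = - ksgn p *\<^sub>R M x (M y z)"
proof -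
  have "M (M x y) z = lin_ext (\<lambda>a. lin_ext (\<lambda>b. lin_ext (\<lambda>c. lin_ext (\<lambda>w. mul w c) (mul a b)) z) y) x"
    unfolding M_def lin_ext_lin_ext by (intro lin_ext_cong lin_ext_swap)
  also have "\<dots> = lin_ext (\<lambda>a. lin_ext (\<lambda>b. lin_ext (\<lambda>c. (- ksgn p) *\<^sub>R lin_ext (mul a) (mul b c)) z) y) x"
    by (intro lin_ext_cong) (use assms mul_assoc in \<open>simp add: hom_def\<close>)
  also have "\<dots> = - ksgn p *\<^sub>R M x (M y z)"
    unfolding M_def lin_ext_fun_scale lin_ext_lin_ext ..
  finally show ?thesis .
qed

lemma dv_M:
  assumes "hom p x"
  shows "dv j (M x y) = ksgn (jd j) *\<^sub>R (M (dv j x) y + ksgn (jd j * p) *\<^sub>R M x (dv j y))"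
proof -
  have "dv j (M x y) = lin_ext (\<lambda>a. lin_ext (\<lambda>b. ksgn (jd j) *\<^sub>R (lin_ext (\<lambda>x. mul x b) (der j a) + ksgn (jd j * p) *\<^sub>R lin_ext (mul a) (der j b))) y) x"
    unfolding M_def dv_def lin_ext_lin_ext by (intro lin_ext_cong) (use assms der_mul in \<open>simp add: hom_def\<close>)
  moreover have "lin_ext (\<lambda>a. lin_ext (\<lambda>b. lin_ext (\<lambda>x. mul x b) (der j a)) y) x = M (dv j x) y"
    unfolding M_def dv_def lin_ext_lin_ext by (intro lin_ext_cong lin_ext_swap)
  ultimately show ?thesis
    unfolding lin_ext_fun_scale lin_ext_fun_add by (simp add: M_def[of x] dv_def lin_ext_lin_ext)
qed

lemma dv_dv: "dv j (dv k x) = ksgn (jd j * jd k) *\<^sub>R dv k (dv j x)"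
proof -
  have "dv j (dv k x) = lin_ext (\<lambda>a. ksgn (jd j * jd k) *\<^sub>R lin_ext (der k) (der j a)) x"
    unfolding dv_def lin_ext_lin_ext by (intro lin_ext_cong der_der)
  then show ?thesis by (simp add: lin_ext_fun_scale dv_def lin_ext_lin_ext)
qed

text \<open>The Poisson bracket in which every variable is paired with its dual;
  \<open>schouten_brk\<close> identifies it with the shifted Schouten bracket.\<close>

definition brk :: "'b \<Rightarrow> 'b \<Rightarrow> 'b \<Rightarrow>\<^sub>0 real" where
  "brk a b = - (\<Sum>j\<in>UNIV. ksgn (jd j * bdeg a) *\<^sub>R M (der j a) (der (dual j) b))"

lemma sum_dual: "(\<Sum>j\<in>UNIV. F j) = (\<Sum>j\<in>UNIV. F (dual j))" for F :: "'j \<Rightarrow> 'v::real_vector"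
  by (rule sum.reindex_bij_witness[of _ dual dual]) (simp_all add: dual_dual)

lemma hom_sum: "(\<And>i. i \<in> I \<Longrightarrow> hom d (f i)) \<Longrightarrow> hom d (sum f I)"
  unfolding hom_def using keys_sum by (metis (no_types, lifting) UN_E subsetD)

lemma hom_scale: "hom d x \<Longrightarrow> hom d (r *\<^sub>R x)" and hom_uminus: "hom d x \<Longrightarrow> hom d (- x)"
  by (auto simp: hom_def in_keys_iff)

lemma hom_brk: "hom (bdeg a + bdeg b) (brk a b)"
  unfolding brk_def
proof (intro hom_sum hom_scale hom_uminus)
  fix j
  show "hom (bdeg a + bdeg b) (M (der j a) (der (dual j) b))"
    using hom_M[OF hom_der[of a j] hom_der[of b "dual j"]] by (simp add: jd_dual)
qed

lemma brk_sym: "brk a b = ksgn ((bdeg a - 1) * (bdeg b - 1)) *\<^sub>R brk b a"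
proof -
  have "ksgn (jd j * bdeg a) *\<^sub>R M (der j a) (der (dual j) b)
      = ksgn ((bdeg a - 1) * (bdeg b - 1)) *\<^sub>R ksgn (jd (dual j) * bdeg b) *\<^sub>R M (der (dual j) b) (der (dual (dual j)) a)" for j
    unfolding M_comm[OF hom_der[of a j] hom_der[of b "dual j"]] by (simp add: dual_dual jd_dual ks mult_ac)
  then show ?thesis
    unfolding brk_def sum_dual[of "\<lambda>j. ksgn (jd j * bdeg b) *\<^sub>R M (der j b) (der (dual j) a)"]
    by (simp add: scaleR_sum_right)
qed

lemma brk_lin: "lin_ext (brk a) y = - (\<Sum>j\<in>UNIV. ksgn (jd j * bdeg a) *\<^sub>R M (der j a) (dv (dual j) y))"
proof -
  have "lin_ext (\<lambda>b. M z (der k b)) y = M z (dv k y)" for z k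
    unfolding M_def dv_def lin_ext_lin_ext by (subst lin_ext_swap) (simp add: lin_ext_lin_ext)
  then show ?thesis unfolding brk_def by (simp add: lin_ext_fun_minus lin_ext_fun_sum lin_ext_fun_scale)
qed

text \<open>The derivation rule \<open>dv_M\<close> splits each summand in two; associativity and
  commutativity of \<open>M\<close> then move the undifferentiated factor outside.\<close>

lemma brk_mul: "lin_ext (\<lambda>x. brk x c) (mul a b)
    = - (ksgn (bdeg a) *\<^sub>R lin_ext (mul a) (brk b c) + ksgn (bdeg b * (bdeg c - 1)) *\<^sub>R lin_ext (\<lambda>x. mul x b) (brk a c))"
proof -
  let ?A = "Poly_Mapping.single a 1" and ?B = "Poly_Mapping.single b 1"
  have X: "lin_ext (\<lambda>x. brk x c) (mul a b) = - (\<Sum>j\<in>UNIV. ksgn (jd j * (bdeg a + bdeg b + 1)) *\<^sub>R M (dv j (M ?A ?B)) (der (dual j) c))"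
  proof -
    have "lin_ext (\<lambda>x. brk x c) (mul a b) = lin_ext (\<lambda>x. - (\<Sum>j\<in>UNIV. ksgn (jd j * (bdeg a + bdeg b + 1)) *\<^sub>R M (der j x) (der (dual j) c))) (mul a b)"
      unfolding brk_def by (rule lin_ext_cong) (simp add: mul_keys)
    moreover have "lin_ext (\<lambda>x. M (der j x) z) y = M (dv j y) z" for j y z
      by (simp add: M_def dv_def lin_ext_lin_ext)
    ultimately show ?thesis by (simp add: lin_ext_fun_minus lin_ext_fun_sum lin_ext_fun_scale M_single)
  qed
  have Y: "ksgn (jd j * (bdeg a + bdeg b + 1)) *\<^sub>R M (dv j (M ?A ?B)) (der (dual j) c)
    = - (ksgn (bdeg a) *\<^sub>R M ?A (ksgn (jd j * bdeg b) *\<^sub>R M (der j b) (der (dual j) c))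
        + ksgn (bdeg b * (bdeg c - 1)) *\<^sub>R M (ksgn (jd j * bdeg a) *\<^sub>R M (der j a) (der (dual j) c)) ?B)" for j
  proof -
    have 1: "M (M (der j a) ?B) (der (dual j) c) = - ksgn (bdeg b * (bdeg c - 1 + jd j)) *\<^sub>R M (M (der j a) (der (dual j) c)) ?B"
      using M_assoc[OF hom_der[of a j]] M_comm[OF hom_single[of b 1] hom_der[of c "dual j"]]
      by (simp add: M_simps jd_dual ks mult_ac)
    show ?thesis
      by (simp add: dv_M[OF hom_single] M_simps dv_simps 1 M_assoc[OF hom_single] jd_dual ks algebra_simps)
  qed
  show ?thesis
    unfolding X unfolding Y M_single(2,3)[symmetric] unfolding brk_def M_simps
    by (simp add: scaleR_sum_right sum.distrib sum_negf sum_subtractf)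
qed

text \<open>The terms of the double bracket in which both brackets differentiate the second argument.\<close>

definition J3 :: "'b \<Rightarrow> 'b \<Rightarrow> 'b \<Rightarrow> 'b \<Rightarrow>\<^sub>0 real" where
  "J3 a b c = (\<Sum>j\<in>UNIV. \<Sum>k\<in>UNIV. ksgn (jd j * bdeg a + jd k * bdeg b + 1 + jd j) *\<^sub>R
     M (der j a) (M (dv (dual j) (der k b)) (der (dual k) c)))"

text \<open>The outer bracket differentiates the derivative of \<open>b\<close> or that of
  \<open>c\<close>. The second case becomes \<open>J3 a c b\<close> after exchanging the two inner
  factors and replacing \<open>k\<close> by its dual.\<close>

lemma brk_brk: "lin_ext (brk a) (brk b c) = J3 a b c + ksgn ((bdeg b - 1) * (bdeg c - 1)) *\<^sub>R J3 a c b"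
proof -
  let ?s = "\<lambda>j k. ksgn (jd j * bdeg a + jd k * bdeg b + 1 + jd j)"
  let ?T = "\<lambda>j k. ksgn ((1 - jd j) * (bdeg b - jd k)) *\<^sub>R M (der k b) (dv (dual j) (der (dual k) c))"
  have "lin_ext (brk a) (brk b c) = (\<Sum>j\<in>UNIV. \<Sum>k\<in>UNIV. ?s j k *\<^sub>R
     M (der j a) (M (dv (dual j) (der k b)) (der (dual k) c) + ?T j k))"
    unfolding brk_lin brk_def[of b]
    by (simp add: dv_simps dv_M[OF hom_der] M_simps sum_negf scaleR_sum_right jd_dual ks mult_ac)
  also have "\<dots> = J3 a b c + (\<Sum>j\<in>UNIV. \<Sum>k\<in>UNIV. ?s j k *\<^sub>R M (der j a) (?T j k))"
    by (simp add: J3_def M_simps scaleR_right_distrib sum.distrib)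
  also have "(\<Sum>j\<in>UNIV. \<Sum>k\<in>UNIV. ?s j k *\<^sub>R M (der j a) (?T j k)) = ksgn ((bdeg b - 1) * (bdeg c - 1)) *\<^sub>R J3 a c b"
  proof -
    have "?s j k *\<^sub>R M (der j a) (?T j k) = ksgn ((bdeg b - 1) * (bdeg c - 1)) *\<^sub>R
       ksgn (jd j * bdeg a + jd (dual k) * bdeg c + 1 + jd j) *\<^sub>R M (der j a) (M (dv (dual j) (der (dual k) c)) (der (dual (dual k)) b))" for j k
      unfolding M_comm[OF hom_der[of b k] hom_dv[OF hom_der[of c "dual k"], of "dual j"]]
      by (simp add: M_simps dual_dual jd_dual ks mult_ac)
    then show ?thesis
      unfolding J3_def scaleR_sum_right
      by (subst sum_dual[of "\<lambda>k. ksgn ((bdeg b - 1) * (bdeg c - 1)) *\<^sub>R ksgn (jd j * bdeg a + jd k * bdeg c + 1 + jd j) *\<^sub>R M (der j a) (M (dv (dual j) (der k c)) (der (dual k) b))" for j]) simp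
  qed
  finally show ?thesis .
qed

text \<open>Reading the triple product backwards exchanges \<open>j\<close> and \<open>k\<close> up
  to duality. The second derivatives of \<open>b\<close> commute by \<open>dv_dv\<close>, and the
  reorderings \<open>1\<close> to \<open>5\<close> produce the sign.\<close>

lemma J3_sym: "J3 c b a = ksgn (bdeg a * bdeg b + bdeg b * bdeg c + bdeg c * bdeg a + bdeg a + bdeg c) *\<^sub>R J3 a b c"
proof -
  have "ksgn (jd (dual k) * bdeg c + jd (dual j) * bdeg b + 1 + jd (dual k)) *\<^sub>R
      M (der (dual k) c) (M (dv (dual (dual k)) (der (dual j) b)) (der (dual (dual j)) a))
    = ksgn (bdeg a * bdeg b + bdeg b * bdeg c + bdeg c * bdeg a + bdeg a + bdeg c) *\<^sub>R
      ksgn (jd j * bdeg a + jd k * bdeg b + 1 + jd j) *\<^sub>R M (der j a) (M (dv (dual j) (der k b)) (der (dual k) c))" for j k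
  proof -
    define P Z R where PZR: "P = der (dual k) c" "Z = dv (dual j) (der k b)" "R = der j a"
    have h: "hom (bdeg c - (1 - jd k)) P" "hom (bdeg b - jd k - (1 - jd j)) Z" "hom (bdeg a - jd j) R"
      unfolding PZR jd_dual[symmetric] by (intro hom_der hom_dv)+
    have z: "dv k (der (dual j) b) = ksgn (jd k * (1 - jd j)) *\<^sub>R Z"
      using dv_dv[of k "dual j" "Poly_Mapping.single b 1"] by (simp add: dv_simps PZR jd_dual)
    have 1: "M Z R = - ksgn ((bdeg b - jd k - (1 - jd j)) * (bdeg a - jd j)) *\<^sub>R M R Z" by (rule M_comm[OF h(2,3)])
    have 2: "M P (M R Z) = - ksgn (bdeg c - (1 - jd k)) *\<^sub>R M (M P R) Z" by (simp add: M_assoc[OF h(1)])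
    have 3: "M P R = - ksgn ((bdeg c - (1 - jd k)) * (bdeg a - jd j)) *\<^sub>R M R P" by (rule M_comm[OF h(1,3)])
    have 4: "M (M R P) Z = - ksgn (bdeg a - jd j) *\<^sub>R M R (M P Z)" by (rule M_assoc[OF h(3)])
    have 5: "M P Z = - ksgn ((bdeg c - (1 - jd k)) * (bdeg b - jd k - (1 - jd j))) *\<^sub>R M Z P" by (rule M_comm[OF h(1,2)])
    have "M P (M Z R) = - ksgn ((bdeg b - jd k - (1 - jd j)) * (bdeg a - jd j) + (bdeg c - (1 - jd k)) + (bdeg c - (1 - jd k)) * (bdeg a - jd j)
        + (bdeg a - jd j) + (bdeg c - (1 - jd k)) * (bdeg b - jd k - (1 - jd j))) *\<^sub>R M R (M Z P)"
      unfolding 1 M_simps 2 3 4 5 by (simp add: ksgn_add mult_ac)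
    then show ?thesis
      unfolding dual_dual z unfolding PZR[symmetric]
      by (simp add: M_simps jd_dual ks mult_ac)
  qed
  then have A: "(\<Sum>k\<in>UNIV. \<Sum>j\<in>UNIV. ksgn (jd (dual k) * bdeg c + jd (dual j) * bdeg b + 1 + jd (dual k)) *\<^sub>R
      M (der (dual k) c) (M (dv (dual (dual k)) (der (dual j) b)) (der (dual (dual j)) a)))
    = ksgn (bdeg a * bdeg b + bdeg b * bdeg c + bdeg c * bdeg a + bdeg a + bdeg c) *\<^sub>R J3 a b c"
    unfolding J3_def by (subst sum.swap) (simp add: scaleR_sum_right)
  have "J3 c b a = (\<Sum>k\<in>UNIV. \<Sum>j\<in>UNIV. ksgn (jd (dual k) * bdeg c + jd (dual j) * bdeg b + 1 + jd (dual k)) *\<^sub>R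
      M (der (dual k) c) (M (dv (dual (dual k)) (der (dual j) b)) (der (dual (dual j)) a)))"
    unfolding J3_def by (subst sum_dual, rule sum.cong[OF refl], subst sum_dual, rule refl)
  from this A show ?thesis by (rule trans)
qed

text \<open>The six terms provided by \<open>brk_brk\<close> cancel in pairs by
  \<open>J3_sym\<close>.\<close>

lemma jacobi:
  "ksgn ((bdeg a + bdeg b - 1) * (bdeg c - 1)) *\<^sub>R lin_ext (brk c) (brk a b)
   + ksgn (bdeg a * (bdeg b - 1)) *\<^sub>R lin_ext (brk b) (brk a c) + ksgn (bdeg a - 1) *\<^sub>R lin_ext (brk a) (brk b c) = 0"
  unfolding brk_brk J3_sym[of c b a] J3_sym[of b a c] J3_sym[of b c a]
  by (simp add: ks algebra_simps)

end

lemma letters_nl: "[] \<notin> set ws \<Longrightarrow> length ws \<le> nl ws \<and> (nl ws = length ws \<longrightarrow> (\<forall>w\<in>set ws. length w = 1))"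
proof (induction ws)
  case (Cons w ws)
  then have "length ws \<le> nl ws" "1 \<le> length w" by (auto simp: Suc_le_eq)
  with Cons show ?case by auto
qed simp

lemma letters_gr2: "[] \<notin> set ws \<Longrightarrow> gr2 ws = 0 \<Longrightarrow> \<forall>w\<in>set ws. length w = 1"
  using letters_nl[of ws] by (simp add: gr_nl)

lemma coderivation_eq_0:
  assumes "coderivation p D" "\<And>ws. cor D ws = 0"
  shows "D x = 0"
proof (rule coderivation_zero[OF assms(1)])
  fix x
  have "cor D = (\<lambda>ws. 0)" using assms(2) by (rule ext)
  then show "cogen (D x) = 0" by (simp add: cogen_cor[OF assms(1)] pl_def)
qed

lemma anticommute_cor:
  assumes "coderivation 1 D" "coderivation 1 E"
    and "\<And>ws. DD 1 (cor E) ws [] (cor D) + DD 1 (cor D) ws [] (cor E) = 0"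
  shows "D (E x) + E (D x) = 0"
proof -
  have "supercommutator 1 1 D E x = 0"
    by (rule coderivation_eq_0[OF coderivation_supercommutator[OF assms(1,2)]])
      (simp add: cor_supercommutator[OF assms(1,2)] assms(3))
  then show ?thesis by (simp add: supercommutator_def)
qed

section \<open>The two differentials on corestrictions\<close>

context poly_letters
begin

definition mm :: "'b list list \<Rightarrow> 'b \<Rightarrow>\<^sub>0 real" where
  "mm ws = (case ws of [[a, b]] \<Rightarrow> mul a b | _ \<Rightarrow> 0)"

definition brr :: "'b list list \<Rightarrow> 'b \<Rightarrow>\<^sub>0 real" where
  "brr ws = (case ws of [[a], [b]] \<Rightarrow> brk a b | _ \<Rightarrow> 0)"

lemma mm_nz: "mm ws \<noteq> 0 \<Longrightarrow> \<exists>a b. ws = [[a, b]]" and brr_nz: "brr ws \<noteq> 0 \<Longrightarrow> \<exists>a b. ws = [[a], [b]]"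
  by (auto simp: mm_def brr_def split: list.splits)

lemma mm_simps [simp]: "mm [[]] = 0" "mm [[a]] = 0" "mm [a # b # v] = (if v = [] then mul a b else 0)"
  by (auto simp: mm_def split: list.splits)

text \<open>The shuffle of two letters gives the sum of \<open>mul a b\<close> and the signed
  \<open>mul b a\<close>, zero by graded commutativity; longer shuffles have too many
  letters.\<close>

lemma cochain_mm: "cochain 1 mm"
  unfolding cochain_def good_def homog_def
proof (intro conjI allI ballI good0I)
  fix us vs :: "'b list list" and u v :: "'b list" assume n: "u \<noteq> []" "v \<noteq> []"
  show "sh u v (\<lambda>w. mm (us @ w # vs)) = 0"
  proof (cases "us = [] \<and> vs = [] \<and> length u = 1 \<and> length v = 1")
    case True
    then obtain a b where "u = [a]" "v = [b]" by (auto simp: length_Suc_conv)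
    moreover have "mul a b + ksgn (bdeg b * bdeg a) *\<^sub>R mul b a = 0" by (subst mul_comm) (simp add: mult.commute)
    ultimately show ?thesis using True by (simp add: sh_Cons mm_def)
  next
    case False
    have "sh u v (\<lambda>w. mm (us @ w # vs)) = sh u v (\<lambda>w. 0)"
    proof (rule sh_cong_deg)
      fix w :: "'b list" assume l: "length w = length u + length v"
      show "mm (us @ w # vs) = 0"
      proof (rule ccontr)
        assume "mm (us @ w # vs) \<noteq> 0"
        then obtain a b where "us @ w # vs = [[a, b]]" using mm_nz by blast
        then have "us = []" "vs = []" "w = [a, b]" by (auto simp: append_eq_Cons_conv)
        with l n False show False by (cases u; cases v) auto
      qed
    qed
    then show ?thesis by simp
  qed
next
  fix us vs :: "'b list list" and u v :: "'b list"
  have "mm (us @ u # v # vs) = 0" for u v using mm_nz[of "us @ u # v # vs"] by (auto simp: append_eq_Cons_conv)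
  then show "mm (us @ u # v # vs) = ksgn (tdeg u * tdeg v) *\<^sub>R mm (us @ v # u # vs)" by simp
next
  fix ws :: "'b list list" assume "[] \<in> set ws" then show "mm ws = 0" using mm_nz[of ws] by (cases "mm ws = 0") auto
next
  show "mm [] = 0" by (simp add: mm_def)
next
  fix vs x assume x: "x \<in> Poly_Mapping.keys (mm vs)"
  then obtain a b where "vs = [[a, b]]" using mm_nz[of vs] by fastforce
  then show "bdeg x = gr1 vs + 1" using x mul_keys[of x a b] by (simp add: mm_def gr1_def tdeg_def)
qed

lemma cochain_brr: "cochain 1 brr"
  unfolding cochain_def good_def homog_def
proof (intro conjI allI ballI good0I)
  fix us vs :: "'b list list" and u v :: "'b list" assume n: "u \<noteq> []" "v \<noteq> []"
  have "sh u v (\<lambda>w. brr (us @ w # vs)) = sh u v (\<lambda>w. 0)"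
  proof (rule sh_cong_deg)
    fix w :: "'b list" assume "length w = length u + length v"
    with n have "length w \<noteq> 1" by (cases u; cases v) auto
    then show "brr (us @ w # vs) = 0" using brr_nz[of "us @ w # vs"] by (force simp: append_eq_Cons_conv)
  qed
  then show "sh u v (\<lambda>w. brr (us @ w # vs)) = 0" by simp
next
  fix us vs :: "'b list list" and u v :: "'b list"
  show "brr (us @ u # v # vs) = ksgn (tdeg u * tdeg v) *\<^sub>R brr (us @ v # u # vs)"
  proof (cases "us = [] \<and> vs = [] \<and> length u = 1 \<and> length v = 1")
    case True
    then obtain a b where uv: "u = [a]" "v = [b]" by (auto simp: length_Suc_conv)
    have "brk a b = ksgn (tdeg u * tdeg v) *\<^sub>R brk b a" by (subst brk_sym) (simp add: uv tdeg_def)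
    then show ?thesis using True uv by (simp add: brr_def)
  next
    case False
    then have "brr (us @ u # v # vs) = 0" "brr (us @ v # u # vs) = 0"
      using brr_nz[of "us @ u # v # vs"] brr_nz[of "us @ v # u # vs"] by (force simp: append_eq_Cons_conv)+
    then show ?thesis by simp
  qed
next
  fix ws :: "'b list list" assume "[] \<in> set ws" then show "brr ws = 0" using brr_nz[of ws] by (cases "brr ws = 0") auto
next
  show "brr [] = 0" by (simp add: brr_def)
next
  fix vs x assume x: "x \<in> Poly_Mapping.keys (brr vs)"
  then obtain a b where "vs = [[a], [b]]" using brr_nz[of vs] by fastforce
  then show "bdeg x = gr1 vs + 1" using x hom_brk[of a b] by (simp add: brr_def gr1_def tdeg_def hom_def)
qed

text \<open>The differential of the bar construction: two neighbouring letters are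
  multiplied.\<close>

primrec dT :: "'b list \<Rightarrow> 'b list \<Rightarrow>\<^sub>0 real" where
  "dT [] = 0"
| "dT (a # w) = (case w of [] \<Rightarrow> 0 | b # w' \<Rightarrow> lin_ext (\<lambda>x. Poly_Mapping.single (x # w') 1) (mul a b))
     + ksgn (bdeg a) *\<^sub>R lin_ext (\<lambda>v. Poly_Mapping.single (a # v) 1) (dT w)"

lemma GG_mm: "GG 1 mm [w] \<Phi> = lin_ext \<Phi> (dT w)"
proof -
  have "dec3 w (\<lambda>u v t. ksgn (wdeg u) *\<^sub>R lin_ext (\<lambda>x. \<Phi> (u @ x # t)) (mm [v])) = lin_ext \<Phi> (dT w)"
  proof (induction w arbitrary: \<Phi>)
    case Nil
    then show ?case by (simp add: dec3_def)
  next
    case (Cons a w)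
    let ?F = "\<lambda>u v t. ksgn (wdeg u) *\<^sub>R lin_ext (\<lambda>x. \<Phi> (u @ x # t)) (mm [v])"
    have 1: "dec (a # w) (?F []) = lin_ext \<Phi> (case w of [] \<Rightarrow> 0 | b # w' \<Rightarrow> lin_ext (\<lambda>x. Poly_Mapping.single (x # w') 1) (mul a b))"
    proof (cases w)
      case (Cons b w')
      have "dec w' (\<lambda>v t. lin_ext (\<lambda>x. \<Phi> (x # t)) (mm [a # b # v])) = lin_ext (\<lambda>x. \<Phi> (x # w')) (mul a b)"
        by (cases w') simp_all
      then show ?thesis by (simp add: Cons lin_ext_lin_ext del: mm_simps(3))
    qed simp
    have "dec3 w (\<lambda>u. ?F (a # u)) = ksgn (bdeg a) *\<^sub>R lin_ext (\<lambda>v. \<Phi> (a # v)) (dT w)"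
      unfolding Cons.IH[symmetric] dec3_scale[symmetric] by (simp add: ks)
    with 1 show ?case by (simp add: dec3_def lin_ext_add lin_ext_scale lin_ext_lin_ext)
  qed
  then show ?thesis by (simp add: GG_def mult.commute)
qed

lemma dT_keys: "v \<in> Poly_Mapping.keys (dT w) \<Longrightarrow> length v + 1 = length w \<and> wdeg v = wdeg w + 1"
proof (induction w arbitrary: v)
  case (Cons a w)
  let ?C = "case w of [] \<Rightarrow> 0 | b # w' \<Rightarrow> lin_ext (\<lambda>x. Poly_Mapping.single (x # w') (1::real)) (mul a b)"
  let ?R = "lin_ext (\<lambda>v. Poly_Mapping.single (a # v) (1::real)) (dT w)"
  have "v \<in> Poly_Mapping.keys ?C \<or> v \<in> Poly_Mapping.keys ?R"
    using Cons.prems by (auto simp: in_keys_iff lookup_add)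
  then show ?case
  proof
    assume "v \<in> Poly_Mapping.keys ?C"
    then show ?case using mul_keys by (cases w) (auto elim!: keys_lin_ext split: if_splits)
  qed (auto elim!: keys_lin_ext dest: Cons.IH split: if_splits)
qed simp

lemma DD_mm: "good0 \<phi> \<Longrightarrow> DD 1 mm ws [] \<phi> = hat 1 dT ws \<phi>"
  by (rule DD_single[OF cochainD(3)[OF cochain_mm]]) (use mm_nz GG_mm in force)+

text \<open>Under the product the output word must have two letters: the value of \<open>f\<close>
  and one leftover letter. The leftover is the first or the last letter of some argument, by
  \<open>GG_dec_cut\<close> for the cut into two letters.\<close>

lemma tau:
  assumes f: "homog p f"
  shows "DD p f ws [] mm = lc ws (\<lambda>a zs. if length a = 1 then ksgn (p * wdeg a) *\<^sub>R lin_ext (mul (hd a)) (f zs) else 0)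
    + rc ws (\<lambda>zs b. if length b = 1 then lin_ext (\<lambda>x. mul x (hd b)) (f zs) else 0)"
proof -
  define m2 :: "'b list \<Rightarrow> 'b list \<Rightarrow> 'b \<Rightarrow>\<^sub>0 real" where
    "m2 = (\<lambda>u v. if length u = 1 \<and> length v = 1 then mul (hd u) (hd v) else 0)"
  have 1: "DD p f ws z mm = GG p f (z @ ws) (\<lambda>g. mm [g])" for z
  proof (induction ws arbitrary: z)
    case (Cons w ws)
    have "DD p f ws z (\<lambda>y. mm (w # y)) = DD p f ws z (\<lambda>y. 0)"
      by (rule DD_cong[OF f]) (use mm_nz in fastforce)
    then show ?case by (simp add: Cons)
  qed simp
  have 2: "mm [g] = dec g m2" for g
  proof (cases "length g = 2")
    case True
    then obtain a b where "g = [a, b]" by (auto simp: numeral_2_eq_2 length_Suc_conv)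
    then show ?thesis by (simp add: m2_def mm_def)
  next
    case False
    have "dec g m2 = dec g (\<lambda>u v. 0)" by (rule dec_cong) (use False in \<open>auto simp: m2_def\<close>)
    moreover have "mm [g] = 0"
    proof (rule ccontr)
      assume "mm [g] \<noteq> 0" then show False using mm_nz[of "[g]"] False by auto
    qed
    ultimately show ?thesis by simp
  qed
  have k: "shk (\<lambda>a. if length a = 1 then F a else 0)" for F :: "'b list \<Rightarrow> 'b \<Rightarrow>\<^sub>0 real"
  proof -
    have "sh u v (\<lambda>a. if length a = 1 then F a else 0) = sh u v (\<lambda>a. 0)" if "u \<noteq> []" "v \<noteq> []" for u v
      by (rule sh_cong_deg) (use that in \<open>cases u; cases v; simp\<close>)
    then show ?thesis by (simp add: shk_def)
  qed
  have m2: "m2 u v = (if length u = 1 then if length v = 1 then mul (hd u) (hd v) else 0 else 0)"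
    "m2 u v = (if length v = 1 then if length u = 1 then mul (hd u) (hd v) else 0 else 0)" for u v
    by (simp_all add: m2_def)
  have k1: "shk (\<lambda>u. m2 u v)" for v unfolding m2(1) by (rule k)
  have "m2 u = (\<lambda>v. if length v = 1 then if length u = 1 then mul (hd u) (hd v) else 0 else 0)" for u
    by (rule ext) (rule m2(2))
  then have k2: "shk (m2 u)" for u using k by simp
  have P: "GG p f zs (\<lambda>g. if length g = 1 then F (hd g) else 0) = lin_ext F (f zs)" for zs and F :: "'b \<Rightarrow> 'b \<Rightarrow>\<^sub>0 real"
  proof -
    have "(\<lambda>A vs B. ksgn (p * wdeg A) *\<^sub>R lin_ext (\<lambda>x. if length (A @ x # B) = 1 then F (hd (A @ x # B)) else 0) (f vs))
        = (\<lambda>A vs B. if A = [] \<and> B = [] then lin_ext F (f vs) else 0)"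
      by (intro ext) auto
    then show ?thesis unfolding GG_def by (simp only: nn_pure)
  qed
  have "GG p f ws (\<lambda>g. dec g m2) = lc ws (\<lambda>a zs. ksgn (p * wdeg a) *\<^sub>R GG p f zs (m2 a)) + rc ws (\<lambda>zs b. GG p f zs (\<lambda>g. m2 g b))"
    by (rule GG_dec_cut[OF f k1 k2]) (simp_all add: m2_def)
  moreover have "GG p f zs (m2 a) = (if length a = 1 then lin_ext (mul (hd a)) (f zs) else 0)" for a zs
    using P[of zs "mul (hd a)"] by (cases "length a = 1") (simp_all add: m2_def)
  moreover have "GG p f zs (\<lambda>g. m2 g b) = (if length b = 1 then lin_ext (\<lambda>x. mul x (hd b)) (f zs) else 0)" for b zs
    using P[of zs "\<lambda>x. mul x (hd b)"] by (cases "length b = 1") (simp_all add: m2_def)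
  moreover have "ksgn k *\<^sub>R (if Q then y else 0) = (if Q then ksgn k *\<^sub>R y else 0)" for k Q and y :: "'b \<Rightarrow>\<^sub>0 real" by simp
  ultimately show ?thesis using 1[of "[]"] by (simp only: 2 append_Nil)
qed

abbreviation "dm \<equiv> cd 1 mm"
abbreviation "db \<equiv> cd 1 brr"

lemmas dm_coder = coderivation_cd[OF cochain_mm] and db_coder = coderivation_cd[OF cochain_brr]
  and cor_dm = cor_cd[OF cochain_mm] and cor_db = cor_cd[OF cochain_brr]

lemma mm_gr: "mm ws \<noteq> 0 \<Longrightarrow> gr2 ws = 1 \<and> gr3 ws = 0" and brr_gr: "brr ws \<noteq> 0 \<Longrightarrow> gr2 ws = 0 \<and> gr3 ws = 1"
  using mm_nz[of ws] brr_nz[of ws] by (auto simp: gr2_def gr3_def)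

lemma dm_hom: "dm \<in> coder_hom 1 (- 1) 0" and db_hom: "db \<in> coder_hom 1 0 (- 1)"
  using mm_gr brr_gr by (auto simp: coder_hom_iff dm_coder db_coder cor_dm cor_db)

lemma hat_cong0: "(\<And>us w vs v. ws = us @ w # vs \<Longrightarrow> v \<in> Poly_Mapping.keys (g w) \<Longrightarrow> \<phi> (us @ v # vs) = 0) \<Longrightarrow> hat q g ws \<phi> = 0"
  using hat_mem[of "{0}" ws g \<phi> q] by (auto simp: subspace_def)

text \<open>Only a single word of three letters can contribute, and there the claim is
  associativity.\<close>

lemma dm_dm: "dm (dm x) = 0"
proof -
  have "DD 1 mm ws [] mm = 0" for ws
  proof (cases "\<exists>a b c. ws = [[a, b, c]]")
    case True
    then obtain a b c where "ws = [[a, b, c]]" by blast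
    then show ?thesis
      using mul_assoc[where a = a and b = b and c = c]
      by (simp add: DD_mm[OF cochainD(2)[OF cochain_mm]] lin_ext_add lin_ext_scale lin_ext_lin_ext del: DD.simps)
  next
    case False
    show ?thesis
      unfolding DD_mm[OF cochainD(2)[OF cochain_mm]]
    proof (rule hat_cong0, rule ccontr)
      fix us w vs v assume ws: "ws = us @ w # vs" and v: "v \<in> Poly_Mapping.keys (dT w)" and n: "mm (us @ v # vs) \<noteq> 0"
      from mm_nz[OF n] obtain a b where "us = []" "vs = []" "v = [a, b]" by (auto simp: append_eq_Cons_conv)
      with dT_keys[OF v] ws False show False by (auto simp: Suc_length_conv length_Suc_conv)
    qed
  qed
  then have "dm (dm x) + dm (dm x) = 0"
    by (intro anticommute_cor dm_coder) (simp add: cor_dm)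
  then show ?thesis by (metis scaleR_2 scaleR_eq_0_iff zero_neq_numeral)
qed

text \<open>By the gradings only three one-letter words can contribute, and there the claim is the
  Jacobi identity.\<close>

lemma db_db: "db (db x) = 0"
proof -
  have "DD 1 brr ws [] brr = 0" for ws
  proof (rule ccontr)
    assume nz: "DD 1 brr ws [] brr \<noteq> 0"
    have "[] \<notin> set ws"
      using good0D(3)[OF goodD(1)[OF good_DD[OF cochain_brr cochainD(2)[OF cochain_brr]]]] nz by blast
    moreover from DD_support[OF cochain_brr nz] obtain x y where xy: "brr x \<noteq> 0" "brr y \<noteq> 0"
      "gr2 ws = gr2 x + gr2 y" "gr3 ws = gr3 x + gr3 y" by blast
    ultimately have "\<forall>w\<in>set ws. length w = 1" "length ws = 3"
      using letters_gr2[of ws] brr_gr[OF xy(1)] brr_gr[OF xy(2)] by (auto simp: gr3_def)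
    then obtain a b c where ws: "ws = [[a], [b], [c]]"
      by (auto simp: numeral_3_eq_3 length_Suc_conv)
    have "DD 1 brr ws [] brr = 0"
      using jacobi[of a b c]
      by (simp add: ws GG_letters[OF cochainD(2)[OF cochain_brr]]) (simp add: brr_def tdeg_def algebra_simps)
    with nz show False by simp
  qed
  then have "db (db x) + db (db x) = 0"
    by (intro anticommute_cor db_coder) (simp add: cor_db)
  then show ?thesis by (metis scaleR_2 scaleR_eq_0_iff zero_neq_numeral)
qed

text \<open>By the gradings only a two-letter word together with a one-letter word can contribute,
  and there the claim is the Leibniz rule \<open>brk_mul\<close>.\<close>

lemma dm_db: "dm (db x) + db (dm x) = 0"
proof -
  let ?F = "\<lambda>ws. DD 1 brr ws [] mm + DD 1 mm ws [] brr"
  have F: "good0 ?F"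
    by (intro good0_add goodD(1) good_DD cochain_brr cochain_mm cochainD(2)[OF cochain_brr] cochainD(2)[OF cochain_mm])
  have 0: "?F [[a, b], [c]] = 0" for a b c
  proof -
    have "DD 1 brr [[a, b], [c]] [] mm = ksgn (bdeg a) *\<^sub>R lin_ext (mul a) (brk b c) + ksgn (bdeg b * (bdeg c - 1)) *\<^sub>R lin_ext (\<lambda>x. mul x b) (brk a c)"
      by (simp add: tau[OF cochainD(3)[OF cochain_brr]] brr_def tdeg_def del: DD.simps)
    moreover have "DD 1 mm [[a, b], [c]] [] brr = lin_ext (\<lambda>x. brk x c) (mul a b)"
      by (simp add: DD_mm[OF cochainD(2)[OF cochain_brr]] lin_ext_lin_ext brr_def del: DD.simps)
    ultimately show ?thesis using brk_mul[of c a b] by simp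
  qed
  have "?F ws = 0" for ws
  proof (rule ccontr)
    assume nz: "?F ws \<noteq> 0"
    have e: "[] \<notin> set ws" using good0D(3)[OF F] nz by blast
    from nz have "DD 1 brr ws [] mm \<noteq> 0 \<or> DD 1 mm ws [] brr \<noteq> 0" by auto
    then have g: "gr2 ws = 1" "gr3 ws = 1"
      using DD_support[OF cochain_brr, of ws mm] DD_support[OF cochain_mm, of ws brr] mm_gr brr_gr by (metis add.commute add_0)+
    then obtain u v where ws: "ws = [u, v]" by (auto simp: gr3_def length_Suc_conv numeral_2_eq_2)
    consider a b c where "u = [a, b]" "v = [c]" | a b c where "v = [a, b]" "u = [c]"
      using e g by (cases u; cases v; cases "tl u"; cases "tl v") (auto simp: ws gr2_def)
    then have "?F [u, v] = 0"
    proof cases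
      case (1 a b c)
      then show ?thesis using 0 by simp
    next
      case (2 a b c)
      then show ?thesis using good0D_hd(2)[OF F, of u v "[]"] 0[of a b c] by simp
    qed
    with nz ws show False by simp
  qed
  then show ?thesis
    by (intro anticommute_cor dm_coder db_coder) (simp add: cor_dm cor_db)
qed

end

section \<open>Calculus of derivations acting on one word at a time\<close>

lemma hat_add: "hat q g ws (\<lambda>y. \<phi> y + \<psi> y) = hat q g ws \<phi> + hat q g ws \<psi>"
  by (induction ws arbitrary: \<phi> \<psi>) (simp_all add: lin_ext_fun_add scaleR_right_distrib)

lemma hat_scale: "hat q g ws (\<lambda>y. r *\<^sub>R \<phi> y) = r *\<^sub>R hat q g ws \<phi>"
  by (induction ws arbitrary: \<phi>)
    (simp_all add: lin_ext_fun_scale scaleR_right_distrib scaleR_left_commute[of _ r] del: scaleR_scaleR)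

lemma hat_zero [simp]: "hat q g ws (\<lambda>y. 0) = 0"
  using hat_scale[of q g ws 0 "\<lambda>y. 0"] by simp

lemma hat_lin_ext: "hat q g ws (\<lambda>y. lin_ext (\<lambda>k. \<Phi> k y) x) = lin_ext (\<lambda>k. hat q g ws (\<Phi> k)) x"
proof (induction ws arbitrary: \<Phi>)
  case (Cons w ws)
  show ?case
    by (simp add: Cons lin_ext_fun_add lin_ext_fun_scale lin_ext_swap[of _ x "g w"])
qed simp

lemma hat_sh: "hat q g ws (\<lambda>y. sh u v (\<lambda>w. \<Phi> w y)) = sh u v (\<lambda>w. hat q g ws (\<Phi> w))"
  unfolding sh_def by (rule hat_lin_ext)

lemma hat_diff_g: "hat q (\<lambda>w. g w - g' w) ws \<phi> = hat q g ws \<phi> - hat q g' ws \<phi>"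
  by (induction ws arbitrary: \<phi>) (simp_all add: lin_ext_diff scaleR_right_diff_distrib)

lemma hat_cong:
  assumes "\<And>us w vs v. ws = us @ w # vs \<Longrightarrow> v \<in> Poly_Mapping.keys (g w) \<Longrightarrow> \<phi> (us @ v # vs) = \<psi> (us @ v # vs)"
  shows "hat q g ws \<phi> = hat q g ws \<psi>"
proof -
  have "hat q g ws (\<lambda>y. \<phi> y + (-1) *\<^sub>R \<psi> y) \<in> {0}"
    by (rule hat_mem) (use assms in \<open>auto simp: subspace_def\<close>)
  then show ?thesis unfolding hat_add hat_scale by simp
qed

text \<open>The anticommutator of two odd derivations is a derivation, since the terms acting on two
  different words cancel. If it acts on words by the scalars \<open>l\<close>, it acts on a list by
  their sum.\<close>

lemma hat_anticommute:
  fixes \<phi> :: "'b::graded_basis list list \<Rightarrow> 'v::real_vector"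
  assumes r: "\<And>w v. v \<in> Poly_Mapping.keys (r w) \<Longrightarrow> wdeg v = wdeg w + 1"
    and h: "\<And>w v. v \<in> Poly_Mapping.keys (h w) \<Longrightarrow> wdeg v = wdeg w - 1"
    and W: "\<And>w us vs. lin_ext (\<lambda>v. lin_ext (\<lambda>x. \<phi> (us @ x # vs)) (h v)) (r w) + lin_ext (\<lambda>v. lin_ext (\<lambda>x. \<phi> (us @ x # vs)) (r v)) (h w)
        = l w *\<^sub>R \<phi> (us @ w # vs)"
  shows "hat 1 r ws (\<lambda>z. hat (-1) h z \<phi>) + hat (-1) h ws (\<lambda>z. hat 1 r z \<phi>) = sum_list (map l ws) *\<^sub>R \<phi> ws"
  using W
proof (induction ws arbitrary: \<phi>)
  case (Cons w ws)
  let ?t = "ksgn (tdeg w)"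
  have 1: "lin_ext (\<lambda>v. ksgn (- tdeg v) *\<^sub>R hat (-1) h ws (\<lambda>y. \<phi> (v # y))) (r w)
      = - ?t *\<^sub>R lin_ext (\<lambda>v. hat (-1) h ws (\<lambda>y. \<phi> (v # y))) (r w)"
    by (rule lin_ext_scale_const) (simp add: r tdeg_def ks)
  have 2: "lin_ext (\<lambda>v. ksgn (tdeg v) *\<^sub>R hat 1 r ws (\<lambda>y. \<phi> (v # y))) (h w)
      = - ?t *\<^sub>R lin_ext (\<lambda>v. hat 1 r ws (\<lambda>y. \<phi> (v # y))) (h w)"
    by (rule lin_ext_scale_const) (simp add: h tdeg_def ks)
  have "hat 1 r ws (\<lambda>z. hat (-1) h z (\<lambda>y. \<phi> (w # y))) + hat (-1) h ws (\<lambda>z. hat 1 r z (\<lambda>y. \<phi> (w # y))) = sum_list (map l ws) *\<^sub>R \<phi> (w # ws)"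
    by (rule Cons.IH) (use Cons.prems[of "w # us" for us] in simp)
  moreover have "lin_ext (\<lambda>v. lin_ext (\<lambda>x. \<phi> (x # ws)) (h v)) (r w) + lin_ext (\<lambda>v. lin_ext (\<lambda>x. \<phi> (x # ws)) (r v)) (h w) = l w *\<^sub>R \<phi> (w # ws)"
    using Cons.prems[of "[]" ws] by simp
  ultimately show ?case
    using 1 2 by (simp add: lin_ext_fun_add hat_add hat_scale hat_lin_ext scaleR_right_distrib scaleR_left_distrib algebra_simps)
qed simp

lemma good0_hat:
  fixes \<phi> :: "'b::graded_basis list list \<Rightarrow> 'v::real_vector"
  assumes g: "\<And>w v. v \<in> Poly_Mapping.keys (g w) \<Longrightarrow> wdeg v = wdeg w + q" and n: "g [] = 0"
    and s: "\<And>(\<Phi> :: 'b list \<Rightarrow> 'v). shk \<Phi> \<Longrightarrow> shk (\<lambda>w. lin_ext \<Phi> (g w))"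
    and f: "good0 \<phi>"
  shows "good0 (\<lambda>ws. hat q g ws \<phi>)"
proof (rule good0I_front)
  fix vs :: "'b list list" and u v :: "'b list" assume uv: "u \<noteq> []" "v \<noteq> []"
  have "sh u v (\<lambda>w. ksgn (q * tdeg w) *\<^sub>R hat q g vs (\<lambda>y. \<phi> (w # y))) = ksgn (q * (wdeg u + wdeg v - 1)) *\<^sub>R sh u v (\<lambda>w. hat q g vs (\<lambda>y. \<phi> (w # y)))"
    by (rule sh_scale_deg) (simp add: tdeg_def)
  also have "sh u v (\<lambda>w. hat q g vs (\<lambda>y. \<phi> (w # y))) = 0"
    unfolding hat_sh[symmetric] good0D_hd(1)[OF f uv] by simp
  finally show "sh u v (\<lambda>w. hat q g (w # vs) \<phi>) = 0"
    using shkD[OF s[OF good0_shk[OF f, of "[]" vs]] uv] by (simp add: sh_add)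
next
  fix us vs :: "'b list list" and u v :: "'b list"
  show "hat q g (us @ u # v # vs) \<phi> = ksgn (tdeg u * tdeg v) *\<^sub>R hat q g (us @ v # u # vs) \<phi>"
    using f
  proof (induction us arbitrary: \<phi>)
    case Nil
    have 1: "lin_ext (\<lambda>x. \<phi> (x # v # vs)) (g u) = ksgn ((tdeg u + q) * tdeg v) *\<^sub>R lin_ext (\<lambda>x. \<phi> (v # x # vs)) (g u)" for u v
      unfolding lin_ext_fun_scale[symmetric]
      by (rule lin_ext_cong, subst good0D_hd(2)[OF Nil]) (simp add: g tdeg_def algebra_simps)
    have 2: "hat q g vs (\<lambda>y. \<phi> (u # v # y)) = ksgn (tdeg u * tdeg v) *\<^sub>R hat q g vs (\<lambda>y. \<phi> (v # u # y))"
      unfolding hat_scale[symmetric] by (rule arg_cong[where f = "hat q g vs"], rule ext, rule good0D_hd(2)[OF Nil])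
    show ?case
      by (simp add: 1[of u v] 1[of v u] 2) (simp add: ks algebra_simps)
  next
    case (Cons w us)
    have "lin_ext (\<lambda>x. \<phi> (x # us @ u # v # vs)) (g w) = ksgn (tdeg u * tdeg v) *\<^sub>R lin_ext (\<lambda>x. \<phi> (x # us @ v # u # vs)) (g w)"
      unfolding lin_ext_fun_scale[symmetric] using good0D(2)[OF Cons.prems, of "x # us" u v vs for x] by simp
    then show ?case using Cons.IH[OF good0_Cons[OF Cons.prems]] by (simp add: scaleR_right_distrib mult_ac)
  qed
next
  fix ws :: "'b list list" assume "[] \<in> set ws"
  then show "hat q g ws \<phi> = 0"
    using f
  proof (induction ws arbitrary: \<phi>)
    case (Cons w ws)
    have "lin_ext (\<lambda>x. \<phi> (x # ws)) (g w) = 0"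
    proof (cases "w = []")
      case False
      then have "\<phi> (x # ws) = 0" for x using Cons.prems good0D(3)[OF Cons.prems(2)] by simp
      then show ?thesis by simp
    qed (simp add: n)
    moreover have "hat q g ws (\<lambda>y. \<phi> (w # y)) = 0"
    proof (cases "w = []")
      case True
      then have "\<phi> (w # y) = 0" for y using good0D(3)[OF Cons.prems(2)] by simp
      then show ?thesis by simp
    qed (use Cons.IH[OF _ good0_Cons[OF Cons.prems(2)]] Cons.prems(1) in auto)
    ultimately show ?case by simp
  qed simp
qed

lemma cochain_hat:
  fixes f :: "'b::graded_basis list list \<Rightarrow> 'b \<Rightarrow>\<^sub>0 real"
  assumes g: "\<And>w v. v \<in> Poly_Mapping.keys (g w) \<Longrightarrow> wdeg v = wdeg w + q" and n: "g [] = 0"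
    and s: "\<And>(\<Phi> :: 'b list \<Rightarrow> 'b \<Rightarrow>\<^sub>0 real). shk \<Phi> \<Longrightarrow> shk (\<lambda>w. lin_ext \<Phi> (g w))"
    and f: "cochain p f"
  shows "cochain (p + q) (\<lambda>ws. hat q g ws f)"
  unfolding cochain_def good_def
proof (intro conjI)
  show "good0 (\<lambda>ws. hat q g ws f)" by (rule good0_hat[OF g n s cochainD(2)[OF f]])
  show "homog (p + q) (\<lambda>ws. hat q g ws f)"
    unfolding homog_def
  proof (intro allI ballI)
    fix ws x assume x: "x \<in> Poly_Mapping.keys (hat q g ws f)"
    have "hat q g ws f \<in> {z. \<forall>x\<in>Poly_Mapping.keys z. bdeg x = gr1 ws + (p + q)}"
      by (rule hat_mem[OF subspace_keys])
        (use cochainD(3)[OF f] g in \<open>auto simp: homog_def gr1_def tdeg_def\<close>)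
    with x show "bdeg x = gr1 ws + (p + q)" by blast
  qed
qed simp

abbreviation cs :: "'b \<Rightarrow> ('b list \<Rightarrow>\<^sub>0 real) \<Rightarrow> 'b list \<Rightarrow>\<^sub>0 real" where
  "cs a \<equiv> lin_ext (\<lambda>v. Poly_Mapping.single (a # v) 1)"

section \<open>The homotopy on the bar construction\<close>

context poly_letters
begin

definition pdw :: "'b list \<Rightarrow> nat" where "pdw w = sum_list (map pd w)"
definition pdl :: "'b list list \<Rightarrow> nat" where "pdl ws = sum_list (map pdw ws)"

lemma pdw_simps [simp]: "pdw [] = 0" "pdw (a # w) = pd a + pdw w" "pdw (u @ v) = pdw u + pdw v"
  by (simp_all add: pdw_def)

lemma pdl_simps [simp]: "pdl [] = 0" "pdl (w # ws) = pdw w + pdl ws" "pdl (us @ vs) = pdl us + pdl vs"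
  by (simp_all add: pdl_def)

text \<open>What left multiplication by an outer letter leaves in lowest polynomial degree: only the
  unit acts, and it merely disappears (\<open>lc_unit\<close>). \<open>sigR\<close> is the
  counterpart for right multiplication (\<open>rc_unit\<close>).\<close>

definition sigL :: "'b list \<Rightarrow> 'b list \<Rightarrow>\<^sub>0 real" where
  "sigL w = (if w \<noteq> [] \<and> hd w = e then Poly_Mapping.single (tl w) 1 else 0)"

definition sigR :: "'b list \<Rightarrow> 'b list \<Rightarrow>\<^sub>0 real" where
  "sigR w = (if w \<noteq> [] \<and> last w = e then Poly_Mapping.single (butlast w) (ksgn (wdeg (butlast w))) else 0)"

text \<open>The part of \<open>[d\<^sub>m, \<cdot>]\<close> preserving the polynomial degree of the arguments: of all products with an outer
  letter only those with the unit survive.\<close>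

definition rho :: "'b list \<Rightarrow> 'b list \<Rightarrow>\<^sub>0 real" where
  "rho w = sigL w - sigR w - dT w"

text \<open>The derivation of the tensor algebra of words that extends \<open>der j\<close> on
  letters.\<close>

primrec Dw :: "'j \<Rightarrow> 'b list \<Rightarrow> 'b list \<Rightarrow>\<^sub>0 real" where
  "Dw j [] = 0"
| "Dw j (a # w) = lin_ext (\<lambda>x. Poly_Mapping.single (x # w) 1) (der j a) + ksgn (jd j * bdeg a) *\<^sub>R cs a (Dw j w)"

definition hp :: "'b list \<Rightarrow> 'b list \<Rightarrow>\<^sub>0 real" where
  "hp w = (\<Sum>j\<in>UNIV. ksgn (jd j) *\<^sub>R cs (xx j) (Dw j w))"

text \<open>The de Rham type homotopy \<open>u v \<mapsto> \<Sum> u x\<^sub>j \<partial>\<^sub>j(v)\<close> on the bar construction of a polynomial algebra.\<close>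

primrec hw :: "'b list \<Rightarrow> 'b list \<Rightarrow>\<^sub>0 real" where
  "hw [] = 0"
| "hw (a # w) = hp (a # w) + ksgn (bdeg a) *\<^sub>R cs a (hw w)"

text \<open>On words in the unit alone \<open>hw\<close> vanishes, so these need a separate homotopy. The words of three or more
  units are combinations of shuffles, which is why \<open>[e]\<close> and \<open>[e, e]\<close> suffice.\<close>

definition h0w :: "'b list \<Rightarrow> 'b list \<Rightarrow>\<^sub>0 real" where
  "h0w w = (if w = [e] then Poly_Mapping.single [e, e] 1 else 0)"

text \<open>\<open>rho\<close> contains \<open>- dT\<close>, so \<open>hw\<close> enters with a
  minus sign; the polynomial degree then occurs in \<open>lam\<close> with a plus sign.\<close>

definition eta :: "'b list \<Rightarrow> 'b list \<Rightarrow>\<^sub>0 real" where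
  "eta w = h0w w - hw w"

lemma Dw_keys: "v \<in> Poly_Mapping.keys (Dw j w) \<Longrightarrow> length v = length w \<and> wdeg v = wdeg w - jd j \<and> pdw v + 1 = pdw w"
proof (induction w arbitrary: v)
  case (Cons a w)
  have "v \<in> Poly_Mapping.keys (lin_ext (\<lambda>x. Poly_Mapping.single (x # w) (1::real)) (der j a)) \<or> v \<in> Poly_Mapping.keys (cs a (Dw j w))"
    using Cons.prems by (auto simp: in_keys_iff lookup_add)
  then show ?case
    by (auto elim!: keys_lin_ext dest!: Cons.IH der_keys split: if_splits)
qed simp

lemma hp_keys:
  assumes "v \<in> Poly_Mapping.keys (hp w)"
  shows "length v = length w + 1 \<and> wdeg v = wdeg w - 1 \<and> pdw v = pdw w"
proof -
  from assms obtain j where "v \<in> Poly_Mapping.keys (cs (xx j) (Dw j w))"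
    using keys_sum[of "\<lambda>j. ksgn (jd j) *\<^sub>R cs (xx j) (Dw j w)" UNIV] unfolding hp_def by (auto simp: in_keys_iff)
  then show ?thesis using Dw_keys by (fastforce elim!: keys_lin_ext simp: xx_deg pd_xx split: if_splits)
qed

lemma hw_keys: "v \<in> Poly_Mapping.keys (hw w) \<Longrightarrow> length v = length w + 1 \<and> wdeg v = wdeg w - 1 \<and> pdw v = pdw w"
proof (induction w arbitrary: v)
  case (Cons a w)
  have "v \<in> Poly_Mapping.keys (hp (a # w)) \<or> v \<in> Poly_Mapping.keys (cs a (hw w))"
    using Cons.prems by (auto simp: in_keys_iff lookup_add)
  then show ?case
    by (auto elim!: keys_lin_ext dest!: Cons.IH hp_keys split: if_splits)
qed simp

lemma eta_keys:
  assumes "v \<in> Poly_Mapping.keys (eta w)"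
  shows "length v = length w + 1 \<and> wdeg v = wdeg w - 1 \<and> pdw v = pdw w"
proof -
  have "v \<in> Poly_Mapping.keys (h0w w) \<or> v \<in> Poly_Mapping.keys (hw w)"
    using assms unfolding eta_def by (auto simp: in_keys_iff lookup_minus)
  then show ?thesis using hw_keys[of v w] by (auto simp: h0w_def e_deg pd_e simp del: hw.simps split: if_splits)
qed

lemma dT_pd: "v \<in> Poly_Mapping.keys (dT w) \<Longrightarrow> pdw v = pdw w"
proof (induction w arbitrary: v)
  case (Cons a w)
  let ?C = "case w of [] \<Rightarrow> 0 | b # w' \<Rightarrow> lin_ext (\<lambda>x. Poly_Mapping.single (x # w') (1::real)) (mul a b)"
  have "v \<in> Poly_Mapping.keys ?C \<or> v \<in> Poly_Mapping.keys (cs a (dT w))"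
    using Cons.prems by (auto simp: in_keys_iff lookup_add)
  then show ?case
  proof
    assume "v \<in> Poly_Mapping.keys ?C"
    then show ?case using mul_keys by (cases w) (auto elim!: keys_lin_ext split: if_splits)
  qed (auto elim!: keys_lin_ext dest: Cons.IH split: if_splits)
qed simp

lemma rho_keys:
  assumes "v \<in> Poly_Mapping.keys (rho w)"
  shows "length v + 1 = length w \<and> wdeg v = wdeg w + 1 \<and> pdw v = pdw w"
proof -
  consider "v \<in> Poly_Mapping.keys (sigL w)" | "v \<in> Poly_Mapping.keys (sigR w)" | "v \<in> Poly_Mapping.keys (dT w)"
    using assms unfolding rho_def in_keys_iff lookup_minus
    by (cases "Poly_Mapping.lookup (sigL w) v = 0"; cases "Poly_Mapping.lookup (sigR w) v = 0") auto
  then show ?thesis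
  proof cases
    case 1 then show ?thesis by (cases w) (auto simp: sigL_def e_deg pd_e split: if_splits)
  next
    case 2 then show ?thesis by (cases w rule: rev_cases) (auto simp: sigR_def e_deg pd_e split: if_splits)
  next
    case 3 then show ?thesis using dT_keys dT_pd by auto
  qed
qed

abbreviation mg :: "'b \<Rightarrow> 'b list \<Rightarrow> 'b list \<Rightarrow>\<^sub>0 real" where
  "mg a w \<equiv> (case w of [] \<Rightarrow> 0 | b # w' \<Rightarrow> lin_ext (\<lambda>x. Poly_Mapping.single (x # w') 1) (mul a b))"

text \<open>If the differentiated letter is not merged, the two operations act independently; if it
  is, the identity is the derivation rule \<open>der_mul\<close>.\<close>

lemma dT_Dw: "lin_ext dT (Dw j w) = ksgn (jd j) *\<^sub>R lin_ext (Dw j) (dT w)"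
proof (induction w)
  case (Cons a w)
  have 1: "lin_ext dT (cs a y) = lin_ext (mg a) y + ksgn (bdeg a) *\<^sub>R cs a (lin_ext dT y)" for a y
    by (simp add: lin_ext_lin_ext lin_ext_fun_add lin_ext_fun_scale)
  have 2: "lin_ext (Dw j) (cs a y) = lin_ext (\<lambda>v. lin_ext (\<lambda>x. Poly_Mapping.single (x # v) 1) (der j a)) y + ksgn (jd j * bdeg a) *\<^sub>R cs a (lin_ext (Dw j) y)" for y
    by (simp add: lin_ext_lin_ext lin_ext_fun_add lin_ext_fun_scale)
  have 3: "lin_ext (\<lambda>x. ksgn (bdeg x) *\<^sub>R cs x (dT w)) (der j a) = ksgn (bdeg a - jd j) *\<^sub>R lin_ext (\<lambda>x. cs x (dT w)) (der j a)"
    by (rule lin_ext_scale_const) (simp add: der_keys)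
  have 4: "lin_ext (\<lambda>x. cs x y) z = lin_ext (\<lambda>v. lin_ext (\<lambda>x. Poly_Mapping.single (x # v) 1) z) y" for y :: "'b list \<Rightarrow>\<^sub>0 real" and z
    by (rule lin_ext_swap)
  have m: "lin_ext (\<lambda>x. mg x w) (der j a) + ksgn (jd j * bdeg a) *\<^sub>R lin_ext (mg a) (Dw j w) = ksgn (jd j) *\<^sub>R lin_ext (Dw j) (mg a w)"
  proof (cases w)
    case (Cons b w')
    let ?S = "\<lambda>x. Poly_Mapping.single (x # w') (1::real)"
    have "lin_ext (Dw j) (mg a w) = lin_ext ?S (lin_ext (der j) (mul a b)) + ksgn (jd j * (bdeg a + bdeg b + 1)) *\<^sub>R lin_ext (\<lambda>x. cs x (Dw j w')) (mul a b)"
    proof -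
      have "lin_ext (\<lambda>x. ksgn (jd j * bdeg x) *\<^sub>R cs x (Dw j w')) (mul a b) = ksgn (jd j * (bdeg a + bdeg b + 1)) *\<^sub>R lin_ext (\<lambda>x. cs x (Dw j w')) (mul a b)"
        by (rule lin_ext_scale_const) (simp add: mul_keys)
      then show ?thesis by (simp add: Cons lin_ext_lin_ext lin_ext_fun_add)
    qed
    moreover have "lin_ext (mg a) (Dw j w) = lin_ext ?S (lin_ext (mul a) (der j b)) + ksgn (jd j * bdeg b) *\<^sub>R lin_ext (\<lambda>x. cs x (Dw j w')) (mul a b)"
      unfolding 4[of "Dw j w'" "mul a b"] by (simp add: Cons lin_ext_add lin_ext_scale lin_ext_lin_ext)
    moreover have "lin_ext (\<lambda>x. mg x w) (der j a) = lin_ext ?S (lin_ext (\<lambda>x. mul x b) (der j a))"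
      by (simp add: Cons lin_ext_lin_ext)
    ultimately show ?thesis
      by (simp add: der_mul lin_ext_add lin_ext_scale ks algebra_simps)
  qed simp
  have "lin_ext dT (Dw j (a # w)) = lin_ext (\<lambda>x. mg x w) (der j a) + ksgn (jd j * bdeg a) *\<^sub>R lin_ext (mg a) (Dw j w)
      + ksgn (bdeg a - jd j) *\<^sub>R lin_ext (\<lambda>x. cs x (dT w)) (der j a) + ksgn (jd j * bdeg a + bdeg a) *\<^sub>R cs a (lin_ext dT (Dw j w))"
    unfolding 3[symmetric] by (simp only: Dw.simps lin_ext_add lin_ext_scale 1 lin_ext_lin_ext lin_ext_single dT.simps lin_ext_fun_add lin_ext_fun_scale ksgn_add)
      (simp add: lin_ext_fun_add lin_ext_fun_scale algebra_simps)
  moreover have "lin_ext (Dw j) (dT (a # w)) = lin_ext (Dw j) (mg a w) + ksgn (bdeg a) *\<^sub>R (lin_ext (\<lambda>x. cs x (dT w)) (der j a) + ksgn (jd j * bdeg a) *\<^sub>R cs a (lin_ext (Dw j) (dT w)))"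
    unfolding dT.simps lin_ext_add lin_ext_scale 2 4[of "dT w"] ..
  ultimately show ?case
    unfolding m Cons by (simp add: lin_ext_scale ks algebra_simps)
qed simp

text \<open>Merging \<open>xx j\<close> with the letter that was differentiated gives Euler's
  formula, and the sum over all cuts gives the total degree. Merging it with a letter that was not
  differentiated occurs from the left and from the right of that letter, and the two cancel by
  commutativity.\<close>

lemma dT_hw: "lin_ext hw (dT w) + lin_ext dT (hw w) = real (pdw w) *\<^sub>R Poly_Mapping.single w 1"
proof (induction w)
  case (Cons a w)
  let ?s = "ksgn (bdeg a)"
  have hpv: "lin_ext hp y = (\<Sum>j\<in>UNIV. ksgn (jd j) *\<^sub>R cs (xx j) (lin_ext (Dw j) y))" for y
    unfolding hp_def by (simp add: lin_ext_fun_sum lin_ext_fun_scale lin_ext_lin_ext)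
  have 1: "lin_ext dT (cs b y) = lin_ext (mg b) y + ksgn (bdeg b) *\<^sub>R cs b (lin_ext dT y)" for b y
    by (simp add: lin_ext_lin_ext lin_ext_fun_add lin_ext_fun_scale)
  have 2: "lin_ext hw (cs a y) = lin_ext hp (cs a y) + ?s *\<^sub>R cs a (lin_ext hw y)" for y
    by (simp add: lin_ext_lin_ext lin_ext_fun_add lin_ext_fun_scale)
  have 3: "lin_ext dT (hp (a # w)) = (\<Sum>j\<in>UNIV. ksgn (jd j) *\<^sub>R lin_ext (mg (xx j)) (Dw j (a # w))) - lin_ext hp (dT (a # w))"
  proof -
    have "lin_ext dT (hp (a # w)) = (\<Sum>j\<in>UNIV. ksgn (jd j) *\<^sub>R lin_ext (mg (xx j)) (Dw j (a # w)) - ksgn (jd j) *\<^sub>R cs (xx j) (lin_ext (Dw j) (dT (a # w))))"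
      unfolding hp_def lin_ext_sum lin_ext_scale 1 dT_Dw xx_deg
      by (intro sum.cong refl) (simp only: lin_ext_scale scaleR_right_distrib scaleR_scaleR ksgn_diff ksgn_1 ksgn_sq ksgn_sq' mult_minus_right mult_1_right scaleR_minus_left, simp)
    then show ?thesis unfolding sum_subtractf hpv .
  qed
  have 4: "lin_ext (mg (xx j)) (Dw j (a # w)) = lin_ext (\<lambda>x. Poly_Mapping.single (x # w) 1) (lin_ext (mul (xx j)) (der j a))
      + ksgn (jd j * bdeg a) *\<^sub>R lin_ext (\<lambda>x. cs x (Dw j w)) (mul (xx j) a)" for j
    unfolding lin_ext_swap[of _ "Dw j w"] by (simp add: lin_ext_add lin_ext_scale lin_ext_lin_ext)
  have e: "(\<Sum>j\<in>UNIV. ksgn (jd j) *\<^sub>R lin_ext (\<lambda>x. Poly_Mapping.single (x # w) (1::real)) (lin_ext (mul (xx j)) (der j a))) = real (pd a) *\<^sub>R Poly_Mapping.single (a # w) 1"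
    using arg_cong[OF euler[of a], of "lin_ext (\<lambda>x. Poly_Mapping.single (x # w) (1::real))"] by (simp add: lin_ext_sum lin_ext_scale)
  \<comment> \<open>These are the merges of \<open>a\<close> with a following \<open>xx j\<close>.
    In \<open>c\<close> commutativity turns them into merges of \<open>xx j\<close> with
    \<open>a\<close>, which cancel against those in \<open>3\<close> and \<open>4\<close>.\<close>
  have 5: "lin_ext hw (mg a w) - lin_ext hp (mg a w) + ?s *\<^sub>R lin_ext (mg a) (hw w)
      = - (\<Sum>j\<in>UNIV. ksgn (jd j) *\<^sub>R ksgn (jd j * bdeg a) *\<^sub>R lin_ext (\<lambda>x. cs x (Dw j w)) (mul (xx j) a))"
  proof (cases w)
    case (Cons b w')
    have a: "lin_ext hw (mg a w) - lin_ext hp (mg a w) = ksgn (bdeg a + bdeg b + 1) *\<^sub>R lin_ext (\<lambda>x. cs x (hw w')) (mul a b)"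
    proof -
      have "lin_ext (\<lambda>x. ksgn (bdeg x) *\<^sub>R cs x (hw w')) (mul a b) = ksgn (bdeg a + bdeg b + 1) *\<^sub>R lin_ext (\<lambda>x. cs x (hw w')) (mul a b)"
        by (rule lin_ext_scale_const) (simp add: mul_keys)
      then show ?thesis by (simp add: Cons lin_ext_lin_ext lin_ext_fun_add)
    qed
    have b: "lin_ext (mg a) (hw w) = (\<Sum>j\<in>UNIV. ksgn (jd j) *\<^sub>R lin_ext (\<lambda>x. cs x (Dw j w)) (mul a (xx j))) + ksgn (bdeg b) *\<^sub>R lin_ext (\<lambda>x. cs x (hw w')) (mul a b)"
    proof -
      have m: "lin_ext (mg a) (cs c y) = lin_ext (\<lambda>x. cs x y) (mul a c)" for c y
        unfolding lin_ext_swap[of _ y] by (simp add: lin_ext_lin_ext)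
      show ?thesis unfolding Cons hw.simps hp_def lin_ext_add lin_ext_sum lin_ext_scale m ..
    qed
    have c: "?s *\<^sub>R ksgn (jd j) *\<^sub>R lin_ext (\<lambda>x. cs x (Dw j w)) (mul a (xx j)) = - (ksgn (jd j) *\<^sub>R ksgn (jd j * bdeg a) *\<^sub>R lin_ext (\<lambda>x. cs x (Dw j w)) (mul (xx j) a))" for j
      by (subst mul_comm) (simp add: lin_ext_scale lin_ext_minus xx_deg ks mult_ac)
    show ?thesis
      unfolding a b scaleR_right_distrib scaleR_sum_right c sum_negf by (simp add: ks)
  next
    case Nil then show ?thesis by simp
  qed
  have "lin_ext hw (dT (a # w)) + lin_ext dT (hw (a # w))
     = cs a (lin_ext hw (dT w) + lin_ext dT (hw w)) + real (pd a) *\<^sub>R Poly_Mapping.single (a # w) 1"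
  proof -
    have "lin_ext hw (dT (a # w)) = lin_ext hw (mg a w) + ?s *\<^sub>R lin_ext hp (cs a (dT w)) + cs a (lin_ext hw (dT w))"
      unfolding dT.simps lin_ext_add lin_ext_scale 2 by (simp add: scaleR_right_distrib)
    moreover have "lin_ext dT (hw (a # w)) = lin_ext dT (hp (a # w)) + ?s *\<^sub>R lin_ext (mg a) (hw w) + cs a (lin_ext dT (hw w))"
      unfolding hw.simps lin_ext_add lin_ext_scale 1 by (simp add: scaleR_right_distrib)
    moreover have "lin_ext hp (dT (a # w)) = lin_ext hp (mg a w) + ?s *\<^sub>R lin_ext hp (cs a (dT w))"
      unfolding dT.simps lin_ext_add lin_ext_scale ..
    moreover have "lin_ext hw (mg a w) = lin_ext hp (mg a w) - ?s *\<^sub>R lin_ext (mg a) (hw w)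
        - (\<Sum>j\<in>UNIV. ksgn (jd j) *\<^sub>R ksgn (jd j * bdeg a) *\<^sub>R lin_ext (\<lambda>x. cs x (Dw j w)) (mul (xx j) a))"
      using 5 by (simp only: diff_eq_eq add_diff_eq eq_diff_eq diff_add_eq add_ac eq_neg_iff_add_eq_0) (simp add: add_ac)
    moreover have "lin_ext dT (hp (a # w)) = real (pd a) *\<^sub>R Poly_Mapping.single (a # w) 1
        + (\<Sum>j\<in>UNIV. ksgn (jd j) *\<^sub>R ksgn (jd j * bdeg a) *\<^sub>R lin_ext (\<lambda>x. cs x (Dw j w)) (mul (xx j) a)) - lin_ext hp (dT (a # w))"
      unfolding 3 4 scaleR_right_distrib sum.distrib e ..
    ultimately show ?thesis
      by (simp only: lin_ext_add) simp
  qed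
  then show ?case unfolding Cons by (simp add: lin_ext_scale scaleR_left_distrib add.commute)
qed simp

end

section \<open>The homotopy modulo shuffles, and its anticommutator with the leading part\<close>

context poly_letters
begin

text \<open>Acting on one letter at a time, \<open>Dw j\<close> is a derivation of the shuffle
  product as well as of concatenation.\<close>

lemma sh_Dw:
  fixes \<Phi> :: "'b list \<Rightarrow> 'v::real_vector"
  shows "sh u v (\<lambda>w. lin_ext \<Phi> (Dw j w)) = lin_ext (\<lambda>u'. sh u' v \<Phi>) (Dw j u)
    + ksgn (jd j * wdeg u) *\<^sub>R lin_ext (\<lambda>v'. sh u v' \<Phi>) (Dw j v)"
proof (induction u v arbitrary: \<Phi> rule: shuffle_prod.induct)
  case (3 a u b v)
  let ?A = "\<lambda>w. \<Phi> (a # w)" and ?B = "\<lambda>w. \<Phi> (b # w)"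
  let ?j = "jd j" and ?\<beta> = "bdeg b" and ?\<alpha> = "wdeg (a # u)"
  have F: "lin_ext \<Phi> (Dw j (c # w)) = lin_ext (\<lambda>x. \<Phi> (x # w)) (der j c) + ksgn (?j * bdeg c) *\<^sub>R lin_ext (\<lambda>w. \<Phi> (c # w)) (Dw j w)" for c w
    by (simp add: lin_ext_add lin_ext_scale lin_ext_lin_ext)
  have L: "lin_ext G (Dw j (c # w)) = lin_ext (\<lambda>x. G (x # w)) (der j c) + ksgn (?j * bdeg c) *\<^sub>R lin_ext (\<lambda>w. G (c # w)) (Dw j w)" for c w and G :: "'b list \<Rightarrow> 'v"
    by (simp add: lin_ext_add lin_ext_scale lin_ext_lin_ext)
  have T1: "lin_ext (\<lambda>x. sh (x # u) (b # v) \<Phi>) (der j a) = lin_ext (\<lambda>x. sh u (b # v) (\<lambda>w. \<Phi> (x # w))) (der j a)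
      + ksgn (?\<beta> * (?\<alpha> - ?j)) *\<^sub>R lin_ext (\<lambda>x. sh (x # u) v ?B) (der j a)"
    unfolding sh_Cons lin_ext_fun_add by (intro arg_cong2[where f = "(+)"] refl lin_ext_scale_const) (simp add: der_keys algebra_simps)
  have T2: "lin_ext (\<lambda>u'. sh (a # u') (b # v) \<Phi>) (Dw j u) = lin_ext (\<lambda>u'. sh u' (b # v) ?A) (Dw j u)
      + ksgn (?\<beta> * (?\<alpha> - ?j)) *\<^sub>R lin_ext (\<lambda>u'. sh (a # u') v ?B) (Dw j u)"
    unfolding sh_Cons lin_ext_fun_add by (intro arg_cong2[where f = "(+)"] refl lin_ext_scale_const) (simp add: Dw_keys algebra_simps)
  have T3: "lin_ext (\<lambda>x. sh (a # u) (x # v) \<Phi>) (der j b) = lin_ext (\<lambda>x. sh u (x # v) ?A) (der j b)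
      + ksgn ((?\<beta> - ?j) * ?\<alpha>) *\<^sub>R lin_ext (\<lambda>x. sh (a # u) v (\<lambda>w. \<Phi> (x # w))) (der j b)"
    unfolding sh_Cons lin_ext_fun_add by (intro arg_cong2[where f = "(+)"] refl lin_ext_scale_const) (simp add: der_keys algebra_simps)
  have T4: "lin_ext (\<lambda>v'. sh (a # u) (b # v') \<Phi>) (Dw j v) = lin_ext (\<lambda>v'. sh u (b # v') ?A) (Dw j v)
      + ksgn (?\<beta> * ?\<alpha>) *\<^sub>R lin_ext (\<lambda>v'. sh (a # u) v' ?B) (Dw j v)"
    unfolding sh_Cons lin_ext_fun_add lin_ext_fun_scale ..
  have "sh (a # u) (b # v) (\<lambda>w. lin_ext \<Phi> (Dw j w)) =
      lin_ext (\<lambda>x. sh u (b # v) (\<lambda>w. \<Phi> (x # w))) (der j a) + ksgn (?j * bdeg a) *\<^sub>R sh u (b # v) (\<lambda>w. lin_ext ?A (Dw j w))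
      + ksgn (?\<beta> * ?\<alpha>) *\<^sub>R (lin_ext (\<lambda>x. sh (a # u) v (\<lambda>w. \<Phi> (x # w))) (der j b) + ksgn (?j * ?\<beta>) *\<^sub>R sh (a # u) v (\<lambda>w. lin_ext ?B (Dw j w)))"
    unfolding sh_Cons[of a u b v] F by (simp add: sh_add sh_scale sh_lin_ext)
  also have "\<dots> = lin_ext (\<lambda>u'. sh u' (b # v) \<Phi>) (Dw j (a # u)) + ksgn (jd j * wdeg (a # u)) *\<^sub>R lin_ext (\<lambda>v'. sh (a # u) v' \<Phi>) (Dw j (b # v))"
    unfolding 3 L T1 T2 T3 T4 by (simp add: ks algebra_simps)
  finally show ?case .
qed simp_all

lemma hw_dec: "lin_ext \<Phi> (hw w) = (\<Sum>j\<in>UNIV. ksgn (jd j) *\<^sub>R dec w (\<lambda>u v. ksgn (wdeg u) *\<^sub>R lin_ext (\<lambda>v'. \<Phi> (u @ xx j # v')) (Dw j v)))"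
  for \<Phi> :: "'b list \<Rightarrow> 'v::real_vector"
proof (induction w arbitrary: \<Phi>)
  case (Cons a w)
  have "lin_ext \<Phi> (hw (a # w)) = lin_ext \<Phi> (hp (a # w)) + ksgn (bdeg a) *\<^sub>R lin_ext (\<lambda>v. \<Phi> (a # v)) (hw w)"
    by (simp add: lin_ext_add lin_ext_scale lin_ext_lin_ext)
  also have "lin_ext \<Phi> (hp (a # w)) = (\<Sum>j\<in>UNIV. ksgn (jd j) *\<^sub>R lin_ext (\<lambda>v'. \<Phi> (xx j # v')) (Dw j (a # w)))"
    unfolding hp_def by (simp add: lin_ext_sum lin_ext_scale lin_ext_lin_ext)
  finally have E: "lin_ext \<Phi> (hw (a # w)) = (\<Sum>j\<in>UNIV. ksgn (jd j) *\<^sub>R lin_ext (\<lambda>v'. \<Phi> (xx j # v')) (Dw j (a # w)))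
      + ksgn (bdeg a) *\<^sub>R lin_ext (\<lambda>v. \<Phi> (a # v)) (hw w)" .
  show ?case
    unfolding E Cons scaleR_sum_right sum.distrib[symmetric]
    by (intro sum.cong refl)
      (simp add: ks scaleR_right_distrib mult_ac flip: dec_scale)
qed simp

text \<open>\<open>dec_sh_insert\<close> read backwards: all ways to distribute \<open>v\<close> to
  the two sides of \<open>x\<close> add up to the shuffle of \<open>v\<close> with
  \<open>A @ x # B\<close>.\<close>

lemma insert_cut:
  fixes \<Phi> :: "'b list \<Rightarrow> 'v::real_vector"
  assumes "wdeg B = c - k" "bdeg x = k - 1"
  shows "dec v (\<lambda>v1 v2. ksgn (c * wdeg v1) *\<^sub>R sh A v1 (\<lambda>p. ksgn (wdeg p) *\<^sub>R sh B v2 (\<lambda>q. \<Phi> (p @ x # q))))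
    = ksgn (c * wdeg v + wdeg A + wdeg v + wdeg A * wdeg v) *\<^sub>R sh v (A @ x # B) \<Phi>"
  unfolding dec_sh_insert dec_scale[symmetric]
proof (rule dec_cong)
  fix v1 v2 :: "'b list" assume v: "v = v1 @ v2"
  have "sh A v1 (\<lambda>p. ksgn (wdeg p) *\<^sub>R sh B v2 (\<lambda>q. \<Phi> (p @ x # q))) = ksgn (wdeg A + wdeg v1) *\<^sub>R sh A v1 (\<lambda>p. sh B v2 (\<lambda>q. \<Phi> (p @ x # q)))"
    by (rule sh_scale_deg) simp
  also have "\<dots> = ksgn (wdeg A + wdeg v1 + wdeg A * wdeg v1 + wdeg B * wdeg v2) *\<^sub>R sh v1 A (\<lambda>p. sh v2 B (\<lambda>q. \<Phi> (p @ x # q)))"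
    unfolding sh_comm[of A v1] sh_comm[of B v2] sh_scale by (simp add: ksgn_add mult_ac)
  finally show "ksgn (c * wdeg v1) *\<^sub>R sh A v1 (\<lambda>p. ksgn (wdeg p) *\<^sub>R sh B v2 (\<lambda>q. \<Phi> (p @ x # q))) =
    ksgn (c * wdeg v + wdeg A + wdeg v + wdeg A * wdeg v) *\<^sub>R
      ksgn (wdeg v2 * (wdeg A + bdeg x)) *\<^sub>R sh v1 A (\<lambda>p. sh v2 B (\<lambda>q. \<Phi> (p @ x # q)))"
    by (simp add: v assms ks mult_ac)
qed

lemma insert_cut':
  fixes \<Phi> :: "'b list \<Rightarrow> 'v::real_vector"
  assumes "bdeg x = k - 1"
  shows "dec u (\<lambda>u1 u2. ksgn (wdeg u2 * wdeg A) *\<^sub>R sh u1 A (\<lambda>p. ksgn (wdeg p) *\<^sub>R ksgn (k * wdeg u2) *\<^sub>R sh u2 B (\<lambda>q. \<Phi> (p @ x # q))))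
    = ksgn (wdeg u + wdeg A) *\<^sub>R sh u (A @ x # B) \<Phi>"
  unfolding dec_sh_insert dec_scale[symmetric]
proof (rule dec_cong)
  fix u1 u2 :: "'b list" assume u: "u = u1 @ u2"
  have "sh u1 A (\<lambda>p. ksgn (wdeg p) *\<^sub>R ksgn (k * wdeg u2) *\<^sub>R sh u2 B (\<lambda>q. \<Phi> (p @ x # q)))
      = ksgn (wdeg u1 + wdeg A) *\<^sub>R sh u1 A (\<lambda>p. ksgn (k * wdeg u2) *\<^sub>R sh u2 B (\<lambda>q. \<Phi> (p @ x # q)))"
    by (rule sh_scale_deg) simp
  then show "ksgn (wdeg u2 * wdeg A) *\<^sub>R sh u1 A (\<lambda>p. ksgn (wdeg p) *\<^sub>R ksgn (k * wdeg u2) *\<^sub>R sh u2 B (\<lambda>q. \<Phi> (p @ x # q))) =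
    ksgn (wdeg u + wdeg A) *\<^sub>R ksgn (wdeg u2 * (wdeg A + bdeg x)) *\<^sub>R sh u1 A (\<lambda>p. sh u2 B (\<lambda>q. \<Phi> (p @ x # q)))"
    unfolding sh_scale by (simp add: u assms ks mult_ac)
qed

text \<open>Cutting a shuffle and differentiating on the right of the cut affects letters of
  \<open>u\<close> or of \<open>v\<close>. For a fixed cut of the affected word the cuts of the
  other one add up to its shuffle with a word containing \<open>xx j\<close>, and
  \<open>\<Phi>\<close> kills it.\<close>

lemma shk_hw:
  fixes \<Phi> :: "'b list \<Rightarrow> 'v::real_vector"
  assumes k: "shk \<Phi>"
  shows "shk (\<lambda>w. lin_ext \<Phi> (hw w))"
  unfolding shk_def
proof (intro allI impI)
  fix u v :: "'b list" assume uv: "u \<noteq> []" "v \<noteq> []"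
  have "sh u v (\<lambda>w. dec w (\<lambda>u v. ksgn (wdeg u) *\<^sub>R lin_ext (\<lambda>v'. \<Phi> (u @ xx j # v')) (Dw j v))) = 0" for j
  proof -
    let ?K = "\<lambda>p q. \<Phi> (p @ xx j # q)"
    have "sh u v (\<lambda>w. dec w (\<lambda>u v. ksgn (wdeg u) *\<^sub>R lin_ext (?K u) (Dw j v)))
      = dec u (\<lambda>u1 u2. dec v (\<lambda>v1 v2. ksgn (wdeg u2 * wdeg v1) *\<^sub>R sh u1 v1 (\<lambda>p. ksgn (wdeg p) *\<^sub>R
          (lin_ext (\<lambda>u'. sh u' v2 (?K p)) (Dw j u2) + ksgn (jd j * wdeg u2) *\<^sub>R lin_ext (\<lambda>v'. sh u2 v' (?K p)) (Dw j v2)))))"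
      unfolding dec_sh sh_scale sh_Dw ..
    also have "\<dots> = dec u (\<lambda>u1 u2. lin_ext (\<lambda>u'. dec v (\<lambda>v1 v2. ksgn (wdeg u2 * wdeg v1) *\<^sub>R sh u1 v1 (\<lambda>p. ksgn (wdeg p) *\<^sub>R sh u' v2 (?K p)))) (Dw j u2))
      + dec u (\<lambda>u1 u2. dec v (\<lambda>v1 v2. lin_ext (\<lambda>v'. ksgn (wdeg u2 * wdeg v1) *\<^sub>R sh u1 v1 (\<lambda>p. ksgn (wdeg p) *\<^sub>R ksgn (jd j * wdeg u2) *\<^sub>R sh u2 v' (?K p))) (Dw j v2)))"
      by (simp add: scaleR_right_distrib sh_add dec_add sh_lin_ext lin_ext_dec flip: lin_ext_fun_scale del: scaleR_scaleR)
    also have "dec u (\<lambda>u1 u2. lin_ext (\<lambda>u'. dec v (\<lambda>v1 v2. ksgn (wdeg u2 * wdeg v1) *\<^sub>R sh u1 v1 (\<lambda>p. ksgn (wdeg p) *\<^sub>R sh u' v2 (?K p)))) (Dw j u2)) = dec u (\<lambda>u1 u2. 0)"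
    proof (rule dec_cong, rule lin_ext_eq_0)
      fix u1 u2 u' assume "u' \<in> Poly_Mapping.keys (Dw j u2)"
      then have "wdeg u' = wdeg u2 - jd j" by (simp add: Dw_keys)
      then show "dec v (\<lambda>v1 v2. ksgn (wdeg u2 * wdeg v1) *\<^sub>R sh u1 v1 (\<lambda>p. ksgn (wdeg p) *\<^sub>R sh u' v2 (?K p))) = 0"
        by (subst insert_cut) (use xx_deg shkD[OF k uv(2)] in auto)
    qed
    also have "dec u (\<lambda>u1 u2. dec v (\<lambda>v1 v2. lin_ext (\<lambda>v'. ksgn (wdeg u2 * wdeg v1) *\<^sub>R sh u1 v1 (\<lambda>p. ksgn (wdeg p) *\<^sub>R ksgn (jd j * wdeg u2) *\<^sub>R sh u2 v' (?K p))) (Dw j v2))) = 0"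
      by (subst dec_swap, subst lin_ext_dec[symmetric], subst insert_cut'[OF xx_deg]) (simp add: shkD[OF k uv(1)])
    finally show ?thesis by simp
  qed
  then show "sh u v (\<lambda>w. lin_ext \<Phi> (hw w)) = 0"
    unfolding hw_dec sh_def lin_ext_fun_sum lin_ext_fun_scale by simp
qed

lemma shk_eta:
  fixes \<Phi> :: "'b list \<Rightarrow> 'v::real_vector"
  assumes k: "shk \<Phi>"
  shows "shk (\<lambda>w. lin_ext \<Phi> (eta w))"
  unfolding shk_def
proof (intro allI impI)
  fix u v :: "'b list" assume uv: "u \<noteq> []" "v \<noteq> []"
  have "sh u v (\<lambda>w. lin_ext \<Phi> (h0w w)) = sh u v (\<lambda>w. 0)"
    by (rule sh_cong_deg) (use uv in \<open>cases u; cases v; auto simp: h0w_def\<close>)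
  then show "sh u v (\<lambda>w. lin_ext \<Phi> (eta w)) = 0"
    using shkD[OF shk_hw[OF k] uv] unfolding eta_def lin_ext_diff sh_def lin_ext_fun_diff by simp
qed

lemma eta_Nil [simp]: "eta [] = 0" by (simp add: eta_def h0w_def)

lemma xx_ne_e: "xx j \<noteq> e" using pd_xx[of j] pd_e by auto

text \<open>A word of \<open>hw w\<close> begins with a variable, which is not the unit, or with the
  first letter of \<open>w\<close>; that letter may be removed before or after \<open>hw\<close>, up
  to the sign of its odd degree.\<close>

lemma sigL_hw: "lin_ext hw (sigL w) + lin_ext sigL (hw w) = 0"
proof (cases w)
  case (Cons a w')
  have "lin_ext sigL (hp w) = 0"
    unfolding hp_def lin_ext_sum lin_ext_scale lin_ext_lin_ext by (simp add: sigL_def xx_ne_e)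
  moreover have "lin_ext sigL (cs a (hw w')) = (if a = e then hw w' else 0)"
    by (simp add: lin_ext_lin_ext sigL_def)
  ultimately show ?thesis
    by (simp add: Cons lin_ext_add lin_ext_scale) (simp add: sigL_def e_deg)
qed (simp add: sigL_def)

lemma Dw_snoc: "lin_ext \<Phi> (Dw j (w @ [b])) = lin_ext (\<lambda>v. \<Phi> (v @ [b])) (Dw j w) + ksgn (jd j * wdeg w) *\<^sub>R lin_ext (\<lambda>x. \<Phi> (w @ [x])) (der j b)"
  for \<Phi> :: "'b list \<Rightarrow> 'v::real_vector"
proof (induction w arbitrary: \<Phi>)
  case Nil
  then show ?case by (simp add: lin_ext_lin_ext)
next
  case (Cons a w)
  then show ?case
    by (simp add: lin_ext_add lin_ext_scale lin_ext_lin_ext ks algebra_simps)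
qed

lemma hw_snoc: "lin_ext \<Phi> (hw (w @ [b])) = lin_ext (\<lambda>v. \<Phi> (v @ [b])) (hw w)
    + (\<Sum>j\<in>UNIV. ksgn (jd j) *\<^sub>R lin_ext (\<lambda>x. dec w (\<lambda>u v. ksgn (wdeg u + jd j * wdeg v) *\<^sub>R \<Phi> (u @ xx j # v @ [x]))) (der j b))"
  for \<Phi> :: "'b list \<Rightarrow> 'v::real_vector"
  unfolding hw_dec dec_snoc
  by (simp add: Dw_snoc scaleR_right_distrib dec_add sum.distrib lin_ext_dec ksgn_add flip: lin_ext_fun_scale)

definition vr :: "'b list \<Rightarrow> bool" where "vr w \<longleftrightarrow> length w = 1 \<and> pdw w = 1"

lemma vr_iff: "vr w \<longleftrightarrow> (\<exists>j. w = [xx j])"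
  using pd_xx pd_1 by (auto simp: vr_def length_Suc_conv)

lemma der_e:
  assumes "e \<in> Poly_Mapping.keys (der j b)" shows "\<exists>k. b = xx k"
  using der_keys[OF assms] pd_1 by (simp add: pd_e)

text \<open>The right end differs from the left: differentiating a last letter \<open>xx k\<close>
  produces a unit there. The sum over the cuts is the shuffle of the rest with
  \<open>[xx k]\<close>, killed by \<open>\<Phi>\<close> unless the rest is empty. Hence the
  exceptional value of \<open>lam\<close> on single variables.\<close>

lemma sigR_hw:
  fixes \<Phi> :: "'b list \<Rightarrow> 'v::real_vector"
  assumes k: "shk \<Phi>"
  shows "lin_ext \<Phi> (lin_ext hw (sigR w)) + lin_ext \<Phi> (lin_ext sigR (hw w)) = - (if vr w then \<Phi> w else 0)"
proof (cases w rule: rev_cases)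
  case (snoc w' b)
  let ?S = "\<lambda>v. lin_ext \<Phi> (sigR v)"
  have S: "?S (v @ [c]) = (if c = e then ksgn (wdeg v) *\<^sub>R \<Phi> v else 0)" for v c
    by (simp add: sigR_def)
  have "lin_ext \<Phi> (lin_ext sigR (hw w)) = lin_ext (\<lambda>v. ?S (v @ [b])) (hw w')
    + (\<Sum>j\<in>UNIV. ksgn (jd j) *\<^sub>R lin_ext (\<lambda>x. dec w' (\<lambda>u v. ksgn (wdeg u + jd j * wdeg v) *\<^sub>R ?S ((u @ xx j # v) @ [x]))) (der j b))"
    unfolding lin_ext_lin_ext unfolding snoc hw_snoc by simp
  also have "lin_ext (\<lambda>v. ?S (v @ [b])) (hw w') = - lin_ext \<Phi> (lin_ext hw (sigR w))"
  proof -
    have "lin_ext (\<lambda>v. ksgn (wdeg v) *\<^sub>R \<Phi> v) (hw w') = ksgn (wdeg w' - 1) *\<^sub>R lin_ext \<Phi> (hw w')"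
      by (rule lin_ext_scale_const) (simp add: hw_keys)
    then show ?thesis unfolding S by (simp add: snoc sigR_def lin_ext_scale ks)
  qed
  also have "(\<Sum>j\<in>UNIV. ksgn (jd j) *\<^sub>R lin_ext (\<lambda>x. dec w' (\<lambda>u v. ksgn (wdeg u + jd j * wdeg v) *\<^sub>R ?S ((u @ xx j # v) @ [x]))) (der j b))
     = - (if vr w then \<Phi> w else 0)"
  proof (cases "\<exists>k. b = xx k")
    case True
    then obtain k where b: "b = xx k" by blast
    have "(\<Sum>j\<in>UNIV. ksgn (jd j) *\<^sub>R lin_ext (\<lambda>x. dec w' (\<lambda>u v. ksgn (wdeg u + jd j * wdeg v) *\<^sub>R ?S ((u @ xx j # v) @ [x]))) (der j b))
      = (\<Sum>j\<in>UNIV. if j = k then ksgn (jd j) *\<^sub>R dec w' (\<lambda>u v. ksgn (wdeg u + jd j * wdeg v) *\<^sub>R ?S ((u @ xx j # v) @ [e])) else 0)"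
      unfolding b by (intro sum.cong refl) (simp add: der_xx)
    also have "\<dots> = ksgn (jd k) *\<^sub>R dec w' (\<lambda>u v. ksgn (wdeg u + jd k * wdeg v) *\<^sub>R ?S ((u @ xx k # v) @ [e]))"
      by simp
    also have "\<dots> = - ksgn (wdeg w' + wdeg w') *\<^sub>R dec w' (\<lambda>u v. ksgn (wdeg v * bdeg (xx k)) *\<^sub>R \<Phi> (u @ xx k # v))"
      unfolding S dec_scale[symmetric] by (rule dec_cong) (simp add: xx_deg ks mult_ac)
    also have "dec w' (\<lambda>u v. ksgn (wdeg v * bdeg (xx k)) *\<^sub>R \<Phi> (u @ xx k # v)) = sh w' [xx k] \<Phi>"
      using dec_sh_insert[of w' "[]" "xx k" "[]" \<Phi>] by simp
    also have "- ksgn (wdeg w' + wdeg w') *\<^sub>R sh w' [xx k] \<Phi> = - (if vr w then \<Phi> w else 0)"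
    proof (cases "w' = []")
      case True then show ?thesis by (auto simp: snoc b vr_iff)
    next
      case False then show ?thesis using shkD[OF k False, of "[xx k]"] by (auto simp: snoc vr_iff)
    qed
    finally show ?thesis .
  next
    case False
    have "lin_ext (\<lambda>x. dec w' (\<lambda>u v. ksgn (wdeg u + jd j * wdeg v) *\<^sub>R ?S ((u @ xx j # v) @ [x]))) (der j b) = 0" for j
    proof (rule lin_ext_eq_0)
      fix x assume "x \<in> Poly_Mapping.keys (der j b)"
      then have "x \<noteq> e" using der_e False by blast
      then show "dec w' (\<lambda>u v. ksgn (wdeg u + jd j * wdeg v) *\<^sub>R ?S ((u @ xx j # v) @ [x])) = 0"
        unfolding S by simp
    qed
    moreover have "\<not> vr w" using False by (auto simp: vr_iff snoc)
    ultimately show ?thesis by simp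
  qed
  finally show ?thesis by simp
qed (simp add: sigR_def vr_def)

definition ue :: "'b list \<Rightarrow> bool" where "ue w \<longleftrightarrow> (length w = 1 \<or> length w = 2) \<and> pdw w = 0"

lemma pd_iff: "pd a = 0 \<longleftrightarrow> a = e"
  using pd_e pd_0 by metis

lemma ue_iff: "ue w \<longleftrightarrow> w = [e] \<or> w = [e, e]"
  by (auto simp: ue_def length_Suc_conv numeral_2_eq_2 pd_iff)

text \<open>In \<open>rho [e, e]\<close> the three terms are \<open>[e]\<close>, \<open>[e]\<close>
  and \<open>- [e]\<close>, while \<open>rho [e] = 0\<close>. So \<open>[e, e]\<close> and
  \<open>[e]\<close> form an acyclic pair contracted by \<open>h0w\<close>.\<close>

lemma rho_h0: "lin_ext h0w (rho w) + lin_ext rho (h0w w) = (if ue w then Poly_Mapping.single w 1 else 0)"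
proof -
  have ee: "mul e e = Poly_Mapping.single e 1" by (rule mul_e)
  have r1: "rho [e] = 0" by (simp add: rho_def sigL_def sigR_def)
  have r2: "rho [e, e] = Poly_Mapping.single [e] 1"
    by (simp add: rho_def sigL_def sigR_def ee e_deg single_uminus)
  consider "w = [e]" | "w = [e, e]" | "\<not> ue w" by (auto simp: ue_iff)
  then show ?thesis
  proof cases
    case 1 then show ?thesis by (simp add: r1 r2 h0w_def ue_iff)
  next
    case 2 then show ?thesis by (simp add: r2 h0w_def ue_iff)
  next
    case 3
    have "lin_ext h0w (rho w) = 0"
    proof (rule lin_ext_eq_0)
      fix v assume "v \<in> Poly_Mapping.keys (rho w)"
      from rho_keys[OF this] 3 have "v \<noteq> [e]" by (auto simp: ue_def pd_e)
      then show "h0w v = 0" by (simp add: h0w_def)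
    qed
    moreover have "h0w w = 0" using 3 by (auto simp: h0w_def ue_iff)
    ultimately show ?thesis using 3 by simp
  qed
qed

text \<open>The diagonal entries: the degree from \<open>dT_hw\<close>, corrected by
  \<open>sigR_hw\<close> on single variables and by \<open>rho_h0\<close> on unit words. The value
  on a single variable is zero, as it must be because derivations survive.\<close>

definition lam :: "'b list \<Rightarrow> real" where
  "lam w = real (pdw w) - (if vr w then 1 else 0) + (if ue w then 1 else 0)"

lemma rho_eta:
  fixes \<Phi> :: "'b list \<Rightarrow> 'v::real_vector"
  assumes k: "shk \<Phi>"
  shows "lin_ext (\<lambda>v. lin_ext \<Phi> (eta v)) (rho w) + lin_ext (\<lambda>v. lin_ext \<Phi> (rho v)) (eta w) = lam w *\<^sub>R \<Phi> w"
proof -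
  have "lin_ext \<Phi> (lin_ext eta (rho w)) + lin_ext \<Phi> (lin_ext rho (eta w))
    = lin_ext \<Phi> (lin_ext h0w (rho w) + lin_ext rho (h0w w)) - lin_ext \<Phi> (lin_ext hw (sigL w) + lin_ext sigL (hw w))
      + (lin_ext \<Phi> (lin_ext hw (sigR w)) + lin_ext \<Phi> (lin_ext sigR (hw w))) + lin_ext \<Phi> (lin_ext hw (dT w) + lin_ext dT (hw w))"
    unfolding eta_def[abs_def] rho_def[abs_def] lin_ext_diff lin_ext_fun_diff lin_ext_add by simp
  also have "\<dots> = lam w *\<^sub>R \<Phi> w"
    unfolding rho_h0 sigL_hw sigR_hw[OF k] dT_hw by (simp add: lam_def lin_ext_scale algebra_simps)
  finally show ?thesis unfolding lin_ext_lin_ext .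
qed

end

section \<open>The complex of \<open>[d_m, \<cdot>]\<close> on corestrictions\<close>

lemma supercommutator_add: "linear D \<Longrightarrow> supercommutator p q D (\<lambda>x. E x + F x) = (\<lambda>x. supercommutator p q D E x + supercommutator p q D F x)"
  by (rule ext) (simp add: supercommutator_def linear_add scaleR_right_distrib)

lemma supercommutator_scale: "linear D \<Longrightarrow> supercommutator p q D (\<lambda>x. r *\<^sub>R E x) = (\<lambda>x. r *\<^sub>R supercommutator p q D E x)"
  by (rule ext) (simp add: supercommutator_def linear_cmul scaleR_right_diff_distrib)

lemma supercommutator_sq:
  assumes "linear D" "\<And>x. D (D x) = 0" "linear E"
  shows "supercommutator 1 (1 + p) D (supercommutator 1 p D E) = (\<lambda>x. 0)"
  by (rule ext) (simp add: supercommutator_def linear_diff[OF assms(1)] linear_cmul[OF assms(1)] assms(2) linear_0[OF assms(3)] ks)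

lemma cochain_add: "cochain p f \<Longrightarrow> cochain p g \<Longrightarrow> cochain p (\<lambda>ws. f ws + g ws)"
  using cochain_cor[OF coderivation_add[OF coderivation_cd coderivation_cd, of p f g]]
  by (simp add: cor_def[abs_def] linear_add[OF linear_cogen] cogen_cd)

lemma cochain_scale: "cochain p f \<Longrightarrow> cochain p (\<lambda>ws. r *\<^sub>R f ws)"
  using cochain_cor[OF coderivation_scale[OF coderivation_cd, of p f r]]
  by (simp add: cor_def[abs_def] linear_cmul[OF linear_cogen] cogen_cd)

lemma cd_add: "cochain p f \<Longrightarrow> cochain p g \<Longrightarrow> cd p (\<lambda>ws. f ws + g ws) = (\<lambda>x. cd p f x + cd p g x)"
  by (rule coderivation_eqI[of p])
    (simp_all add: coderivation_cd coderivation_add cochain_add cor_def linear_add[OF linear_cogen] cogen_cd)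

lemma cd_scale: "cochain p f \<Longrightarrow> cd p (\<lambda>ws. r *\<^sub>R f ws) = (\<lambda>x. r *\<^sub>R cd p f x)"
  by (rule coderivation_eqI[of p])
    (simp_all add: coderivation_cd coderivation_scale cochain_scale cor_def linear_cmul[OF linear_cogen] cogen_cd)

lemma cochain_scale_inv:
  assumes "cochain p f" "word_inv r"
  shows "cochain p (\<lambda>ws. r ws *\<^sub>R f ws)"
  using good0_scale_inv[OF cochainD(2)[OF assms(1)] assms(2)] cochainD(3,4)[OF assms(1)]
  by (auto simp: cochain_def good_def homog_def in_keys_iff)

lemma cochain_zero: "cochain p (\<lambda>ws. 0)"
  by (simp add: cochain_def good_def homog_def)

context poly_letters
begin

definition dl :: "int \<Rightarrow> ('b list list \<Rightarrow> 'b \<Rightarrow>\<^sub>0 real) \<Rightarrow> 'b list list \<Rightarrow> 'b \<Rightarrow>\<^sub>0 real" where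
  "dl p f = cor (supercommutator 1 p dm (cd p f))"

lemma dm_linear: "linear dm" and db_linear: "linear db"
  by (rule linear_cd[OF cochain_mm], rule linear_cd[OF cochain_brr])

lemma cochain_dl: "cochain p f \<Longrightarrow> cochain (p + 1) (dl p f)"
  unfolding dl_def add.commute[of p 1] by (rule cochain_cor[OF coderivation_supercommutator[OF dm_coder coderivation_cd]])

lemma dl_eq: "cochain p f \<Longrightarrow> dl p f ws = DD p f ws [] mm - ksgn p *\<^sub>R hat 1 dT ws f"
  unfolding dl_def cor_supercommutator[OF dm_coder coderivation_cd]
  by (simp add: cor_cd cor_dm DD_mm cochainD(2))

lemma dl_add: "cochain p f \<Longrightarrow> cochain p g \<Longrightarrow> dl p (\<lambda>ws. f ws + g ws) ws = dl p f ws + dl p g ws"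
  unfolding dl_def by (simp add: cd_add supercommutator_add[OF dm_linear] cor_def linear_add[OF linear_cogen])

lemma dl_scale: "cochain p f \<Longrightarrow> dl p (\<lambda>ws. r *\<^sub>R f ws) ws = r *\<^sub>R dl p f ws"
  unfolding dl_def by (simp add: cd_scale supercommutator_scale[OF dm_linear] cor_def linear_cmul[OF linear_cogen])

lemma dl_dl: "cochain p f \<Longrightarrow> dl (p + 1) (dl p f) ws = 0"
proof -
  assume f: "cochain p f"
  have "cd (p + 1) (dl p f) = supercommutator 1 p dm (cd p f)"
    unfolding dl_def add.commute[of p] by (rule cd_cor[OF coderivation_supercommutator[OF dm_coder coderivation_cd[OF f]]])
  then show ?thesis
    unfolding dl_def[of "p + 1"] using supercommutator_sq[OF dm_linear dm_dm linear_cd[OF f], of p]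
    by (simp add: cor_def add.commute linear_0[OF linear_cogen])
qed

lemma mul_e': "mul e = (\<lambda>a. Poly_Mapping.single a 1)"
  by (rule ext) (rule mul_e)

text \<open>Splitting off a letter of positive polynomial degree leaves arguments of degree below
  \<open>n\<close>, where \<open>\<phi>\<close> vanishes. Only the unit remains, and multiplying by
  it changes nothing.\<close>

lemma lc_unit:
  assumes "\<And>zs. pdl zs < n \<Longrightarrow> \<phi> zs = 0" "pdl ws \<le> n"
  shows "lc ws (\<lambda>a zs. if length a = 1 then K a *\<^sub>R lin_ext (mul (hd a)) (\<phi> zs) else 0) = K [e] *\<^sub>R hat 1 sigL ws \<phi>"
  using assms
proof (induction ws arbitrary: n \<phi> K)
  case (Cons w ws)
  have "lc ws (\<lambda>a zs. if length a = 1 then (ksgn (wdeg a * tdeg w) * K a) *\<^sub>R lin_ext (mul (hd a)) (\<phi> (w # zs)) else 0)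
      = (ksgn (wdeg [e] * tdeg w) * K [e]) *\<^sub>R hat 1 sigL ws (\<lambda>y. \<phi> (w # y))"
    by (rule Cons.IH[of "n - pdw w"]) (use Cons.prems in auto)
  moreover have "dec w (\<lambda>a b. if a = [] then 0 else if length a = 1 then K a *\<^sub>R lin_ext (mul (hd a)) (\<phi> (b # ws)) else 0)
      = K [e] *\<^sub>R lin_ext (\<lambda>v. \<phi> (v # ws)) (sigL w)"
  proof (cases w)
    case (Cons x w')
    have z: "\<phi> (w' # ws) = 0" if "x \<noteq> e"
      using Cons.prems pd_iff[of x] that by (intro Cons.prems(1)) (simp add: \<open>w = x # w'\<close>)
    have "dec w' (\<lambda>u v. if length (x # u) = 1 then K (x # u) *\<^sub>R lin_ext (mul (hd (x # u))) (\<phi> (v # ws)) else 0)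
        = dec w' (\<lambda>u v. if u = [] then K [x] *\<^sub>R lin_ext (mul x) (\<phi> (v # ws)) else 0)"
      by (rule dec_cong) simp
    also have "\<dots> = K [x] *\<^sub>R lin_ext (mul x) (\<phi> (w' # ws))" by (cases w') simp_all
    also have "K [x] *\<^sub>R lin_ext (mul x) (\<phi> (w' # ws)) = K [e] *\<^sub>R lin_ext (\<lambda>v. \<phi> (v # ws)) (sigL w)"
      using z by (cases "x = e") (simp_all add: Cons sigL_def mul_e')
    finally show ?thesis by (simp add: Cons)
  qed (simp add: sigL_def)
  moreover have "ksgn (wdeg a * tdeg w) *\<^sub>R (if length a = 1 then K a *\<^sub>R y else 0) = (if length a = 1 then (ksgn (wdeg a * tdeg w) * K a) *\<^sub>R y else 0)"
    for a and y :: "'b \<Rightarrow>\<^sub>0 real" by simp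
  ultimately show ?case
    by (simp only: lc.simps hat.simps) (simp add: e_deg scaleR_right_distrib mult_ac)
qed simp

lemma mul_unit_right:
  assumes "homog q \<phi>"
  shows "lin_ext (\<lambda>y. mul y e) (\<phi> zs) = (- ksgn (gr1 zs + q)) *\<^sub>R \<phi> zs"
proof -
  have "lin_ext (\<lambda>y. mul y e) (\<phi> zs) = lin_ext (\<lambda>y. (- ksgn (gr1 zs + q)) *\<^sub>R Poly_Mapping.single y 1) (\<phi> zs)"
  proof (rule lin_ext_cong)
    fix y assume "y \<in> Poly_Mapping.keys (\<phi> zs)"
    then have "bdeg y = gr1 zs + q" using assms by (simp add: homog_def)
    then show "mul y e = (- ksgn (gr1 zs + q)) *\<^sub>R Poly_Mapping.single y 1"
      by (subst mul_comm) (simp add: mul_e e_deg ks)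
  qed
  then show ?thesis unfolding lin_ext_fun_scale lin_ext_id .
qed

lemma rc_unit:
  assumes "\<And>zs. pdl zs < n \<Longrightarrow> \<phi> zs = 0" "pdl ws \<le> n" "homog q \<phi>"
  shows "rc ws (\<lambda>zs b. if length b = 1 then lin_ext (\<lambda>x. mul x (hd b)) (\<phi> zs) else 0) = - ksgn q *\<^sub>R hat 1 sigR ws \<phi>"
  using assms
proof (induction ws arbitrary: n \<phi> q)
  case (Cons w ws)
  have h: "homog (q + tdeg w) (\<lambda>y. \<phi> (w # y))"
    using Cons.prems(3) by (auto simp: homog_def gr1_def)
  have "rc ws (\<lambda>zs b. if length b = 1 then lin_ext (\<lambda>x. mul x (hd b)) (\<phi> (w # zs)) else 0) = - ksgn (q + tdeg w) *\<^sub>R hat 1 sigR ws (\<lambda>y. \<phi> (w # y))"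
    by (rule Cons.IH[of "n - pdw w", OF _ _ h]) (use Cons.prems in auto)
  moreover have "dec w (\<lambda>a b. if b = [] then 0 else ksgn (wdeg b * sdeg ws) *\<^sub>R (if length b = 1 then lin_ext (\<lambda>x. mul x (hd b)) (\<phi> (a # ws)) else 0))
      = - ksgn q *\<^sub>R lin_ext (\<lambda>v. \<phi> (v # ws)) (sigR w)"
  proof (cases w rule: rev_cases)
    case (snoc w' x)
    have z: "\<phi> (w' # ws) = 0" if "x \<noteq> e"
      using Cons.prems pd_iff[of x] that by (intro Cons.prems(1)) (simp add: snoc)
    have d: "dec u (\<lambda>a b. if b = [] then F a else 0) = F u" for u and F :: "'b list \<Rightarrow> 'b \<Rightarrow>\<^sub>0 real"
      by (induction u arbitrary: F) simp_all
    have "dec w' (\<lambda>a b. if b @ [x] = [] then 0 else ksgn (wdeg (b @ [x]) * sdeg ws) *\<^sub>R (if length (b @ [x]) = 1 then lin_ext (\<lambda>y. mul y (hd (b @ [x]))) (\<phi> (a # ws)) else 0))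
        = dec w' (\<lambda>a b. if b = [] then ksgn (bdeg x * sdeg ws) *\<^sub>R lin_ext (\<lambda>y. mul y x) (\<phi> (a # ws)) else 0)"
      by (rule dec_cong) simp
    also have "\<dots> = ksgn (bdeg x * sdeg ws) *\<^sub>R lin_ext (\<lambda>y. mul y x) (\<phi> (w' # ws))" by (rule d)
    also have "\<dots> = - ksgn q *\<^sub>R lin_ext (\<lambda>v. \<phi> (v # ws)) (sigR w)"
    proof (cases "x = e")
      case True
      show ?thesis
        using mul_unit_right[OF Cons.prems(3), of "w' # ws"]
        unfolding True by (simp add: snoc True sigR_def e_deg gr1_def tdeg_def ks)
    next
      case False
      then show ?thesis using z by (simp add: snoc sigR_def)
    qed
    finally show ?thesis unfolding snoc dec_snoc by simp
  qed (simp add: sigR_def)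
  ultimately show ?case
    by (simp only: rc.simps hat.simps) (simp add: ks scaleR_right_distrib)
qed simp

text \<open>The inner products contribute \<open>dT\<close>, and by \<open>lc_unit\<close> and
  \<open>rc_unit\<close> the outer ones reduce to \<open>sigL\<close> and
  \<open>sigR\<close>.\<close>

lemma dl_lead:
  assumes f: "cochain p f" and v: "\<And>zs. pdl zs < n \<Longrightarrow> f zs = 0" "pdl ws \<le> n"
  shows "dl p f ws = ksgn p *\<^sub>R hat 1 rho ws f"
proof -
  have "DD p f ws [] mm = ksgn (p * wdeg [e]) *\<^sub>R hat 1 sigL ws f - ksgn p *\<^sub>R hat 1 sigR ws f"
    using lc_unit[OF v, where K = "\<lambda>a. ksgn (p * wdeg a)"] rc_unit[OF v cochainD(3)[OF f]]
    unfolding tau[OF cochainD(3)[OF f]] by simp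
  then show ?thesis
    unfolding dl_eq[OF f] rho_def[abs_def] hat_diff_g by (simp add: e_deg scaleR_right_diff_distrib)
qed

definition fh :: "('b list list \<Rightarrow> 'b \<Rightarrow>\<^sub>0 real) \<Rightarrow> 'b list list \<Rightarrow> 'b \<Rightarrow>\<^sub>0 real" where
  "fh f = (\<lambda>ws. hat (- 1) eta ws f)"

lemma cochain_fh: "cochain p f \<Longrightarrow> cochain (p - 1) (fh f)"
  unfolding fh_def diff_conv_add_uminus by (rule cochain_hat[OF _ eta_Nil shk_eta]) (simp_all add: eta_keys)

lemma pdl_eta: "ws = us @ w # vs \<Longrightarrow> v \<in> Poly_Mapping.keys (eta w) \<Longrightarrow> pdl (us @ v # vs) = pdl ws"
  by (simp add: eta_keys)

lemma fh_vanish: "(\<And>zs. pdl zs < n \<Longrightarrow> f zs = 0) \<Longrightarrow> pdl ws < n \<Longrightarrow> fh f ws = 0"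
  unfolding fh_def by (rule hat_cong0) (metis pdl_eta)

text \<open>The anticommutator of the homotopy with \<open>[d_m, \<cdot>]\<close>. It appears as a
  difference because the sign of \<open>dl\<close> alternates with \<open>p\<close>; the factor
  \<open>ksgn p\<close> makes the diagonal entries equal to \<open>lamL\<close> in every
  degree.\<close>

definition Aop :: "int \<Rightarrow> ('b list list \<Rightarrow> 'b \<Rightarrow>\<^sub>0 real) \<Rightarrow> 'b list list \<Rightarrow> 'b \<Rightarrow>\<^sub>0 real" where
  "Aop p f ws = ksgn p *\<^sub>R (fh (dl p f) ws - dl (p - 1) (fh f) ws)"

definition lamL :: "'b list list \<Rightarrow> real" where "lamL ws = sum_list (map lam ws)"

lemma cochain_Aop: "cochain p f \<Longrightarrow> cochain p (Aop p f)"
proof -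
  assume f: "cochain p f"
  have "cochain p (fh (dl p f))" "cochain p (dl (p - 1) (fh f))"
    using cochain_fh[OF cochain_dl[OF f]] cochain_dl[OF cochain_fh[OF f]] by simp_all
  from cochain_scale[OF cochain_add[OF this(1) cochain_scale[OF this(2), of "-1"]], of "ksgn p"]
  show ?thesis unfolding Aop_def[abs_def] by simp
qed

lemma fh_add: "fh (\<lambda>ws. f ws + g ws) ws = fh f ws + fh g ws" and fh_scale: "fh (\<lambda>ws. r *\<^sub>R f ws) ws = r *\<^sub>R fh f ws"
  unfolding fh_def by (rule hat_add, rule hat_scale)

lemma Aop_add:
  assumes "cochain p f" "cochain p g"
  shows "Aop p (\<lambda>ws. f ws + g ws) ws = Aop p f ws + Aop p g ws"
proof -
  have 1: "dl p (\<lambda>ws. f ws + g ws) = (\<lambda>ws. dl p f ws + dl p g ws)" by (rule ext) (rule dl_add[OF assms])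
  have 2: "fh (\<lambda>ws. f ws + g ws) = (\<lambda>ws. fh f ws + fh g ws)" by (rule ext) (rule fh_add)
  show ?thesis unfolding Aop_def 1 2 fh_add dl_add[OF cochain_fh[OF assms(1)] cochain_fh[OF assms(2)]]
    by (simp add: algebra_simps)
qed

text \<open>In lowest polynomial degree \<open>dl\<close> is \<open>rho\<close> up to sign, so
  \<open>hat_anticommute\<close> and \<open>rho_eta\<close> give the scalar.\<close>

lemma Aop_lead:
  assumes f: "cochain p f" and v: "\<And>zs. pdl zs < n \<Longrightarrow> f zs = 0" "pdl ws \<le> n"
  shows "Aop p f ws = lamL ws *\<^sub>R f ws"
proof -
  have "dl (p - 1) (fh f) ws = ksgn (p - 1) *\<^sub>R hat 1 rho ws (fh f)"
    by (rule dl_lead[OF cochain_fh[OF f] fh_vanish v(2)]) (use v(1) in auto)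
  moreover have "fh (dl p f) ws = hat (-1) eta ws (\<lambda>z. ksgn p *\<^sub>R hat 1 rho z f)"
    unfolding fh_def by (rule hat_cong, rule dl_lead[OF f v(1)]) (use pdl_eta v(2) in auto)
  moreover have "hat 1 rho ws (\<lambda>z. hat (-1) eta z f) + hat (-1) eta ws (\<lambda>z. hat 1 rho z f) = lamL ws *\<^sub>R f ws"
    unfolding lamL_def
    by (rule hat_anticommute) (use rho_keys eta_keys rho_eta[OF good0_shk[OF cochainD(2)[OF f]]] in auto)
  ultimately show ?thesis
    unfolding Aop_def fh_def by (simp add: hat_scale ks algebra_simps)
qed

lemma Aop_dl: "cochain p f \<Longrightarrow> Aop (p + 1) (dl p f) ws = dl p (Aop p f) ws"
proof -
  assume f: "cochain p f"
  let ?g = "fh (dl p f)"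
  have g: "cochain p ?g" using cochain_fh[OF cochain_dl[OF f]] by simp
  have d: "cochain p (dl (p - 1) (fh f))" using cochain_dl[OF cochain_fh[OF f]] by simp
  have z: "dl (p + 1) (dl p f) = (\<lambda>ws. 0)" using dl_dl[OF f] by auto
  have "dl p (dl (p - 1) (fh f)) ws = 0" using dl_dl[OF cochain_fh[OF f]] by simp
  then have "dl p (Aop p f) ws = ksgn p *\<^sub>R dl p ?g ws"
    using dl_scale[OF cochain_add[OF g cochain_scale[OF d, of "-1"]], of "ksgn p" ws] dl_add[OF g cochain_scale[OF d, of "-1"], of ws] dl_scale[OF d, of "-1" ws]
    unfolding Aop_def[abs_def] by simp
  moreover have "Aop (p + 1) (dl p f) ws = ksgn p *\<^sub>R dl p ?g ws"
    unfolding Aop_def z by (simp add: fh_def ks)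
  ultimately show ?thesis by simp
qed

definition supp :: "int \<Rightarrow> int \<Rightarrow> ('b list list \<Rightarrow> 'b \<Rightarrow>\<^sub>0 real) \<Rightarrow> bool" where
  "supp a b f \<longleftrightarrow> (\<forall>ws. f ws \<noteq> 0 \<longrightarrow> gr2 ws = a \<and> gr3 ws = b)"

lemma supp_lin: "supp a b f \<Longrightarrow> supp a b g \<Longrightarrow> supp a b (\<lambda>ws. r ws *\<^sub>R f ws + s ws *\<^sub>R g ws)"
  unfolding supp_def by (intro allI impI) (metis add_0 scaleR_zero_right)

lemma supp_hom: "cochain p f \<Longrightarrow> cd p f \<in> coder_hom p a b \<longleftrightarrow> supp (- a) (- b) f"
  by (simp add: coder_hom_iff supp_def coderivation_cd cor_cd)

lemma supp_dl:
  assumes f: "cochain p f" and s: "supp a b f"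
  shows "supp (a + 1) b (dl p f)"
proof -
  have "supercommutator 1 p dm (cd p f) \<in> coder_hom (1 + p) (- 1 + - a) (0 + - b)"
    by (rule supercommutator_hom[OF dm_hom]) (use supp_hom[OF f, of "- a" "- b"] s in simp)
  then show ?thesis unfolding dl_def by (auto simp: coder_hom_iff supp_def)
qed

lemma supp_fh: "supp a b f \<Longrightarrow> supp (a - 1) b (fh f)"
  unfolding supp_def
proof (intro allI impI, rule ccontr)
  fix ws assume s: "\<forall>ws. f ws \<noteq> 0 \<longrightarrow> gr2 ws = a \<and> gr3 ws = b" and nz: "fh f ws \<noteq> 0" and n: "\<not> (gr2 ws = a - 1 \<and> gr3 ws = b)"
  have "fh f ws = 0"
    unfolding fh_def
  proof (rule hat_cong0, rule ccontr)
    fix us w vs v assume "ws = us @ w # vs" "v \<in> Poly_Mapping.keys (eta w)" "f (us @ v # vs) \<noteq> 0"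
    then show False using n s eta_keys[of v w] by (fastforce simp: gr2_def gr3_def)
  qed
  with nz show False ..
qed

lemma supp_Aop:
  assumes f: "cochain p f" and s: "supp a b f"
  shows "supp a b (Aop p f)"
proof -
  have "supp a b (fh (dl p f))" "supp a b (dl (p - 1) (fh f))"
    using supp_fh[OF supp_dl[OF f s]] supp_dl[OF cochain_fh[OF f] supp_fh[OF s]] by simp_all
  from supp_lin[OF this, of "\<lambda>ws. ksgn p" "\<lambda>ws. - ksgn p"] show ?thesis
    by (simp add: Aop_def[abs_def] scaleR_right_diff_distrib)
qed

text \<open>The unit is odd in \<open>V[1]\<close>, so shuffling in a single \<open>e\<close> may
  give zero: its coefficient passes from \<open>r\<close> to \<open>1 - r\<close> with each further
  letter. Shuffling in \<open>[e, e]\<close> has a positive coefficient, and for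
  \<open>n \<ge> 3\<close> the other word is not empty.\<close>

lemma unit_word:
  fixes f :: "'b list list \<Rightarrow> 'b \<Rightarrow>\<^sub>0 real"
  assumes f: "good0 f" and n: "n \<ge> 3"
  shows "f (us @ replicate n e # vs) = 0"
proof -
  have 1: "\<exists>r\<ge>0. sh [e] (replicate k e) \<Phi> = r *\<^sub>R \<Phi> (replicate (Suc k) e) \<and> r \<le> 1" for k and \<Phi> :: "'b list \<Rightarrow> 'b \<Rightarrow>\<^sub>0 real"
  proof (induction k arbitrary: \<Phi>)
    case 0 show ?case by (intro exI[of _ 1]) simp
  next
    case (Suc k)
    from Suc[of "\<lambda>w. \<Phi> (e # w)"] obtain r where "r \<ge> 0" "r \<le> 1" "sh [e] (replicate k e) (\<lambda>w. \<Phi> (e # w)) = r *\<^sub>R \<Phi> (replicate (Suc (Suc k)) e)" by auto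
    then show ?case by (intro exI[of _ "1 - r"]) (simp add: sh_Cons e_deg scaleR_left_diff_distrib)
  qed
  have 2: "\<exists>r>0. sh [e, e] (replicate k e) \<Phi> = r *\<^sub>R \<Phi> (replicate (Suc (Suc k)) e)" for k and \<Phi> :: "'b list \<Rightarrow> 'b \<Rightarrow>\<^sub>0 real"
  proof (induction k arbitrary: \<Phi>)
    case 0 show ?case by (intro exI[of _ 1]) simp
  next
    case (Suc k)
    from Suc[of "\<lambda>w. \<Phi> (e # w)"] obtain r where "r > 0" "sh [e, e] (replicate k e) (\<lambda>w. \<Phi> (e # w)) = r *\<^sub>R \<Phi> (replicate (Suc (Suc (Suc k))) e)" by auto
    moreover from 1[of "Suc k" "\<lambda>w. \<Phi> (e # w)"] obtain s where "s \<ge> 0" "sh [e] (replicate (Suc k) e) (\<lambda>w. \<Phi> (e # w)) = s *\<^sub>R \<Phi> (replicate (Suc (Suc (Suc k))) e)" by auto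
    ultimately show ?case by (intro exI[of _ "s + r"]) (simp add: sh_Cons e_deg scaleR_left_distrib)
  qed
  from n obtain k where k: "n = Suc (Suc k)" "k \<noteq> 0"
    by (metis One_nat_def Suc_le_D le_0_eq not_less_eq_eq numeral_3_eq_3 old.nat.exhaust)
  from 2[of k "\<lambda>w. f (us @ w # vs)"] obtain r where "r > 0" "sh [e, e] (replicate k e) (\<lambda>w. f (us @ w # vs)) = r *\<^sub>R f (us @ replicate n e # vs)"
    unfolding k by blast
  moreover have "sh [e, e] (replicate k e) (\<lambda>w. f (us @ w # vs)) = 0"
    using good0D(1)[OF f, of "[e, e]" "replicate k e"] k by simp
  ultimately show ?thesis by simp
qed

lemma lam_nonneg: "lam w \<ge> 0"
  by (auto simp: lam_def vr_def)

text \<open>Positive \<open>gr2\<close> forces a word with at least two letters. It is not a single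
  variable, and if it consists of units it has length 2 by \<open>unit_word\<close>; so its entry is
  positive while all others are non-negative.\<close>

lemma lamL_nz:
  fixes f :: "'b list list \<Rightarrow> 'b \<Rightarrow>\<^sub>0 real"
  assumes f: "good0 f" and nz: "f ws \<noteq> 0" and g: "gr2 ws > 0"
  shows "lamL ws \<noteq> 0"
proof -
  have "[] \<notin> set ws" using good0D(3)[OF f] nz by blast
  have "\<exists>w\<in>set ws. length w \<ge> 2"
  proof (rule ccontr)
    assume "\<not> ?thesis"
    then have "\<forall>w\<in>set ws. int (length w) - 1 \<le> 0" by auto
    then have "gr2 ws \<le> 0" unfolding gr2_def by (induction ws) auto
    with g show False by simp
  qed
  then obtain w where w: "w \<in> set ws" "length w \<ge> 2" by blast
  then obtain us vs where ws: "ws = us @ w # vs" by (auto simp: in_set_conv_decomp)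
  have "lam w > 0"
  proof (cases "pdw w = 0")
    case True
    then have "\<forall>x\<in>set w. x = e" using pd_iff by (auto simp: pdw_def)
    then have r: "w = replicate (length w) e" by (simp add: replicate_length_same)
    then have "length w = 2" using unit_word[OF f, of "length w" us vs] nz w(2) ws by (cases "length w = 2") auto
    then show ?thesis using True by (simp add: lam_def ue_def vr_def)
  next
    case False
    then show ?thesis using w(2) by (simp add: lam_def vr_def)
  qed
  moreover have "sum_list (map lam us) \<ge> 0" "sum_list (map lam vs) \<ge> 0"
    using lam_nonneg by (auto intro!: sum_list_nonneg)
  ultimately show ?thesis unfolding lamL_def ws by simp
qed

lemma pdw_perm: "mset u = mset v \<Longrightarrow> pdw u = pdw v"
  unfolding pdw_def by (metis mset_map sum_mset_sum_list)

lemma word_inv_lamL: "word_inv lamL" and word_inv_pdl: "word_inv pdl"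
proof -
  show "word_inv lamL"
    unfolding lamL_def
  proof (rule word_inv_sum_list)
    fix w w' :: "'b list" assume m: "mset w = mset w'"
    show "lam w = lam w'"
      unfolding lam_def vr_def ue_def pdw_perm[OF m] mset_eq_length[OF m] ..
  qed
  show "word_inv pdl"
    unfolding pdl_def by (rule word_inv_sum_list) (rule pdw_perm)
qed

text \<open>Where \<open>f\<close> vanishes in all smaller polynomial degrees, \<open>Aop\<close> is
  multiplication by \<open>lamL\<close>, non-zero wherever \<open>f\<close> is.\<close>

lemma Aop_inj:
  assumes f: "cochain p f" and s: "supp a b f" "a > 0" and z: "\<And>ws. Aop p f ws = 0"
  shows "f ws = 0"
proof (induction "pdl ws" arbitrary: ws rule: less_induct)
  case less
  have "Aop p f ws = lamL ws *\<^sub>R f ws"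
    by (rule Aop_lead[OF f _ order_refl]) (rule less)
  then have "lamL ws *\<^sub>R f ws = 0" by (simp add: z)
  then show ?case using lamL_nz[OF cochainD(2)[OF f], of ws] s by (auto simp: supp_def)
qed

text \<open>Successive approximation of a solution of \<open>Aop p F = f\<close>: the current error
  is divided by the diagonal entry. At a zero entry the correction is zero because
  \<open>1 / 0 = 0\<close>.\<close>

primrec Fs :: "int \<Rightarrow> ('b list list \<Rightarrow> 'b \<Rightarrow>\<^sub>0 real) \<Rightarrow> nat \<Rightarrow> 'b list list \<Rightarrow> 'b \<Rightarrow>\<^sub>0 real" where
  "Fs p f 0 = (\<lambda>ws. 0)"
| "Fs p f (Suc n) = (\<lambda>ws. Fs p f n ws + (1 / lamL ws) *\<^sub>R (f ws - Aop p (Fs p f n) ws))"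

text \<open>Each correction removes the lowest part of the error, so the \<open>n\<close>-th error
  \<open>r n\<close> vanishes in polynomial degrees below \<open>n\<close>. The values therefore
  stabilise, and their limit \<open>G\<close> inherits all properties from the
  approximations.\<close>

lemma Aop_surj:
  assumes f: "cochain p f" and s: "supp a b f" "a > 0"
  obtains F where "cochain p F" "supp a b F" "\<And>ws. Aop p F ws = f ws"
proof -
  define F where "F = Fs p f"
  define r where "r n ws = f ws - Aop p (F n) ws" for n ws
  have R: "cochain p (r n) \<and> supp a b (r n)" if "cochain p (F n) \<and> supp a b (F n)" for n
  proof -
    from that have c: "cochain p (F n)" and s': "supp a b (F n)" by auto
    have "cochain p (\<lambda>ws. f ws + (-1) *\<^sub>R Aop p (F n) ws)"
      by (intro cochain_add f cochain_scale cochain_Aop c)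
    then show ?thesis
      using supp_lin[OF s(1) supp_Aop[OF c s'], of "\<lambda>ws. 1" "\<lambda>ws. -1"] unfolding r_def[abs_def] by simp
  qed
  have F: "cochain p (F n) \<and> supp a b (F n)" for n
  proof (induction n)
    case 0 then show ?case by (simp add: F_def cochain_zero supp_def)
  next
    case (Suc n)
    note r = R[OF Suc]
    have "cochain p (\<lambda>ws. F n ws + (1 / lamL ws) *\<^sub>R r n ws)"
      by (intro cochain_add cochain_scale_inv[OF conjunct1[OF r]] word_inv_comp[OF word_inv_lamL, of "\<lambda>l. 1 / l"]) (simp add: Suc)
    then show ?case
      using supp_lin[OF conjunct2[OF Suc] conjunct2[OF r], of "\<lambda>ws. 1" "\<lambda>ws. 1 / lamL ws"] unfolding F_def r_def by simp
  qed
  have r: "cochain p (r n)" "supp a b (r n)" for n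
    using R[OF F] by auto
  let ?c = "\<lambda>n ws. (1 / lamL ws) *\<^sub>R r n ws"
  have c: "cochain p (?c n)" for n
    by (rule cochain_scale_inv[OF r(1) word_inv_comp[OF word_inv_lamL, of "\<lambda>l. 1 / l"]])
  have FS: "F (Suc n) = (\<lambda>ws. F n ws + ?c n ws)" for n by (simp add: F_def r_def)
  have v: "r n ws = 0" if "pdl ws < n" for n ws
    using that
  proof (induction n arbitrary: ws)
    case (Suc n)
    have "Aop p (?c n) ws = lamL ws *\<^sub>R ?c n ws"
      by (rule Aop_lead[OF c, of n]) (use Suc in auto)
    also have "\<dots> = r n ws"
    proof (cases "r n ws = 0")
      case False
      then have "lamL ws \<noteq> 0"
        using lamL_nz[OF cochainD(2)[OF r(1)] False] r(2)[of n] s(2) False by (auto simp: supp_def)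
      then show ?thesis by simp
    qed simp
    finally have "Aop p (F (Suc n)) ws = Aop p (F n) ws + r n ws"
      unfolding FS Aop_add[OF conjunct1[OF F] c] by simp
    then show ?case by (simp add: r_def)
  qed simp
  have stable: "F m ws = F n ws" if "pdl ws < n" "n \<le> m" for m n ws
    using that(2,1) by (induction m rule: dec_induct) (auto simp: FS v)
  define G where "G ws = F (Suc (pdl ws)) ws" for ws
  have G: "G ws = F n ws" if "pdl ws < n" for ws n
    unfolding G_def using stable[of ws "Suc (pdl ws)" n] that by simp
  have eq: "pdl ws < n \<Longrightarrow> pdl ws' < n \<Longrightarrow> G ws = F n ws \<and> G ws' = F n ws'" for ws ws' n using G by simp
  have gG: "cochain p G"
    unfolding cochain_def good_def
  proof (intro conjI)
    show "good0 G"
    proof (rule good0I)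
      fix us vs :: "'b list list" and u v :: "'b list" assume uv: "u \<noteq> []" "v \<noteq> []"
      let ?n = "Suc (pdl us + pdw u + pdw v + pdl vs)"
      have "sh u v (\<lambda>w. G (us @ w # vs)) = sh u v (\<lambda>w. F ?n (us @ w # vs))"
      proof (rule sh_cong)
        fix w :: "'b list" assume "mset w = mset u + mset v"
        then have "pdw w = pdw u + pdw v" using pdw_perm[of w "u @ v"] by simp
        then show "G (us @ w # vs) = F ?n (us @ w # vs)" by (intro G) simp
      qed
      then show "sh u v (\<lambda>w. G (us @ w # vs)) = 0" using good0D(1)[OF cochainD(2)[OF conjunct1[OF F]] uv] by simp
    next
      fix us vs :: "'b list list" and u v :: "'b list"
      let ?n = "Suc (pdl us + pdw u + pdw v + pdl vs)"
      have "G (us @ u # v # vs) = F ?n (us @ u # v # vs)" "G (us @ v # u # vs) = F ?n (us @ v # u # vs)"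
        by (intro G; simp)+
      then show "G (us @ u # v # vs) = ksgn (tdeg u * tdeg v) *\<^sub>R G (us @ v # u # vs)"
        using good0D(2)[OF cochainD(2)[OF conjunct1[OF F]]] by metis
    next
      fix ws :: "'b list list" assume "[] \<in> set ws"
      then show "G ws = 0" unfolding G_def by (rule good0D(3)[OF cochainD(2)[OF conjunct1[OF F]]])
    qed
    show "G [] = 0" unfolding G_def by (rule cochainD(4)[OF conjunct1[OF F]])
    show "homog p G" using cochainD(3)[OF conjunct1[OF F]] unfolding homog_def G_def by blast
  qed
  have "Aop p G ws = f ws" for ws
  proof -
    let ?n = "Suc (pdl ws)"
    \<comment> \<open>This difference vanishes in all polynomial degrees up to
      \<open>pdl ws\<close>, so by \<open>Aop_lead\<close> the value of \<open>Aop\<close> at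
      \<open>ws\<close> is the same for \<open>G\<close> and \<open>F ?n\<close>.\<close>
    let ?d = "\<lambda>ws. G ws + (-1) *\<^sub>R F ?n ws"
    have d: "cochain p ?d" by (intro cochain_add gG cochain_scale) (simp add: F)
    have "Aop p ?d ws = lamL ws *\<^sub>R ?d ws"
      by (rule Aop_lead[OF d _ order_refl]) (simp add: G[of _ ?n])
    also have "\<dots> = 0" by (simp add: G[of ws ?n])
    finally have "Aop p (\<lambda>ws. ?d ws + F ?n ws) ws = Aop p (F ?n) ws"
      unfolding Aop_add[OF d conjunct1[OF F]] by simp
    then have "Aop p G ws = Aop p (F ?n) ws" by simp
    then show ?thesis using v[of ws ?n] by (simp add: r_def)
  qed
  moreover have "supp a b G" using F unfolding supp_def G_def by blast
  ultimately show thesis using that gG by blast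
qed

text \<open>Solve \<open>Aop p F = f\<close>. As \<open>Aop\<close> commutes with \<open>dl\<close>
  and is injective on the support of \<open>dl p F\<close>, the solution \<open>F\<close> is closed
  like \<open>f\<close>. Then the anticommutator reduces to a coboundary, and a multiple of
  \<open>fh F\<close> is the required primitive.\<close>

theorem dm_exact:
  assumes D: "D \<in> coder_hom p a b" and a: "a < 0" and z: "supercommutator 1 p dm D = 0"
  obtains E where "E \<in> coder_hom (p - 1) (a + 1) b" "supercommutator 1 (p - 1) dm E = D"
proof -
  define f where "f = cor D"
  have cD: "coderivation p D" using D by (simp add: coder_hom_iff)
  have f: "cochain p f" "cd p f = D" unfolding f_def by (rule cochain_cor[OF cD], rule cd_cor[OF cD])
  have s: "supp (- a) (- b) f" using D supp_hom[OF f(1)] f(2) by simp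
  have zf: "dl p f ws = 0" for ws unfolding dl_def f(2) z by (simp add: cor_def linear_0[OF linear_cogen])
  obtain F where F: "cochain p F" "supp (- a) (- b) F" "\<And>ws. Aop p F ws = f ws"
    using Aop_surj[OF f(1) s] a by auto
  have AF: "Aop p F = f" using F(3) by auto
  have "dl p F ws = 0" for ws
  proof (rule Aop_inj[OF cochain_dl[OF F(1)] supp_dl[OF F(1,2)]])
    show "0 < - a + 1" using a by simp
    show "Aop (p + 1) (dl p F) ws = 0" for ws unfolding Aop_dl[OF F(1)] AF by (rule zf)
  qed
  then have dF: "dl p F = (\<lambda>ws. 0)" by auto
  define g where "g = (\<lambda>ws. (- ksgn p) *\<^sub>R fh F ws)"
  have g: "cochain (p - 1) g" unfolding g_def by (rule cochain_scale[OF cochain_fh[OF F(1)]])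
  have "dl (p - 1) g ws = f ws" for ws
    using F(3)[of ws] unfolding g_def dl_scale[OF cochain_fh[OF F(1)]] Aop_def dF by (simp add: fh_def)
  then have "supercommutator 1 (p - 1) dm (cd (p - 1) g) = D"
    using coderivation_supercommutator[OF dm_coder coderivation_cd[OF g]] cD
    by (intro coderivation_eqI[of p]) (simp_all add: dl_def f_def)
  moreover have "cd (p - 1) g \<in> coder_hom (p - 1) (a + 1) b"
    using supp_fh[OF F(2)] unfolding supp_hom[OF g] by (auto simp: supp_def g_def)
  ultimately show thesis using that by blast
qed

end

text \<open>The analogue of \<open>good0_scale_inv\<close> with linear operators in place of
  scalars; it serves for the weights \<open>W (rw ws)\<close>.\<close>

lemma good0_op_inv:
  assumes g: "good0 \<phi>" and r: "word_inv r" and L: "\<And>s. linear (L s)"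
  shows "good0 (\<lambda>ws. L (r ws) (\<phi> ws))"
proof (rule good0I)
  fix us vs and u v :: "'a list" assume uv: "u \<noteq> []" "v \<noteq> []"
  have "sh u v (\<lambda>w. L (r (us @ w # vs)) (\<phi> (us @ w # vs))) = sh u v (\<lambda>w. L (r (us @ (u @ v) # vs)) (\<phi> (us @ w # vs)))"
  proof (rule sh_cong)
    fix w assume "mset w = mset u + mset v"
    then have "r (us @ w # vs) = r (us @ (u @ v) # vs)" using r unfolding word_inv_def by (metis mset_append)
    then show "L (r (us @ w # vs)) (\<phi> (us @ w # vs)) = L (r (us @ (u @ v) # vs)) (\<phi> (us @ w # vs))" by simp
  qed
  then show "sh u v (\<lambda>w. L (r (us @ w # vs)) (\<phi> (us @ w # vs))) = 0"
    using good0D(1)[OF g uv] by (simp add: sh_lin[OF L, symmetric] linear_0[OF L])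
next
  fix us vs and u v :: "'a list"
  have "r (us @ u # v # vs) = r (us @ v # u # vs)" using r unfolding word_inv_def by blast
  then show "L (r (us @ u # v # vs)) (\<phi> (us @ u # v # vs)) = ksgn (tdeg u * tdeg v) *\<^sub>R L (r (us @ v # u # vs)) (\<phi> (us @ v # u # vs))"
    by (subst good0D(2)[OF g]) (simp add: linear_cmul[OF L])
next
  fix ws :: "'a list list" assume "[] \<in> set ws"
  then show "L (r ws) (\<phi> ws) = 0" by (simp add: good0D(3)[OF g] linear_0[OF L])
qed

section \<open>Multiderivations and the Poincare lemma for \<open>[d_br, \<cdot>]\<close>\<close>

context poly_letters
begin

text \<open>Maps supported on \<open>gr2 = 0\<close> are given by multilinear maps of single letters; they commute with \<open>d\<^sub>m\<close>
  iff they are derivations in each argument.\<close>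

lemma supp0_long:
  assumes "good0 f" "supp 0 c f" shows "f ((a # b # w) # zs) = 0"
proof (rule ccontr)
  assume nz: "f ((a # b # w) # zs) \<noteq> 0"
  then have "[] \<notin> set ((a # b # w) # zs)" using good0D(3)[OF assms(1)] by blast
  moreover have "gr2 ((a # b # w) # zs) = 0" using nz assms(2) by (auto simp: supp_def)
  ultimately show False using letters_gr2 by fastforce
qed

text \<open>At a two-letter word, \<open>[d_m, f]\<close> is the failure of the Leibniz rule in that
  argument: the outer products use its first or last letter, the inner one multiplies both.\<close>

lemma dl_pair:
  assumes f: "cochain p f" and s: "supp 0 c f"
  shows "dl p f ([a, b] # ws) = ksgn (p * bdeg a) *\<^sub>R lin_ext (mul a) (f ([b] # ws))
    + ksgn (bdeg b * sdeg ws) *\<^sub>R lin_ext (\<lambda>x. mul x b) (f ([a] # ws)) - ksgn p *\<^sub>R lin_ext (\<lambda>x. f ([x] # ws)) (mul a b)"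
proof -
  note z = supp0_long[OF cochainD(2)[OF f] s]
  have "hat 1 dT ([a, b] # ws) f = lin_ext (\<lambda>x. f ([x] # ws)) (mul a b)"
    by (simp add: z lin_ext_lin_ext)
  moreover have l: "lc ws (\<lambda>a zs. 0) = (0 :: 'b \<Rightarrow>\<^sub>0 real)" and r: "rc ws (\<lambda>zs b. 0) = (0 :: 'b \<Rightarrow>\<^sub>0 real)"
    using lc_scale[of ws 0 "\<lambda>a zs. 0 :: 'b \<Rightarrow>\<^sub>0 real"] rc_scale[of ws 0 "\<lambda>a zs. 0 :: 'b \<Rightarrow>\<^sub>0 real"] by simp_all
  ultimately show ?thesis
    unfolding dl_eq[OF f] tau[OF cochainD(3)[OF f]] by (simp add: z cong: if_cong)
qed

text \<open>\<open>[d_m, f]\<close> lives on \<open>gr2 = 1\<close>, so exactly one word has two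
  letters, and symmetry moves it to the front.\<close>

lemma dl_zeroI:
  assumes f: "cochain p f" and s: "supp 0 c f" and z: "\<And>a b ws. dl p f ([a, b] # ws) = 0"
  shows "dl p f ws = 0"
proof (rule ccontr)
  assume nz: "dl p f ws \<noteq> 0"
  note g = cochainD(2)[OF cochain_dl[OF f]]
  have e: "[] \<notin> set ws" using good0D(3)[OF g] nz by blast
  have g2: "gr2 ws = 1" using supp_dl[OF f s] nz by (auto simp: supp_def)
  have "\<exists>w\<in>set ws. length w \<noteq> 1"
  proof (rule ccontr)
    assume "\<not> ?thesis"
    then have "gr2 ws = 0" unfolding gr2_def by (induction ws) auto
    with g2 show False by simp
  qed
  then obtain us w vs where ws: "ws = us @ w # vs" and w: "length w \<noteq> 1" by (auto simp: in_set_conv_decomp)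
  have "gr2 us \<ge> 0" "gr2 vs \<ge> 0" using letters_nl[of us] letters_nl[of vs] e by (auto simp: ws gr_nl)
  moreover have "gr2 ws = gr2 us + (int (length w) - 1) + gr2 vs" by (simp add: ws gr2_def)
  moreover have "length w \<ge> 2" using e w by (cases w) (auto simp: ws Suc_le_eq)
  ultimately have "length w = 2" using g2 by linarith
  then obtain a b where "w = [a, b]" by (auto simp: numeral_2_eq_2 length_Suc_conv)
  then have "dl p f ws = 0"
    using sym_move[of "dl p f" us w vs, OF good0D(2)[OF g]] z by (simp add: ws)
  with nz show False ..
qed

text \<open>The Leibniz rule for the product of \<open>e\<close> with itself.\<close>

lemma dl_unit:
  assumes f: "cochain p f" and s: "supp 0 c f" and z: "\<And>ws. dl p f ws = 0" and e: "[e] \<in> set ws"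
  shows "f ws = 0"
proof -
  have 0: "f ([e] # zs) = 0" for zs
    using dl_pair[OF f s, of e e zs] z mul_unit_right[OF cochainD(3)[OF f], of "[e] # zs"]
    by (simp add: mul_e' e_deg mul_e)
  from e obtain us vs where "ws = us @ [e] # vs" by (auto simp: in_set_conv_decomp)
  then show ?thesis using sym_move[of f us "[e]" vs, OF good0D(2)[OF cochainD(2)[OF f]]] 0 by simp
qed

definition vars :: "'b list list \<Rightarrow> bool" where "vars ws \<longleftrightarrow> (\<forall>w\<in>set ws. \<exists>i. w = [xx i])"

text \<open>By Euler's formula a letter of polynomial degree at least 2 is a combination of products
  of letters of smaller degree, where the Leibniz rule and the induction give zero. Units are
  covered by \<open>dl_unit\<close>.\<close>

lemma vars_zero:
  assumes f: "cochain p f" and s: "supp 0 c f" and z: "\<And>ws. dl p f ws = 0" and v: "\<And>ws. vars ws \<Longrightarrow> f ws = 0"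
  shows "f ws = 0"
proof (induction "pdl ws" arbitrary: ws rule: less_induct)
  case less
  show ?case
  proof (rule ccontr)
    assume nz: "f ws \<noteq> 0"
    then have "[] \<notin> set ws" using good0D(3)[OF cochainD(2)[OF f]] by blast
    moreover have "gr2 ws = 0" using nz s by (auto simp: supp_def)
    ultimately have l: "\<forall>w\<in>set ws. length w = 1" by (rule letters_gr2)
    from v nz have "\<not> vars ws" by blast
    then obtain w where w: "w \<in> set ws" "\<nexists>i. w = [xx i]" unfolding vars_def by blast
    with l obtain a where a: "w = [a]" by (auto simp: length_Suc_conv)
    then obtain us vs where ws: "ws = us @ [a] # vs" using w by (auto simp: in_set_conv_decomp)
    have "a \<noteq> e" using dl_unit[OF f s z, of ws] nz ws by auto
    then have "pd a \<noteq> 0" "pd a \<noteq> 1" using pd_iff[of a] pd_1[of a] w a by blast+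
    then have pd2: "pd a \<ge> 2" by linarith
    let ?zs = "us @ vs"
    have lt: "f ([b] # ?zs) = 0" if "pd b < pd a" for b
      using that by (intro less) (simp add: ws)
    have "lin_ext (\<lambda>x. f ([x] # ?zs)) (lin_ext (mul (xx j)) (der j a)) = 0" for j
      unfolding lin_ext_lin_ext
    proof (rule lin_ext_eq_0)
      fix b assume "b \<in> Poly_Mapping.keys (der j a)"
      from der_keys[OF this] pd2 have "f ([b] # ?zs) = 0" "f ([xx j] # ?zs) = 0" by (auto intro!: lt simp: pd_xx)
      then show "lin_ext (\<lambda>x. f ([x] # ?zs)) (mul (xx j) b) = 0"
        using dl_pair[OF f s, of "xx j" b ?zs] z by simp
    qed
    then have "real (pd a) *\<^sub>R f ([a] # ?zs) = 0"
      using arg_cong[OF euler[of a], of "lin_ext (\<lambda>x. f ([x] # ?zs))"] by (simp add: lin_ext_sum lin_ext_scale)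
    then have "f ([a] # ?zs) = 0" using pd2 by simp
    then have "f ws = 0" using sym_move[of f us "[a]" vs, OF good0D(2)[OF cochainD(2)[OF f]]] by (simp add: ws)
    with nz show False ..
  qed
qed

text \<open>The inverse of the weight by which the homotopy identity for \<open>[d\<^sub>b\<^sub>r, \<cdot>]\<close> scales.\<close>

definition W :: "real \<Rightarrow> ('b \<Rightarrow>\<^sub>0 real) \<Rightarrow> 'b \<Rightarrow>\<^sub>0 real" where
  "W r = lin_ext (\<lambda>x. Poly_Mapping.single x (1 / (real (pd x) + r)))"

lemma linear_W: "linear (W r)" unfolding W_def by (rule linear_lin_ext)

lemma W_simps: "W r (x + y) = W r x + W r y" "W r (s *\<^sub>R x) = s *\<^sub>R W r x" "W r (- x) = - W r x" "W r 0 = 0"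
  "W r (x - y) = W r x - W r y"
  by (simp_all add: W_def le_simps)

lemma W_const: "(\<And>x. x \<in> Poly_Mapping.keys y \<Longrightarrow> real (pd x) + r = c) \<Longrightarrow> W r y = (1 / c) *\<^sub>R y"
proof -
  assume c: "\<And>x. x \<in> Poly_Mapping.keys y \<Longrightarrow> real (pd x) + r = c"
  have "W r y = lin_ext (\<lambda>x. (1 / c) *\<^sub>R Poly_Mapping.single x 1) y"
    unfolding W_def by (rule lin_ext_cong) (simp add: c single_scaleR)
  then show ?thesis unfolding lin_ext_fun_scale lin_ext_id .
qed

text \<open>An operator shifting the polynomial degree by a constant intertwines two weights; a zero
  weight is inverted to zero on both sides.\<close>

lemma W_op:
  assumes "\<And>b x. x \<in> Poly_Mapping.keys (F b) \<Longrightarrow> real (pd x) + r = real (pd b) + s"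
  shows "W r (lin_ext F y) = lin_ext F (W s y)"
proof -
  have "W r (F b) = (1 / (real (pd b) + s)) *\<^sub>R F b" for b
    by (rule W_const) (rule assms)
  then show ?thesis
    by (simp add: lin_ext_linear[OF linear_W] W_def[of s] lin_ext_lin_ext)
qed

lemma W_dv: "dv j (W r y) = W (r + 1) (dv j y)"
  unfolding dv_def by (rule W_op[symmetric]) (use der_keys in fastforce)

lemma hom_W: "hom d y \<Longrightarrow> hom d (W r y)"
  unfolding W_def by (rule hom_lin_ext) (auto simp: hom_def split: if_splits)

text \<open>On variables \<open>pdl ws = length ws\<close>, so this is \<open>length ws + 1\<close>,
  the number of arguments of \<open>f\<close> in \<open>KE\<close>. Elsewhere it is determined by
  the Leibniz rule, which changes the polynomial degree of an argument and of the value by the same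
  amount; hence \<open>- pdl ws\<close>.\<close>

definition rw :: "'b list list \<Rightarrow> real" where "rw ws = 2 * real (length ws) + 1 - real (pdl ws)"

text \<open>One summand of the contraction of a form with the Euler vector field: a generator is
  inserted as first argument and the value is multiplied by its dual variable.\<close>

definition KE :: "int \<Rightarrow> ('b list list \<Rightarrow> 'b \<Rightarrow>\<^sub>0 real) \<Rightarrow> 'j \<Rightarrow> 'b list list \<Rightarrow> 'b \<Rightarrow>\<^sub>0 real" where
  "KE p f j ws = ksgn (p * (1 + jd j)) *\<^sub>R lin_ext (mul (xx j)) (W (rw ws) (f ([xx (dual j)] # ws)))"

lemma cochain_KE:
  assumes f: "cochain p f" and n: "\<And>j. f [[xx j]] = 0"
  shows "cochain (p - 1) (KE p f j)"
  unfolding cochain_def good_def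
proof (intro conjI)
  have r: "word_inv rw" unfolding rw_def[abs_def]
    by (intro word_inv_comp2[of "\<lambda>ws. length ws" pdl "\<lambda>n m. 2 * real n + 1 - real m"] word_inv_gr word_inv_pdl)
  have "linear (\<lambda>y. ksgn (p * (1 + jd j)) *\<^sub>R lin_ext (mul (xx j)) (W s y))" for s
    using linear_compose[OF linear_W linear_lin_ext] by (intro linear_compose_scale_right) (simp add: o_def)
  from good0_op_inv[OF good0_Cons[OF cochainD(2)[OF f], of "[xx (dual j)]"] r this]
  show "good0 (KE p f j)" unfolding KE_def[abs_def] .
  show "KE p f j [] = 0" by (simp add: KE_def n W_simps)
  show "homog (p - 1) (KE p f j)"
    unfolding homog_def
  proof (intro allI ballI)
    fix ws x assume x: "x \<in> Poly_Mapping.keys (KE p f j ws)"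
    have "hom (gr1 ([xx (dual j)] # ws) + p) (f ([xx (dual j)] # ws))"
      using cochainD(3)[OF f] by (simp add: homog_def hom_def)
    from hom_M[OF hom_single[of "xx j" 1] hom_W[OF this, of "rw ws"]]
    have "hom (gr1 ws + (p - 1)) (KE p f j ws)"
      unfolding KE_def M_single(2)[symmetric] by (intro hom_scale) (simp add: xx_deg jd_dual gr1_def tdeg_def algebra_simps)
    with x show "bdeg x = gr1 ws + (p - 1)" by (simp add: hom_def)
  qed
qed

lemma supp_KE: "supp a b f \<Longrightarrow> supp a (b - 1) (KE p f j)"
  unfolding supp_def
proof (intro allI impI)
  fix ws assume s: "\<forall>ws. f ws \<noteq> 0 \<longrightarrow> gr2 ws = a \<and> gr3 ws = b" and nz: "KE p f j ws \<noteq> 0"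
  then have "f ([xx (dual j)] # ws) \<noteq> 0" by (auto simp: KE_def W_simps)
  with s show "gr2 ws = a \<and> gr3 ws = b - 1" by (fastforce simp: gr2_def gr3_def)
qed

text \<open>The Leibniz rule for \<open>f\<close> with \<open>xx (dual j)\<close> inserted is
  carried through the weight (\<open>2\<close>) and through the multiplication by
  \<open>xx j\<close> (\<open>3\<close>). The weight in the product is lowered by the degrees of
  both factors, which the undifferentiated factor compensates.\<close>

lemma dl_KE:
  assumes f: "cochain p f" and n: "\<And>j. f [[xx j]] = 0" and s: "supp 0 c f" and z: "\<And>ws. dl p f ws = 0"
  shows "dl (p - 1) (KE p f j) ws = 0"
proof (rule dl_zeroI[OF cochain_KE[OF f n] supp_KE[OF s]])
  fix a b :: 'b and ws :: "'b list list"
  let ?v = "[xx (dual j)]" and ?X = "Poly_Mapping.single (xx j) (1::real)" and ?A = "Poly_Mapping.single a (1::real)" and ?B = "Poly_Mapping.single b (1::real)"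
  let ?T = "1 + jd j" and ?\<alpha> = "bdeg a" and ?\<beta> = "bdeg b" and ?s = "sdeg ws"
  define G where "G x = f (?v # [x] # ws)" for x
  define R where "R = 2 * real (length ws) + 3 - real (pdl ws)"
  have r: "rw ([x] # ws) = R - real (pd x)" for x by (simp add: rw_def R_def)
  have fG: "f ([x] # ?v # ws) = ksgn (?T * (bdeg x - 1)) *\<^sub>R G x" for x
    unfolding G_def by (subst good0D_hd(2)[OF cochainD(2)[OF f]]) (simp add: tdeg_def xx_deg jd_dual ks mult_ac)
  have "lin_ext (\<lambda>x. f ([x] # ?v # ws)) (mul a b) = ksgn (?T * (?\<alpha> + ?\<beta>)) *\<^sub>R lin_ext G (mul a b)"
    unfolding fG by (rule lin_ext_scale_const) (simp add: mul_keys)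
  with dl_pair[OF f s, of a b "?v # ws"] z
  have "ksgn (p * ?\<alpha> + ?T * (?\<beta> - 1)) *\<^sub>R M ?A (G b) + ksgn (?\<beta> * (sdeg (?v # ws)) + ?T * (?\<alpha> - 1)) *\<^sub>R M (G a) ?B
      - ksgn (p + ?T * (?\<alpha> + ?\<beta>)) *\<^sub>R lin_ext G (mul a b) = 0"
    unfolding fG by (simp add: M_single lin_ext_scale ksgn_add)
  from arg_cong[OF this, of "\<lambda>y. ksgn (?T * (?\<alpha> + ?\<beta>)) *\<^sub>R y"]
  have 1: "ksgn ((p + ?T) * ?\<alpha> + ?T) *\<^sub>R M ?A (G b) + ksgn (?\<beta> * ?s + ?T) *\<^sub>R M (G a) ?B = ksgn p *\<^sub>R lin_ext G (mul a b)"
    by (simp add: tdeg_def xx_deg jd_dual ks scaleR_right_distrib scaleR_right_diff_distrib mult_ac)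
  let ?r = "R - real (pd a) - real (pd b)"
  define GW where "GW x = W (rw ([x] # ws)) (G x)" for x
  have W1: "W ?r (M ?A (G b)) = M ?A (GW b)"
    unfolding M_single GW_def by (rule W_op) (auto simp: r dest!: mul_keys)
  have W2: "W ?r (M (G a) ?B) = M (GW a) ?B"
    unfolding M_single GW_def by (rule W_op) (auto simp: r dest!: mul_keys)
  have W3: "W ?r (lin_ext G (mul a b)) = lin_ext GW (mul a b)"
    unfolding lin_ext_linear[OF linear_W] GW_def by (rule lin_ext_cong) (auto simp: r diff_diff_eq dest!: mul_keys)
  from arg_cong[OF 1, of "W ?r"]
  have 2: "ksgn ((p + ?T) * ?\<alpha> + ?T) *\<^sub>R M ?A (GW b) + ksgn (?\<beta> * ?s + ?T) *\<^sub>R M (GW a) ?B = ksgn p *\<^sub>R lin_ext GW (mul a b)"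
    by (simp only: W_simps W1 W2 W3)
  have X: "hom (jd j - 1) ?X" using hom_single[of "xx j" 1] by (simp add: xx_deg)
  have X1: "M ?X (M ?A y) = - ksgn ((jd j - 1) * (?\<alpha> + 1) + ?\<alpha>) *\<^sub>R M ?A (M ?X y)" for y
  proof -
    have "M (M ?X ?A) y = - ksgn (jd j - 1) *\<^sub>R M ?X (M ?A y)" by (rule M_assoc[OF X])
    moreover have "M (M ?X ?A) y = - ksgn ((jd j - 1) * ?\<alpha>) *\<^sub>R M (M ?A ?X) y"
      unfolding M_comm[OF X hom_single[of a 1]] by (simp add: M_simps)
    moreover have "M (M ?A ?X) y = - ksgn ?\<alpha> *\<^sub>R M ?A (M ?X y)" by (rule M_assoc[OF hom_single])
    ultimately have "ksgn (jd j - 1) *\<^sub>R (- ksgn (jd j - 1) *\<^sub>R M ?X (M ?A y)) = ksgn (jd j - 1) *\<^sub>R (ksgn ((jd j - 1) * ?\<alpha> + ?\<alpha>) *\<^sub>R M ?A (M ?X y))"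
      by (simp add: ksgn_add)
    then show ?thesis by (simp add: ks mult_ac minus_equation_iff[of "M ?X (M ?A y)"])
  qed
  have X2: "M ?X (M y ?B) = - ksgn (jd j - 1) *\<^sub>R M (M ?X y) ?B" for y
    unfolding M_assoc[OF X] by simp
  define K where "K x = M ?X (GW x)" for x
  have X3: "M ?X (lin_ext GW y) = lin_ext K y" for y
    unfolding K_def M_single by (rule lin_ext_linear) (rule linear_lin_ext)
  have KK: "KE p f j ([x] # ws) = ksgn (p * (1 + jd j)) *\<^sub>R K x" for x
    by (simp add: KE_def K_def GW_def G_def M_single)
  from arg_cong[OF 2, of "M ?X"]
  have "- ksgn ((p - 1) * ?\<alpha>) *\<^sub>R M ?A (K b) - ksgn (?\<beta> * ?s) *\<^sub>R M (K a) ?B = ksgn p *\<^sub>R lin_ext K (mul a b)"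
    unfolding M_simps X1 X2 X3 K_def[symmetric] by (simp add: ks mult_ac)
  then have 3: "ksgn p *\<^sub>R lin_ext K (mul a b) = - ksgn ((p - 1) * ?\<alpha>) *\<^sub>R M ?A (K b) - ksgn (?\<beta> * ?s) *\<^sub>R M (K a) ?B" ..
  have 4: "ksgn ((p - 1) * ?\<alpha>) *\<^sub>R M ?A (K b) + ksgn (?\<beta> * ?s) *\<^sub>R M (K a) ?B + ksgn p *\<^sub>R lin_ext K (mul a b) = 0"
    unfolding 3 by simp
  show "dl (p - 1) (KE p f j) ([a, b] # ws) = 0"
    unfolding dl_pair[OF cochain_KE[OF f n] supp_KE[OF s]] KK lin_ext_fun_scale M_single(2,3)[symmetric] M_simps
    using arg_cong[OF 4, of "\<lambda>y. ksgn (p * (1 + jd j)) *\<^sub>R y"] by (simp add: ksgn_diff algebra_simps)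
qed

text \<open>The bracket composed with the coderivation of \<open>f\<close> on one-letter words: one
  argument is bracketed with the value on the others. On variables this is the de Rham differential,
  by \<open>brk_xx\<close>.\<close>

primrec om :: "int \<Rightarrow> ('b list list \<Rightarrow> 'b \<Rightarrow>\<^sub>0 real) \<Rightarrow> 'b list list \<Rightarrow> 'b list list \<Rightarrow> 'b \<Rightarrow>\<^sub>0 real" where
  "om p f [] z = 0"
| "om p f (w # ws) z = om p f ws (z @ [w]) + ksgn ((p + sdeg z) * tdeg w) *\<^sub>R lin_ext (brk (hd w)) (f (z @ ws))"

lemma DD_om:
  assumes f: "good0 f" and l: "\<forall>w\<in>set ws \<union> set z. length w = 1"
  shows "DD p f ws z brr = om p f ws z"
  using l
proof (induction ws arbitrary: z)
  case Nil
  have "brr [[x]] = 0" for x by (simp add: brr_def)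
  then show ?case using Nil by (simp add: GG_letters[OF f])
next
  case (Cons w ws)
  then obtain a where w: "w = [a]" by (auto simp: length_Suc_conv)
  have "DD p f vs z (\<lambda>y. brr ([a] # y)) = lin_ext (brk a) (f (z @ vs))" if "\<forall>w\<in>set vs \<union> set z. length w = 1" for vs z
    using that
  proof (induction vs arbitrary: z)
    case Nil
    then show ?case by (simp add: GG_letters[OF f] brr_def)
  next
    case (Cons v vs)
    have "(\<lambda>y. brr ([a] # v # y)) = (\<lambda>y. if y = [] then brr [[a], v] else 0)" by (auto simp: brr_def split: list.splits)
    have "DD p f vs z (\<lambda>y. brr ([a] # v # y)) = DD p f vs z (\<lambda>y. 0)"
    proof -
      have "DD p f vs z \<psi> = 0" if "\<And>y. y \<noteq> [] \<Longrightarrow> \<psi> y = 0" for \<psi> :: "'b list list \<Rightarrow> 'b \<Rightarrow>\<^sub>0 real"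
        using that
      proof (induction vs arbitrary: z \<psi>)
        case Nil then show ?case by (simp add: GG_def)
      qed simp
      moreover have "brr ([a] # v # y) = 0" if "y \<noteq> []" for y using brr_nz[of "[a] # v # y"] that by auto
      ultimately show ?thesis by simp
    qed
    then show ?case using Cons by simp
  qed
  with Cons show ?case by (simp add: w)
qed

text \<open>The derivatives of a variable are constants and only \<open>j = i\<close> contributes,
  so bracketing with a variable is a partial derivative.\<close>

lemma brk_xx: "lin_ext (brk (xx i)) y = - dv (dual i) y"
proof -
  have "(\<Sum>j\<in>UNIV. ksgn (jd j * bdeg (xx i)) *\<^sub>R M (der j (xx i)) (dv (dual j) y)) = (\<Sum>j\<in>UNIV. if j = i then dv (dual i) y else 0)"
    by (intro sum.cong refl) (simp add: der_xx M_simps M_single mul_e' xx_deg ks)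
  then show ?thesis unfolding brk_lin by simp
qed

text \<open>The bracket of two variables is a multiple of the unit, where \<open>\<phi>\<close>
  vanishes.\<close>

lemma DD_brr_vars:
  assumes "\<And>zs. [e] \<in> set zs \<Longrightarrow> \<phi> zs = 0" "vars ws" "vars z"
  shows "DD 1 brr ws z \<phi> = 0"
  using assms
proof (induction ws arbitrary: z \<phi>)
  case Nil
  have l: "\<forall>w\<in>set z. length w = 1" using Nil(3) by (auto simp: vars_def)
  have "lin_ext (\<lambda>x. \<phi> [[x]]) (brr z) = 0"
  proof (cases "brr z = 0")
    case False
    then obtain a b where "z = [[a], [b]]" using brr_nz by blast
    with Nil(3) obtain i k where z: "z = [[xx i], [xx k]]" by (auto simp: vars_def)
    have "brk (xx i) (xx k) = - der (dual i) (xx k)" using brk_xx[of i "Poly_Mapping.single (xx k) 1"] by (simp add: dv_simps)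
    then show ?thesis using Nil(1)[of "[[e]]"] by (simp add: z brr_def der_xx lin_ext_minus)
  qed simp
  then show ?case by (simp add: GG_letters[OF cochainD(2)[OF cochain_brr] l])
next
  case (Cons w ws)
  have "DD 1 brr ws (z @ [w]) \<phi> = 0" by (rule Cons.IH) (use Cons.prems in \<open>auto simp: vars_def\<close>)
  moreover have "DD 1 brr ws z (\<lambda>y. \<phi> (w # y)) = 0" by (rule Cons.IH) (use Cons.prems in \<open>auto simp: vars_def\<close>)
  ultimately show ?case by simp
qed

definition KS :: "int \<Rightarrow> ('b list list \<Rightarrow> 'b \<Rightarrow>\<^sub>0 real) \<Rightarrow> 'b list list \<Rightarrow> 'b \<Rightarrow>\<^sub>0 real" where
  "KS p f ws = (\<Sum>j\<in>UNIV. KE p f j ws)"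

lemma vars_pdl: "vars ws \<Longrightarrow> pdl ws = length ws"
  by (induction ws) (auto simp: vars_def pd_xx)

text \<open>Cartan's formula for the Euler vector field with part of the arguments already in
  \<open>z\<close>. Each step differentiates a product with \<open>xx j\<close>: the derivative of
  \<open>xx j\<close> survives for \<open>j = dual i\<close> and yields one copy of the weighted
  \<open>f\<close>; the other terms assemble into \<open>om p f\<close> with one more argument in
  the accumulator.\<close>

lemma om_KS:
  assumes f: "good0 f" and v: "vars ws" "vars z"
  shows "om (p - 1) (KS p f) ws z = real (length ws) *\<^sub>R W (real (length (z @ ws))) (f (z @ ws))
    + (\<Sum>j\<in>UNIV. ksgn (jd j) *\<^sub>R ksgn (p * (1 + jd j)) *\<^sub>R lin_ext (mul (xx j)) (W (real (length (z @ ws)) + 1) (om p f ws ([xx (dual j)] # z))))"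
  using v
proof (induction ws arbitrary: z)
  case Nil
  then show ?case by (simp add: W_simps)
next
  case (Cons w ws)
  let ?r = "real (length (z @ w # ws))"
  from Cons.prems obtain i where w: "w = [xx i]" by (auto simp: vars_def)
  have tw: "tdeg w = jd i - 2" by (simp add: w tdeg_def xx_deg)
  have vz: "vars (z @ ws)" using Cons.prems by (auto simp: vars_def)
  have rw: "rw (z @ ws) = ?r" using vars_pdl[OF vz] by (simp add: rw_def)
  let ?f = "\<lambda>j. f ([xx (dual j)] # z @ ws)" and ?c = "\<lambda>j. ksgn (p * (1 + jd j))"
  have d: "dv (dual i) (KE p f j (z @ ws)) = ?c j *\<^sub>R ksgn (1 - jd i) *\<^sub>R
      ((if j = dual i then W ?r (?f j) else 0) + ksgn ((1 - jd i) * (jd j - 1)) *\<^sub>R lin_ext (mul (xx j)) (W (?r + 1) (dv (dual i) (?f j))))" for j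
    unfolding KE_def rw M_single(2)[symmetric] dv_simps dv_M[OF hom_single[of "xx j" 1]] W_dv
    by (simp add: der_xx dv_simps jd_dual xx_deg M_simps M_single mul_e' eq_commute[of "dual i" j])
  have fm: "f (w # z @ ws) = ksgn (tdeg w * sdeg z) *\<^sub>R f (z @ w # ws)"
    using sym_move[of f z w ws, OF good0D(2)[OF f]] by simp
  have "(\<Sum>j\<in>UNIV. ?c j *\<^sub>R ksgn (1 - jd i) *\<^sub>R (if j = dual i then W ?r (?f j) else 0))
      = (\<Sum>j\<in>UNIV. if j = dual i then ?c (dual i) *\<^sub>R ksgn (1 - jd i) *\<^sub>R W ?r (?f (dual i)) else 0)"
    by (intro sum.cong refl) simp
  also have "\<dots> = ?c (dual i) *\<^sub>R ksgn (1 - jd i) *\<^sub>R W ?r (?f (dual i))" by simp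
  also have "\<dots> = - ksgn ((p - 1 + sdeg z) * tdeg w) *\<^sub>R W ?r (f (z @ w # ws))"
    unfolding dual_dual w[symmetric] fm W_simps unfolding jd_dual tw by (simp add: ks mult_ac)
  finally have s1: "(\<Sum>j\<in>UNIV. ?c j *\<^sub>R ksgn (1 - jd i) *\<^sub>R (if j = dual i then W ?r (?f j) else 0)) = - ksgn ((p - 1 + sdeg z) * tdeg w) *\<^sub>R W ?r (f (z @ w # ws))" .
  have o: "om p f (w # ws) ([xx (dual j)] # z) = om p f ws ([xx (dual j)] # z @ [w]) - ksgn ((p + (1 + jd j) + sdeg z) * tdeg w) *\<^sub>R dv (dual i) (?f j)" for j
    by (simp add: w brk_xx) (simp add: tdeg_def xx_deg jd_dual ks mult_ac)
  have ih: "om (p - 1) (KS p f) ws (z @ [w]) = real (length ws) *\<^sub>R W ?r (f (z @ w # ws))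
    + (\<Sum>j\<in>UNIV. ksgn (jd j) *\<^sub>R ?c j *\<^sub>R lin_ext (mul (xx j)) (W (?r + 1) (om p f ws ([xx (dual j)] # z @ [w]))))"
    using Cons.IH[of "z @ [w]"] Cons.prems by (simp add: vars_def)
  have "om (p - 1) (KS p f) (w # ws) z = om (p - 1) (KS p f) ws (z @ [w]) - ksgn ((p - 1 + sdeg z) * tdeg w) *\<^sub>R (\<Sum>j\<in>UNIV. dv (dual i) (KE p f j (z @ ws)))"
    by (simp add: w brk_xx KS_def dv_simps)
  also have "(\<Sum>j\<in>UNIV. dv (dual i) (KE p f j (z @ ws))) = - ksgn ((p - 1 + sdeg z) * tdeg w) *\<^sub>R W ?r (f (z @ w # ws))
      + (\<Sum>j\<in>UNIV. ?c j *\<^sub>R ksgn (1 - jd i) *\<^sub>R ksgn ((1 - jd i) * (jd j - 1)) *\<^sub>R lin_ext (mul (xx j)) (W (?r + 1) (dv (dual i) (?f j))))"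
    unfolding d scaleR_right_distrib sum.distrib s1 ..
  also have "ksgn ((p - 1 + sdeg z) * tdeg w) *\<^sub>R (- ksgn ((p - 1 + sdeg z) * tdeg w) *\<^sub>R W ?r (f (z @ w # ws))
      + (\<Sum>j\<in>UNIV. ?c j *\<^sub>R ksgn (1 - jd i) *\<^sub>R ksgn ((1 - jd i) * (jd j - 1)) *\<^sub>R lin_ext (mul (xx j)) (W (?r + 1) (dv (dual i) (?f j)))))
      = - W ?r (f (z @ w # ws)) + (\<Sum>j\<in>UNIV. ksgn (jd j) *\<^sub>R ?c j *\<^sub>R lin_ext (mul (xx j)) (W (?r + 1) (ksgn ((p + (1 + jd j) + sdeg z) * tdeg w) *\<^sub>R dv (dual i) (?f j))))"
  proof -
    have sg: "ksgn ((p - 1 + sdeg z) * tdeg w) *\<^sub>R ?c j *\<^sub>R ksgn (1 - jd i) *\<^sub>R ksgn ((1 - jd i) * (jd j - 1)) *\<^sub>R y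
      = ksgn (jd j) *\<^sub>R ?c j *\<^sub>R ksgn ((p + (1 + jd j) + sdeg z) * tdeg w) *\<^sub>R y" for j and y :: "'b \<Rightarrow>\<^sub>0 real"
      unfolding tw by (simp add: ks mult_ac)
    show ?thesis unfolding scaleR_right_distrib scaleR_sum_right W_simps lin_ext_scale sg by simp
  qed
  finally show ?case
    unfolding ih o W_simps lin_ext_diff scaleR_right_diff_distrib sum_subtractf
    by (simp add: scaleR_left_distrib algebra_simps)
qed

text \<open>On variables \<open>KS p f\<close> is a primitive by Cartan's formula; the difference to
  \<open>D\<close> is a multiderivation and is zero by \<open>vars_zero\<close>. For
  \<open>b < 0\<close> the map \<open>f\<close> vanishes on lists of one word, so that
  \<open>KS p f\<close> vanishes on the empty list.\<close>

theorem db_exact: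
  assumes D: "D \<in> coder_hom p 0 b" and b: "b < 0"
    and zm: "supercommutator 1 p dm D = 0" and zb: "supercommutator 1 p db D = 0"
  obtains E where "E \<in> coder_hom (p - 1) 0 (b + 1)" "supercommutator 1 (p - 1) dm E = 0" "supercommutator 1 (p - 1) db E = D"
proof -
  define f where "f = cor D"
  have cD: "coderivation p D" using D by (simp add: coder_hom_iff)
  have f: "cochain p f" "cd p f = D" unfolding f_def by (rule cochain_cor[OF cD], rule cd_cor[OF cD])
  have s: "supp 0 (- b) f" using D supp_hom[OF f(1)] f(2) by simp
  have zf: "dl p f ws = 0" for ws unfolding dl_def f(2) zm by (simp add: cor_def linear_0[OF linear_cogen])
  have n: "f [[xx j]] = 0" for j
  proof (rule ccontr)
    assume "f [[xx j]] \<noteq> 0" then have "gr3 [[xx j]] = - b" using s by (auto simp: supp_def)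
    then show False using b by (simp add: gr3_def)
  qed
  have K: "cochain (p - 1) (KE p f j)" "supp 0 (- b - 1) (KE p f j)" "dl (p - 1) (KE p f j) ws = 0" for j ws
    by (rule cochain_KE[OF f(1) n], rule supp_KE[OF s], rule dl_KE[OF f(1) n s zf])
  have KS: "cochain (p - 1) (\<lambda>ws. \<Sum>j\<in>J. KE p f j ws) \<and> supp 0 (- b - 1) (\<lambda>ws. \<Sum>j\<in>J. KE p f j ws)
      \<and> (\<forall>ws. dl (p - 1) (\<lambda>ws. \<Sum>j\<in>J. KE p f j ws) ws = 0)" if "finite J" for J
    using that
  proof (induction J rule: finite_induct)
    case empty
    have "dl (p - 1) (\<lambda>ws. 0) ws = 0" for ws using dl_scale[OF cochain_zero, of "p - 1" 0 ws] by simp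
    then show ?case by (simp add: cochain_zero supp_def)
  next
    case (insert j J)
    then have c: "cochain (p - 1) (\<lambda>ws. \<Sum>j\<in>J. KE p f j ws)" "supp 0 (- b - 1) (\<lambda>ws. \<Sum>j\<in>J. KE p f j ws)" by auto
    show ?case
      using insert cochain_add[OF K(1) c(1), of j] supp_lin[OF K(2) c(2), of "\<lambda>ws. 1" j "\<lambda>ws. 1"] dl_add[OF K(1) c(1), of j] K(3)
      by simp
  qed
  have E: "cochain (p - 1) (KS p f)" "supp 0 (- b - 1) (KS p f)" "\<And>ws. dl (p - 1) (KS p f) ws = 0"
    using KS[of UNIV] unfolding KS_def[abs_def] by auto
  define E where "E = cd (p - 1) (KS p f)"
  have cE: "coderivation (p - 1) E" "cor E = KS p f" unfolding E_def by (rule coderivation_cd[OF E(1)], rule cor_cd[OF E(1)])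
  have hE: "E \<in> coder_hom (p - 1) 0 (b + 1)" 
  proof -
    have "- (b + 1) = - b - 1" by simp
    then show ?thesis unfolding E_def supp_hom[OF E(1)] using E(2) by (simp only: minus_zero)
  qed
  have mE: "supercommutator 1 (p - 1) dm E = (\<lambda>x. 0)"
    using coderivation_eq_0[OF coderivation_supercommutator[OF dm_coder cE(1)]] E(3) unfolding dl_def E_def by blast
  have bE: "coderivation p (supercommutator 1 (p - 1) db E)" using coderivation_supercommutator[OF db_coder cE(1)] by simp
  have v: "cor (supercommutator 1 (p - 1) db E) ws = f ws" if v: "vars ws" for ws
  proof (cases "ws = []")
    case True
    then show ?thesis using cochainD(4)[OF f(1)] cochainD(4)[OF cochain_cor[OF bE]] by simp
  next
    case False
    let ?r = "real (length ws)"
    have l: "\<forall>w\<in>set ws. length w = 1" using v by (auto simp: vars_def)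
    have e1: "DD 1 brr zs [] f = 0" "DD 1 brr zs [] (KS p f) = 0" if "vars zs" for zs
      using that dl_unit[OF f(1) s zf] dl_unit[OF E(1,2,3)] by (auto intro!: DD_brr_vars simp: vars_def)
    \<comment> \<open>Closedness at the arguments extended by \<open>xx (dual j)\<close>: the first
      term of \<open>om\<close> is a derivative of \<open>f ws\<close>, and the rest is the
      expression occurring in \<open>om_KS\<close>.\<close>
    have o: "om p f ws [[xx (dual j)]] = ksgn (p * (1 + jd j)) *\<^sub>R dv j (f ws)" for j
    proof -
      let ?zs = "[xx (dual j)] # ws"
      have vz: "vars ?zs" using v by (auto simp: vars_def)
      have "cor (supercommutator 1 p db D) ?zs = 0" unfolding zb by (simp add: cor_def linear_0[OF linear_cogen])
      then have "DD p f ?zs [] brr - ksgn p *\<^sub>R DD 1 brr ?zs [] f = 0"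
        unfolding cor_supercommutator[OF db_coder cD] cor_db f_def by simp
      then have "om p f ?zs [] = 0"
        unfolding e1(1)[OF vz] by (subst (asm) DD_om[OF cochainD(2)[OF f(1)]]) (use l in auto)
      then show ?thesis
        by (simp add: brk_xx dual_dual) (simp add: tdeg_def xx_deg jd_dual ks mult_ac)
    qed
    have "cor (supercommutator 1 (p - 1) db E) ws = om (p - 1) (KS p f) ws []"
      unfolding cor_supercommutator[OF db_coder cE(1)] cor_db cE(2) e1(2)[OF v]
      by (subst DD_om[OF cochainD(2)[OF E(1)]]) (use l in auto)
    also have "\<dots> = ?r *\<^sub>R W ?r (f ws) + (\<Sum>j\<in>UNIV. ksgn (jd j) *\<^sub>R lin_ext (mul (xx j)) (dv j (W ?r (f ws))))"
      by (subst om_KS[OF cochainD(2)[OF f(1)] v]) (simp_all add: vars_def o W_simps lin_ext_scale W_dv)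
    also have "(\<Sum>j\<in>UNIV. ksgn (jd j) *\<^sub>R lin_ext (mul (xx j)) (dv j y)) = lin_ext (\<lambda>a. real (pd a) *\<^sub>R Poly_Mapping.single a 1) y" for y
      unfolding euler[symmetric] dv_def lin_ext_lin_ext lin_ext_fun_sum lin_ext_fun_scale ..
    \<comment> \<open>The number of arguments and the polynomial degree of the value add up to the
      weight inverted by \<open>W ?r\<close>, which is positive as \<open>ws\<close> is not
      empty.\<close>
    also have "?r *\<^sub>R W ?r (f ws) + lin_ext (\<lambda>a. real (pd a) *\<^sub>R Poly_Mapping.single a 1) (W ?r (f ws)) = f ws"
    proof -
      have "?r *\<^sub>R W ?r y + lin_ext (\<lambda>a. real (pd a) *\<^sub>R Poly_Mapping.single a 1) (W ?r y) = lin_ext (\<lambda>x. Poly_Mapping.single x 1) y" for y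
      proof -
        have "?r *\<^sub>R Poly_Mapping.single x (1 / (real (pd x) + ?r)) + (1 / (real (pd x) + ?r)) *\<^sub>R (real (pd x) *\<^sub>R Poly_Mapping.single x 1) = Poly_Mapping.single x (1::real)" for x
        proof -
          have "real (pd x) + ?r > 0" using False by (simp add: add_nonneg_pos)
          then have "?r * (1 / (real (pd x) + ?r)) + 1 / (real (pd x) + ?r) * real (pd x) = 1"
            by (simp add: add.commute flip: add_divide_distrib)
          then show ?thesis unfolding single_scaleR scaleR_scaleR single_add[symmetric] by simp
        qed
        then show ?thesis
          unfolding W_def lin_ext_lin_ext lin_ext_single lin_ext_fun_scale[symmetric] lin_ext_fun_add[symmetric] by simp
      qed
      then show ?thesis by simp
    qed
    finally show ?thesis .
  qed
  define g where "g ws = cor (supercommutator 1 (p - 1) db E) ws - f ws" for ws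
  have gc: "g = cor (\<lambda>x. supercommutator 1 (p - 1) db E x - D x)"
    unfolding g_def[abs_def] f_def cor_def linear_diff[OF linear_cogen] ..
  have cg: "coderivation p (\<lambda>x. supercommutator 1 (p - 1) db E x - D x)" by (rule coderivation_diff[OF bE cD])
  have g: "cochain p g" unfolding gc by (rule cochain_cor[OF cg])
  have bEh: "supercommutator 1 (p - 1) db E \<in> coder_hom p 0 b"
    using supercommutator_hom[OF db_hom hE] by simp
  have sg: "supp 0 (- b) g"
    unfolding supp_def
  proof (intro allI impI)
    fix ws assume "g ws \<noteq> 0"
    then have "cor (supercommutator 1 (p - 1) db E) ws \<noteq> 0 \<or> f ws \<noteq> 0" by (auto simp: g_def)
    then show "gr2 ws = 0 \<and> gr3 ws = - b" using bEh s by (auto simp: supp_def coder_hom_iff)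
  qed
  have "dl p g ws = 0" for ws
  proof -
    have "supercommutator 1 p dm (\<lambda>x. supercommutator 1 (p - 1) db E x - D x) x = 0" for x
    proof -
      have 1: "dm (db y) = - db (dm y)" for y using dm_db[of y] by (simp add: eq_neg_iff_add_eq_0)
      have 2: "dm (E y) = ksgn (p - 1) *\<^sub>R E (dm y)" for y using fun_cong[OF mE, of y] by (simp add: supercommutator_def)
      have 3: "dm (D y) = ksgn p *\<^sub>R D (dm y)" for y using fun_cong[OF zm, of y] by (simp add: supercommutator_def)
      note l = dm_linear db_linear coderivation_linear[OF cE(1)]
      show ?thesis
        by (simp add: supercommutator_def linear_diff[OF dm_linear] linear_cmul[OF dm_linear] linear_cmul[OF db_linear] linear_cmul[OF l(3)] 1 2 3
            linear_neg[OF l(3)] linear_neg[OF db_linear] linear_neg[OF dm_linear] linear_add[OF l(1)] linear_add[OF l(2)] linear_add[OF l(3)] ks algebra_simps)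
    qed
    then have "supercommutator 1 p dm (\<lambda>x. supercommutator 1 (p - 1) db E x - D x) = (\<lambda>x. 0)" by auto
    then show ?thesis unfolding dl_def gc cd_cor[OF cg] by (simp add: cor_def linear_0[OF linear_cogen])
  qed
  then have "g ws = 0" for ws by (rule vars_zero[OF g sg]) (simp add: g_def v)
  then have "supercommutator 1 (p - 1) db E = D"
    by (intro coderivation_eqI[OF bE cD]) (simp add: g_def f_def)
  moreover have "supercommutator 1 (p - 1) dm E = 0" unfolding mE by (simp add: zero_fun_def)
  ultimately show thesis using that hE by blast
qed

end

section \<open>The spectral sequence\<close>

lemma coset_absorb:
  fixes x :: "'a::ab_group_add"
  assumes "x \<in> B" "\<And>u v. u \<in> B \<Longrightarrow> v \<in> B \<Longrightarrow> u - v \<in> B"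
  shows "coset x B = B"
  unfolding coset_def
proof (intro set_eqI iffI)
  fix y :: 'a
  show "y \<in> {y. x - y \<in> B} \<Longrightarrow> y \<in> B" using assms(2)[OF assms(1), of "x - y"] by simp
  show "y \<in> B \<Longrightarrow> y \<in> {y. x - y \<in> B}" using assms by simp
qed

text \<open>The algebra enters only through \<open>exA\<close> and \<open>exB\<close>. By
  \<open>pos\<close> there are no boundaries of \<open>d\<close> at \<open>a = 0\<close>; so
  \<open>E1\<close> consists there of the cocycles of \<open>d\<close>, and \<open>exB\<close> is
  exactness of their complex under \<open>d'\<close>.\<close>

locale bicomplex =
  fixes C :: "int \<Rightarrow> int \<Rightarrow> int \<Rightarrow> 'a::ab_group_add set" and d d' :: "int \<Rightarrow> 'a \<Rightarrow> 'a"
  assumes zero: "0 \<in> C p a b" and diff: "x \<in> C p a b \<Longrightarrow> y \<in> C p a b \<Longrightarrow> x - y \<in> C p a b"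
    and d_diff: "d p (x - y) = d p x - d p y" and d'_diff: "d' p (x - y) = d' p x - d' p y"
    and dC: "x \<in> C p a b \<Longrightarrow> d p x \<in> C (p + 1) (a - 1) b"
    and d'C: "x \<in> C p a b \<Longrightarrow> d' p x \<in> C (p + 1) a (b - 1)"
    and anti: "x \<in> C p a b \<Longrightarrow> d' (p + 1) (d p x) = - d (p + 1) (d' p x)"
    and pos: "a > 0 \<or> b > 0 \<Longrightarrow> C p a b = {0}"
    and exA: "x \<in> C p a b \<Longrightarrow> a < 0 \<Longrightarrow> d p x = 0 \<Longrightarrow> \<exists>y\<in>C (p - 1) (a + 1) b. d (p - 1) y = x"
    and exB: "x \<in> C p 0 b \<Longrightarrow> b < 0 \<Longrightarrow> d p x = 0 \<Longrightarrow> d' p x = 0 \<Longrightarrow>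
      \<exists>y\<in>C (p - 1) 0 (b + 1). d (p - 1) y = 0 \<and> d' (p - 1) y = x"
begin

lemma d_0 [simp]: "d p 0 = 0" "d' p 0 = 0"
  using d_diff[of p 0 0] d'_diff[of p 0 0] by simp_all

lemma B1_diff: "u \<in> E1_zero C d p a b \<Longrightarrow> v \<in> E1_zero C d p a b \<Longrightarrow> u - v \<in> E1_zero C d p a b"
  unfolding E1_zero_def using diff by (auto simp flip: d_diff)

lemma B1_0: "0 \<in> E1_zero C d p a b"
  unfolding E1_zero_def using zero by (auto simp: image_iff intro!: bexI[of _ 0])

text \<open>For \<open>a \<noteq> 0\<close> already \<open>E1\<close> has a single class. For
  \<open>a = 0\<close> the classes of \<open>E1\<close> are one-element sets and every cocycle is a
  boundary, by \<open>exB\<close> or trivially for \<open>b > 0\<close>, so all of them define the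
  same class.\<close>

theorem E2_singleton:
  assumes ab: "(a, b) \<noteq> (0, 0)"
  shows "is_singleton (E2 C d d' p a b)"
proof (cases "a = 0")
  case False
  have "{x \<in> C p a b. d p x = 0} \<subseteq> E1_zero C d p a b"
    using False pos[of a b p] exA[of _ p a b] B1_0[of p a b] unfolding E1_zero_def by (cases "a > 0") fastforce+
  then have "coset x (E1_zero C d p a b) = E1_zero C d p a b" if "x \<in> C p a b" "d p x = 0" for x
    using that by (intro coset_absorb B1_diff) auto
  then have E1: "E1 C d p a b = {E1_zero C d p a b}"
    unfolding E1_def subquotient_def using zero[of p a b] d_0 by (auto simp: image_iff intro!: exI[of _ 0])
  \<comment> \<open>Boundaries of \<open>d\<close> go to boundaries because the differentials
    anticommute; hence the induced map sends the zero class to the zero class.\<close>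
  have "coset (d' p x) (E1_zero C d (p + 1) a (b - 1)) = E1_zero C d (p + 1) a (b - 1)" if "x \<in> E1_zero C d p a b" for x
  proof (rule coset_absorb[OF _ B1_diff])
    from that obtain y where y: "y \<in> C (p - 1) (a + 1) b" "x = d (p - 1) y" by (auto simp: E1_zero_def)
    have "d' p x = d p (- d' (p - 1) y)"
      using anti[OF y(1)] d_diff[of p 0 "d' (p - 1) y"] y(2) by simp
    moreover have "- d' (p - 1) y \<in> C p (a + 1) (b - 1)"
      using diff[OF zero d'C[OF y(1)]] by simp
    ultimately show "d' p x \<in> E1_zero C d (p + 1) a (b - 1)" by (auto simp: E1_zero_def)
  qed
  then have "E1_diff C d d' p a b (E1_zero C d p a b) = (\<Union>x\<in>E1_zero C d p a b. E1_zero C d (p + 1) a (b - 1))"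
    unfolding E1_diff_def by (rule SUP_cong[OF refl])
  also have "\<dots> = E1_zero C d (p + 1) a (b - 1)" using B1_0[of p a b] by (subst UN_constant) (simp split: if_splits, blast)
  finally have ED: "E1_diff C d d' p a b (E1_zero C d p a b) = E1_zero C d (p + 1) a (b - 1)" .
  have Z: "{c \<in> {E1_zero C d p a b}. E1_diff C d d' p a b c = E1_zero C d (p + 1) a (b - 1)} = {E1_zero C d p a b}"
    by (auto simp: ED)
  show ?thesis
    unfolding E2_def Let_def E1 Z image_insert image_empty is_singleton_def by blast
next
  case True
  have B0: "E1_zero C d p 0 b = {0}" for p b
    unfolding E1_zero_def using pos[of 1 b "p - 1"] by simp
  have c0: "coset x {0} = {x}" for x :: 'a by (auto simp: coset_def)
  have E1: "E1 C d p 0 b = (\<lambda>x. {x}) ` {x \<in> C p 0 b. d p x = 0}" for p b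
    unfolding E1_def subquotient_def B0 c0 ..
  have df: "E1_diff C d d' p 0 b {x} = {d' p x}" for p b x
    by (simp add: E1_diff_def B0 c0)
  define Bs where "Bs = d' (p - 1) ` {y \<in> C (p - 1) 0 (b + 1). d (p - 1) y = 0}"
  have BE: "E1_diff C d d' (p - 1) 0 (b + 1) ` E1 C d (p - 1) 0 (b + 1) = (\<lambda>x. {x}) ` Bs"
    unfolding E1 Bs_def by (simp add: image_image df)
  have Bd: "u - v \<in> Bs" if uv: "u \<in> Bs" "v \<in> Bs" for u v
  proof -
    from uv obtain x y where "x \<in> C (p - 1) 0 (b + 1)" "d (p - 1) x = 0" "u = d' (p - 1) x"
      "y \<in> C (p - 1) 0 (b + 1)" "d (p - 1) y = 0" "v = d' (p - 1) y" unfolding Bs_def by blast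
    then show ?thesis unfolding Bs_def
      by (intro image_eqI[of _ _ "x - y"]) (simp_all add: d_diff d'_diff diff)
  qed
  have b: "b > 0 \<or> b < 0" using ab True by auto
  have 0: "0 \<in> Bs" unfolding Bs_def using zero by (intro image_eqI[of _ _ 0]) simp_all
  have Z: "x \<in> Bs" if "x \<in> C p 0 b" "d p x = 0" "d' p x = 0" for x
    using b
  proof
    assume "b > 0" then show ?thesis using pos[of 0 b p] that 0 by auto
  next
    assume "b < 0" then show ?thesis using exB[OF that(1) _ that(2,3)] unfolding Bs_def by fastforce
  qed
  have "{c' \<in> E1 C d p 0 b. {x - y |x y. x \<in> {z} \<and> y \<in> c'} \<in> (\<lambda>x. {x}) ` Bs} = {c' \<in> E1 C d p 0 b. \<exists>y\<in>Bs. c' = {y}}" if z: "z \<in> Bs" for z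
  proof -
    have "z - y \<in> Bs \<longleftrightarrow> y \<in> Bs" for y using Bd[OF z, of y] Bd[OF z, of "z - y"] by auto
    then show ?thesis unfolding E1 by auto
  qed
  moreover have "{0} \<in> {c \<in> E1 C d p 0 b. E1_diff C d d' p 0 b c = {0}}"
    unfolding E1 using zero by (auto simp: df)
  ultimately have "E2 C d d' p 0 b = {{c' \<in> E1 C d p 0 b. \<exists>y\<in>Bs. c' = {y}}}"
    unfolding E2_def Let_def BE B0
  proof (intro set_eqI iffI)
    fix X assume *: "X \<in> (\<lambda>c. {c' \<in> E1 C d p 0 b. {x - y |x y. x \<in> c \<and> y \<in> c'} \<in> (\<lambda>x. {x}) ` Bs}) ` {c \<in> E1 C d p 0 b. E1_diff C d d' p 0 b c = {0}}"
      and H: "\<And>z. z \<in> Bs \<Longrightarrow> {c' \<in> E1 C d p 0 b. {x - y |x y. x \<in> {z} \<and> y \<in> c'} \<in> (\<lambda>x. {x}) ` Bs} = {c' \<in> E1 C d p 0 b. \<exists>y\<in>Bs. c' = {y}}"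
    from * obtain c where c: "c \<in> E1 C d p 0 b" "E1_diff C d d' p 0 b c = {0}"
      and X: "X = {c' \<in> E1 C d p 0 b. {x - y |x y. x \<in> c \<and> y \<in> c'} \<in> (\<lambda>x. {x}) ` Bs}" by blast
    then obtain z where z: "c = {z}" "z \<in> C p 0 b" "d p z = 0" unfolding E1 by blast
    with c(2) have "z \<in> Bs" by (intro Z) (simp_all add: df)
    from H[OF this] show "X \<in> {{c' \<in> E1 C d p 0 b. \<exists>y\<in>Bs. c' = {y}}}" unfolding X z(1) by blast
  next
    fix X assume *: "X \<in> {{c' \<in> E1 C d p 0 b. \<exists>y\<in>Bs. c' = {y}}}"
      and H: "\<And>z. z \<in> Bs \<Longrightarrow> {c' \<in> E1 C d p 0 b. {x - y |x y. x \<in> {z} \<and> y \<in> c'} \<in> (\<lambda>x. {x}) ` Bs} = {c' \<in> E1 C d p 0 b. \<exists>y\<in>Bs. c' = {y}}"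
      and 1: "{0} \<in> {c \<in> E1 C d p 0 b. E1_diff C d d' p 0 b c = {0}}"
    show "X \<in> (\<lambda>c. {c' \<in> E1 C d p 0 b. {x - y |x y. x \<in> c \<and> y \<in> c'} \<in> (\<lambda>x. {x}) ` Bs}) ` {c \<in> E1 C d p 0 b. E1_diff C d d' p 0 b c = {0}}"
      by (rule image_eqI[OF _ 1]) (use * H[OF 0] in blast)
  qed
  then show ?thesis unfolding True is_singleton_def by blast
qed

end

lemma cor_gr_nonneg:
  assumes "coderivation p D" "cor D ws \<noteq> 0"
  shows "gr2 ws \<ge> 0" "gr3 ws \<ge> 0"
proof -
  note c = cochain_cor[OF assms(1)]
  have "[] \<notin> set ws" "ws \<noteq> []" using good0D(3)[OF cochainD(2)[OF c]] cochainD(4)[OF c] assms(2) by auto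
  then show "gr2 ws \<ge> 0" "gr3 ws \<ge> 0" using letters_nl[of ws] by (auto simp: gr_nl gr3_def Suc_le_eq)
qed

lemma supercommutator_support:
  assumes "D \<in> coder_hom p a b" "coderivation q E" "cor (supercommutator p q D E) ws \<noteq> 0"
  obtains y where "cor E y \<noteq> 0" "gr2 ws = gr2 y - a" "gr3 ws = gr3 y - b"
proof -
  have D: "coderivation p D" "\<And>ws. cor D ws \<noteq> 0 \<Longrightarrow> gr2 ws = - a \<and> gr3 ws = - b"
    using assms(1) by (auto simp: coder_hom_iff)
  consider "DD q (cor E) ws [] (cor D) \<noteq> 0" | "DD p (cor D) ws [] (cor E) \<noteq> 0"
    using assms(3) unfolding cor_supercommutator[OF D(1) assms(2)] by fastforce
  then show thesis
  proof cases
    case 1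
    from DD_support[OF cochain_cor[OF assms(2)] 1] obtain x y where "cor D x \<noteq> 0" "cor E y \<noteq> 0"
      "gr2 ws = gr2 x + gr2 y" "gr3 ws = gr3 x + gr3 y" .
    then show thesis using D(2)[of x] by (intro that[of y]) auto
  next
    case 2
    from DD_support[OF cochain_cor[OF D(1)] 2] obtain x y where "cor E x \<noteq> 0" "cor D y \<noteq> 0"
      "gr2 ws = gr2 x + gr2 y" "gr3 ws = gr3 x + gr3 y" .
    then show thesis using D(2)[of y] by (intro that[of x]) auto
  qed
qed

lemma supercommutator_diff: "linear D \<Longrightarrow> supercommutator p q D (E - F) = supercommutator p q D E - supercommutator p q D F"
  by (rule ext) (simp add: supercommutator_def linear_diff scaleR_right_diff_distrib)

lemma supercommutator_anti:
  assumes "linear D" "linear D'" "\<And>x. D (D' x) + D' (D x) = 0" "linear E"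
  shows "supercommutator 1 (1 + p) D' (supercommutator 1 p D E) = - supercommutator 1 (1 + p) D (supercommutator 1 p D' E)"
proof
  fix x
  have a: "D (D' y) = - D' (D y)" for y using assms(3)[of y] by (simp add: eq_neg_iff_add_eq_0)
  show "supercommutator 1 (1 + p) D' (supercommutator 1 p D E) x = (- supercommutator 1 (1 + p) D (supercommutator 1 p D' E)) x"
    by (simp add: supercommutator_def linear_diff[OF assms(1)] linear_cmul[OF assms(1)] linear_diff[OF assms(2)] linear_cmul[OF assms(2)]
        a linear_neg[OF assms(4)] ks algebra_simps)
qed

text \<open>A corestriction is non-zero only on non-empty lists of non-empty words, where
  \<open>gr2\<close> and \<open>gr3\<close> are non-negative.\<close>

lemma coder_hom_pos:
  assumes "a > 0 \<or> b > 0" shows "coder_hom p a b = {0 :: 'b::graded_basis cofree \<Rightarrow> 'b cofree}"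
proof -
  have "D = 0" if "D \<in> coder_hom p a b" for D :: "'b cofree \<Rightarrow> 'b cofree"
  proof
    have D: "coderivation p D" "\<And>ws. cor D ws \<noteq> 0 \<Longrightarrow> gr2 ws = - a \<and> gr3 ws = - b"
      using that by (auto simp: coder_hom_iff)
    have "cor D ws = 0" for ws
    proof (rule ccontr)
      assume "cor D ws \<noteq> 0"
      from D(2)[OF this] cor_gr_nonneg[OF D(1) this] assms show False by simp
    qed
    then show "D x = 0 x" for x using coderivation_eq_0[OF D(1)] by simp
  qed
  then show ?thesis using coder_hom_0 by blast
qed

context poly_letters
begin

theorem schouten_E2:
  assumes "(a, b) \<noteq> (0, 0)"
  shows "is_singleton (E2 coder_hom (\<lambda>q. supercommutator 1 q dm) (\<lambda>q. supercommutator 1 q db) p a b)"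
proof -
  interpret bicomplex coder_hom "\<lambda>q. supercommutator 1 q dm" "\<lambda>q. supercommutator 1 q db"
  proof
    fix p a b and x y :: "'b cofree \<Rightarrow> 'b cofree"
    show "0 \<in> coder_hom p a b" by (rule coder_hom_0)
    show "x \<in> coder_hom p a b \<Longrightarrow> y \<in> coder_hom p a b \<Longrightarrow> x - y \<in> coder_hom p a b" by (rule coder_hom_diff)
    show "supercommutator 1 p dm (x - y) = supercommutator 1 p dm x - supercommutator 1 p dm y"
      "supercommutator 1 p db (x - y) = supercommutator 1 p db x - supercommutator 1 p db y"
      by (rule supercommutator_diff, rule dm_linear db_linear)+
    show "x \<in> coder_hom p a b \<Longrightarrow> supercommutator 1 p dm x \<in> coder_hom (p + 1) (a - 1) b"
      "x \<in> coder_hom p a b \<Longrightarrow> supercommutator 1 p db x \<in> coder_hom (p + 1) a (b - 1)"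
      using supercommutator_hom[OF dm_hom, of x p a b] supercommutator_hom[OF db_hom, of x p a b] by (simp_all add: add.commute)
    show "supercommutator 1 (p + 1) db (supercommutator 1 p dm x) = - supercommutator 1 (p + 1) dm (supercommutator 1 p db x)" if "x \<in> coder_hom p a b"
    proof -
      have "linear x" using that coderivation_linear by (auto simp: coder_hom_iff)
      from supercommutator_anti[OF dm_linear db_linear dm_db this, of p] show ?thesis by (simp add: add.commute)
    qed
    show "0 < a \<or> 0 < b \<Longrightarrow> coder_hom p a b = {0 :: 'b cofree \<Rightarrow> 'b cofree}" by (rule coder_hom_pos)
    show "\<exists>y\<in>coder_hom (p - 1) (a + 1) b. supercommutator 1 (p - 1) dm y = x"
      if "x \<in> coder_hom p a b" "a < 0" "supercommutator 1 p dm x = 0"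
      using dm_exact[OF that] by blast
    show "\<exists>y\<in>coder_hom (p - 1) 0 (b + 1). supercommutator 1 (p - 1) dm y = 0 \<and> supercommutator 1 (p - 1) db y = x"
      if "x \<in> coder_hom p 0 b" "b < 0" "supercommutator 1 p dm x = 0" "supercommutator 1 p db x = 0"
      using db_exact[OF that] by blast
  qed
  show ?thesis by (rule E2_singleton[OF assms])
qed

section \<open>The total complex\<close>

abbreviation "dt \<equiv> dm + db"

lemma dt_linear: "linear dt"
  using linear_compose_add[OF dm_linear db_linear] by (simp add: plus_fun_def)

lemma dt_dt: "dt (dt x) = 0"
  using dm_dm[of x] db_db[of x] dm_db[of x] by (simp add: linear_add[OF dm_linear] linear_add[OF db_linear])

lemma supercommutator_dt: "linear E \<Longrightarrow> supercommutator 1 q dt E = (\<lambda>x. supercommutator 1 q dm E x + supercommutator 1 q db E x)"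
  by (rule ext) (simp add: supercommutator_def linear_add algebra_simps)

text \<open>The component \<open>x1\<close> of highest \<open>gr2\<close> is closed for
  \<open>d_m\<close>, as no other term of the total cocycle condition reaches
  \<open>gr2 = n + 2\<close>. Subtracting the total coboundary of its primitive lowers the bound on
  \<open>gr2\<close> by 1. At \<open>gr2 = 0\<close> the gradings separate the cocycle condition
  into its two parts, and \<open>db_exact\<close> applies.\<close>

lemma total_exact:
  assumes "coderivation p x" "\<And>ws. cor x ws \<noteq> 0 \<Longrightarrow> gr2 ws + gr3 ws = - k \<and> gr2 ws \<le> int n"
    and "k < 0" "supercommutator 1 p dt x = (\<lambda>x. 0)"
  shows "\<exists>y\<in>coder_tot (p - 1) (k + 1). supercommutator 1 (p - 1) dt y = x"
  using assms
proof (induction n arbitrary: x)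
  case 0
  have h: "x \<in> coder_hom p 0 k"
    unfolding coder_hom_iff using 0(1,2) cor_gr_nonneg[OF 0(1)] by fastforce
  have c: "cor (supercommutator 1 p dm x) ws + cor (supercommutator 1 p db x) ws = 0" for ws
    using arg_cong[OF 0(4), of "\<lambda>D. cor D ws"] unfolding supercommutator_dt[OF coderivation_linear[OF 0(1)]]
    by (simp add: cor_def linear_add[OF linear_cogen] linear_0[OF linear_cogen])
  have m: "cor (supercommutator 1 p dm x) ws = 0" for ws
  proof (rule ccontr)
    assume nz: "cor (supercommutator 1 p dm x) ws \<noteq> 0"
    then have "cor (supercommutator 1 p db x) ws \<noteq> 0" using c[of ws] by auto
    then show False
      using nz supercommutator_hom[OF dm_hom h] supercommutator_hom[OF db_hom h] by (auto simp: coder_hom_iff)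
  qed
  have "supercommutator 1 p dm x = 0" "supercommutator 1 p db x = 0"
    using coderivation_eq_0[OF coderivation_supercommutator[OF dm_coder 0(1)]] m
      coderivation_eq_0[OF coderivation_supercommutator[OF db_coder 0(1)]] c by (auto simp: fun_eq_iff)
  from db_exact[OF h 0(3) this] obtain E where E: "E \<in> coder_hom (p - 1) 0 (k + 1)"
    "supercommutator 1 (p - 1) dm E = 0" "supercommutator 1 (p - 1) db E = x" .
  then have "supercommutator 1 (p - 1) dt E = x"
    using supercommutator_dt[OF coderivation_linear, of "p - 1" E "p - 1"] by (auto simp: coder_hom_iff)
  moreover have "E \<in> coder_tot (p - 1) (k + 1)" using E(1) by (auto simp: coder_hom_iff coder_tot_iff)
  ultimately show ?case by blast
next
  case (Suc n)
  define f where "f ws = (if gr2 ws = int (Suc n) then cor x ws else 0)" for ws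
  have f: "cochain p f"
    using good0_if_inv[OF cochainD(2)[OF cochain_cor[OF Suc(2)]] word_inv_comp[OF word_inv_gr(3), of "\<lambda>g. g = int (Suc n)"]]
      cochainD(3,4)[OF cochain_cor[OF Suc(2)]]
    unfolding cochain_def good_def homog_def f_def[abs_def] by (simp add: f_def)
  define x1 where "x1 = cd p f"
  have x1: "coderivation p x1" "cor x1 = f" unfolding x1_def by (rule coderivation_cd[OF f], rule cor_cd[OF f])
  have h1: "x1 \<in> coder_hom p (- int (Suc n)) (k + int (Suc n))"
    using Suc(3) by (fastforce simp: coder_hom_iff x1 f_def split: if_splits)
  define x2 where "x2 = (\<lambda>z. x z - x1 z)"
  have x2: "coderivation p x2" unfolding x2_def by (rule coderivation_diff[OF Suc(2) x1(1)])
  have c2: "cor x2 ws = (if gr2 ws = int (Suc n) then 0 else cor x ws)" for ws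
    using cor_diff[of x x1 ws] by (simp add: x2_def x1 f_def fun_diff_def)
  have x: "x = (\<lambda>z. x1 z + x2 z)" by (simp add: x2_def)
  have "cor (supercommutator 1 p dm x1) ws = 0" for ws
  proof (rule ccontr)
    assume nz: "cor (supercommutator 1 p dm x1) ws \<noteq> 0"
    then have g: "gr2 ws = int n + 2" using supercommutator_hom[OF dm_hom h1] by (auto simp: coder_hom_iff)
    have "cor (supercommutator 1 p dm x2) ws = 0"
    proof (rule ccontr)
      assume "cor (supercommutator 1 p dm x2) ws \<noteq> 0"
      from supercommutator_support[OF dm_hom x2 this] obtain y where "cor x2 y \<noteq> 0" "gr2 ws = gr2 y - (- 1)" .
      then show False using g Suc(3)[of y] by (auto simp: c2 split: if_splits)
    qed
    moreover have "cor (supercommutator 1 p db x) ws = 0"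
    proof (rule ccontr)
      assume "cor (supercommutator 1 p db x) ws \<noteq> 0"
      from supercommutator_support[OF db_hom Suc(2) this] obtain y where "cor x y \<noteq> 0" "gr2 ws = gr2 y - 0" .
      then show False using g Suc(3)[of y] by auto
    qed
    moreover have "cor (supercommutator 1 p dm x) ws + cor (supercommutator 1 p db x) ws = 0"
      using arg_cong[OF Suc(5), of "\<lambda>D. cor D ws"] unfolding supercommutator_dt[OF coderivation_linear[OF Suc(2)]]
      by (simp add: cor_def linear_add[OF linear_cogen] linear_0[OF linear_cogen])
    moreover have "cor (supercommutator 1 p dm x) ws = cor (supercommutator 1 p dm x1) ws + cor (supercommutator 1 p dm x2) ws"
      by (subst x) (simp add: supercommutator_add[OF dm_linear] cor_def linear_add[OF linear_cogen])
    ultimately show False using nz by simp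
  qed
  then have "supercommutator 1 p dm x1 = 0"
    using coderivation_eq_0[OF coderivation_supercommutator[OF dm_coder x1(1)]] by (auto simp: fun_eq_iff)
  from dm_exact[OF h1 _ this] obtain y where y: "y \<in> coder_hom (p - 1) (- int (Suc n) + 1) (k + int (Suc n))"
    "supercommutator 1 (p - 1) dm y = x1" by auto
  have cy: "coderivation (p - 1) y" using y(1) by (simp add: coder_hom_iff)
  define w where "w = (\<lambda>z. x z - supercommutator 1 (p - 1) dt y z)"
  have ct: "supercommutator 1 (p - 1) dt y = (\<lambda>z. x1 z + supercommutator 1 (p - 1) db y z)"
    using supercommutator_dt[OF coderivation_linear[OF cy]] y(2) by simp
  have cb: "coderivation p (supercommutator 1 (p - 1) db y)" using coderivation_supercommutator[OF db_coder cy] by simp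
  have w: "w = (\<lambda>z. x2 z - supercommutator 1 (p - 1) db y z)" unfolding w_def ct x2_def by (simp add: algebra_simps)
  have hb: "supercommutator 1 (p - 1) db y \<in> coder_hom p (- int n) (k + int n)"
    using supercommutator_hom[OF db_hom y(1)] by (simp add: algebra_simps)
  have "\<exists>v\<in>coder_tot (p - 1) (k + 1). supercommutator 1 (p - 1) dt v = w"
  proof (rule Suc.IH)
    show "coderivation p w" unfolding w by (rule coderivation_diff[OF x2 cb])
    show "k < 0" by (rule Suc)
    show "gr2 ws + gr3 ws = - k \<and> gr2 ws \<le> int n" if "cor w ws \<noteq> 0" for ws
    proof -
      have "cor w ws = cor x2 ws - cor (supercommutator 1 (p - 1) db y) ws"
        unfolding w cor_def linear_diff[OF linear_cogen] ..
      with that have "cor x2 ws \<noteq> 0 \<or> cor (supercommutator 1 (p - 1) db y) ws \<noteq> 0" by auto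
      then show ?thesis
      proof
        assume "cor x2 ws \<noteq> 0" then show ?thesis using Suc(3)[of ws] by (auto simp: c2 split: if_splits)
      next
        assume "cor (supercommutator 1 (p - 1) db y) ws \<noteq> 0" then show ?thesis using hb by (auto simp: coder_hom_iff)
      qed
    qed
    have "supercommutator 1 p dt (supercommutator 1 (p - 1) dt y) = (\<lambda>x. 0)"
      using supercommutator_sq[OF dt_linear dt_dt coderivation_linear[OF cy], of "p - 1"] by (simp only: add_diff_eq add_diff_cancel_left')
    then show "supercommutator 1 p dt w = (\<lambda>x. 0)"
      using supercommutator_diff[OF dt_linear, of 1 p x "supercommutator 1 (p - 1) dt y"] Suc(5)
      unfolding w_def fun_diff_def by simp
  qed
  then obtain v where v: "v \<in> coder_tot (p - 1) (k + 1)" "supercommutator 1 (p - 1) dt v = w" by blast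
  have "supercommutator 1 (p - 1) dt (\<lambda>z. y z + v z) = x"
    unfolding supercommutator_add[OF dt_linear] v(2) w_def by simp
  moreover have "(\<lambda>z. y z + v z) \<in> coder_tot (p - 1) (k + 1)"
  proof -
    have s: "cor (\<lambda>z. y z + v z) ws = cor y ws + cor v ws" for ws by (simp add: cor_def linear_add[OF linear_cogen])
    have "gr2 ws + gr3 ws = - (k + 1)" if "cor (\<lambda>z. y z + v z) ws \<noteq> 0" for ws
    proof -
      from that have "cor y ws \<noteq> 0 \<or> cor v ws \<noteq> 0" unfolding s by auto
      then show ?thesis using v(1) y(1) by (auto simp: coder_tot_iff coder_hom_iff)
    qed
    moreover have "coderivation (p - 1) v" using v(1) by (simp add: coder_tot_iff)
    ultimately show ?thesis
      using coderivation_add[OF cy] by (simp add: coder_tot_iff)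
  qed
  ultimately show ?case by blast
qed

theorem schouten_total:
  assumes k: "k < 0"
  shows "is_singleton (total_cohomology coder_tot (\<lambda>q. supercommutator 1 q dt) p k)"
proof -
  let ?B = "supercommutator 1 (p - 1) dt ` coder_tot (p - 1) (k + 1)"
  let ?Z = "{x \<in> coder_tot p k. supercommutator 1 p dt x = 0}"
  have td: "u - v \<in> coder_tot q j" if "u \<in> coder_tot q j" "v \<in> coder_tot q j" for u v :: "'b cofree \<Rightarrow> 'b cofree" and q j
    using that coderivation_diff[of q u v] unfolding coder_tot_iff cor_diff by (auto simp: fun_diff_def) (metis diff_zero)+
  have t0: "(0 :: 'b cofree \<Rightarrow> 'b cofree) \<in> coder_tot q j" for q j
    using coder_hom_0[of q 0 j] by (auto simp: coder_hom_iff coder_tot_iff)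
  have "coset x ?B = ?B" if "x \<in> ?Z" for x
  proof -
    have x: "coderivation p x" "\<And>ws. cor x ws \<noteq> 0 \<Longrightarrow> gr2 ws + gr3 ws = - k" "supercommutator 1 p dt x = (\<lambda>x. 0)"
      using that by (auto simp: coder_tot_iff zero_fun_def)
    \<comment> \<open>Since \<open>gr3\<close> is non-negative, \<open>gr2\<close> is at most
      \<open>- k\<close>; this bound starts the zigzag.\<close>
    have "x \<in> ?B"
      using total_exact[OF x(1) _ k x(3), of "nat (- k)"] x(2) cor_gr_nonneg[OF x(1)] by fastforce
    moreover have "u - v \<in> ?B" if "u \<in> ?B" "v \<in> ?B" for u v
      using that td by (auto simp flip: supercommutator_diff[OF dt_linear])
    ultimately show ?thesis by (rule coset_absorb)
  qed
  moreover have "0 \<in> ?Z"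
    using t0 supercommutator_diff[OF dt_linear, of 1 p 0 0] by simp
  ultimately have "(\<lambda>x. coset x ?B) ` ?Z = {?B}" by blast
  then show ?thesis unfolding total_cohomology_def subquotient_def is_singleton_def by blast
qed

end

section \<open>The Schouten algebra\<close>

interpretation schouten: poly_letters smul sder svar sjd sdual sunit spd
  by (rule schouten_letters)

lemma mult_corestr_pl: "mult_corestr = pl schouten.mm"
proof -
  have "(case ws of [[Shift a, Shift b]] \<Rightarrow> ksgn (bdeg a) *\<^sub>R to_shift (mono_mult a b) | _ \<Rightarrow> 0) = schouten.mm ws" for ws :: "'a mono shifted list list"
    by (auto simp: schouten.mm_def smul.simps split: list.splits shifted.splits)
  then show ?thesis by (intro ext) (simp add: mult_corestr_def pl_def)
qed

lemma smul_to_shift: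
  assumes "hom d x"
  shows "schouten.M (to_shift x) (to_shift y) = ksgn d *\<^sub>R to_shift (schouten_mult x y)"
proof -
  have "schouten.M (to_shift x) (to_shift y) = lin_ext (\<lambda>k. ksgn (bdeg k) *\<^sub>R lin_ext (\<lambda>l. to_shift (mono_mult k l)) y) x"
    by (simp add: schouten.M_def to_shift_def lin_ext_lin_ext smul.simps lin_ext_fun_scale)
  also have "\<dots> = ksgn d *\<^sub>R lin_ext (\<lambda>k. lin_ext (\<lambda>l. to_shift (mono_mult k l)) y) x"
    by (rule lin_ext_scale_const) (use assms in \<open>simp add: hom_def\<close>)
  finally show ?thesis unfolding schouten_mult_def lin_ext_linear[OF linear_to_shift] .
qed

text \<open>The letters passed from the left and from the right are together all letters except
  \<open>i\<close>, so the two signs differ by that of \<open>card A - 1\<close>.\<close>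

lemma dxi_right_left: "dxi_right i a = - ksgn (bdeg a) *\<^sub>R dxi_left i a"
proof (cases a)
  case (Mono \<alpha> A)
  show ?thesis
  proof (cases "i \<in> A")
    case True
    have d: "inversions {i} A = inversions {i} (A - {i})" "inversions A {i} = inversions (A - {i}) {i}"
      using inversions_Un_right[of "{i}" "A - {i}" "{i}"] inversions_Un_left[of "{i}" "A - {i}" "{i}"] True by (simp_all add: insert_absorb)
    have "int (card A) = int (card (A - {i})) + 1"
      using True by (simp add: card_Suc_Diff1[symmetric] del: card_Diff_insert)
    moreover have "inversions {i} (A - {i}) + inversions (A - {i}) {i} = int (card (A - {i}))"
      using inversions_swap[of "{i}" "A - {i}"] by (simp del: card_Diff_insert)
    ultimately have "inversions A {i} = int (card A) - 1 - inversions {i} A"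
      unfolding d by linarith
    then show ?thesis using True by (simp add: Mono dxi_simp single_scaleR ks single_uminus)
  qed (simp add: Mono dxi_simp)
qed

text \<open>The sum over all variables splits into the even and the odd ones;
  \<open>dxi_right_left\<close> turns the right derivative of \<open>mono_bracket\<close> into the
  left one used by \<open>brk\<close>.\<close>

lemma schouten_brk: "schouten.brk (Shift a) (Shift b) = ksgn (bdeg a) *\<^sub>R to_shift (mono_bracket a b)"
proof -
  have h1: "hom (bdeg a) (dx i a)" for i by (cases a) (auto simp: hom_def split: if_splits)
  have h2: "hom (bdeg a - 1) (dxi_left i a)" for i
  proof (cases a)
    case (Mono \<alpha> A)
    have "i \<in> A \<Longrightarrow> int (card A) = int (card (A - {i})) + 1" by (simp add: card_Suc_Diff1[symmetric] del: card_Diff_insert)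
    then show ?thesis by (auto simp: Mono hom_def dxi_simp simp del: card_Diff_insert split: if_splits)
  qed
  have l: "schouten_mult (r *\<^sub>R x) y = r *\<^sub>R schouten_mult x y" for r x and y :: "'a schouten"
    by (simp add: schouten_mult_def lin_ext_scale)
  have "schouten.brk (Shift a) (Shift b) = - ((\<Sum>i\<in>UNIV. schouten.M (to_shift (dx i a)) (to_shift (dxi_left i b)))
      + (\<Sum>i\<in>UNIV. ksgn (bdeg a - 1) *\<^sub>R schouten.M (to_shift (dxi_left i a)) (to_shift (dx i b))))"
    unfolding schouten.brk_def by (subst UNIV_Plus_UNIV[symmetric], subst sum.Plus) (simp_all add: o_def sder.simps)
  also have "\<dots> = (\<Sum>i\<in>UNIV. ksgn (bdeg a) *\<^sub>R to_shift (schouten_mult (dxi_right i a) (dx i b) - schouten_mult (dx i a) (dxi_left i b)))"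
    unfolding smul_to_shift[OF h1] smul_to_shift[OF h2] dxi_right_left l
    by (simp add: linear_diff[OF linear_to_shift] linear_cmul[OF linear_to_shift] linear_neg[OF linear_to_shift] ks
        sum_subtractf sum_negf scaleR_right_diff_distrib)
  finally show ?thesis
    by (simp add: mono_bracket_def linear_sum[OF linear_to_shift] scaleR_sum_right)
qed

lemma bracket_corestr_pl: "bracket_corestr = pl schouten.brr"
proof -
  have "(case ws of [[Shift a], [Shift b]] \<Rightarrow> ksgn (bdeg a) *\<^sub>R to_shift (mono_bracket a b) | _ \<Rightarrow> 0) = schouten.brr ws" for ws :: "'a mono shifted list list"
    by (auto simp: schouten.brr_def schouten_brk split: list.splits shifted.splits)
  then show ?thesis by (intro ext) (simp add: bracket_corestr_def pl_def)
qed

lemma d_m_eq: "d_m = schouten.dm" and d_br_eq: "d_br = schouten.db"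
  unfolding d_m_def d_br_def
  by (rule coder_of_cd[OF schouten.cochain_mm mult_corestr_pl], rule coder_of_cd[OF schouten.cochain_brr bracket_corestr_pl])

text \<open>A quotient space is zero when its set of cosets has exactly one element.\<close>

theorem mainTheorem3:
  shows "(\<forall>p a b. (a, b) \<noteq> (0, 0) \<longrightarrow>
            is_singleton
              (E2 coder_hom
                 (\<lambda>q. supercommutator 1 q
                    (d_m :: 'n::{finite,linorder} mono shifted cofree \<Rightarrow> 'n mono shifted cofree))
                 (\<lambda>q. supercommutator 1 q d_br) p a b)) \<and>
         (\<forall>p k. k < 0 \<longrightarrow>
            is_singleton
              (total_cohomology coder_tot
                 (\<lambda>q. supercommutator 1 q
                    (d_m + d_br :: 'n mono shifted cofree \<Rightarrow> 'n mono shifted cofree)) p k))"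
  unfolding d_m_eq d_br_eq by (intro conjI allI impI schouten.schouten_E2 schouten.schouten_total)

end
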